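(* Let $A_1,\dots,A_d$ be Hermitian $n\times n$ matrices, and let $Q=\{\rho=0\}\subset\mathbb{C}^{N}=\mathbb{C}^n_z\times\mathbb{C}^d_w$ be the quadric submanifold of real codimension $d$ with $\rho=(\rho_1,\dots,\rho_d)$, $\rho_j(z,w)=\mathrm{Re}\, w_j-{}^t\bar zA_jz$. Assume that $Q$ satisfies condition $(\mathfrak{t})$: there exists $c=(c_1,\dots,c_d)\in\mathbb{R}^d$ such that $A=\sum_{j=1}^d c_jA_j$ is invertible. With such a $c$, consider an initial disc $\boldsymbol{f_0}\in\mathcal{S}_0(Q)$ of the form $$\boldsymbol{f_0}(\zeta)=\left((1-\zeta)V,\,2(1-\zeta)\,{}^t\overline{V}A_1V,\ldots,2(1-\zeta)\,{}^t\overline{V}A_dV,\,(1-\zeta)\,{}^t\overline{V}A,\,\tfrac{\zeta}{2}c\right),\qquad V\in\mathbb{C}^n.$$ Then there exist an open neighborhood $U$ of $\rho$ in $(\mathcal{C}^4(\mathbb{B}))^{d}$ and $\varepsilon>0$ such that for all $r\in U$ the $2$-jet map $\mathfrak{j}_2$ at $\zeta=1$, $$\mathfrak{j}_2(\boldsymbol f)=\left(\boldsymbol f(1),\frac{\partial\boldsymbol f}{\partial\zeta}(1),\frac{\partial^2\boldsymbol f}{\partial\zeta^2}(1)\right)\in\mathbb{C}^{6N},$$ is injective on $$\{\boldsymbol{f}\in\mathcal{S}(\{r=0\})\;:\;\|\boldsymbol{f}-\boldsymbol{f_0}\|_{1,\alpha}<\varepsilon\};$$ in other words, such discs are determined by their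 $2$-jet at $1$.
   Context: $\Delta$ is the open unit disc in $\mathbb{C}$, $\mathbb{B}$ the unit ball of $\mathbb{C}^N$, and $0<\alpha<1$ is fixed. $\mathcal{A}^{1,\alpha}$ is the space of functions $\overline\Delta\to\mathbb{C}$ holomorphic on $\Delta$ whose trace on $\partial\Delta$ is of class $\mathcal{C}^{1,\alpha}$; $\|\cdot\|_{1,\alpha}$ denotes the usual $\mathcal{C}^{1,\alpha}$ norm on $\partial\Delta$ (so discs in the set above belong to $(\mathcal{A}^{1,\alpha})^{2N}$). For a submanifold $M=\{r=0\}$ with $r=(r_1,\dots,r_d)$, let $N^*_{q}M=\mathrm{span}_{\mathbb{R}}\{\partial r_1(q),\dots,\partial r_d(q)\}$ be the conormal fiber at $q\in M$. $\mathcal{S}(M)$ is the set of discs $\boldsymbol f=(f,\tilde f):\overline\Delta\to T^*\mathbb{C}^N\cong\mathbb{C}^{2N}$, continuous on $\overline\Delta$ and holomorphic on $\Delta$, with $f$ non-constant, such that for all $\zeta\in\partial\Delta$ one has $f(\zeta)\in M$ and $\tilde f(\zeta)\in\zeta N^*_{f(\zeta)}M\setminus\{0\}$ (lifts of stationary discs). $\mathcal{S}_0(M)$ is the subset of those $\boldsymbol f\in\mathcal{S}(M)$ of the form $\left((1-\zeta)h,(1-\zeta)g,(1-\zeta)\tilde h,(1-\zeta)\tilde g+\frac{\zeta}{2}c\right)$ with $h,\tilde h\in(\mathcal{A}^{1,\alpha})^n$ and $g,\tilde g\in(\mathcal{A}^{1,\alpha})^d$ (so $\boldsymbol f(1)=(0,0,0,c/2)$).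 The map $\mathfrak{j}_2$ is well defined on the lifts considered: by condition $(\mathfrak t)$ the conormal bundle is totally real near $(0,c/2)$ (with $c/2$ in the $w$-covector directions), and by a known regularity theorem such lifts are of class $\mathcal{C}^{2,\beta}$ up to the boundary near $\zeta=1$ for every $0<\beta<1$. *)

theory Defs
  imports "HOL-Analysis.Analysis"
begin

section \<open>The Banach space of \<open>C\<^sup>k\<close> maps on an open set\<close>

text \<open>Iterated partial derivatives, taken along the basis vectors in the list \<open>vs\<close>.
  The real basis of \<open>complex ^ 'a\<close> is \<open>axis i 1\<close>, \<open>axis i \<i>\<close>.\<close>

primrec iter_partial ::
  "'a::euclidean_space list \<Rightarrow> ('a \<Rightarrow> 'b::real_normed_vector) \<Rightarrow> 'a \<Rightarrow> 'b" where
  "iter_partial [] g = g"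
| "iter_partial (v # vs) g = (\<lambda>x. frechet_derivative (iter_partial vs g) (at x) v)"

definition partials :: "nat \<Rightarrow> 'a::euclidean_space list set" where
  "partials k = {vs. set vs \<subseteq> Basis \<and> length vs \<le> k}"

text \<open>Maps that are \<open>C\<^sup>k\<close> on the open set \<open>S\<close> with bounded derivatives up to order \<open>k\<close>, so that
  \<open>Ck_norm k S\<close> is finite. Elements are total functions; values outside \<open>S\<close> are irrelevant to
  membership, norm and topology.\<close>

definition Ck :: "nat \<Rightarrow> 'a::euclidean_space set \<Rightarrow> ('a \<Rightarrow> 'b::real_normed_vector) set" where
  "Ck k S = {g. (\<forall>vs\<in>partials k. continuous_on S (iter_partial vs g)
                   \<and> bounded (iter_partial vs g ` S)
                   \<and> (length vs < k \<longrightarrow> iter_partial vs g differentiable_on S))}"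

definition Ck_norm :: "nat \<Rightarrow> 'a::euclidean_space set \<Rightarrow> ('a \<Rightarrow> 'b::real_normed_vector) \<Rightarrow> real" where
  "Ck_norm k S g = (\<Sum>vs\<in>partials k. SUP x\<in>S. norm (iter_partial vs g x))"

definition Ck_topology ::
  "nat \<Rightarrow> 'a::euclidean_space set \<Rightarrow> ('a \<Rightarrow> 'b::real_normed_vector) topology" where
  "Ck_topology k S = topology (\<lambda>U. U \<subseteq> Ck k S \<and>
     (\<forall>g\<in>U. \<exists>\<delta>>0. \<forall>h\<in>Ck k S. Ck_norm k S (\<lambda>x. h x - g x) < \<delta> \<longrightarrow> h \<in> U))"

lemma openin_Ck_topology:
  fixes U :: "('a::euclidean_space \<Rightarrow> 'b::real_normed_vector) set"
  shows "openin (Ck_topology k S) U \<longleftrightarrow> U \<subseteq> Ck k S \<and>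
     (\<forall>g\<in>U. \<exists>\<delta>>0. \<forall>h\<in>Ck k S. Ck_norm k S (\<lambda>x. h x - g x) < \<delta> \<longrightarrow> h \<in> U)"
proof -
  define P where "P = (\<lambda>U :: ('a \<Rightarrow> 'b) set. U \<subseteq> Ck k S \<and>
     (\<forall>g\<in>U. \<exists>\<delta>>0. \<forall>h\<in>Ck k S. Ck_norm k S (\<lambda>x. h x - g x) < \<delta> \<longrightarrow> h \<in> U))"
  have inter: "P (U \<inter> V)" if U: "P U" and V: "P V" for U V :: "('a \<Rightarrow> 'b) set"
    unfolding P_def
  proof (intro conjI ballI)
    show "U \<inter> V \<subseteq> Ck k S" using U unfolding P_def by blast
    fix g assume "g \<in> U \<inter> V"
    then obtain a b where "a > 0" "b > 0"
      and "\<forall>h\<in>Ck k S. Ck_norm k S (\<lambda>x. h x - g x) < a \<longrightarrow> h \<in> U"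
      and "\<forall>h\<in>Ck k S. Ck_norm k S (\<lambda>x. h x - g x) < b \<longrightarrow> h \<in> V"
      using U V unfolding P_def by blast
    then show "\<exists>\<delta>>0. \<forall>h\<in>Ck k S. Ck_norm k S (\<lambda>x. h x - g x) < \<delta> \<longrightarrow> h \<in> U \<inter> V"
      by (intro exI[of _ "min a b"]) auto
  qed
  have union: "P (\<Union>\<K>)" if *: "\<forall>K\<in>\<K>. P K" for \<K> :: "('a \<Rightarrow> 'b) set set"
    unfolding P_def
  proof (intro conjI ballI)
    show "\<Union>\<K> \<subseteq> Ck k S" using * unfolding P_def by blast
    fix g assume "g \<in> \<Union>\<K>"
    then obtain K where K: "K \<in> \<K>" "g \<in> K" by blast
    then obtain a where "a > 0" "\<forall>h\<in>Ck k S. Ck_norm k S (\<lambda>x. h x - g x) < a \<longrightarrow> h \<in> K"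
      using * unfolding P_def by meson
    then show "\<exists>\<delta>>0. \<forall>h\<in>Ck k S. Ck_norm k S (\<lambda>x. h x - g x) < \<delta> \<longrightarrow> h \<in> \<Union>\<K>"
      using K by blast
  qed
  have "istopology P"
    unfolding istopology_def using inter union by blast
  then show ?thesis
    by (simp add: Ck_topology_def P_def)
qed

section \<open>Holder spaces on the circle and analytic discs\<close>

text \<open>The derivative of \<open>g\<close> with respect to the angle \<open>\<theta>\<close>, at the point \<open>\<zeta>\<close> of the unit circle.\<close>

definition circle_deriv :: "(complex \<Rightarrow> 'b::real_normed_vector) \<Rightarrow> complex \<Rightarrow> 'b" where
  "circle_deriv g \<zeta> = vector_derivative (\<lambda>t. g (\<zeta> * cis t)) (at 0)"

definition C1_holder :: "real \<Rightarrow> (complex \<Rightarrow> 'b::real_normed_vector) set" where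
  "C1_holder \<alpha> = {g.
     (\<forall>\<zeta>\<in>sphere 0 1. (\<lambda>t. g (\<zeta> * cis t)) differentiable (at (0::real))) \<and>
     (\<exists>C. \<forall>\<zeta>\<in>sphere 0 1. \<forall>\<eta>\<in>sphere 0 1.
        norm (circle_deriv g \<zeta> - circle_deriv g \<eta>) \<le> C * cmod (\<zeta> - \<eta>) powr \<alpha>)}"

definition C1_holder_norm :: "real \<Rightarrow> (complex \<Rightarrow> 'b::real_normed_vector) \<Rightarrow> real" where
  "C1_holder_norm \<alpha> g =
     (SUP \<zeta>\<in>sphere 0 1. norm (g \<zeta>)) + (SUP \<zeta>\<in>sphere 0 1. norm (circle_deriv g \<zeta>)) +
     (SUP (\<zeta>, \<eta>)\<in>{(\<zeta>, \<eta>). \<zeta> \<in> sphere 0 1 \<and> \<eta> \<in> sphere 0 1 \<and> \<zeta> \<noteq> \<eta>}.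
        norm (circle_deriv g \<zeta> - circle_deriv g \<eta>) / cmod (\<zeta> - \<eta>) powr \<alpha>)"

text \<open>Vector-valued discs, continuous on the closed disc and holomorphic inside.\<close>

definition analytic_disc :: "(complex \<Rightarrow> complex ^ 'm) \<Rightarrow> bool" where
  "analytic_disc F \<longleftrightarrow> continuous_on (cball 0 1) F \<and>
     (\<forall>k. (\<lambda>\<zeta>. F \<zeta> $ k) holomorphic_on ball 0 1)"

definition A1_holder :: "real \<Rightarrow> (complex \<Rightarrow> complex ^ 'm) set" where
  "A1_holder \<alpha> = {F. analytic_disc F \<and> F \<in> C1_holder \<alpha>}"

section \<open>Product coordinates\<close>

text \<open>\<open>complex ^ ('a + 'b)\<close> is the product of \<open>complex ^ 'a\<close> and \<open>complex ^ 'b\<close>. It is used both for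
  \<open>(z, w)\<close> in the base and for \<open>(q, \<xi>)\<close> in the cotangent bundle.\<close>

definition join :: "complex ^ 'a \<Rightarrow> complex ^ 'b \<Rightarrow> complex ^ ('a::finite + 'b::finite)" where
  "join x y = (\<chi> k. case k of Inl i \<Rightarrow> x $ i | Inr j \<Rightarrow> y $ j)"

definition left_part :: "complex ^ ('a::finite + 'b::finite) \<Rightarrow> complex ^ 'a" where
  "left_part p = (\<chi> i. p $ Inl i)"

definition right_part :: "complex ^ ('a::finite + 'b::finite) \<Rightarrow> complex ^ 'b" where
  "right_part p = (\<chi> j. p $ Inr j)"

section \<open>Conormal fibers and lifts of stationary discs\<close>

text \<open>The covector \<open>(\<partial>\<phi>/\<partial>z\<^sub>k)\<^sub>k\<close> of Wirtinger derivatives of a real function,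
  \<open>\<partial>/\<partial>z\<^sub>k = (\<partial>/\<partial>x\<^sub>k - i \<partial>/\<partial>y\<^sub>k) / 2\<close>.\<close>

definition wirtinger :: "(complex ^ 'a \<Rightarrow> real) \<Rightarrow> complex ^ 'a \<Rightarrow> complex ^ 'a" where
  "wirtinger \<phi> q = (\<chi> k. (of_real (frechet_derivative \<phi> (at q) (axis k 1))
                        - \<i> * of_real (frechet_derivative \<phi> (at q) (axis k \<i>))) / 2)"

text \<open>\<open>span\<close> is the span over the reals.\<close>

definition conormal_fiber :: "(complex ^ 'a \<Rightarrow> real ^ 'd) \<Rightarrow> complex ^ 'a \<Rightarrow> (complex ^ 'a) set" where
  "conormal_fiber r q = span {wirtinger (\<lambda>p. r p $ j) q | j. True}"

text \<open>Lifts of stationary discs for \<open>M = {q \<in> D. r q = 0}\<close>, where the open set \<open>D\<close> is the domain of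
  the defining map \<open>r\<close>. Discs are functions on the closed unit disc, hence \<open>extensional\<close>.\<close>

definition stationary_lifts ::
  "(complex ^ 'a) set \<Rightarrow> (complex ^ 'a \<Rightarrow> real ^ 'd) \<Rightarrow> (complex \<Rightarrow> complex ^ ('a::finite + 'a)) set" where
  "stationary_lifts D r = {F. F \<in> extensional (cball 0 1) \<and> analytic_disc F \<and>
     \<not> (\<lambda>\<zeta>. left_part (F \<zeta>)) constant_on cball 0 1 \<and>
     (\<forall>\<zeta>\<in>sphere 0 1. left_part (F \<zeta>) \<in> {q \<in> D. r q = 0} \<and>
        right_part (F \<zeta>) \<in> (\<lambda>\<xi>. \<zeta> *s \<xi>) ` conormal_fiber r (left_part (F \<zeta>)) - {0})}"

definition stationary_lifts0 ::
  "real \<Rightarrow> real ^ 'd::finite \<Rightarrow> (complex ^ ('n::finite + 'd)) set \<Rightarrow> (complex ^ ('n + 'd) \<Rightarrow> real ^ 'd) \<Rightarrow>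
   (complex \<Rightarrow> complex ^ (('n + 'd) + ('n + 'd))) set" where
  "stationary_lifts0 \<alpha> c D r = {F \<in> stationary_lifts D r.
     \<exists>h\<in>A1_holder \<alpha>. \<exists>g\<in>A1_holder \<alpha>. \<exists>h'\<in>A1_holder \<alpha>. \<exists>g'\<in>A1_holder \<alpha>. \<forall>\<zeta>\<in>cball 0 1.
       F \<zeta> = join (join ((1 - \<zeta>) *s h \<zeta>) ((1 - \<zeta>) *s g \<zeta>))
                  (join ((1 - \<zeta>) *s h' \<zeta>)
                        ((1 - \<zeta>) *s g' \<zeta> + (\<zeta> / 2) *s (\<chi> j. of_real (c $ j))))}"

section \<open>Jets at a boundary point\<close>

text \<open>The complex derivative within the closed disc, which also makes sense at boundary points.\<close>

definition disc_deriv :: "(complex \<Rightarrow> complex ^ 'm) \<Rightarrow> complex \<Rightarrow> complex ^ 'm" where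
  "disc_deriv F \<zeta> =
     (\<chi> k. SOME D. ((\<lambda>\<eta>. F \<eta> $ k) has_field_derivative D) (at \<zeta> within cball 0 1))"

definition jet2 ::
  "(complex \<Rightarrow> complex ^ 'm) \<Rightarrow> (complex ^ 'm) \<times> (complex ^ 'm) \<times> (complex ^ 'm)" where
  "jet2 F = (F 1, disc_deriv F 1, disc_deriv (disc_deriv F) 1)"

section \<open>Quadrics\<close>

definition hermitian :: "complex ^ 'n ^ 'n \<Rightarrow> bool" where
  "hermitian M \<longleftrightarrow> (\<forall>i k. M $ i $ k = cnj (M $ k $ i))"

definition cnj_vec :: "complex ^ 'n \<Rightarrow> complex ^ 'n" where
  "cnj_vec z = (\<chi> i. cnj (z $ i))"

definition herm_form :: "complex ^ 'n ^ 'n \<Rightarrow> complex ^ 'n \<Rightarrow> complex" where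
  "herm_form M z = (\<Sum>i\<in>UNIV. (cnj_vec z v* M) $ i * z $ i)"

text \<open>For Hermitian \<open>A j\<close> the form is real-valued; the outer \<open>Re\<close> only adjusts the type.\<close>

definition quadric_map ::
  "('d::finite \<Rightarrow> complex ^ 'n::finite ^ 'n) \<Rightarrow> complex ^ ('n + 'd) \<Rightarrow> real ^ 'd" where
  "quadric_map A q = (\<chi> j. Re (right_part q $ j) - Re (herm_form (A j) (left_part q)))"

definition initial_disc ::
  "('d::finite \<Rightarrow> complex ^ 'n::finite ^ 'n) \<Rightarrow> real ^ 'd \<Rightarrow> complex ^ 'n \<Rightarrow>
   complex \<Rightarrow> complex ^ (('n + 'd) + ('n + 'd))" where
  "initial_disc A c V = (\<lambda>\<zeta>\<in>cball 0 1.
     join (join ((1 - \<zeta>) *s V) (\<chi> j. 2 * (1 - \<zeta>) * herm_form (A j) V))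
          (join ((1 - \<zeta>) *s (cnj_vec V v* (\<Sum>j\<in>UNIV. c $ j *\<^sub>R A j)))
                ((\<zeta> / 2) *s (\<chi> j. of_real (c $ j)))))"

end

theory Submission
  imports Defs "HOL-Complex_Analysis.Conformal_Mappings"
begin

text \<open>Let N be the difference of the two defining maps, r minus the quadric map. Along the circle, a lift
  consists of a base point x = (z, w), of the two covector components p, q (the fiber part multiplied by
  \<open>cnj \<zeta>\<close>, which removes the twist by \<open>\<zeta>\<close> in the conormal condition), and of the real multipliers
  that express the covector in the differentials of the components of r. These data satisfy the system
  \<open>lift_at\<close>; for N = 0 it says that Re w is the Hermitian form of z, that q is half the multiplier, and that
  p is minus the multiplier times the conjugate of z times the matrices.

  The proof rests on one a priori estimate (\<open>perturbation_estimate\<close>). By Hadamard's lemma the difference of two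
  nearby lifts satisfies, without remainder, a linear system whose coefficients are close to those of
  the quadric with the constant multiplier c, and that system is triangular (\<open>linear_estimate\<close>).
  The multipliers are real, so the imaginary part of q is controlled, and Privalov's theorem controls q, hence the multipliers. The equation
  for p then controls the sum of p and the conjugate of X = A z, so that the real part of p + X and the imaginary
  part of p - X are controlled; Privalov's theorem gives X, and z because A is invertible.
  Finally the equation for Re w controls w. The terms produced by N are small multiples of the unknowns
  and are absorbed.

  The estimate is used twice. Applied to a lift and its rotations, and then to the differences of the
  resulting quotients, it bounds all second rotation quotients; hence lifts are twice differentiable up to the circle with a Hoelder
  continuous second derivative (\<open>lift_C2_holder\<close>). Therefore the difference of two lifts with the same
  2-jet at 1 has the form \<open>(1 - \<zeta>)\<^sup>2 * H\<close> with H Hoelder continuous and H 1 = 0. On the circle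
  \<open>(1 - \<zeta>)\<^sup>2\<close> equals \<open>- \<zeta>\<close> times the positive number \<open>\<bar>1 - \<zeta>\<bar>\<^sup>2\<close>. Division by this real
  factor preserves the linear system and turns the difference into \<open>- \<zeta> * H\<close>, which vanishes at 0, and its
  q component into \<open>- H\<close>, which vanishes at 1. The estimate bounds its solution by
  the defects and these values, all zero, and so the two lifts coincide (\<open>lifts_determined\<close>).\<close>

section \<open>Hardy-Littlewood estimates and the derivative kernel\<close>

definition disc_algebra :: "(complex \<Rightarrow> complex) set" where
  "disc_algebra = {f. continuous_on (cball 0 1) f \<and> f holomorphic_on ball 0 1}"

lemma half_le_sin:
  fixes x :: real
  assumes "0 \<le> x" "x \<le> pi / 2"
  shows "x / 2 \<le> sin x"
proof (cases "x \<le> pi / 3")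
  case True
  have "sin 0 - 0 / 2 \<le> sin x - x / 2"
  proof (rule DERIV_nonneg_imp_nondecreasing[OF assms(1)])
    fix y assume y: "0 \<le> y" "y \<le> x"
    have "cos (pi / 3) \<le> cos y"
      using y True pi_gt_zero by (intro cos_monotone_0_pi_le) linarith+
    moreover have "((\<lambda>u. sin u - u / 2) has_real_derivative (cos y - 1 / 2)) (at y)"
      by (auto intro!: derivative_eq_intros)
    ultimately show "\<exists>d. ((\<lambda>u. sin u - u / 2) has_real_derivative d) (at y) \<and> 0 \<le> d"
      by (intro exI[of _ "cos y - 1 / 2"]) (simp add: cos_60)
  qed
  then show ?thesis by simp
next
  case False
  have "sin (pi / 3) \<le> sin x"
    using False assms by (intro sin_monotone_2pi_le) (use pi_gt_zero in linarith)+
  moreover have "17/10 \<le> sqrt 3" by (rule real_le_rsqrt) (simp add: power2_eq_square)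
  moreover have "x \<le> 16/10" using assms(2) pi_less_4 pi_approx by simp
  ultimately show ?thesis by (simp add: sin_60)
qed

lemma chord_ge_half_angle:
  assumes "\<bar>t\<bar> \<le> pi"
  shows "\<bar>t\<bar> / 2 \<le> cmod (cis t - 1)"
proof -
  have "cmod (cis t - 1) = 2 * \<bar>sin (t / 2)\<bar>"
    using dist_exp_i_1[of t] by (simp add: cis_conv_exp dist_norm)
  moreover have "\<bar>sin (t/2)\<bar> = sin (\<bar>t\<bar> / 2)"
    using assms sin_ge_zero[of "t / 2"] sin_ge_zero[of "- t / 2"] by (cases "t \<ge> 0") auto
  ultimately show ?thesis using half_le_sin[of "\<bar>t\<bar>/2"] assms by simp
qed

text \<open>A mean value estimate along a segment whose end point may lie on the circle, where there is no derivative: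
  the integrated majorant \<open>\<phi>\<close> only needs to be continuous up to the end.\<close>

lemma segment_increment_bound:
  assumes f: "f \<in> disc_algebra"
    and z: "z \<in> cball 0 1" and w: "w \<in> cball 0 1"
    and bnd: "\<And>t. 0 < t \<Longrightarrow> t < 1 \<Longrightarrow>
      norm (deriv f (z + of_real t * (w - z)) - m) * cmod (w - z) \<le> \<phi>' t"
    and \<phi>: "\<And>t. 0 < t \<Longrightarrow> t < 1 \<Longrightarrow> (\<phi> has_real_derivative \<phi>' t) (at t)"
    and \<phi>c: "continuous_on {0..1} \<phi>"
  shows "cmod (f w - f z - m * (w - z)) \<le> \<phi> 1 - \<phi> 0"
proof (cases "z = w")
  case True
  have "norm ((\<lambda>_. 0::real) 1 - (\<lambda>_. 0::real) (0::real)) \<le> \<phi> 1 - \<phi> 0"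
    using \<phi> bnd True
    by (intro differentiable_bound_general[where f' = "\<lambda>_. 0" and \<phi>' = \<phi>'])
       (auto simp: has_real_derivative_iff_has_vector_derivative \<phi>c)
  then show ?thesis using True by simp
next
  case False
  define p where "p = (\<lambda>t::real. z + of_real t * (w - z))"
  have p_seg: "p t \<in> open_segment z w" if "0 < t" "t < 1" for t
    using that False by (auto simp: p_def in_segment algebra_simps scaleR_conv_of_real intro!: exI[of _ t])
  have pb: "p t \<in> ball 0 1" if t: "0 < t" "t < 1" for t
    using dist_decreases_open_segment[OF p_seg[OF t], of 0] z w by (auto simp: dist_norm)
  have pc: "p t \<in> cball 0 1" if t: "0 \<le> t" "t \<le> 1" for t
    using pb[of t] t z w by (cases "t = 0 \<or> t = 1") (auto simp: p_def)
  have fc: "continuous_on (cball 0 1) f" and fh: "f holomorphic_on ball 0 1"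
    using f by (auto simp: disc_algebra_def)
  have "norm ((\<lambda>t. f (p t) - m * p t) 1 - (\<lambda>t. f (p t) - m * p t) 0) \<le> \<phi> 1 - \<phi> 0"
  proof (rule differentiable_bound_general)
    have "continuous_on {0..1} p" unfolding p_def by (intro continuous_intros)
    moreover have "p ` {0..1} \<subseteq> cball 0 1" using pc by auto
    ultimately show "continuous_on {0..1} (\<lambda>t. f (p t) - m * p t)"
      by (intro continuous_intros continuous_on_compose2[OF fc]) auto
    fix t :: real assume t: "0 < t" "t < 1"
    have d: "(f has_field_derivative deriv f (p t)) (at (p t))"
      using holomorphic_derivI[OF fh _ pb[OF t]] by simp
    have dp: "(p has_vector_derivative (w - z)) (at t)"
      unfolding p_def by (auto intro!: derivative_eq_intros)
    have "((\<lambda>t. f (p t) - m * p t) has_vector_derivative (w - z) * deriv f (p t) - m * (w - z)) (at t)"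
      using field_vector_diff_chain_at[OF dp d] dp
      by (intro derivative_intros) (auto simp: o_def)
    then show "((\<lambda>t. f (p t) - m * p t) has_vector_derivative (deriv f (p t) - m) * (w - z)) (at t)"
      by (simp add: algebra_simps)
    show "norm ((deriv f (p t) - m) * (w - z)) \<le> \<phi>' t"
      using bnd[OF t] by (simp add: p_def norm_mult)
    show "(\<phi> has_vector_derivative \<phi>' t) (at t)"
      using \<phi>[OF t] by (simp add: has_real_derivative_iff_has_vector_derivative)
  qed (use \<phi>c in auto)
  then show ?thesis by (simp add: p_def algebra_simps)
qed

lemma segment_in_cball:
  assumes "z \<in> cball 0 R" "w \<in> cball 0 R" "0 \<le> t" "t \<le> (1::real)"
  shows "z + of_real t * (w - z) \<in> cball (0::complex) R"
proof -
  have "z + of_real t * (w - z) = (1 - t) *\<^sub>R z + t *\<^sub>R w"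
    by (simp add: algebra_simps scaleR_conv_of_real)
  then show ?thesis
    using convexD[OF convex_cball[of "0::complex" R], of z w "1 - t" t] assms by simp
qed

text \<open>Two points are joined by moving both radially inward by the distance between them; there the derivative
  bound is harmless, and along the radii the singularity \<open>(1 - \<bar>z\<bar>) powr (\<alpha> - 1)\<close> is integrable.\<close>

lemma hardy_littlewood_aux:
  fixes f :: "complex \<Rightarrow> complex"
  assumes \<alpha>: "0 < \<alpha>" "\<alpha> < 1" and f: "f \<in> disc_algebra" and C: "0 \<le> C"
    and bnd: "\<And>z. z \<in> ball 0 1 \<Longrightarrow> cmod (deriv f z) \<le> C * (1 - cmod z) powr (\<alpha> - 1)"
    and a: "a \<in> cball 0 1" and b: "b \<in> cball 0 1"
  shows "cmod (f a - f b) \<le> C * (2 / \<alpha> + 1) * cmod (a - b) powr \<alpha>"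
proof (cases "a = b")
  case False
  define d where "d = min 1 (cmod (a - b))"
  have d: "0 < d" "d \<le> 1" "d \<le> cmod (a - b)" using False by (auto simp: d_def)
  have radial: "cmod (f ((1 - of_real d) * e) - f e) \<le> C / \<alpha> * d powr \<alpha>" if e: "e \<in> cball 0 1" for e
  proof -
    have "cmod (f ((1 - of_real d) * e) - f e - 0 * ((1 - of_real d) * e - e))
        \<le> C / \<alpha> * (d * 1) powr \<alpha> - C / \<alpha> * (d * 0) powr \<alpha>"
    proof (rule segment_increment_bound[OF f e, where \<phi>' = "\<lambda>t. C * d * (d * t) powr (\<alpha> - 1)"])
      show "(1 - of_real d) * e \<in> cball 0 1"
        using segment_in_cball[OF e, of 0 d] d by (simp add: algebra_simps)
      fix t :: real assume t: "0 < t" "t < 1"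
      have eq: "e + of_real t * ((1 - of_real d) * e - e) = of_real (1 - d * t) * e"
        by (simp add: algebra_simps)
      have "d * t \<le> t" using d t by (intro mult_left_le_one_le) auto
      then have "d * t < 1" using t by linarith
      moreover have "0 < d * t" using d t by simp
      ultimately have dt: "0 < d * t" "d * t < 1" by simp_all
      have le: "cmod (of_real (1 - d * t) * e) \<le> 1 - d * t"
        using dt e by (simp add: norm_mult mult_left_le del: of_real_diff of_real_mult)
      have inb: "of_real (1 - d * t) * e \<in> ball 0 1"
        using le dt unfolding mem_ball_0 by linarith
      have "cmod (deriv f (of_real (1 - d * t) * e)) \<le> C * (1 - cmod (of_real (1 - d * t) * e)) powr (\<alpha> - 1)"
        by (rule bnd[OF inb])
      also have "\<dots> \<le> C * (d * t) powr (\<alpha> - 1)"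
        using le dt \<alpha> C by (intro mult_left_mono powr_mono2') linarith+
      finally have "cmod (deriv f (of_real (1 - d * t) * e)) * cmod ((1 - of_real d) * e - e)
          \<le> (C * (d * t) powr (\<alpha> - 1)) * d"
        using e d C by (intro mult_mono) (auto simp: algebra_simps norm_mult mult_left_le)
      then show "cmod (deriv f (e + of_real t * ((1 - of_real d) * e - e)) - 0) *
         cmod ((1 - of_real d) * e - e) \<le> C * d * (d * t) powr (\<alpha> - 1)"
        unfolding eq diff_zero by (simp only: mult_ac)
      show "((\<lambda>t. C / \<alpha> * (d * t) powr \<alpha>) has_real_derivative C * d * (d * t) powr (\<alpha> - 1)) (at t)"
        using d t \<alpha> by (auto intro!: derivative_eq_intros simp: powr_diff field_simps)
    next
      show "continuous_on {0..1} (\<lambda>t. C / \<alpha> * (d * t) powr \<alpha>)"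
        using \<alpha> d by (intro continuous_intros continuous_on_powr') auto
    qed
    then show ?thesis by simp
  qed
  have inner: "cmod (f ((1 - of_real d) * b) - f ((1 - of_real d) * a)) \<le> C * d powr (\<alpha> - 1) * cmod (a - b)" 
  proof (cases "d = 1")
    case True then show ?thesis using C by simp
  next
    case False
    then have d1: "d < 1" using d by simp
    have small: "(1 - of_real d) * e \<in> cball 0 (1 - d)" if "e \<in> cball 0 1" for e :: complex
    proof -
      have eq: "(1 - of_real d) * e = of_real (1 - d) * e" by simp
      have "cmod ((1 - of_real d) * e) = (1 - d) * cmod e"
        unfolding eq norm_mult norm_of_real using d by simp
      also have "\<dots> \<le> 1 - d" using that d by (intro mult_left_le) auto
      finally show ?thesis by simp
    qed
    have "cmod (f ((1 - of_real d) * b) - f ((1 - of_real d) * a) - 0 * ((1 - of_real d) * b - (1 - of_real d) * a))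
       \<le> C * d powr (\<alpha> - 1) * cmod (a - b) * 1 - C * d powr (\<alpha> - 1) * cmod (a - b) * 0"
    proof (rule segment_increment_bound[OF f, where \<phi>' = "\<lambda>t. C * d powr (\<alpha> - 1) * cmod (a - b)"])
      show "(1 - of_real d) * a \<in> cball 0 1" "(1 - of_real d) * b \<in> cball 0 1"
        using small[OF a] small[OF b] d by auto
      fix t :: real assume t: "0 < t" "t < 1"
      let ?w = "(1 - of_real d) * a + of_real t * ((1 - of_real d) * b - (1 - of_real d) * a)"
      have w: "?w \<in> cball 0 (1 - d)"
        using segment_in_cball[OF small[OF a] small[OF b], of t] t by simp
      then have "cmod ?w \<le> 1 - d" by simp
      then have inb: "?w \<in> ball 0 1" using d unfolding mem_ball_0 by linarith
      have "cmod (deriv f ?w) \<le> C * (1 - cmod ?w) powr (\<alpha> - 1)" by (rule bnd[OF inb])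
      also have "\<dots> \<le> C * d powr (\<alpha> - 1)"
        using w d \<alpha> C by (intro mult_left_mono powr_mono2') auto
      finally have "cmod (deriv f ?w) \<le> C * d powr (\<alpha> - 1)" .
      moreover have "cmod ((1 - of_real d) * b - (1 - of_real d) * a) \<le> cmod (a - b)"
      proof -
        have "(1 - of_real d) * b - (1 - of_real d) * a = of_real (1 - d) * (b - a)"
          by (simp add: algebra_simps)
        then show ?thesis using d by (simp add: norm_mult norm_minus_commute mult_left_le_one_le del: of_real_diff)
      qed
      ultimately have "cmod (deriv f ?w) * cmod ((1 - of_real d) * b - (1 - of_real d) * a)
         \<le> C * d powr (\<alpha> - 1) * cmod (a - b)"
        using C by (intro mult_mono) auto
      then show "cmod (deriv f ?w - 0) * cmod ((1 - of_real d) * b - (1 - of_real d) * a)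
         \<le> C * d powr (\<alpha> - 1) * cmod (a - b)" by simp
    qed (auto intro!: derivative_eq_intros continuous_intros)
    then show ?thesis by simp
  qed
  have d_le: "d powr \<alpha> \<le> cmod (a - b) powr \<alpha>"
    using d \<alpha> by (intro powr_mono2) auto
  have "d powr (\<alpha> - 1) * cmod (a - b) \<le> cmod (a - b) powr \<alpha> \<or> d = 1"
  proof (cases "d = 1")
    case False
    then have "d = cmod (a - b)" by (auto simp: d_def min_def split: if_splits)
    then show ?thesis using d by (simp add: powr_diff)
  qed simp
  then have inner': "cmod (f ((1 - of_real d) * b) - f ((1 - of_real d) * a)) \<le> C * cmod (a - b) powr \<alpha>"
    using inner mult_left_mono[OF _ C, of "d powr (\<alpha> - 1) * cmod (a - b)" "cmod (a - b) powr \<alpha>"] C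
    by (auto simp: mult.assoc)
  have "cmod (f a - f b) \<le> cmod (f ((1 - of_real d) * a) - f a) + cmod (f ((1 - of_real d) * b) - f ((1 - of_real d) * a))
      + cmod (f ((1 - of_real d) * b) - f b)"
  proof -
    have "f a - f b = - (f ((1 - of_real d) * a) - f a) - (f ((1 - of_real d) * b) - f ((1 - of_real d) * a))
      + (f ((1 - of_real d) * b) - f b)" by simp
    moreover have "cmod (- p - q + r) \<le> cmod p + cmod q + cmod r" for p q r
      using norm_triangle_ineq[of "- p - q" r] norm_triangle_ineq4[of "- p" q] by simp
    ultimately show ?thesis by metis
  qed
  also have "\<dots> \<le> C / \<alpha> * d powr \<alpha> + C * cmod (a - b) powr \<alpha> + C / \<alpha> * d powr \<alpha>"
    using radial[OF a] radial[OF b] inner' by linarith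
  also have "\<dots> \<le> C / \<alpha> * cmod (a - b) powr \<alpha> + C * cmod (a - b) powr \<alpha> + C / \<alpha> * cmod (a - b) powr \<alpha>"
    using d_le \<alpha> C by (intro add_mono mult_left_mono) auto
  also have "\<dots> = C * (2 / \<alpha> + 1) * cmod (a - b) powr \<alpha>"
    by (simp add: field_simps)
  finally show ?thesis .
qed (use \<alpha> in simp)

lemma hardy_littlewood:
  fixes f :: "complex \<Rightarrow> complex"
  assumes \<alpha>: "0 < \<alpha>" "\<alpha> < 1" and f: "f holomorphic_on ball 0 1" and C: "0 \<le> C"
    and bnd: "\<And>z. z \<in> ball 0 1 \<Longrightarrow> cmod (deriv f z) \<le> C * (1 - cmod z) powr (\<alpha> - 1)"
    and a: "a \<in> ball 0 1" and b: "b \<in> ball 0 1"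
  shows "cmod (f a - f b) \<le> C * (2 / \<alpha> + 1) * cmod (a - b) powr \<alpha>"
proof -
  define m where "m = max (max (cmod a) (cmod b)) (1/2)"
  have m: "cmod a \<le> m" "cmod b \<le> m" "0 < m" "m < 1" using a b by (auto simp: m_def)
  have ev: "cmod (f a - f b) \<le> C * (2 / \<alpha> + 1) * cmod (a / of_real r - b / of_real r) powr \<alpha>"
    if r: "m < r" "r < 1" for r :: real
  proof -
    define g where "g = (\<lambda>z. f (of_real r * z))"
    have r0: "0 < r" using r m by linarith
    have img: "(\<lambda>z. of_real r * z) ` cball 0 1 \<subseteq> ball (0::complex) 1"
    proof (rule image_subsetI)
      fix z :: complex assume "z \<in> cball 0 1"
      then have "r * cmod z \<le> r * 1" using r0 by (intro mult_left_mono) auto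
      then have "r * cmod z < 1" using r by linarith
      then show "of_real r * z \<in> ball 0 1" using r0 by (simp add: norm_mult)
    qed
    have "g \<in> disc_algebra"
    proof -
      have "continuous_on (cball 0 1) g" unfolding g_def
        by (intro continuous_on_compose2[OF holomorphic_on_imp_continuous_on[OF f]] continuous_intros img)
      moreover have "(f \<circ> (\<lambda>z. of_real r * z)) holomorphic_on ball 0 1"
        
      proof (rule holomorphic_on_compose_gen[OF _ f])
        show "(\<lambda>z. of_real r * z) ` ball 0 1 \<subseteq> ball (0::complex) 1"
          by (rule order_trans[OF image_mono[OF ball_subset_cball] img])
      qed (intro holomorphic_intros)
      ultimately show ?thesis by (simp add: disc_algebra_def g_def o_def)
    qed
    moreover have "cmod (deriv g z) \<le> C * (1 - cmod z) powr (\<alpha> - 1)" if z: "z \<in> ball 0 1" for z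
    proof -
      have z1: "cmod z < 1" using z by simp
      have rz: "of_real r * z \<in> ball 0 1"
        by (rule subsetD[OF img imageI]) (use z in simp)
      have "(f has_field_derivative deriv f (of_real r * z)) (at (of_real r * z))"
        using holomorphic_derivI[OF f _ rz] by simp
      then have "(g has_field_derivative deriv f (of_real r * z) * of_real r) (at z)"
        unfolding g_def by (rule DERIV_chain2) (auto intro!: derivative_eq_intros)
      then have "deriv g z = deriv f (of_real r * z) * of_real r" by (rule DERIV_imp_deriv)
      then have "cmod (deriv g z) = cmod (deriv f (of_real r * z)) * r"
        using r0 by (simp add: norm_mult)
      also have "\<dots> \<le> cmod (deriv f (of_real r * z)) * 1" using r by (intro mult_left_mono) auto
      also have "\<dots> \<le> C * (1 - cmod (of_real r * z)) powr (\<alpha> - 1)" using bnd[OF rz] by simp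
      also have "\<dots> \<le> C * (1 - cmod z) powr (\<alpha> - 1)"
        using r r0 z1 C \<alpha> by (intro mult_left_mono powr_mono2') (auto simp: norm_mult mult_left_le_one_le)
      finally show ?thesis .
    qed
    moreover have "a / of_real r \<in> cball 0 1" "b / of_real r \<in> cball 0 1"
      using m r r0 by (auto simp: norm_divide divide_simps)
    ultimately have "cmod (g (a / of_real r) - g (b / of_real r)) \<le> C * (2 / \<alpha> + 1) * cmod (a / of_real r - b / of_real r) powr \<alpha>"
      using \<alpha> C by (intro hardy_littlewood_aux) auto
    then show ?thesis using r0 by (simp add: g_def)
  qed
  show ?thesis
  proof (rule tendsto_lowerbound)
    show "((\<lambda>r. C * (2 / \<alpha> + 1) * cmod (a / of_real r - b / of_real r) powr \<alpha>)
        \<longlongrightarrow> C * (2 / \<alpha> + 1) * cmod (a - b) powr \<alpha>) (at_left (1::real))"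
      by (rule tendsto_eq_intros refl | use \<alpha> in simp)+
    show "\<forall>\<^sub>F r in at_left 1. cmod (f a - f b) \<le> C * (2 / \<alpha> + 1) * cmod (a / of_real r - b / of_real r) powr \<alpha>"
      using ev eventually_at_left[of m 1] m by auto
  qed auto
qed

text \<open>The derivative at z is an integral over the circle of the real part alone against \<open>1 / (u - z)\<^sup>2\<close>,
  since the conjugate of a holomorphic function does not contribute. The constant Re (f 1) may be subtracted, and the
  resulting integrand \<open>\<bar>u - 1\<bar> powr \<alpha> / \<bar>u - r\<bar>\<^sup>2\<close> has integral of order \<open>(1 - r) powr (\<alpha> - 1)\<close>.\<close>

lemma deriv_real_axis_bound:
  fixes f :: "complex \<Rightarrow> complex"
  assumes \<alpha>: "0 < \<alpha>" "\<alpha> < 1" and f: "f \<in> disc_algebra" and r: "0 \<le> r" "r < 1" and B: "0 \<le> B"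
    and hol: "\<And>z. z \<in> sphere 0 1 \<Longrightarrow> \<bar>Re (f z) - Re (f 1)\<bar> \<le> B * cmod (z - 1) powr \<alpha>"
  shows "cmod (deriv f (of_real r)) \<le> 32 * B / (1 - \<alpha>) * (1 - r) powr (\<alpha> - 1)"
proof -
  define e where "e = (\<lambda>t::real. exp (2 * of_real pi * \<i> * of_real t))"
  have e1: "cmod (e t) = 1" for t by (simp add: e_def)
  have ecis: "e t = cis (2 * pi * t)" for t by (simp add: e_def cis_conv_exp mult_ac)
  have e0: "e t \<noteq> 0" for t by (simp add: e_def)
  have er: "e t \<noteq> of_real r" for t using e1[of t] r by (metis abs_of_nonneg norm_of_real order_less_irrefl)
  have ecnj: "cnj (e t) = inverse (e t)" for t by (simp add: ecis cis_cnj)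
  have fc: "continuous_on (cball 0 1) f" and fh: "f holomorphic_on ball 0 1"
    using f by (auto simp: disc_algebra_def)
  define k where "k = (\<lambda>t. e t / (e t - of_real r)\<^sup>2)"
  have circ: "((\<lambda>t. h (e t) * (2 * of_real pi * \<i> * e t)) has_integral I) {0..1}"
    if "(h has_contour_integral I) (circlepath 0 1)" for h I
  proof -
    have "((\<lambda>t. h (circlepath 0 1 t) * vector_derivative (circlepath 0 1) (at t)) has_integral I) {0..1}"
      using that unfolding has_contour_integral .
    then show ?thesis
      unfolding vector_derivative_circlepath by (simp add: circlepath e_def)
  qed
  have kernel: "((\<lambda>t. of_real (2 * Re (g (e t))) * k t) has_integral deriv g (of_real r)) {0..1}"
    if g: "continuous_on (cball 0 1) g" "g holomorphic_on ball 0 1" for g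
  proof -
    have rb: "(of_real r :: complex) \<in> ball 0 1" using r by simp
    have "((\<lambda>u. g u / (u - of_real r) ^ 2) has_contour_integral 2 * pi * \<i> * deriv g (of_real r)) (circlepath 0 1)"
      using Cauchy_has_contour_integral_higher_derivative_circlepath[OF g rb, of 1]
      by (simp add: power2_eq_square)
    from has_integral_mult_right[OF circ[OF this], of "1 / (2 * of_real pi * \<i>)"]
    have A: "((\<lambda>t. g (e t) * k t) has_integral deriv g (of_real r)) {0..1}"
      by (simp add: k_def field_simps)
    have ru: "1 - of_real r * u \<noteq> 0" if "u \<in> cball 0 1" for u :: complex
    proof
      assume "1 - of_real r * u = 0"
      then have "1 = cmod (of_real r * u)" by simp
      also have "\<dots> \<le> r * 1" using that r by (auto simp: norm_mult intro: mult_left_le)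
      finally show False using r by simp
    qed
    have "continuous_on (cball 0 1) (\<lambda>u. g u * u / (1 - of_real r * u)\<^sup>2)"
      using ru by (intro continuous_intros g) auto
    moreover have "(\<lambda>u. g u * u / (1 - of_real r * u)\<^sup>2) holomorphic_on ball 0 1"
      using ru by (intro holomorphic_intros g) auto
    ultimately have "((\<lambda>u. g u * u / (1 - of_real r * u)\<^sup>2 / (u - 0)) has_contour_integral 2 * pi * \<i> * (g 0 * 0 / (1 - of_real r * 0)\<^sup>2)) (circlepath 0 1)"
      using Cauchy_has_contour_integral_higher_derivative_circlepath[of 0 1 "\<lambda>u. g u * u / (1 - of_real r * u)\<^sup>2" 0 0]
      by simp
    note J = has_integral_mult_right[OF circ[OF this], of "1 / (2 * of_real pi * \<i>)"]
    have cancel: "1 / (2 * of_real pi * \<i>) * (a / (u - 0) * (2 * of_real pi * \<i> * u)) = a"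
      if "u \<noteq> 0" for a u :: complex
      using that by (simp add: field_simps)
    have "((\<lambda>t. g (e t) * e t / (1 - of_real r * e t)\<^sup>2) has_integral 0) {0..1}"
      using J unfolding cancel[OF e0] by simp
    from has_integral_linear[OF this bounded_linear_cnj]
    have "((\<lambda>t. cnj (g (e t)) * k t) has_integral 0) {0..1}"
    proof (rule has_integral_eq_rhs[OF has_integral_eq, rotated])
      show "(cnj \<circ> (\<lambda>t. g (e t) * e t / (1 - of_real r * e t)\<^sup>2)) t = cnj (g (e t)) * k t" for t
      proof -
        have "inverse (e t) / (1 - of_real r * inverse (e t))\<^sup>2 = k t"
          using e0[of t] er[of t] by (simp add: k_def divide_simps power2_eq_square)
        then show ?thesis by (simp add: ecnj flip: times_divide_eq_right)
      qed
    qed simp_all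
    from has_integral_add[OF A this] show ?thesis
      by (simp add: complex_add_cnj flip: distrib_right)
  qed
  have "((\<lambda>t. of_real (2 * Re (f (e t) - f 1)) * k t) has_integral deriv (\<lambda>z. f z - f 1) (of_real r)) {0..1}"
    by (intro kernel continuous_intros holomorphic_intros fc fh)
  moreover have "deriv (\<lambda>z. f z - f 1) (of_real r) = deriv f (of_real r)"
    using holomorphic_on_imp_differentiable_at[OF fh, of "of_real r"] r by simp
  ultimately have I: "((\<lambda>t. of_real (2 * Re (f (e t) - f 1)) * k t) has_integral deriv f (of_real r)) {0..1}"
    by simp
  define K where "K = (\<lambda>t. 16 * B * ((1 - r + t) powr (\<alpha> - 2) + (1 - r + (1 - t)) powr (\<alpha> - 2)))"
  have bnd: "cmod (of_real (2 * Re (f (e t) - f 1)) * k t) \<le> K t" if t: "t \<in> {0..1}" for t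
  proof -
    define R where "R = cmod (e t - of_real r)"
    have d: "1 - r \<le> R" using norm_triangle_ineq2[of "e t" "of_real r"] r e1[of t] by (simp add: R_def)
    have e1R: "cmod (e t - 1) \<le> 2 * R"
    proof -
      have "cmod (e t - 1) \<le> R + cmod (of_real r - 1)"
        unfolding R_def using norm_triangle_ineq[of "e t - of_real r" "of_real r - 1"] by simp
      also have "cmod (of_real r - 1) = 1 - r" using r by (metis abs_minus_commute abs_of_nonneg diff_ge_0_iff_ge less_eq_real_def norm_of_real of_real_1 of_real_diff)
      finally show ?thesis using d by simp
    qed
    have Rpos: "0 < R" using d r by linarith
    define m where "m = min t (1 - t)"
    have em: "2 * m \<le> cmod (e t - 1)"
    proof (cases "t \<le> 1/2")
      case True
      have "\<bar>2 * pi * t\<bar> / 2 \<le> cmod (cis (2 * pi * t) - 1)"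
        using True t by (intro chord_ge_half_angle) (auto simp: field_simps)
      moreover have "2 * t \<le> pi * t" using t pi_gt3 by (intro mult_right_mono) auto
      ultimately show ?thesis using True t unfolding ecis m_def by auto
    next
      case False
      have "\<bar>2 * pi * (t - 1)\<bar> / 2 \<le> cmod (cis (2 * pi * (t - 1)) - 1)"
        using False t by (intro chord_ge_half_angle) (auto simp: abs_mult field_simps)
      moreover have "cis (2 * pi * (t - 1)) = cis (2 * pi * t)"
        using cis_divide[of "2*pi*t" "2 * pi"] by (simp add: right_diff_distrib)
      moreover have "2 * (1 - t) \<le> pi * (1 - t)" using t pi_gt3 by (intro mult_right_mono) auto
      moreover have "\<bar>2 * pi * (t - 1)\<bar> / 2 = pi * (1 - t)" using t by (simp add: abs_mult)
      ultimately show ?thesis using False t unfolding ecis m_def by auto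
    qed
    have Rm: "(1 - r + m) / 2 \<le> R" 
    proof -
      have "m \<le> R" using em e1R by linarith
      then show ?thesis using d by simp
    qed
    have m0: "0 \<le> m" using t by (auto simp: m_def)
    have "R powr (\<alpha> - 2) \<le> ((1 - r + m) / 2) powr (\<alpha> - 2)"
      using Rm r m0 \<alpha> by (intro powr_mono2') auto
    also have "\<dots> = (1 - r + m) powr (\<alpha> - 2) * 2 powr (2 - \<alpha>)"
      using r m0 by (simp add: powr_divide powr_diff field_simps)
    also have "\<dots> \<le> (1 - r + m) powr (\<alpha> - 2) * 2 powr 2"
      using \<alpha> by (intro mult_left_mono powr_mono) auto
    also have "(1 - r + m) powr (\<alpha> - 2) \<le> (1 - r + t) powr (\<alpha> - 2) + (1 - r + (1 - t)) powr (\<alpha> - 2)"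
      by (auto simp: m_def min_def)
    finally have Rp: "R powr (\<alpha> - 2) \<le> 4 * ((1 - r + t) powr (\<alpha> - 2) + (1 - r + (1 - t)) powr (\<alpha> - 2))"
      by simp
    have "\<bar>Re (f (e t) - f 1)\<bar> \<le> B * cmod (e t - 1) powr \<alpha>"
      using hol[of "e t"] e1[of t] by simp
    also have "\<dots> \<le> B * (2 * R) powr \<alpha>"
      using e1R \<alpha> B by (intro mult_left_mono powr_mono2) auto
    also have "(2 * R) powr \<alpha> \<le> 2 * R powr \<alpha>"
      using powr_mono[of \<alpha> 1 2] \<alpha> Rpos by (simp add: powr_mult)
    finally have "\<bar>Re (f (e t) - f 1)\<bar> \<le> 2 * B * R powr \<alpha>" using B by (simp add: mult_left_mono)
    moreover have "cmod (k t) = 1 / R\<^sup>2"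
      by (simp add: k_def norm_divide e1 norm_power R_def)
    moreover have "\<bar>2 * Re (f (e t) - f 1)\<bar> = 2 * \<bar>Re (f (e t) - f 1)\<bar>" by (rule abs_mult[THEN trans]) simp
    ultimately have "cmod (of_real (2 * Re (f (e t) - f 1)) * k t) = 2 * \<bar>Re (f (e t) - f 1)\<bar> / R\<^sup>2"
      unfolding norm_mult norm_of_real by simp
    also have "\<dots> \<le> 2 * (2 * B * R powr \<alpha>) / R\<^sup>2"
      using \<open>\<bar>Re (f (e t) - f 1)\<bar> \<le> 2 * B * R powr \<alpha>\<close> by (intro divide_right_mono mult_left_mono) auto
    also have "2 * (2 * B * R powr \<alpha>) / R\<^sup>2 = 4 * B * R powr (\<alpha> - 2)" using Rpos by (simp add: powr_diff powr_numeral)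
    also have "\<dots> \<le> 4 * B * (4 * ((1 - r + t) powr (\<alpha> - 2) + (1 - r + (1 - t)) powr (\<alpha> - 2)))"
      using Rp B by (intro mult_left_mono) auto
    also have "\<dots> = K t" by (simp add: K_def)
    finally show ?thesis .
  qed
  have KI: "(K has_integral 16 * B / (\<alpha> - 1) * ((1 - r + 1) powr (\<alpha> - 1) - (1 - r + (1 - 1)) powr (\<alpha> - 1))
       - 16 * B / (\<alpha> - 1) * ((1 - r + 0) powr (\<alpha> - 1) - (1 - r + (1 - 0)) powr (\<alpha> - 1))) {0..1}"
  proof (rule fundamental_theorem_of_calculus)
    fix t :: real assume t: "t \<in> {0..1}"
    show "((\<lambda>t. 16 * B / (\<alpha> - 1) * ((1 - r + t) powr (\<alpha> - 1) - (1 - r + (1 - t)) powr (\<alpha> - 1))) has_vector_derivative K t) (at t within {0..1})"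
      unfolding has_real_derivative_iff_has_vector_derivative[symmetric] K_def
      using t r \<alpha> by (auto intro!: derivative_eq_intros simp: divide_simps) (simp add: algebra_simps)
  qed simp
  have "cmod (deriv f (of_real r)) \<le> integral {0..1} K"
    using integral_norm_bound_integral[of "\<lambda>t. of_real (2 * Re (f (e t) - f 1)) * k t" "{0..1}" K]
      has_integral_integrable[OF I] has_integral_integrable[OF KI] bnd integral_unique[OF I] by simp
  also have "\<dots> = 32 * B / (1 - \<alpha>) * ((1 - r) powr (\<alpha> - 1) - (2 - r) powr (\<alpha> - 1))"
    using integral_unique[OF KI] \<alpha> by (simp add: divide_simps) (simp add: algebra_simps)
  also have "\<dots> \<le> 32 * B / (1 - \<alpha>) * (1 - r) powr (\<alpha> - 1)"
    using \<alpha> B by (intro mult_left_mono) auto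
  finally show ?thesis .
qed

section \<open>Privalov's theorem and boundary regularity\<close>

lemma sphere_minus_one_limit:
  assumes "z \<in> sphere (0::complex) 1"
  obtains s where "\<And>n. s n \<in> sphere 0 1 - {1}" "s \<longlonglongrightarrow> z"
proof (cases "z = 1")
  case False
  then show ?thesis using assms that[of "\<lambda>_. z"] by auto
next
  case True
  define s where "s = (\<lambda>n. cis (inverse (real (Suc n))))"
  have "s n \<noteq> 1" for n
  proof
    assume "s n = 1"
    then have "sin (inverse (real (Suc n))) = 0" unfolding s_def by (metis cis.simps(2) one_complex.simps(2))
    moreover have "0 < sin (inverse (real (Suc n)))"
    proof (rule sin_gt_zero)
      have "inverse (real (Suc n)) \<le> 1" by (simp add: field_simps)
      then show "inverse (real (Suc n)) < pi" using pi_gt3 by linarith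
    qed simp
    ultimately show False by simp
  qed
  moreover have "s \<longlonglongrightarrow> cis 0"
    unfolding s_def by (intro isCont_tendsto_compose[OF _ LIMSEQ_inverse_real_of_nat]) (auto simp: isCont_def cis_conv_exp intro!: tendsto_eq_intros)
  ultimately show ?thesis using that[of s] True by (simp add: s_def)
qed

definition privalov_const :: "real \<Rightarrow> real" where
  "privalov_const \<alpha> = 32 / (1 - \<alpha>) * (2 / \<alpha> + 1)"

text \<open>By a rotation, the bound on the real axis holds on every radius. The point 1 is left out of the
  hypothesis because quotients by \<open>1 - \<zeta>\<close> will only be known away from it; continuity supplies it.\<close>

lemma disc_algebra_deriv_bound:
  fixes f :: "complex \<Rightarrow> complex"
  assumes \<alpha>: "0 < \<alpha>" "\<alpha> < 1" and f: "f \<in> disc_algebra" and B: "0 \<le> B"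
    and hol: "\<And>z w. z \<in> sphere 0 1 - {1} \<Longrightarrow> w \<in> sphere 0 1 - {1} \<Longrightarrow>
       \<bar>Re (f z) - Re (f w)\<bar> \<le> B * cmod (z - w) powr \<alpha>"
    and z: "z \<in> ball 0 1"
  shows "cmod (deriv f z) \<le> 32 * B / (1 - \<alpha>) * (1 - cmod z) powr (\<alpha> - 1)"
proof -
  have fc: "continuous_on (cball 0 1) f" and fh: "f holomorphic_on ball 0 1"
    using f by (auto simp: disc_algebra_def)
  have hol': "\<bar>Re (f z) - Re (f w)\<bar> \<le> B * cmod (z - w) powr \<alpha>"
    if zw: "z \<in> sphere 0 1" "w \<in> sphere 0 1" for z w
  proof -
    obtain s t where s: "\<And>n. s n \<in> sphere 0 1 - {1}" "s \<longlonglongrightarrow> z"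
      and t: "\<And>n. t n \<in> sphere 0 1 - {1}" "t \<longlonglongrightarrow> w"
      using sphere_minus_one_limit zw by metis
    have lim: "(\<lambda>n. f (u n)) \<longlonglongrightarrow> f x"
      if "\<And>n. u n \<in> sphere 0 1 - {1}" "u \<longlonglongrightarrow> x" "x \<in> sphere 0 1" for u x
      using continuous_on_tendsto_compose[OF fc that(2)] that by (auto intro!: always_eventually)
    show ?thesis
    proof (rule LIMSEQ_le)
      show "(\<lambda>n. \<bar>Re (f (s n)) - Re (f (t n))\<bar>) \<longlonglongrightarrow> \<bar>Re (f z) - Re (f w)\<bar>"
        by (intro tendsto_intros lim s t zw)
      show "(\<lambda>n. B * cmod (s n - t n) powr \<alpha>) \<longlonglongrightarrow> B * cmod (z - w) powr \<alpha>"
        using \<alpha> by (intro tendsto_intros s t tendsto_powr') auto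
    qed (use hol s t in blast)
  qed
  define \<omega> where "\<omega> = (if z = 0 then 1 else sgn z)"
  have \<omega>: "cmod \<omega> = 1" "z = \<omega> * of_real (cmod z)"
    by (auto simp: \<omega>_def sgn_eq norm_divide)
  define g where "g = (\<lambda>w. f (\<omega> * w))"
  have img: "(\<lambda>w. \<omega> * w) ` cball 0 1 \<subseteq> cball 0 1" "(\<lambda>w. \<omega> * w) ` ball 0 1 \<subseteq> ball 0 1"
    using \<omega> by (auto simp: norm_mult)
  have "g \<in> disc_algebra"
  proof -
    have "continuous_on (cball 0 1) g" unfolding g_def
      by (rule continuous_on_compose2[OF fc _ img(1)]) (intro continuous_intros)
    moreover have "(f \<circ> (\<lambda>w. \<omega> * w)) holomorphic_on ball 0 1"
      by (rule holomorphic_on_compose_gen[OF _ fh img(2)]) (intro holomorphic_intros)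
    ultimately show ?thesis by (simp add: disc_algebra_def g_def o_def)
  qed
  then have "cmod (deriv g (of_real (cmod z))) \<le> 32 * B / (1 - \<alpha>) * (1 - cmod z) powr (\<alpha> - 1)"
  proof (rule deriv_real_axis_bound[OF \<alpha>])
    fix w assume "w \<in> sphere (0::complex) 1"
    then have "\<bar>Re (g w) - Re (g 1)\<bar> \<le> B * cmod (\<omega> * w - \<omega> * 1) powr \<alpha>"
      unfolding g_def using \<omega> by (intro hol') (auto simp: norm_mult)
    also have "cmod (\<omega> * w - \<omega> * 1) = cmod (w - 1)"
      using \<omega>(1) norm_mult[of \<omega> "w - 1"] by (simp add: right_diff_distrib)
    finally show "\<bar>Re (g w) - Re (g 1)\<bar> \<le> B * cmod (w - 1) powr \<alpha>" .
  qed (use z B in auto)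
  moreover have "deriv g (of_real (cmod z)) = deriv f z * \<omega>"
  proof (rule DERIV_imp_deriv)
    have "(f has_field_derivative deriv f z) (at (\<omega> * of_real (cmod z)))"
      using holomorphic_derivI[OF fh _ z] \<omega>(2) by simp
    then show "(g has_field_derivative deriv f z * \<omega>) (at (of_real (cmod z)))"
      unfolding g_def by (rule DERIV_chain2) (auto intro!: derivative_eq_intros)
  qed
  ultimately show ?thesis using \<omega>(1) by (simp add: norm_mult)
qed

text \<open>Passing from the real part to the whole function costs only a constant depending on \<open>\<alpha>\<close>.
  The proof combines the kernel bound for the derivative with the Hardy-Littlewood theorem.\<close>

theorem privalov:
  fixes f :: "complex \<Rightarrow> complex"
  assumes \<alpha>: "0 < \<alpha>" "\<alpha> < 1" and f: "f \<in> disc_algebra" and B: "0 \<le> B"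
    and hol: "\<And>z w. z \<in> sphere 0 1 - {1} \<Longrightarrow> w \<in> sphere 0 1 - {1} \<Longrightarrow>
       \<bar>Re (f z) - Re (f w)\<bar> \<le> B * cmod (z - w) powr \<alpha>"
    and ab: "a \<in> cball 0 1" "b \<in> cball 0 1"
  shows "cmod (f a - f b) \<le> privalov_const \<alpha> * B * cmod (a - b) powr \<alpha>"
proof -
  have "cmod (f a - f b) \<le> (32 * B / (1 - \<alpha>)) * (2 / \<alpha> + 1) * cmod (a - b) powr \<alpha>"
    using disc_algebra_deriv_bound[OF \<alpha> f B hol] \<alpha> B ab
    by (intro hardy_littlewood_aux[OF \<alpha> f]) auto
  then show ?thesis by (simp add: privalov_const_def field_simps)
qed

lemma powr_ge_one_disc:
  assumes "z \<in> ball (0::complex) 1" "\<alpha> < 1"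
  shows "1 \<le> (1 - cmod z) powr (\<alpha> - 1)"
  using powr_mono2'[of "\<alpha> - 1" "1 - cmod z" 1] assms by simp

lemma hardy_littlewood_bounded:
  fixes f :: "complex \<Rightarrow> complex"
  assumes \<alpha>: "0 < \<alpha>" "\<alpha> < 1" and f: "f holomorphic_on ball 0 1" and C: "0 \<le> C"
    and bnd: "\<And>z. z \<in> ball 0 1 \<Longrightarrow> cmod (deriv f z) \<le> C * (1 - cmod z) powr (\<alpha> - 1)"
  obtains M where "0 \<le> M" "\<And>z. z \<in> ball 0 1 \<Longrightarrow> cmod (f z) \<le> M"
proof
  show "0 \<le> cmod (f 0) + C * (2 / \<alpha> + 1)" using C \<alpha> by simp
  fix z assume z: "z \<in> ball (0::complex) 1"
  have "cmod (f z - f 0) \<le> C * (2 / \<alpha> + 1) * cmod (z - 0) powr \<alpha>"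
    by (rule hardy_littlewood[OF \<alpha> f C bnd z]) auto
  also have "\<dots> \<le> C * (2 / \<alpha> + 1) * 1"
    using z \<alpha> C by (intro mult_left_mono powr_le1) auto
  finally show "cmod (f z) \<le> cmod (f 0) + C * (2 / \<alpha> + 1)"
    using norm_triangle_ineq2[of "f z" "f 0"] by simp
qed

lemma deriv_bound_divide_id:
  fixes P \<phi> :: "complex \<Rightarrow> complex"
  assumes \<alpha>: "0 < \<alpha>" "\<alpha> < 1" and \<phi>: "\<phi> holomorphic_on ball 0 1" and C: "0 \<le> C"
    and bnd: "\<And>z. z \<in> ball 0 1 \<Longrightarrow> cmod (deriv (\<lambda>z. z * \<phi> z) z) \<le> C * (1 - cmod z) powr (\<alpha> - 1)"
  obtains C' where "0 \<le> C'" "\<And>z. z \<in> ball 0 1 \<Longrightarrow> cmod (deriv \<phi> z) \<le> C' * (1 - cmod z) powr (\<alpha> - 1)"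
proof -
  have P: "(\<lambda>z. z * \<phi> z) holomorphic_on ball 0 1" by (intro holomorphic_intros \<phi>)
  obtain M where M: "0 \<le> M" "\<And>z. z \<in> ball 0 1 \<Longrightarrow> cmod (z * \<phi> z) \<le> M"
    using hardy_littlewood_bounded[OF \<alpha> P C bnd] by blast
  have "continuous_on (cball 0 (1/2)) (deriv \<phi>)"
    using holomorphic_deriv[OF \<phi>] by (intro continuous_on_subset[OF holomorphic_on_imp_continuous_on]) auto
  then have "bounded (deriv \<phi> ` cball 0 (1/2))"
    by (intro compact_imp_bounded compact_continuous_image) auto
  then obtain D where D: "0 < D" "\<And>z. z \<in> cball 0 (1/2) \<Longrightarrow> cmod (deriv \<phi> z) \<le> D"
    unfolding bounded_pos by auto
  show thesis
  proof (rule that[of "D + 2 * C + 4 * M"])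
    show "0 \<le> D + 2 * C + 4 * M" using D C M by simp
    fix z assume z: "z \<in> ball (0::complex) 1"
    define p where "p = (1 - cmod z) powr (\<alpha> - 1)"
    have p: "1 \<le> p" using powr_ge_one_disc[OF z \<alpha>(2)] by (simp add: p_def)
    show "cmod (deriv \<phi> z) \<le> (D + 2 * C + 4 * M) * (1 - cmod z) powr (\<alpha> - 1)"
    proof (cases "cmod z \<le> 1/2")
      case True
      then have "cmod (deriv \<phi> z) \<le> D * 1" using D by auto
      also have "\<dots> \<le> (D + 2 * C + 4 * M) * p" using p D C M by (intro mult_mono) auto
      finally show ?thesis by (simp add: p_def)
    next
      case False
      have d: "deriv (\<lambda>z. z * \<phi> z) z = \<phi> z + z * deriv \<phi> z"
        using holomorphic_derivI[OF \<phi> _ z] by (intro DERIV_imp_deriv) (auto intro!: derivative_eq_intros)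
      have "cmod (z * deriv \<phi> z) \<le> cmod (deriv (\<lambda>z. z * \<phi> z) z) + cmod (\<phi> z)"
        using norm_triangle_ineq4[of "deriv (\<lambda>z. z * \<phi> z) z" "\<phi> z"] by (simp add: d)
      then have a: "cmod z * cmod (deriv \<phi> z) \<le> C * p + cmod (\<phi> z)"
        using bnd[OF z] by (simp add: norm_mult p_def)
      have "1/2 * cmod (\<phi> z) \<le> cmod z * cmod (\<phi> z)" using False by (intro mult_right_mono) auto
      then have b: "cmod (\<phi> z) \<le> 2 * M" using M(2)[OF z] by (simp add: norm_mult)
      have "1/2 * cmod (deriv \<phi> z) \<le> cmod z * cmod (deriv \<phi> z)" using False by (intro mult_right_mono) auto
      then have "cmod (deriv \<phi> z) \<le> 2 * C * p + 4 * M * 1" using a b by simp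
      also have "\<dots> \<le> 2 * C * p + 4 * M * p" using p M by (intro add_left_mono mult_left_mono) auto
      also have "\<dots> \<le> (D + 2 * C + 4 * M) * p" using D p by (simp add: algebra_simps)
      finally show ?thesis by (simp add: p_def)
    qed
  qed
qed

lemma cis_has_vector_derivative: "(cis has_vector_derivative cis t * \<i>) (at t within S)"
  unfolding cis_conv_exp
  by (rule has_vector_derivative_real_field) (auto intro!: derivative_eq_intros)

lemma cis_mult_ball: "z \<in> ball 0 1 \<Longrightarrow> cis t * z \<in> ball 0 1"
  and cis_mult_cball: "z \<in> cball 0 1 \<Longrightarrow> cis t * z \<in> cball 0 1"
  and cis_mult_sphere: "z \<in> sphere 0 1 \<Longrightarrow> cis t * z \<in> sphere 0 1"
  by (auto simp: norm_mult)

lemma deriv_rotation_difference: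
  assumes G: "G holomorphic_on ball 0 1" and z: "z \<in> ball 0 1"
  shows "deriv (\<lambda>z. G (cis k * z) - G z) z = cis k * deriv G (cis k * z) - deriv G z"
proof (rule DERIV_imp_deriv)
  have "(G has_field_derivative deriv G (cis k * z)) (at (cis k * z))"
    using holomorphic_derivI[OF G _ cis_mult_ball[OF z]] by simp
  then have "((\<lambda>z. G (cis k * z)) has_field_derivative deriv G (cis k * z) * cis k) (at z)"
    by (rule DERIV_chain2) (auto intro!: derivative_eq_intros)
  then show "((\<lambda>z. G (cis k * z) - G z) has_field_derivative cis k * deriv G (cis k * z) - deriv G z) (at z)"
    using holomorphic_derivI[OF G _ z] by (auto intro!: derivative_eq_intros simp: mult.commute)
qed

text \<open>The rotation difference divided by k tends to \<open>\<i>\<close> times \<open>z * deriv G z\<close>, locally uniformly in the open disc,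
  so derivative bounds proportional to k survive the limit.\<close>

lemma rotation_difference_limit:
  assumes G: "G holomorphic_on ball 0 1" and z: "z \<in> ball 0 1"
    and bnd: "\<And>k. 0 < k \<Longrightarrow> k < 1 \<Longrightarrow> cmod (deriv (\<lambda>z. G (cis k * z) - G z) z) \<le> M * k"
  shows "cmod (deriv (\<lambda>z. z * deriv G z) z) \<le> M"
proof -
  have dG: "deriv G holomorphic_on ball 0 1" by (rule holomorphic_deriv[OF G]) simp
  define \<tau> where "\<tau> = (\<lambda>w. w * deriv G (w * z))"
  have d1: "(deriv G has_field_derivative deriv (deriv G) z) (at (1 * z))"
    using holomorphic_derivI[OF dG _ z] by simp
  from d1 have "((\<lambda>w. deriv G (w * z)) has_field_derivative deriv (deriv G) z * z) (at 1)"
    by (rule DERIV_chain2) (auto intro!: derivative_eq_intros)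
  then have d: "(\<tau> has_field_derivative (deriv G z + z * deriv (deriv G) z)) (at 1)"
    unfolding \<tau>_def by (auto intro!: derivative_eq_intros)
  have "(cis has_vector_derivative \<i>) (at 0)"
    using cis_has_vector_derivative[of 0] by simp
  then have "((\<tau> \<circ> cis) has_vector_derivative \<i> * (deriv G z + z * deriv (deriv G) z)) (at 0)"
    using d by (intro field_vector_diff_chain_at) auto
  then have "((\<lambda>k. norm ((\<tau> \<circ> cis) (0 + k) - (\<tau> \<circ> cis) 0 - k *\<^sub>R (\<i> * (deriv G z + z * deriv (deriv G) z))) / norm k) \<longlongrightarrow> 0) (at 0)"
    unfolding has_vector_derivative_def has_derivative_at by blast
  moreover have "\<forall>\<^sub>F k in at (0::real). norm ((\<tau> \<circ> cis) (0 + k) - (\<tau> \<circ> cis) 0 - k *\<^sub>R L) / norm k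
      = norm (((\<tau> \<circ> cis) (0 + k) - (\<tau> \<circ> cis) 0) /\<^sub>R k - L)" for L
  proof (rule eventually_at_topological[THEN iffD2], intro exI[of _ UNIV] conjI ballI impI)
    fix k :: real assume k: "k \<noteq> 0"
    have "((\<tau> \<circ> cis) (0 + k) - (\<tau> \<circ> cis) 0) /\<^sub>R k - L = ((\<tau> \<circ> cis) (0 + k) - (\<tau> \<circ> cis) 0 - k *\<^sub>R L) /\<^sub>R k"
      using k by (simp add: algebra_simps)
    then show "norm ((\<tau> \<circ> cis) (0 + k) - (\<tau> \<circ> cis) 0 - k *\<^sub>R L) / norm k
      = norm (((\<tau> \<circ> cis) (0 + k) - (\<tau> \<circ> cis) 0) /\<^sub>R k - L)" by (simp add: divide_inverse mult.commute)
  qed auto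
  ultimately have "((\<lambda>k. norm (((\<tau> \<circ> cis) (0 + k) - (\<tau> \<circ> cis) 0) /\<^sub>R k - \<i> * (deriv G z + z * deriv (deriv G) z))) \<longlongrightarrow> 0) (at 0)"
    by (rule Lim_transform_eventually)
  then have "((\<lambda>k. ((\<tau> \<circ> cis) (0 + k) - (\<tau> \<circ> cis) 0) /\<^sub>R k) \<longlongrightarrow> \<i> * (deriv G z + z * deriv (deriv G) z)) (at 0)"
    by (rule LIM_zero_cancel[OF tendsto_norm_zero_cancel])
  then have lim: "((\<lambda>k. cmod (((\<tau> \<circ> cis) (0 + k) - (\<tau> \<circ> cis) 0) /\<^sub>R k)) \<longlongrightarrow> cmod (\<i> * (deriv G z + z * deriv (deriv G) z))) (at_right 0)"
    by (intro tendsto_norm) (auto intro: tendsto_within_subset)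
  have "cmod (\<i> * (deriv G z + z * deriv (deriv G) z)) \<le> M"
  proof (rule tendsto_upperbound[OF lim])
    have "\<forall>\<^sub>F k in at_right (0::real). k \<in> {0<..<1}" by (rule eventually_at_right_real) simp
    then show "\<forall>\<^sub>F k in at_right 0. cmod (((\<tau> \<circ> cis) (0 + k) - (\<tau> \<circ> cis) 0) /\<^sub>R k) \<le> M"
    proof eventually_elim
      case (elim k)
      then have "cmod (cis k * deriv G (cis k * z) - deriv G z) \<le> M * k"
        using bnd[of k] by (simp add: deriv_rotation_difference[OF G z])
      then show ?case using elim by (simp add: \<tau>_def divide_simps mult.commute)
    qed
  qed simp
  moreover have "deriv (\<lambda>z. z * deriv G z) z = deriv G z + z * deriv (deriv G) z"
    using holomorphic_derivI[OF dG _ z] by (intro DERIV_imp_deriv) (auto intro!: derivative_eq_intros)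
  ultimately show ?thesis by (simp add: norm_mult)
qed

lemma holder_extension:
  fixes f :: "complex \<Rightarrow> complex"
  assumes \<alpha>: "0 < \<alpha>" and f: "f holomorphic_on ball 0 1"
    and hol: "\<And>a b. a \<in> ball 0 1 \<Longrightarrow> b \<in> ball 0 1 \<Longrightarrow> cmod (f a - f b) \<le> C * cmod (a - b) powr \<alpha>"
  obtains g where "g \<in> disc_algebra" "\<And>z. z \<in> ball 0 1 \<Longrightarrow> g z = f z"
proof -
  have "uniformly_continuous_on (ball 0 1) f"
    unfolding uniformly_continuous_on_def
  proof (intro allI impI)
    fix e :: real assume e: "0 < e"
    define D where "D = max C 1"
    have D: "0 < D" "C \<le> D" by (auto simp: D_def)
    show "\<exists>d>0. \<forall>x\<in>ball 0 1. \<forall>x'\<in>ball 0 1. dist x' x < d \<longrightarrow> dist (f x') (f x) < e"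
    proof (intro exI[of _ "(e / D) powr (1 / \<alpha>)"] conjI ballI impI)
      show "0 < (e / D) powr (1 / \<alpha>)" using e D by simp
      fix x x' :: complex assume x: "x \<in> ball 0 1" "x' \<in> ball 0 1" "dist x' x < (e / D) powr (1 / \<alpha>)"
      have "dist x' x powr \<alpha> < ((e / D) powr (1 / \<alpha>)) powr \<alpha>"
        using x \<alpha> by (intro powr_less_mono2) auto
      also have "\<dots> = e / D" using e D \<alpha> by (simp add: powr_powr)
      finally have "D * dist x' x powr \<alpha> < e" using D by (simp add: field_simps)
      moreover have "dist (f x') (f x) \<le> D * dist x' x powr \<alpha>"
        using hol[OF x(2,1)] D mult_right_mono[OF D(2), of "dist x' x powr \<alpha>"] by (simp add: dist_norm)
      ultimately show "dist (f x') (f x) < e" by simp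
    qed
  qed
  then obtain g where g: "uniformly_continuous_on (closure (ball 0 1)) g" "\<And>x. x \<in> ball 0 1 \<Longrightarrow> f x = g x"
    using uniformly_continuous_on_extension_on_closure by metis
  show thesis
  proof
    have "g holomorphic_on ball 0 1" using f by (rule holomorphic_transform) (use g in auto)
    then show "g \<in> disc_algebra"
      using uniformly_continuous_imp_continuous[OF g(1)] by (simp add: disc_algebra_def)
  qed (use g in auto)
qed

text \<open>Integrating the increment of f1 along segments of the closed disc shows that a continuous extension of the derivative is the
  derivative at boundary points, within the closed disc.\<close>

lemma disc_algebra_boundary_derivative:
  assumes f: "f \<in> disc_algebra" and f1: "f1 \<in> disc_algebra"
    and d: "\<And>z. z \<in> ball 0 1 \<Longrightarrow> deriv f z = f1 z" and z: "z \<in> cball 0 1"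
  shows "(f has_field_derivative f1 z) (at z within cball 0 1)"
  unfolding has_field_derivative_def has_derivative_within_alt
proof (intro conjI allI impI)
  show "bounded_linear ((*) (f1 z))" by (rule bounded_linear_mult_right)
  fix e :: real assume e: "0 < e"
  have "continuous_on (cball 0 1) f1" using f1 by (simp add: disc_algebra_def)
  then obtain \<delta> where \<delta>: "\<delta> > 0" "\<And>w. w \<in> cball 0 1 \<Longrightarrow> dist w z < \<delta> \<Longrightarrow> dist (f1 w) (f1 z) < e"
    using z e unfolding continuous_on_iff by metis
  show "\<exists>d>0. \<forall>y\<in>cball 0 1. norm (y - z) < d \<longrightarrow> norm (f y - f z - f1 z * (y - z)) \<le> e * norm (y - z)"
  proof (intro exI[of _ \<delta>] conjI ballI impI \<delta>(1))
    fix y assume y: "y \<in> cball 0 1" "norm (y - z) < \<delta>"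
    show "norm (f y - f z - f1 z * (y - z)) \<le> e * norm (y - z)"
    proof (cases "y = z")
      case False
      have "cmod (f y - f z - f1 z * (y - z)) \<le> e * cmod (y - z) * 1 - e * cmod (y - z) * 0"
      proof (rule segment_increment_bound[OF f z y(1), where \<phi>' = "\<lambda>_. e * cmod (y - z)"])
        fix t :: real assume t: "0 < t" "t < 1"
        let ?w = "z + of_real t * (y - z)"
        have "?w \<in> open_segment z y"
          using t False by (auto simp: in_segment algebra_simps scaleR_conv_of_real intro!: exI[of _ t])
        then have wb: "?w \<in> ball 0 1"
          using dist_decreases_open_segment[of ?w z y 0] z y(1) by (auto simp: dist_norm)
        have "dist ?w z = t * cmod (y - z)" using t by (simp add: dist_norm norm_mult)
        also have "\<dots> \<le> cmod (y - z)" using t by (intro mult_left_le_one_le) auto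
        finally have "dist (f1 ?w) (f1 z) < e" using wb y(2) by (intro \<delta>(2)) auto
        then show "cmod (deriv f ?w - f1 z) * cmod (y - z) \<le> e * cmod (y - z)"
          using d[OF wb] by (intro mult_right_mono) (auto simp: dist_norm)
      qed (auto intro!: derivative_eq_intros continuous_intros)
      then show ?thesis by simp
    qed simp
  qed
qed

text \<open>Second rotation differences are again in the disc algebra, so Privalov's kernel estimate bounds their
  derivative by \<open>h * k * (1 - \<bar>z\<bar>) powr (\<alpha> - 1)\<close>. Dividing by h and k and letting them tend to 0 bounds
  the third derivative of g, and the Hardy-Littlewood theorem turns this into a Hoelder bound for the second.\<close>

theorem second_rotation_difference_regularity:
  fixes g :: "complex \<Rightarrow> complex"
  assumes \<alpha>: "0 < \<alpha>" "\<alpha> < 1" and g: "g \<in> disc_algebra" and K: "0 \<le> K"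
    and bnd: "\<And>h k z w. 0 < h \<Longrightarrow> h < 1 \<Longrightarrow> 0 < k \<Longrightarrow> k < 1 \<Longrightarrow> z \<in> sphere 0 1 \<Longrightarrow> w \<in> sphere 0 1 \<Longrightarrow>
      cmod ((g (cis (h + k) * z) - g (cis h * z) - g (cis k * z) + g z)
        - (g (cis (h + k) * w) - g (cis h * w) - g (cis k * w) + g w)) \<le> K * h * k * cmod (z - w) powr \<alpha>"
  obtains g1 g2 C where "0 \<le> C"
    "\<And>z. z \<in> cball 0 1 \<Longrightarrow> (g has_field_derivative g1 z) (at z within cball 0 1)"
    "\<And>z. z \<in> cball 0 1 \<Longrightarrow> (g1 has_field_derivative g2 z) (at z within cball 0 1)"
    "\<And>z w. z \<in> cball 0 1 \<Longrightarrow> w \<in> cball 0 1 \<Longrightarrow> cmod (g2 z - g2 w) \<le> C * cmod (z - w) powr \<alpha>"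
proof -
  have gc: "continuous_on (cball 0 1) g" and gh: "g holomorphic_on ball 0 1"
    using g by (auto simp: disc_algebra_def)
  let ?p = "\<lambda>z::complex. (1 - cmod z) powr (\<alpha> - 1)"
  define L where "L = 32 * K / (1 - \<alpha>)"
  have rot: "(\<lambda>z. f (cis t * z)) \<in> disc_algebra" if f: "f \<in> disc_algebra" for f t
  proof -
    have fc: "continuous_on (cball 0 1) f" and fh: "f holomorphic_on ball 0 1"
      using f by (auto simp: disc_algebra_def)
    have "continuous_on (cball 0 1) (\<lambda>z. f (cis t * z))"
      by (rule continuous_on_compose2[OF fc _ image_subsetI[OF cis_mult_cball]]) (intro continuous_intros)
    moreover have "(f \<circ> (\<lambda>z. cis t * z)) holomorphic_on ball 0 1"
      by (rule holomorphic_on_compose_gen[OF _ fh image_subsetI[OF cis_mult_ball]]) (intro holomorphic_intros)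
    ultimately show ?thesis by (simp add: disc_algebra_def o_def)
  qed
  have diff: "(\<lambda>z. f (cis t * z) - f z) \<in> disc_algebra" if f: "f \<in> disc_algebra" for f t
    using rot[OF f, of t] f unfolding disc_algebra_def mem_Collect_eq
    by (intro conjI continuous_on_diff holomorphic_on_diff) blast+
  define D where "D = (\<lambda>h z. g (cis h * z) - g z)"
  have D: "D h \<in> disc_algebra" for h unfolding D_def by (rule diff[OF g])
  have dD: "D h holomorphic_on ball 0 1" for h using D by (simp add: disc_algebra_def)
  have step1: "cmod (deriv (\<lambda>z. D h (cis k * z) - D h z) z) \<le> L * ?p z * h * k"
    if hk: "0 < h" "h < 1" "0 < k" "k < 1" and z: "z \<in> ball 0 1" for h k z
  proof -
    have eq: "D h (cis k * z) - D h z = g (cis (h + k) * z) - g (cis h * z) - g (cis k * z) + g z" for z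
      by (simp add: D_def cis_mult[symmetric] mult.assoc)
    have "cmod (deriv (\<lambda>z. D h (cis k * z) - D h z) z) \<le> 32 * (K * h * k) / (1 - \<alpha>) * (1 - cmod z) powr (\<alpha> - 1)"
    proof (rule disc_algebra_deriv_bound[OF \<alpha> diff[OF D] _ _ z])
      fix z w :: complex assume zw: "z \<in> sphere 0 1 - {1}" "w \<in> sphere 0 1 - {1}"
      have "\<bar>Re (D h (cis k * z) - D h z) - Re (D h (cis k * w) - D h w)\<bar>
         \<le> cmod ((D h (cis k * z) - D h z) - (D h (cis k * w) - D h w))"
        using abs_Re_le_cmod[of "(D h (cis k * z) - D h z) - (D h (cis k * w) - D h w)"] by simp
      also have "\<dots> \<le> K * h * k * cmod (z - w) powr \<alpha>"
        unfolding eq using hk zw by (intro bnd) auto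
      finally show "\<bar>Re (D h (cis k * z) - D h z) - Re (D h (cis k * w) - D h w)\<bar> \<le> K * h * k * cmod (z - w) powr \<alpha>" .
    qed (use hk K in auto)
    then show ?thesis by (simp add: L_def field_simps)
  qed
  have step2: "cmod (deriv (\<lambda>z. z * deriv (D h) z) z) \<le> L * ?p z * h"
    if "0 < h" "h < 1" and z: "z \<in> ball 0 1" for h z
    by (rule rotation_difference_limit[OF dD z]) (use step1 that in auto)
  have dg: "deriv g holomorphic_on ball 0 1" by (rule holomorphic_deriv[OF gh]) simp
  define Q where "Q = (\<lambda>z. z * deriv g z)"
  have Q: "Q holomorphic_on ball 0 1" unfolding Q_def by (intro holomorphic_intros dg)
  have dQ: "deriv Q holomorphic_on ball 0 1" by (rule holomorphic_deriv[OF Q]) simp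
  have step3: "cmod (deriv (\<lambda>z. z * deriv Q z) z) \<le> L * ?p z" if z: "z \<in> ball 0 1" for z
  proof (rule rotation_difference_limit[OF Q z])
    fix h :: real assume h: "0 < h" "h < 1"
    have "deriv (\<lambda>z. z * deriv (D h) z) z = deriv (\<lambda>z. Q (cis h * z) - Q z) z"
    proof (rule deriv_cong_ev)
      have "\<forall>\<^sub>F w in nhds z. w \<in> ball 0 1" using z by (intro eventually_nhds_in_open) auto
      then show "\<forall>\<^sub>F w in nhds z. w * deriv (D h) w = Q (cis h * w) - Q w"
      proof eventually_elim
        case (elim w)
        have "deriv (D h) w = cis h * deriv g (cis h * w) - deriv g w"
          unfolding D_def by (rule deriv_rotation_difference[OF gh elim])
        then show ?case unfolding Q_def by algebra
      qed
    qed (rule refl)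
    then show "cmod (deriv (\<lambda>z. Q (cis h * z) - Q z) z) \<le> L * ?p z * h"
      using step2[OF h z] by simp
  qed
  have L: "0 \<le> L" using K \<alpha> by (simp add: L_def)
  obtain C1 where C1: "0 \<le> C1" "\<And>z. z \<in> ball 0 1 \<Longrightarrow> cmod (deriv (deriv Q) z) \<le> C1 * ?p z"
    by (rule deriv_bound_divide_id[OF \<alpha> dQ L step3]) (assumption | rule that | blast)+
  obtain M where M: "0 \<le> M" "\<And>z. z \<in> ball 0 1 \<Longrightarrow> cmod (deriv Q z) \<le> M"
    by (rule hardy_littlewood_bounded[OF \<alpha> dQ C1]) (assumption | rule that | blast)+
  have step4: "cmod (deriv (\<lambda>z. z * deriv g z) z) \<le> M * ?p z" if "z \<in> ball 0 1" for z
    using M(2)[OF that] mult_left_mono[OF powr_ge_one_disc[OF that \<alpha>(2)] M(1)] by (simp add: Q_def)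
  obtain C2 where C2: "0 \<le> C2" "\<And>z. z \<in> ball 0 1 \<Longrightarrow> cmod (deriv (deriv g) z) \<le> C2 * ?p z"
    by (rule deriv_bound_divide_id[OF \<alpha> dg M(1) step4]) (assumption | rule that | blast)+
  have ddg: "deriv (deriv g) holomorphic_on ball 0 1" by (rule holomorphic_deriv[OF dg]) simp
  have step5: "cmod (deriv (\<lambda>z. z * deriv (deriv g) z) z) \<le> (C1 + C2) * ?p z" if z: "z \<in> ball 0 1" for z
  proof -
    have "deriv (\<lambda>z. z * deriv (deriv g) z) z = deriv (\<lambda>z. deriv Q z - deriv g z) z"
    proof (rule deriv_cong_ev)
      have "\<forall>\<^sub>F w in nhds z. w \<in> ball 0 1" using z by (intro eventually_nhds_in_open) auto
      then show "\<forall>\<^sub>F w in nhds z. w * deriv (deriv g) w = deriv Q w - deriv g w"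
      proof eventually_elim
        case (elim w)
        have "deriv Q w = deriv g w + w * deriv (deriv g) w"
          unfolding Q_def using holomorphic_derivI[OF dg _ elim]
          by (intro DERIV_imp_deriv) (auto intro!: derivative_eq_intros)
        then show ?case by simp
      qed
    qed simp
    also have "\<dots> = deriv (deriv Q) z - deriv (deriv g) z"
      using holomorphic_derivI[OF dg _ z] holomorphic_derivI[OF dQ _ z]
      by (intro DERIV_imp_deriv) (auto intro!: derivative_eq_intros)
    finally have eq: "deriv (\<lambda>z. z * deriv (deriv g) z) z = deriv (deriv Q) z - deriv (deriv g) z" .
    show ?thesis
      unfolding eq distrib_right
      using C1(2)[OF z] C2(2)[OF z] norm_triangle_ineq4[of "deriv (deriv Q) z" "deriv (deriv g) z"]
      by linarith
  qed
  have C12: "0 \<le> C1 + C2" using C1(1) C2(1) by simp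
  obtain C3 where C3: "0 \<le> C3" "\<And>z. z \<in> ball 0 1 \<Longrightarrow> cmod (deriv (deriv (deriv g)) z) \<le> C3 * ?p z"
    by (rule deriv_bound_divide_id[OF \<alpha> ddg C12 step5]) (assumption | rule that | blast)+
  obtain g1 where g1: "g1 \<in> disc_algebra" "\<And>z. z \<in> ball 0 1 \<Longrightarrow> g1 z = deriv g z"
    by (rule holder_extension[OF \<alpha>(1) dg hardy_littlewood[OF \<alpha> dg C2]]) (assumption | rule that | blast)+
  obtain g2 where g2: "g2 \<in> disc_algebra" "\<And>z. z \<in> ball 0 1 \<Longrightarrow> g2 z = deriv (deriv g) z"
    by (rule holder_extension[OF \<alpha>(1) ddg hardy_littlewood[OF \<alpha> ddg C3]]) (assumption | rule that | blast)+
  have dcong: "deriv u z = deriv v z" if "\<And>z. z \<in> ball 0 1 \<Longrightarrow> u z = v z" "z \<in> ball 0 1" for u v :: "complex \<Rightarrow> complex" and z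
  proof (rule deriv_cong_ev)
    have "\<forall>\<^sub>F w in nhds z. w \<in> ball 0 1" using that by (intro eventually_nhds_in_open) auto
    then show "\<forall>\<^sub>F w in nhds z. u w = v w" by eventually_elim (rule that)
  qed simp
  show thesis
  proof (rule that[of "C3 * (2 / \<alpha> + 1)" g1 g2])
    show "0 \<le> C3 * (2 / \<alpha> + 1)" using C3(1) \<alpha> by simp
    show "(g has_field_derivative g1 z) (at z within cball 0 1)" if "z \<in> cball 0 1" for z
      using g1 by (intro disc_algebra_boundary_derivative[OF g g1(1)] that) simp
    show "(g1 has_field_derivative g2 z) (at z within cball 0 1)" if "z \<in> cball 0 1" for z
      using dcong[OF g1(2)] g2(2) by (intro disc_algebra_boundary_derivative[OF g1(1) g2(1)] that) simp
    show "cmod (g2 z - g2 w) \<le> C3 * (2 / \<alpha> + 1) * cmod (z - w) powr \<alpha>"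
      if "z \<in> cball 0 1" "w \<in> cball 0 1" for z w
    proof (rule hardy_littlewood_aux[OF \<alpha> g2(1) C3(1) _ that])
      fix z assume "z \<in> ball (0::complex) 1"
      then show "cmod (deriv g2 z) \<le> C3 * (1 - cmod z) powr (\<alpha> - 1)"
        using C3(2)[of z] dcong[OF g2(2)] by (simp add:)
    qed
  qed
qed

section \<open>Hoelder bounds and the linear boundary value problem\<close>

text \<open>One constant bounds both the supremum and the Hoelder quotient, which keeps the arithmetic of
  constants short. The set \<open>\<Gamma>\<close> will be the circle or the circle without the point 1.\<close>

definition holder_bound :: "real \<Rightarrow> complex set \<Rightarrow> real \<Rightarrow> (complex \<Rightarrow> 'b::real_normed_vector) \<Rightarrow> bool" where
  "holder_bound \<alpha> \<Gamma> C u \<longleftrightarrow> (\<forall>z\<in>\<Gamma>. norm (u z) \<le> C) \<and>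
     (\<forall>z\<in>\<Gamma>. \<forall>w\<in>\<Gamma>. norm (u z - u w) \<le> C * cmod (z - w) powr \<alpha>)"

lemma holder_boundI:
  assumes "\<And>z. z \<in> \<Gamma> \<Longrightarrow> norm (u z) \<le> C"
    and "\<And>z w. z \<in> \<Gamma> \<Longrightarrow> w \<in> \<Gamma> \<Longrightarrow> norm (u z - u w) \<le> C * cmod (z - w) powr \<alpha>"
  shows "holder_bound \<alpha> \<Gamma> C u"
  using assms by (auto simp: holder_bound_def)

lemma holder_boundD:
  assumes "holder_bound \<alpha> \<Gamma> C u" "z \<in> \<Gamma>"
  shows "norm (u z) \<le> C" "w \<in> \<Gamma> \<Longrightarrow> norm (u z - u w) \<le> C * cmod (z - w) powr \<alpha>"
  using assms by (auto simp: holder_bound_def)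

lemma holder_bound_mono:
  assumes "holder_bound \<alpha> \<Gamma> C u" "C \<le> D"
  shows "holder_bound \<alpha> \<Gamma> D u"
proof (rule holder_boundI)
  fix z w assume zw: "z \<in> \<Gamma>" "w \<in> \<Gamma>"
  show "norm (u z - u w) \<le> D * cmod (z - w) powr \<alpha>"
    using holder_boundD(2)[OF assms(1) zw] mult_right_mono[OF assms(2), of "cmod (z - w) powr \<alpha>"] by simp
qed (use holder_boundD(1)[OF assms(1)] assms(2) in force)

lemma holder_bound_subset:
  "holder_bound \<alpha> \<Gamma> C u \<Longrightarrow> \<Gamma>' \<subseteq> \<Gamma> \<Longrightarrow> holder_bound \<alpha> \<Gamma>' C u"
  unfolding holder_bound_def by blast

lemma holder_bound_cong:
  assumes "holder_bound \<alpha> \<Gamma> C u" "\<And>z. z \<in> \<Gamma> \<Longrightarrow> v z = u z"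
  shows "holder_bound \<alpha> \<Gamma> C v"
  using assms by (simp add: holder_bound_def)

lemma holder_bound_const:
  "norm c \<le> C \<Longrightarrow> holder_bound \<alpha> \<Gamma> C (\<lambda>_. c)"
  using order_trans[OF norm_ge_zero, of c C] by (intro holder_boundI) auto

lemma holder_bound_lipschitz_image:
  assumes "holder_bound \<alpha> \<Gamma> C u" and "\<And>x. norm (f x) \<le> norm x" and "\<And>x y. norm (f x - f y) \<le> norm (x - y)"
  shows "holder_bound \<alpha> \<Gamma> C (\<lambda>z. f (u z))"
  by (rule holder_boundI) (blast intro: order_trans[OF assms(2)] order_trans[OF assms(3)] holder_boundD[OF assms(1)])+

lemma holder_bound_cnj: "holder_bound \<alpha> \<Gamma> C u \<Longrightarrow> holder_bound \<alpha> \<Gamma> C (\<lambda>z. cnj (u z))"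
  by (erule holder_bound_lipschitz_image) (auto simp flip: complex_cnj_diff)

lemma holder_bound_Re: "holder_bound \<alpha> \<Gamma> C u \<Longrightarrow> holder_bound \<alpha> \<Gamma> C (\<lambda>z. Re (u z))"
  by (erule holder_bound_lipschitz_image) (auto simp: abs_Re_le_cmod simp flip: minus_complex.simps)

lemma holder_bound_Im: "holder_bound \<alpha> \<Gamma> C u \<Longrightarrow> holder_bound \<alpha> \<Gamma> C (\<lambda>z. Im (u z))"
  by (erule holder_bound_lipschitz_image) (auto simp: abs_Im_le_cmod simp flip: minus_complex.simps)

lemma holder_bound_uminus: "holder_bound \<alpha> \<Gamma> C u \<Longrightarrow> holder_bound \<alpha> \<Gamma> C (\<lambda>z. - u z)"
  by (erule holder_bound_lipschitz_image) (auto simp: norm_minus_commute)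

lemma holder_bound_component:
  "holder_bound \<alpha> \<Gamma> C u \<Longrightarrow> holder_bound \<alpha> \<Gamma> C (\<lambda>z. u z $ i)"
  by (erule holder_bound_lipschitz_image) (auto simp: component_le_norm_cart Finite_Cartesian_Product.norm_nth_le simp flip: vector_minus_component)

lemma holder_bound_add:
  assumes "holder_bound \<alpha> \<Gamma> C u" "holder_bound \<alpha> \<Gamma> D v"
  shows "holder_bound \<alpha> \<Gamma> (C + D) (\<lambda>z. u z + v z)"
proof (rule holder_boundI)
  fix z assume "z \<in> \<Gamma>"
  then show "norm (u z + v z) \<le> C + D"
    using assms by (meson holder_boundD(1) norm_triangle_mono)
next
  fix z w assume "z \<in> \<Gamma>" "w \<in> \<Gamma>"
  then have "norm ((u z - u w) + (v z - v w)) \<le> C * cmod (z - w) powr \<alpha> + D * cmod (z - w) powr \<alpha>"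
    using assms by (meson holder_boundD(2) norm_triangle_mono)
  then show "norm (u z + v z - (u w + v w)) \<le> (C + D) * cmod (z - w) powr \<alpha>"
    by (simp add: algebra_simps)
qed

lemma holder_bound_diff:
  assumes "holder_bound \<alpha> \<Gamma> C u" "holder_bound \<alpha> \<Gamma> D v"
  shows "holder_bound \<alpha> \<Gamma> (C + D) (\<lambda>z. u z - v z)"
  using holder_bound_add[OF assms(1) holder_bound_uminus[OF assms(2)]] by simp

lemma holder_bound_sum:
  fixes u :: "'i::finite \<Rightarrow> complex \<Rightarrow> 'b::real_normed_vector"
  assumes "\<And>i. holder_bound \<alpha> \<Gamma> C (u i)"
  shows "holder_bound \<alpha> \<Gamma> (real CARD('i) * C) (\<lambda>z. \<Sum>i\<in>UNIV. u i z)"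
proof -
  have "holder_bound \<alpha> \<Gamma> (real (card I) * C) (\<lambda>z. \<Sum>i\<in>I. u i z)" if "finite I" for I
    using that
  proof (induction I)
    case empty then show ?case by (simp add: holder_bound_const)
  next
    case (insert i I)
    then show ?case
      using holder_bound_add[OF assms[of i] insert.IH] by (simp add: algebra_simps)
  qed
  then show ?thesis by simp
qed

lemma holder_bound_vec:
  fixes u :: "complex \<Rightarrow> 'b::real_normed_vector ^ 'i"
  assumes "\<And>i. holder_bound \<alpha> \<Gamma> C (\<lambda>z. u z $ i)"
  shows "holder_bound \<alpha> \<Gamma> (real CARD('i) * C) u"
proof -
  have *: "norm x \<le> real CARD('i) * B" if "\<And>i. norm (x $ i) \<le> B" for x :: "'b ^ 'i" and B
  proof -
    have "norm x \<le> (\<Sum>i\<in>UNIV. norm (x $ i))"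
      unfolding norm_vec_def by (rule L2_set_le_sum) simp
    also have "\<dots> \<le> (\<Sum>i\<in>(UNIV::'i set). B)" by (intro sum_mono that)
    finally show ?thesis by simp
  qed
  show ?thesis
  proof (rule holder_boundI)
    fix z w assume "z \<in> \<Gamma>" "w \<in> \<Gamma>"
    then show "norm (u z - u w) \<le> real CARD('i) * C * cmod (z - w) powr \<alpha>"
      using *[of "u z - u w" "C * cmod (z - w) powr \<alpha>"] holder_boundD(2)[OF assms] by simp
  qed (use * holder_boundD(1)[OF assms] in blast)
qed

lemma holder_bound_mult:
  fixes u v :: "complex \<Rightarrow> 'b::real_normed_algebra"
  assumes u: "holder_bound \<alpha> \<Gamma> C u" and v: "holder_bound \<alpha> \<Gamma> D v"
  shows "holder_bound \<alpha> \<Gamma> (2 * C * D) (\<lambda>z. u z * v z)"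
proof (rule holder_boundI)
  fix z assume z: "z \<in> \<Gamma>"
  have C: "0 \<le> C" and D: "0 \<le> D"
    using holder_boundD(1)[OF u z] holder_boundD(1)[OF v z] norm_ge_zero[of "u z"] norm_ge_zero[of "v z"] by linarith+
  have "norm (u z * v z) \<le> C * D"
    using holder_boundD(1)[OF u z] holder_boundD(1)[OF v z] C
    by (intro order_trans[OF norm_mult_ineq] mult_mono) auto
  also have "\<dots> \<le> 2 * C * D" using mult_nonneg_nonneg[OF C D] by linarith
  finally show "norm (u z * v z) \<le> 2 * C * D" .
  fix w assume w: "w \<in> \<Gamma>"
  have "u z * v z - u w * v w = (u z - u w) * v z + u w * (v z - v w)" by (simp add: algebra_simps)
  also have "norm \<dots> \<le> C * cmod (z - w) powr \<alpha> * D + C * (D * cmod (z - w) powr \<alpha>)"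
    using holder_boundD[OF u z] holder_boundD[OF v z] holder_boundD(1)[OF u w] C D w
    by (intro norm_triangle_mono order_trans[OF norm_mult_ineq] mult_mono) auto
  finally show "norm (u z * v z - u w * v w) \<le> 2 * C * D * cmod (z - w) powr \<alpha>"
    by (simp add: algebra_simps)
qed

lemma holder_bound_cmult:
  fixes u :: "complex \<Rightarrow> 'b::real_normed_algebra"
  assumes u: "holder_bound \<alpha> \<Gamma> C u" and k: "norm k \<le> M"
  shows "holder_bound \<alpha> \<Gamma> (M * C) (\<lambda>z. k * u z)"
proof (rule holder_boundI)
  have M: "0 \<le> M" using k norm_ge_zero order_trans by blast
  fix z assume z: "z \<in> \<Gamma>"
  show "norm (k * u z) \<le> M * C"
    using holder_boundD(1)[OF u z] k M by (intro order_trans[OF norm_mult_ineq] mult_mono) auto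
  fix w assume w: "w \<in> \<Gamma>"
  have "norm (k * (u z - u w)) \<le> M * (C * cmod (z - w) powr \<alpha>)"
    using holder_boundD(2)[OF u z w] k M by (intro order_trans[OF norm_mult_ineq] mult_mono) auto
  then show "norm (k * u z - k * u w) \<le> M * C * cmod (z - w) powr \<alpha>" by (simp add: algebra_simps)
qed

lemma holder_bound_scaleR:
  assumes u: "holder_bound \<alpha> \<Gamma> C u"
  shows "holder_bound \<alpha> \<Gamma> (\<bar>k\<bar> * C) (\<lambda>z. k *\<^sub>R u z)"
proof (rule holder_boundI)
  fix z assume z: "z \<in> \<Gamma>"
  show "norm (k *\<^sub>R u z) \<le> \<bar>k\<bar> * C" using holder_boundD(1)[OF u z] by (simp add: mult_left_mono)
  fix w assume w: "w \<in> \<Gamma>"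
  show "norm (k *\<^sub>R u z - k *\<^sub>R u w) \<le> \<bar>k\<bar> * C * cmod (z - w) powr \<alpha>"
    using mult_left_mono[OF holder_boundD(2)[OF u z w], of "\<bar>k\<bar>"] by (simp flip: scaleR_diff_right)
qed

lemma holder_bound_rotate:
  assumes "holder_bound \<alpha> (sphere 0 1) C u"
  shows "holder_bound \<alpha> (sphere 0 1) C (\<lambda>z. u (cis t * z))"
proof (rule holder_boundI)
  fix z w assume zw: "z \<in> sphere (0::complex) 1" "w \<in> sphere (0::complex) 1"
  have "norm (u (cis t * z) - u (cis t * w)) \<le> C * cmod (cis t * z - cis t * w) powr \<alpha>"
    by (rule holder_boundD(2)[OF assms cis_mult_sphere[OF zw(1)] cis_mult_sphere[OF zw(2)]])
  also have "cmod (cis t * z - cis t * w) = cmod (z - w)"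
    using norm_mult[of "cis t" "z - w"] by (simp add: right_diff_distrib)
  finally show "norm (u (cis t * z) - u (cis t * w)) \<le> C * cmod (z - w) powr \<alpha>" .
qed (use holder_boundD(1)[OF assms cis_mult_sphere] in blast)

lemma holder_bound_closed:
  assumes "\<And>n. holder_bound \<alpha> \<Gamma> (S n) u" "S \<longlonglongrightarrow> s"
  shows "holder_bound \<alpha> \<Gamma> s u"
proof (rule holder_boundI)
  fix z assume z: "z \<in> \<Gamma>"
  show "norm (u z) \<le> s"
    by (rule LIMSEQ_le_const[OF assms(2)]) (use holder_boundD(1)[OF assms(1) z] in blast)
  fix w assume w: "w \<in> \<Gamma>"
  show "norm (u z - u w) \<le> s * cmod (z - w) powr \<alpha>"
    by (rule LIMSEQ_le_const[OF tendsto_mult_right[OF assms(2)]]) (use holder_boundD(2)[OF assms(1) z w] in blast)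
qed

text \<open>The absorption argument: if a bound S always improves to \<open>\<theta> * S + E\<close>, iteration converges
  to the fixed point. The limit remembers nothing of the bound S0 from which the iteration starts.\<close>

lemma absorb_small_multiple:
  fixes P :: "real \<Rightarrow> bool"
  assumes closed: "\<And>S s. (\<And>n. P (S n)) \<Longrightarrow> S \<longlonglongrightarrow> s \<Longrightarrow> P s"
    and start: "P S0" and S0: "0 \<le> S0"
    and step: "\<And>S. 0 \<le> S \<Longrightarrow> P S \<Longrightarrow> P (\<theta> * S + E)"
    and \<theta>: "0 \<le> \<theta>" "\<theta> < 1" and E: "0 \<le> E"
  shows "P (E / (1 - \<theta>))"
proof (rule closed)
  define F where "F = E / (1 - \<theta>)"
  have "F * (1 - \<theta>) = E" using \<theta> by (simp add: F_def)
  then have F: "E = F - \<theta> * F" by (simp add: algebra_simps)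
  define S where "S = (\<lambda>n::nat. \<theta> ^ n * (S0 - F) + F)"
  have S: "S 0 = S0" "S (Suc n) = \<theta> * S n + E" for n
    by (simp_all add: S_def F algebra_simps)
  have "0 \<le> S n \<and> P (S n)" for n
    by (induction n) (use S S0 start step \<theta> E in auto)
  then show "P (S n)" for n by simp
  have "S \<longlonglongrightarrow> 0 * (S0 - F) + F"
    unfolding S_def using \<theta> by (intro tendsto_intros LIMSEQ_power_zero) auto
  then show "S \<longlonglongrightarrow> E / (1 - \<theta>)" by (simp add: F_def)
qed

lemma privalov_const_nonneg: "0 < \<alpha> \<Longrightarrow> \<alpha> < 1 \<Longrightarrow> 0 \<le> privalov_const \<alpha>"
  by (simp add: privalov_const_def)

lemma disc_algebra_linear:
  assumes "\<And>i. i \<in> I \<Longrightarrow> f i \<in> disc_algebra"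
  shows "(\<lambda>z. \<Sum>i\<in>I. k i * f i z) \<in> disc_algebra"
  using assms unfolding disc_algebra_def by (auto intro!: continuous_intros holomorphic_intros)

lemma holder_from_real_part:
  assumes \<alpha>: "0 < \<alpha>" "\<alpha> < 1" and f: "f \<in> disc_algebra" and \<Gamma>: "sphere 0 1 - {1} \<subseteq> \<Gamma>" and B: "0 \<le> B"
    and Re: "holder_bound \<alpha> \<Gamma> B (\<lambda>z. Re (f z))"
    and ab: "a \<in> cball 0 1" "b \<in> cball 0 1"
  shows "cmod (f a - f b) \<le> privalov_const \<alpha> * B * cmod (a - b) powr \<alpha>"
proof (rule privalov[OF \<alpha> f B _ ab])
  fix z w assume "z \<in> sphere (0::complex) 1 - {1}" "w \<in> sphere (0::complex) 1 - {1}"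
  then have "z \<in> \<Gamma>" "w \<in> \<Gamma>" using \<Gamma> by blast+
  then show "\<bar>Re (f z) - Re (f w)\<bar> \<le> B * cmod (z - w) powr \<alpha>"
    using holder_boundD(2)[OF Re, of z w] by simp
qed

lemma holder_from_imaginary_part:
  assumes \<alpha>: "0 < \<alpha>" "\<alpha> < 1" and f: "f \<in> disc_algebra" and \<Gamma>: "sphere 0 1 - {1} \<subseteq> \<Gamma>" and B: "0 \<le> B"
    and Im: "holder_bound \<alpha> \<Gamma> B (\<lambda>z. Im (f z))"
    and ab: "a \<in> cball 0 1" "b \<in> cball 0 1"
  shows "cmod (f a - f b) \<le> privalov_const \<alpha> * B * cmod (a - b) powr \<alpha>"
proof -
  have "(\<lambda>z. - \<i> * f z) \<in> disc_algebra"
    using f by (auto simp: disc_algebra_def intro!: continuous_intros holomorphic_intros)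
  then have "cmod ((- \<i> * f a) - (- \<i> * f b)) \<le> privalov_const \<alpha> * B * cmod (a - b) powr \<alpha>"
    using Im by (intro holder_from_real_part[OF \<alpha> _ \<Gamma> B _ ab]) auto
  moreover have "(- \<i> * f a) - (- \<i> * f b) = - \<i> * (f a - f b)" by (simp add: algebra_simps)
  ultimately show ?thesis by (simp add: norm_mult)
qed

lemma holder_bound_from_increments:
  assumes \<alpha>: "0 < \<alpha>" "\<alpha> < 1" and \<Gamma>: "\<Gamma> \<subseteq> sphere 0 1" and C: "0 \<le> C"
    and inc: "\<And>a b. a \<in> cball 0 1 \<Longrightarrow> b \<in> cball 0 1 \<Longrightarrow> cmod (f a - f b) \<le> C * cmod (a - b) powr \<alpha>"
    and p: "p \<in> cball 0 1" "cmod (f p) \<le> J"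
  shows "holder_bound \<alpha> \<Gamma> (J + 2 * C) f"
proof (rule holder_boundI)
  have J: "0 \<le> J" using p(2) norm_ge_zero order_trans by blast
  fix z assume "z \<in> \<Gamma>"
  then have z: "z \<in> cball 0 1" using \<Gamma> by auto
  have "cmod (z - p) \<le> 2" using z p(1) norm_triangle_ineq4[of z p] by simp
  then have "cmod (z - p) powr \<alpha> \<le> 2 powr 1"
    using \<alpha> powr_mono2[of \<alpha> "cmod (z - p)" 2] powr_mono[of \<alpha> 1 "2::real"] by simp
  then have "C * cmod (z - p) powr \<alpha> \<le> C * 2" using C by (intro mult_left_mono) auto
  then have "cmod (f z - f p) \<le> 2 * C" using inc[OF z p(1)] by simp
  then show "norm (f z) \<le> J + 2 * C" using norm_triangle_ineq2[of "f z" "f p"] p(2) by simp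
  fix w assume "w \<in> \<Gamma>"
  then have w: "w \<in> cball 0 1" using \<Gamma> by auto
  have "C * cmod (z - w) powr \<alpha> \<le> (J + 2 * C) * cmod (z - w) powr \<alpha>"
    using C J by (intro mult_right_mono) auto
  then show "norm (f z - f w) \<le> (J + 2 * C) * cmod (z - w) powr \<alpha>" using inc[OF z w] by simp
qed

text \<open>The linearization at the quadric with multiplier c. The unknowns x, a are increments of z, w and y, b those
  of the covector components, while ep and eq are given functions, not holomorphic, that arise from rotating \<open>cnj \<zeta>\<close>.
  The system is solved in the order b, \<open>\<gamma>\<close>, x, y, a. Invertibility of the combined matrix enters only for x, and each
  constant K1, ..., K7 below belongs to one of these steps. The bounds at single points
  fix the additive constants that Privalov's theorem leaves free.\<close>

lemma linear_estimate:
  fixes A :: "'d::finite \<Rightarrow> complex ^ 'n::finite ^ 'n" and c :: "real ^ 'd"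
  assumes \<alpha>: "0 < \<alpha>" "\<alpha> < 1"
    and herm: "\<And>j. hermitian (A j)"
    and inv: "invertible (\<Sum>j\<in>UNIV. c $ j *\<^sub>R A j)"
    and L: "0 \<le> L"
  obtains K where "0 \<le> K" and
    "\<And>\<Gamma> T J z1 z2 x y a b \<gamma> ep eq.
      \<lbrakk>sphere 0 1 - {1} \<subseteq> \<Gamma>; \<Gamma> \<subseteq> sphere 0 1; 0 \<le> T; 0 \<le> J;
       \<And>i. holder_bound \<alpha> \<Gamma> L (z1 i); \<And>i. holder_bound \<alpha> \<Gamma> L (z2 i);
       \<And>i. x i \<in> disc_algebra; \<And>i. y i \<in> disc_algebra;
       \<And>j. a j \<in> disc_algebra; \<And>j. b j \<in> disc_algebra;
       \<And>j. holder_bound \<alpha> \<Gamma> T (\<lambda>\<zeta>. b j \<zeta> + eq j \<zeta> - complex_of_real (\<gamma> j \<zeta>) / 2);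
       \<And>i. holder_bound \<alpha> \<Gamma> T (\<lambda>\<zeta>. y i \<zeta> + ep i \<zeta>
          + (\<Sum>k\<in>UNIV. of_real (c $ k) * (\<Sum>l\<in>UNIV. cnj (x l \<zeta>) * A k $ l $ i))
          + (\<Sum>k\<in>UNIV. of_real (\<gamma> k \<zeta>) * (\<Sum>l\<in>UNIV. cnj (z1 l \<zeta>) * A k $ l $ i)));
       \<And>j. holder_bound \<alpha> \<Gamma> T (\<lambda>\<zeta>. Re (a j \<zeta>)
          - Re (\<Sum>l\<in>UNIV. \<Sum>m\<in>UNIV. cnj (x l \<zeta>) * A j $ l $ m * z1 m \<zeta> + cnj (z2 l \<zeta>) * A j $ l $ m * x m \<zeta>));
       \<And>i. holder_bound \<alpha> \<Gamma> J (ep i); \<And>j. holder_bound \<alpha> \<Gamma> J (eq j);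
       \<And>j. cmod (a j 0) \<le> J; \<And>i. cmod (x i 0) \<le> J; \<And>j. \<exists>p\<in>cball 0 1. cmod (b j p) \<le> J\<rbrakk>
     \<Longrightarrow> (\<forall>i. holder_bound \<alpha> \<Gamma> (K * (T + J)) (x i)) \<and> (\<forall>i. holder_bound \<alpha> \<Gamma> (K * (T + J)) (y i))
       \<and> (\<forall>j. holder_bound \<alpha> \<Gamma> (K * (T + J)) (a j)) \<and> (\<forall>j. holder_bound \<alpha> \<Gamma> (K * (T + J)) (b j))
       \<and> (\<forall>j. holder_bound \<alpha> \<Gamma> (K * (T + J)) (\<lambda>\<zeta>. complex_of_real (\<gamma> j \<zeta>)))"
proof -
  define P where "P = privalov_const \<alpha>"
  have P: "0 \<le> P" using privalov_const_nonneg[OF \<alpha>] by (simp add: P_def)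
  define Ac where "Ac = (\<Sum>j\<in>UNIV. c $ j *\<^sub>R A j)"
  obtain Bi where Bi: "Bi ** Ac = mat 1" using inv unfolding invertible_def Ac_def by blast
  define M where "M = (\<Sum>j\<in>UNIV. \<Sum>l\<in>UNIV. \<Sum>m\<in>UNIV. cmod (A j $ l $ m)) + (\<Sum>k\<in>UNIV. \<bar>c $ k\<bar>)"
  have Mc: "\<bar>c $ k\<bar> \<le> M" for k
  proof -
    have "\<bar>c $ k\<bar> \<le> (\<Sum>k\<in>UNIV. \<bar>c $ k\<bar>)" by (rule member_le_sum) auto
    then show ?thesis unfolding M_def by (simp add: sum_nonneg add_increasing)
  qed
  have MA: "cmod (A j $ l $ m) \<le> M" for j l m
  proof -
    have "cmod (A j $ l $ m) \<le> (\<Sum>m\<in>UNIV. cmod (A j $ l $ m))" by (rule member_le_sum) auto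
    also have "\<dots> \<le> (\<Sum>l\<in>UNIV. \<Sum>m\<in>UNIV. cmod (A j $ l $ m))"
      by (rule member_le_sum[where f = "\<lambda>l. \<Sum>m\<in>UNIV. cmod (A j $ l $ m)"]) (auto intro: sum_nonneg)
    also have "\<dots> \<le> (\<Sum>j\<in>UNIV. \<Sum>l\<in>UNIV. \<Sum>m\<in>UNIV. cmod (A j $ l $ m))"
      by (rule member_le_sum[where f = "\<lambda>j. \<Sum>l\<in>UNIV. \<Sum>m\<in>UNIV. cmod (A j $ l $ m)"]) (auto intro!: sum_nonneg)
    finally show ?thesis unfolding M_def by (simp add: sum_nonneg add_increasing2)
  qed
  have M: "0 \<le> M" using MA norm_ge_zero order_trans by blast
  define \<beta> where "\<beta> = (\<Sum>l\<in>UNIV. \<Sum>m\<in>UNIV. cmod (Bi $ l $ m))"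
  have \<beta>: "cmod (Bi $ l $ m) \<le> \<beta>" for l m
  proof -
    have "cmod (Bi $ l $ m) \<le> (\<Sum>m\<in>UNIV. cmod (Bi $ l $ m))" by (rule member_le_sum) auto
    also have "\<dots> \<le> \<beta>" unfolding \<beta>_def
      by (rule member_le_sum[where f = "\<lambda>l. \<Sum>m\<in>UNIV. cmod (Bi $ l $ m)"]) (auto intro: sum_nonneg)
    finally show ?thesis .
  qed
  have \<beta>0: "0 \<le> \<beta>" using \<beta> norm_ge_zero order_trans by blast
  let ?n = "real CARD('n)" and ?d = "real CARD('d)"
  define K1 where "K1 = 1 + 2 * P"
  define K2 where "K2 = 2 * K1 + 4"
  define K3 where "K3 = 2 + ?d * (2 * K2 * (?n * (M * L)))"
  define K4 where "K4 = 1 + 2 * (?n * (\<beta> * (P * K3)))"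
  define K5 where "K5 = K3 + ?d * (M * (?n * (M * K4)))"
  define K6 where "K6 = 1 + ?n * (?n * (M * (2 * K4 * L) + M * (2 * L * K4)))"
  define K7 where "K7 = 1 + 2 * (P * K6)"
  have K: "0 \<le> K1" "0 \<le> K2" "0 \<le> K3" "0 \<le> K4" "0 \<le> K5" "0 \<le> K6" "0 \<le> K7"
  proof -
    show "0 \<le> K1" using P by (simp add: K1_def)
    then show "0 \<le> K2" by (simp add: K2_def)
    then show "0 \<le> K3" using M L by (simp add: K3_def)
    then show "0 \<le> K4" using \<beta>0 P by (simp add: K4_def)
    then show "0 \<le> K5" using M \<open>0 \<le> K3\<close> by (simp add: K5_def)
    show "0 \<le> K6" using M L \<open>0 \<le> K4\<close> by (simp add: K6_def)
    then show "0 \<le> K7" using P by (simp add: K7_def)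
  qed
  show thesis
  proof (rule that[of "K1 + K2 + K4 + K5 + K7"])
    show "0 \<le> K1 + K2 + K4 + K5 + K7" using K by simp
    fix \<Gamma> T J z1 z2 and x y :: "'n \<Rightarrow> complex \<Rightarrow> complex" and a b :: "'d \<Rightarrow> complex \<Rightarrow> complex" and \<gamma> ep eq
    assume \<Gamma>: "sphere 0 1 - {1} \<subseteq> \<Gamma>" "\<Gamma> \<subseteq> sphere 0 1" and T: "0 \<le> T" and J: "0 \<le> (J::real)"
      and z1: "\<And>i. holder_bound \<alpha> \<Gamma> L (z1 i)" and z2: "\<And>i. holder_bound \<alpha> \<Gamma> L (z2 i)"
      and x: "\<And>i. x i \<in> disc_algebra" and y: "\<And>i. y i \<in> disc_algebra"
      and a: "\<And>j. a j \<in> disc_algebra" and b: "\<And>j. b j \<in> disc_algebra"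
      and EQ: "\<And>j. holder_bound \<alpha> \<Gamma> T (\<lambda>\<zeta>. b j \<zeta> + eq j \<zeta> - complex_of_real (\<gamma> j \<zeta>) / 2)"
      and EP: "\<And>i. holder_bound \<alpha> \<Gamma> T (\<lambda>\<zeta>. y i \<zeta> + ep i \<zeta>
          + (\<Sum>k\<in>UNIV. of_real (c $ k) * (\<Sum>l\<in>UNIV. cnj (x l \<zeta>) * A k $ l $ i))
          + (\<Sum>k\<in>UNIV. of_real (\<gamma> k \<zeta>) * (\<Sum>l\<in>UNIV. cnj (z1 l \<zeta>) * A k $ l $ i)))"
      and EW: "\<And>j. holder_bound \<alpha> \<Gamma> T (\<lambda>\<zeta>. Re (a j \<zeta>)
          - Re (\<Sum>l\<in>UNIV. \<Sum>m\<in>UNIV. cnj (x l \<zeta>) * A j $ l $ m * z1 m \<zeta> + cnj (z2 l \<zeta>) * A j $ l $ m * x m \<zeta>))"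
      and ep: "\<And>i. holder_bound \<alpha> \<Gamma> J (ep i)" and eq: "\<And>j. holder_bound \<alpha> \<Gamma> J (eq j)"
      and a0: "\<And>j. cmod (a j 0) \<le> J" and x0: "\<And>i. cmod (x i 0) \<le> J"
      and b0: "\<And>j. \<exists>p\<in>cball 0 1. cmod (b j p) \<le> J"
    define S where "S = T + J"
    have S: "0 \<le> S" "T \<le> S" "J \<le> S" using T J by (auto simp: S_def)
    have hb_b: "holder_bound \<alpha> \<Gamma> (K1 * S) (b j)" for j
    proof -
      have "holder_bound \<alpha> \<Gamma> S (\<lambda>\<zeta>. Im (b j \<zeta>))"
        using holder_bound_diff[OF holder_bound_Im[OF EQ] holder_bound_Im[OF eq], of j j] by (simp add: S_def)
      from holder_from_imaginary_part[OF \<alpha> b \<Gamma>(1) S(1) this]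
      have inc: "cmod (b j u - b j v) \<le> (P * S) * cmod (u - v) powr \<alpha>" if "u \<in> cball 0 1" "v \<in> cball 0 1" for u v
        using that by (simp add: P_def)
      obtain p where p: "p \<in> cball 0 1" "cmod (b j p) \<le> J" using b0 by blast
      have "holder_bound \<alpha> \<Gamma> (J + 2 * (P * S)) (b j)"
        using P S by (intro holder_bound_from_increments[OF \<alpha> \<Gamma>(2) _ inc p]) auto
      then show ?thesis
        by (rule holder_bound_mono) (use S in \<open>simp add: K1_def algebra_simps\<close>)
    qed
    have hb_\<gamma>: "holder_bound \<alpha> \<Gamma> (K2 * S) (\<lambda>\<zeta>. complex_of_real (\<gamma> j \<zeta>))" for j
    proof -
      have "holder_bound \<alpha> \<Gamma> (2 * (K1 * S + J + T)) (\<lambda>\<zeta>. 2 * (b j \<zeta> + eq j \<zeta> - (b j \<zeta> + eq j \<zeta> - complex_of_real (\<gamma> j \<zeta>) / 2)))"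
        by (intro holder_bound_cmult holder_bound_diff holder_bound_add hb_b eq EQ) simp
      then have "holder_bound \<alpha> \<Gamma> (2 * (K1 * S + J + T)) (\<lambda>\<zeta>. complex_of_real (\<gamma> j \<zeta>))"
        by (rule holder_bound_cong) (simp add: field_simps)
      then show ?thesis by (rule holder_bound_mono) (use S in \<open>simp add: K2_def algebra_simps\<close>)
    qed
    define X where "X = (\<lambda>i \<zeta>. \<Sum>l\<in>UNIV. Ac $ i $ l * x l \<zeta>)"
    have X: "X i \<in> disc_algebra" for i unfolding X_def by (rule disc_algebra_linear) (rule x)
    have cnjX: "cnj (X i \<zeta>) = (\<Sum>k\<in>UNIV. of_real (c $ k) * (\<Sum>l\<in>UNIV. cnj (x l \<zeta>) * A k $ l $ i))" for i \<zeta>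
    proof -
      have A_cnj: "cnj (A k $ i $ l) = A k $ l $ i" for k l
        using herm[of k] unfolding hermitian_def by (metis complex_cnj_cnj)
      have "cnj (X i \<zeta>) = (\<Sum>l\<in>UNIV. \<Sum>k\<in>UNIV. of_real (c $ k) * (cnj (x l \<zeta>) * A k $ l $ i))"
        by (simp add: X_def Ac_def sum_component scaleR_conv_of_real[symmetric] A_cnj sum_distrib_right sum_distrib_left mult_ac)
      also have "\<dots> = (\<Sum>k\<in>UNIV. \<Sum>l\<in>UNIV. of_real (c $ k) * (cnj (x l \<zeta>) * A k $ l $ i))"
        by (rule sum.swap)
      finally show ?thesis by (simp add: sum_distrib_left)
    qed
    have hb_g: "holder_bound \<alpha> \<Gamma> (K3 * S) (\<lambda>\<zeta>. y i \<zeta> + cnj (X i \<zeta>))" for i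
    proof -
      have "holder_bound \<alpha> \<Gamma> (T + J + ?d * (2 * (K2 * S) * (?n * (M * L))))
        (\<lambda>\<zeta>. (y i \<zeta> + ep i \<zeta>
          + (\<Sum>k\<in>UNIV. of_real (c $ k) * (\<Sum>l\<in>UNIV. cnj (x l \<zeta>) * A k $ l $ i))
          + (\<Sum>k\<in>UNIV. of_real (\<gamma> k \<zeta>) * (\<Sum>l\<in>UNIV. cnj (z1 l \<zeta>) * A k $ l $ i)))
          - ep i \<zeta> - (\<Sum>k\<in>UNIV. of_real (\<gamma> k \<zeta>) * (\<Sum>l\<in>UNIV. A k $ l $ i * cnj (z1 l \<zeta>))))"
        by (intro holder_bound_diff EP ep holder_bound_sum holder_bound_mult hb_\<gamma> holder_bound_cmult holder_bound_cnj z1 MA)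
      then have "holder_bound \<alpha> \<Gamma> (T + J + ?d * (2 * (K2 * S) * (?n * (M * L)))) (\<lambda>\<zeta>. y i \<zeta> + cnj (X i \<zeta>))"
        by (rule holder_bound_cong) (simp add: cnjX mult.commute)
      then show ?thesis
        by (rule holder_bound_mono) (use S T J in \<open>simp add: K3_def S_def algebra_simps\<close>)
    qed
    have inc_X: "cmod (X i u - X i v) \<le> P * (K3 * S) * cmod (u - v) powr \<alpha>"
      if uv: "u \<in> cball 0 1" "v \<in> cball 0 1" for i u v
    proof -
      have K3S: "0 \<le> K3 * S" using K S by simp
      have s: "(\<lambda>\<zeta>. y i \<zeta> + X i \<zeta>) \<in> disc_algebra" "(\<lambda>\<zeta>. y i \<zeta> - X i \<zeta>) \<in> disc_algebra"
        using y[of i] X[of i] by (auto simp: disc_algebra_def intro!: continuous_intros holomorphic_intros)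
      have "cmod ((y i u + X i u) - (y i v + X i v)) \<le> P * (K3 * S) * cmod (u - v) powr \<alpha>"
        using holder_from_real_part[OF \<alpha> s(1) \<Gamma>(1) K3S _ uv] holder_bound_Re[OF hb_g, of i] by (simp add: P_def)
      moreover have "cmod ((y i u - X i u) - (y i v - X i v)) \<le> P * (K3 * S) * cmod (u - v) powr \<alpha>"
        using holder_from_imaginary_part[OF \<alpha> s(2) \<Gamma>(1) K3S _ uv] holder_bound_Im[OF hb_g, of i] by (simp add: P_def)
      moreover have "2 * (X i u - X i v) = ((y i u + X i u) - (y i v + X i v)) - ((y i u - X i u) - (y i v - X i v))"
        by simp
      then have "2 * cmod (X i u - X i v) \<le> cmod ((y i u + X i u) - (y i v + X i v)) + cmod ((y i u - X i u) - (y i v - X i v))"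
        by (metis norm_mult norm_numeral norm_triangle_ineq4)
      ultimately show ?thesis by linarith
    qed
    have xX: "x l \<zeta> = (\<Sum>i\<in>UNIV. Bi $ l $ i * X i \<zeta>)" for l \<zeta>
    proof -
      have "X i \<zeta> = (Ac *v (\<chi> l. x l \<zeta>)) $ i" for i by (simp add: X_def matrix_vector_mult_def)
      then have "(\<chi> i. X i \<zeta>) = Ac *v (\<chi> l. x l \<zeta>)" by (simp add: vec_eq_iff)
      then have "Bi *v (\<chi> i. X i \<zeta>) = (\<chi> l. x l \<zeta>)"
        by (simp add: matrix_vector_mul_assoc Bi)
      then have "(Bi *v (\<chi> i. X i \<zeta>)) $ l = x l \<zeta>" by simp
      then show ?thesis by (simp add: matrix_vector_mult_def)
    qed
    have hb_x: "holder_bound \<alpha> \<Gamma> (K4 * S) (x l)" for l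
    proof -
      have inc: "cmod (x l u - x l v) \<le> (?n * (\<beta> * (P * (K3 * S)))) * cmod (u - v) powr \<alpha>"
        if uv: "u \<in> cball 0 1" "v \<in> cball 0 1" for u v
      proof -
        have "x l u - x l v = (\<Sum>i\<in>UNIV. Bi $ l $ i * (X i u - X i v))"
          by (simp add: xX right_diff_distrib sum_subtractf)
        also have "cmod \<dots> \<le> (\<Sum>i\<in>(UNIV::'n set). \<beta> * (P * (K3 * S) * cmod (u - v) powr \<alpha>))"
          by (intro sum_norm_le order_trans[OF norm_mult_ineq] mult_mono \<beta> inc_X[OF uv] \<beta>0 norm_ge_zero)
        finally show ?thesis by (simp add: algebra_simps)
      qed
      have "holder_bound \<alpha> \<Gamma> (J + 2 * (?n * (\<beta> * (P * (K3 * S))))) (x l)"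
        using \<beta>0 P K S x0 by (intro holder_bound_from_increments[OF \<alpha> \<Gamma>(2) _ inc, of 0]) auto
      then show ?thesis
        by (rule holder_bound_mono) (use S in \<open>simp add: K4_def algebra_simps\<close>)
    qed
    have hb_y: "holder_bound \<alpha> \<Gamma> (K5 * S) (y i)" for i
    proof -
      have "holder_bound \<alpha> \<Gamma> (K3 * S + ?d * (M * (?n * (M * (K4 * S)))))
         (\<lambda>\<zeta>. y i \<zeta> + cnj (X i \<zeta>) - (\<Sum>k\<in>UNIV. of_real (c $ k) * (\<Sum>l\<in>UNIV. A k $ l $ i * cnj (x l \<zeta>))))"
        by (intro holder_bound_diff hb_g holder_bound_sum holder_bound_cmult holder_bound_cnj hb_x MA)
           (use Mc in simp)
      then have "holder_bound \<alpha> \<Gamma> (K3 * S + ?d * (M * (?n * (M * (K4 * S))))) (y i)"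
        by (rule holder_bound_cong) (simp add: cnjX mult.commute)
      then show ?thesis
        by (rule holder_bound_mono) (use S in \<open>simp add: K5_def algebra_simps\<close>)
    qed
    have hb_Re_a: "holder_bound \<alpha> \<Gamma> (K6 * S) (\<lambda>\<zeta>. Re (a j \<zeta>))" for j
    proof -
      have "holder_bound \<alpha> \<Gamma> (T + ?n * (?n * (M * (2 * (K4 * S) * L) + M * (2 * L * (K4 * S)))))
         (\<lambda>\<zeta>. Re (a j \<zeta>)
          - Re (\<Sum>l\<in>UNIV. \<Sum>m\<in>UNIV. cnj (x l \<zeta>) * A j $ l $ m * z1 m \<zeta> + cnj (z2 l \<zeta>) * A j $ l $ m * x m \<zeta>)
          + Re (\<Sum>l\<in>UNIV. \<Sum>m\<in>UNIV. A j $ l $ m * (cnj (x l \<zeta>) * z1 m \<zeta>) + A j $ l $ m * (cnj (z2 l \<zeta>) * x m \<zeta>)))"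
        by (intro holder_bound_add EW holder_bound_Re holder_bound_sum holder_bound_cmult holder_bound_mult holder_bound_cnj hb_x z1 z2 MA)
      then have "holder_bound \<alpha> \<Gamma> (T + ?n * (?n * (M * (2 * (K4 * S) * L) + M * (2 * L * (K4 * S))))) (\<lambda>\<zeta>. Re (a j \<zeta>))"
        by (rule holder_bound_cong) (simp add: mult_ac)
      then show ?thesis
        by (rule holder_bound_mono) (use S in \<open>simp add: K6_def algebra_simps\<close>)
    qed
    have hb_a: "holder_bound \<alpha> \<Gamma> (K7 * S) (a j)" for j
    proof -
      have K6S: "0 \<le> K6 * S" using K S by simp
      have inc: "cmod (a j u - a j v) \<le> (P * (K6 * S)) * cmod (u - v) powr \<alpha>" if "u \<in> cball 0 1" "v \<in> cball 0 1" for u v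
        using holder_from_real_part[OF \<alpha> a \<Gamma>(1) K6S hb_Re_a that] by (simp add: P_def)
      have "holder_bound \<alpha> \<Gamma> (J + 2 * (P * (K6 * S))) (a j)"
        using P K6S a0 by (intro holder_bound_from_increments[OF \<alpha> \<Gamma>(2) _ inc, of 0]) auto
      then show ?thesis
        by (rule holder_bound_mono) (use S in \<open>simp add: K7_def algebra_simps\<close>)
    qed
    have le: "k * S \<le> (K1 + K2 + K4 + K5 + K7) * S" if "k \<in> {K1, K2, K4, K5, K7}" for k
      using that K S by (intro mult_right_mono) auto
    show "(\<forall>i. holder_bound \<alpha> \<Gamma> ((K1 + K2 + K4 + K5 + K7) * (T + J)) (x i)) \<and> (\<forall>i. holder_bound \<alpha> \<Gamma> ((K1 + K2 + K4 + K5 + K7) * (T + J)) (y i))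
       \<and> (\<forall>j. holder_bound \<alpha> \<Gamma> ((K1 + K2 + K4 + K5 + K7) * (T + J)) (a j)) \<and> (\<forall>j. holder_bound \<alpha> \<Gamma> ((K1 + K2 + K4 + K5 + K7) * (T + J)) (b j))
       \<and> (\<forall>j. holder_bound \<alpha> \<Gamma> ((K1 + K2 + K4 + K5 + K7) * (T + J)) (\<lambda>\<zeta>. complex_of_real (\<gamma> j \<zeta>)))"
      unfolding S_def[symmetric]
      by (intro conjI allI holder_bound_mono[OF hb_x] holder_bound_mono[OF hb_y] holder_bound_mono[OF hb_a]
          holder_bound_mono[OF hb_b] holder_bound_mono[OF hb_\<gamma>] le) simp_all
  qed
qed

section \<open>Hadamard difference quotients\<close>

text \<open>Only derivatives along basis vectors are bounded, as these are the quantities that a small norm of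
  differentiable maps controls.\<close>

primrec smooth_bound ::
  "nat \<Rightarrow> 'a::euclidean_space set \<Rightarrow> real \<Rightarrow> ('a \<Rightarrow> 'b::real_normed_vector) \<Rightarrow> bool" where
  "smooth_bound 0 S \<delta> \<phi> \<longleftrightarrow> (\<forall>x\<in>S. norm (\<phi> x) \<le> \<delta>)"
| "smooth_bound (Suc m) S \<delta> \<phi> \<longleftrightarrow> (\<forall>x\<in>S. norm (\<phi> x) \<le> \<delta> \<and> \<phi> differentiable (at x)) \<and>
     (\<forall>b\<in>Basis. smooth_bound m S \<delta> (\<lambda>x. frechet_derivative \<phi> (at x) b))"

lemma smooth_bound_norm: "smooth_bound m S \<delta> \<phi> \<Longrightarrow> x \<in> S \<Longrightarrow> norm (\<phi> x) \<le> \<delta>"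
  by (cases m) auto

lemma smooth_bound_mono: "smooth_bound (Suc m) S \<delta> \<phi> \<Longrightarrow> smooth_bound m S \<delta> \<phi>"
  by (induction m arbitrary: \<phi>) auto

lemma smooth_bound_has_derivative:
  "smooth_bound (Suc m) S \<delta> \<phi> \<Longrightarrow> x \<in> S \<Longrightarrow> (\<phi> has_derivative frechet_derivative \<phi> (at x)) (at x)"
  by (simp add: frechet_derivative_works)

lemma frechet_derivative_basis_sum:
  fixes \<phi> :: "'a::euclidean_space \<Rightarrow> 'b::real_normed_vector"
  assumes "\<phi> differentiable (at x)"
  shows "frechet_derivative \<phi> (at x) v = (\<Sum>b\<in>Basis. (v \<bullet> b) *\<^sub>R frechet_derivative \<phi> (at x) b)"
proof -
  have lin: "linear (frechet_derivative \<phi> (at x))"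
    using assms by (rule linear_frechet_derivative)
  have "frechet_derivative \<phi> (at x) v = frechet_derivative \<phi> (at x) (\<Sum>b\<in>Basis. (v \<bullet> b) *\<^sub>R b)"
    by (simp add: euclidean_representation)
  also have "\<dots> = (\<Sum>b\<in>Basis. (v \<bullet> b) *\<^sub>R frechet_derivative \<phi> (at x) b)"
    by (simp add: linear_sum[OF lin] linear_scale[OF lin])
  finally show ?thesis .
qed

lemma norm_basis_sum_le:
  fixes v :: "'a::euclidean_space" and g :: "'a \<Rightarrow> 'b::real_normed_vector"
  assumes "\<And>b. b \<in> Basis \<Longrightarrow> norm (g b) \<le> C"
  shows "norm (\<Sum>b\<in>Basis. (v \<bullet> b) *\<^sub>R g b) \<le> real DIM('a) * C * norm v"
proof -
  have "norm (\<Sum>b\<in>Basis. (v \<bullet> b) *\<^sub>R g b) \<le> (\<Sum>b\<in>(Basis::'a set). norm v * C)"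
    using assms by (intro sum_norm_le) (auto intro!: mult_mono Basis_le_norm)
  then show ?thesis by (simp add: mult_ac)
qed

lemma smooth_bound_derivative:
  fixes \<phi> :: "'a::euclidean_space \<Rightarrow> 'b::real_normed_vector"
  assumes "smooth_bound (Suc m) S \<delta> \<phi>" "x \<in> S"
  shows "norm (frechet_derivative \<phi> (at x) v) \<le> real DIM('a) * \<delta> * norm v"
proof -
  have d: "\<phi> differentiable (at x)" using assms by simp
  show ?thesis
    unfolding frechet_derivative_basis_sum[OF d, of v]
    using assms by (intro norm_basis_sum_le smooth_bound_norm[of m S \<delta>]) auto
qed

lemma smooth_bound_lipschitz:
  fixes \<phi> :: "'a::euclidean_space \<Rightarrow> 'b::real_normed_vector"
  assumes "smooth_bound (Suc m) S \<delta> \<phi>" "convex S" "x \<in> S" "y \<in> S"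
  shows "norm (\<phi> x - \<phi> y) \<le> real DIM('a) * \<delta> * norm (x - y)"
proof (rule differentiable_bound[OF assms(2)])
  show "(\<phi> has_derivative frechet_derivative \<phi> (at z)) (at z within S)" if "z \<in> S" for z
    using smooth_bound_has_derivative[OF assms(1) that] by (rule has_derivative_at_withinI)
  show "onorm (frechet_derivative \<phi> (at z)) \<le> real DIM('a) * \<delta>" if "z \<in> S" for z
    by (rule onorm_le) (rule smooth_bound_derivative[OF assms(1) that])
qed (use assms in auto)

lemma smooth_bound_derivative_lipschitz:
  fixes \<phi> :: "'a::euclidean_space \<Rightarrow> 'b::real_normed_vector"
  assumes \<phi>: "smooth_bound (Suc (Suc m)) S \<delta> \<phi>" and S: "convex S" "x \<in> S" "y \<in> S"
  shows "norm (frechet_derivative \<phi> (at x) v - frechet_derivative \<phi> (at y) v)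
    \<le> real DIM('a) * (real DIM('a) * \<delta> * norm (x - y)) * norm v"
proof -
  have d: "\<phi> differentiable (at x)" "\<phi> differentiable (at y)" using \<phi> S by auto
  have "frechet_derivative \<phi> (at x) v - frechet_derivative \<phi> (at y) v
    = (\<Sum>b\<in>Basis. (v \<bullet> b) *\<^sub>R (frechet_derivative \<phi> (at x) b - frechet_derivative \<phi> (at y) b))"
    unfolding frechet_derivative_basis_sum[OF d(1), of v] frechet_derivative_basis_sum[OF d(2), of v]
    by (simp add: scaleR_diff_right sum_subtractf)
  also have "norm \<dots> \<le> real DIM('a) * (real DIM('a) * \<delta> * norm (x - y)) * norm v"
  proof (rule norm_basis_sum_le)
    fix b :: 'a assume "b \<in> Basis"
    then have "smooth_bound (Suc m) S \<delta> (\<lambda>x. frechet_derivative \<phi> (at x) b)" using \<phi> by simp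
    from smooth_bound_lipschitz[OF this S]
    show "norm (frechet_derivative \<phi> (at x) b - frechet_derivative \<phi> (at y) b) \<le> real DIM('a) * \<delta> * norm (x - y)" .
  qed
  finally show ?thesis .
qed

lemma segment_in_convex:
  assumes "convex S" "x \<in> S" "y \<in> S" "0 \<le> t" "t \<le> 1"
  shows "y + t *\<^sub>R (x - y) \<in> S"
proof -
  have "y + t *\<^sub>R (x - y) = (1 - t) *\<^sub>R y + t *\<^sub>R x" by (simp add: algebra_simps)
  then show ?thesis using convexD[OF assms(1) assms(3,2), of "1 - t" t] assms(4,5) by simp
qed

lemma norm_segment_diff_le:
  assumes "0 \<le> t" "t \<le> 1"
  shows "norm ((y + t *\<^sub>R (x - y)) - (y' + t *\<^sub>R (x' - y'))) \<le> norm (x - x') + norm (y - y')"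
proof -
  have "(y + t *\<^sub>R (x - y)) - (y' + t *\<^sub>R (x' - y')) = t *\<^sub>R (x - x') + (1 - t) *\<^sub>R (y - y')"
    by (simp add: algebra_simps)
  also have "norm \<dots> \<le> norm (x - x') + norm (y - y')"
    using assms by (intro norm_triangle_mono) (auto simp: mult_left_le_one_le)
  finally show ?thesis .
qed

text \<open>Second order mean value estimate: the mixed difference is governed by the mixed difference of the points,
  up to a product of two first differences. It yields Hoelder bounds for differences of compositions.\<close>

lemma four_point_estimate:
  fixes \<phi> :: "'a::euclidean_space \<Rightarrow> 'b::real_normed_vector"
  assumes \<phi>: "smooth_bound (Suc (Suc m)) S \<delta> \<phi>" and S: "convex S" and \<delta>: "0 \<le> \<delta>"
    and x: "x1 \<in> S" "x2 \<in> S" "x3 \<in> S" "x4 \<in> S"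
  shows "norm (\<phi> x1 - \<phi> x2 - \<phi> x3 + \<phi> x4) \<le> real DIM('a) * (real DIM('a) * \<delta>) *
    (norm (x1 - x2 - x3 + x4) + norm (x1 - x2) * (norm (x1 - x3) + norm (x2 - x4)))"
proof -
  define p where "p = (\<lambda>t::real. x2 + t *\<^sub>R (x1 - x2))"
  define q where "q = (\<lambda>t::real. x4 + t *\<^sub>R (x3 - x4))"
  define B where "B = real DIM('a) * (real DIM('a) * \<delta>) *
    (norm (x1 - x2 - x3 + x4) + norm (x1 - x2) * (norm (x1 - x3) + norm (x2 - x4)))"
  have pS: "p t \<in> S" and qS: "q t \<in> S" if "0 \<le> t" "t \<le> 1" for t
    using that segment_in_convex[OF S] x by (auto simp: p_def q_def)
  have dp: "((\<lambda>t. \<phi> (p t)) has_vector_derivative frechet_derivative \<phi> (at (p t)) (x1 - x2)) (at t)"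
    if "0 \<le> t" "t \<le> 1" for t
  proof -
    have "(p has_vector_derivative (x1 - x2)) (at t)"
      unfolding p_def by (auto intro!: derivative_eq_intros)
    from diff_chain_at[OF this[unfolded has_vector_derivative_def] smooth_bound_has_derivative[OF \<phi> pS[OF that]]]
    show ?thesis
      using linear_frechet_derivative[of \<phi> "at (p t)"] \<phi> pS[OF that]
      by (simp add: has_vector_derivative_def o_def linear_scale)
  qed
  have dq: "((\<lambda>t. \<phi> (q t)) has_vector_derivative frechet_derivative \<phi> (at (q t)) (x3 - x4)) (at t)"
    if "0 \<le> t" "t \<le> 1" for t
  proof -
    have "(q has_vector_derivative (x3 - x4)) (at t)"
      unfolding q_def by (auto intro!: derivative_eq_intros)
    from diff_chain_at[OF this[unfolded has_vector_derivative_def] smooth_bound_has_derivative[OF \<phi> qS[OF that]]]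
    show ?thesis
      using linear_frechet_derivative[of \<phi> "at (q t)"] \<phi> qS[OF that]
      by (simp add: has_vector_derivative_def o_def linear_scale)
  qed
  have "norm ((\<lambda>t. \<phi> (p t) - \<phi> (q t)) 1 - (\<lambda>t. \<phi> (p t) - \<phi> (q t)) 0) \<le> B * 1 - B * 0"
  proof (rule differentiable_bound_general[where f = "\<lambda>t. \<phi> (p t) - \<phi> (q t)" and \<phi> = "\<lambda>t. B * t" and \<phi>' = "\<lambda>_. B"])
    show "continuous_on {0..1} (\<lambda>t. \<phi> (p t) - \<phi> (q t))"
    proof (rule continuous_on_vector_derivative)
      fix t :: real assume t: "t \<in> {0..1}"
      show "((\<lambda>t. \<phi> (p t) - \<phi> (q t)) has_vector_derivative
        frechet_derivative \<phi> (at (p t)) (x1 - x2) - frechet_derivative \<phi> (at (q t)) (x3 - x4)) (at t within {0..1})"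
        by (rule has_vector_derivative_at_within[OF has_vector_derivative_diff[OF dp dq]]) (use t in auto)
    qed
    fix t :: real assume t: "0 < t" "t < 1"
    show "((\<lambda>t. \<phi> (p t) - \<phi> (q t)) has_vector_derivative
        frechet_derivative \<phi> (at (p t)) (x1 - x2) - frechet_derivative \<phi> (at (q t)) (x3 - x4)) (at t)"
      using t by (intro has_vector_derivative_diff dp dq) auto
    have P: "p t \<in> S" and Q: "q t \<in> S" using pS[of t] qS[of t] t by auto
    have lin: "linear (frechet_derivative \<phi> (at (q t)))"
      by (rule linear_frechet_derivative) (use \<phi> Q in auto)
    have "frechet_derivative \<phi> (at (p t)) (x1 - x2) - frechet_derivative \<phi> (at (q t)) (x3 - x4)
      = frechet_derivative \<phi> (at (q t)) (x1 - x2 - x3 + x4)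
        + (frechet_derivative \<phi> (at (p t)) (x1 - x2) - frechet_derivative \<phi> (at (q t)) (x1 - x2))"
      using linear_diff[OF lin, of "x1 - x2" "x3 - x4"] by (simp add: algebra_simps)
    also have "norm \<dots> \<le> real DIM('a) * \<delta> * norm (x1 - x2 - x3 + x4)
        + real DIM('a) * (real DIM('a) * \<delta> * norm (p t - q t)) * norm (x1 - x2)"
      by (intro norm_triangle_mono smooth_bound_derivative[OF \<phi> Q] smooth_bound_derivative_lipschitz[OF \<phi> S P Q])
    also have "\<dots> \<le> real DIM('a) * (real DIM('a) * \<delta>) * norm (x1 - x2 - x3 + x4)
        + real DIM('a) * (real DIM('a) * \<delta> * (norm (x1 - x3) + norm (x2 - x4))) * norm (x1 - x2)"
    proof -
      have "1 * (real DIM('a) * \<delta>) \<le> real DIM('a) * (real DIM('a) * \<delta>)"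
        using \<delta> DIM_ge_Suc0[where 'a='a] by (intro mult_right_mono) auto
      then have a: "real DIM('a) * \<delta> \<le> real DIM('a) * (real DIM('a) * \<delta>)" by simp
      have b: "norm (p t - q t) \<le> norm (x1 - x3) + norm (x2 - x4)"
        unfolding p_def q_def using t by (intro norm_segment_diff_le) auto
      show ?thesis
        by (rule add_mono[OF mult_right_mono[OF a norm_ge_zero]
              mult_right_mono[OF mult_left_mono[OF mult_left_mono[OF b]] norm_ge_zero]]) (use \<delta> in auto)
    qed
    also have "\<dots> = B" by (simp add: B_def algebra_simps)
    finally show "norm (frechet_derivative \<phi> (at (p t)) (x1 - x2) - frechet_derivative \<phi> (at (q t)) (x3 - x4)) \<le> B" .
    show "((\<lambda>t. B * t) has_vector_derivative B) (at t)"
      by (auto intro!: derivative_eq_intros simp: has_real_derivative_iff_has_vector_derivative[symmetric])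
  qed (auto intro!: continuous_intros)
  then show ?thesis by (simp add: p_def q_def B_def algebra_simps)
qed

text \<open>The map M x y plays the role of the derivative averaged along the segment from y to x, which makes
  \<open>\<phi> x - \<phi> y = M x y (x - y)\<close> an exact linear relation. The last clause is the four point estimate for M; it is what
  allows differences of such relations to be estimated once more.\<close>

definition difference_quotient ::
  "'a::real_normed_vector set \<Rightarrow> real \<Rightarrow> ('a \<Rightarrow> 'b::real_normed_vector) \<Rightarrow> ('a \<Rightarrow> 'a \<Rightarrow> 'a \<Rightarrow> 'b) \<Rightarrow> bool" where
  "difference_quotient S D \<phi> M \<longleftrightarrow> 0 \<le> D \<and> (\<forall>x\<in>S. norm (\<phi> x) \<le> D) \<and>
     (\<forall>x\<in>S. \<forall>y\<in>S. linear (M x y) \<and> \<phi> x - \<phi> y = M x y (x - y) \<and> (\<forall>v. norm (M x y v) \<le> D * norm v)) \<and>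
     (\<forall>x1\<in>S. \<forall>y1\<in>S. \<forall>x2\<in>S. \<forall>y2\<in>S. \<forall>v.
        norm (M x1 y1 v - M x2 y2 v) \<le> D * (norm (x1 - x2) + norm (y1 - y2)) * norm v) \<and>
     (\<forall>x1\<in>S. \<forall>y1\<in>S. \<forall>x2\<in>S. \<forall>y2\<in>S. \<forall>x3\<in>S. \<forall>y3\<in>S. \<forall>x4\<in>S. \<forall>y4\<in>S. \<forall>v.
        norm (M x1 y1 v - M x2 y2 v - M x3 y3 v + M x4 y4 v) \<le>
          D * (norm (x1 - x2 - x3 + x4) + norm (y1 - y2 - y3 + y4)
             + (norm (x1 - x2) + norm (y1 - y2)) * (norm (x1 - x3) + norm (y1 - y3) + norm (x2 - x4) + norm (y2 - y4))) * norm v)"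

lemma difference_quotientD:
  assumes "difference_quotient S D \<phi> M"
  shows "0 \<le> D" "x \<in> S \<Longrightarrow> norm (\<phi> x) \<le> D"
    "x \<in> S \<Longrightarrow> y \<in> S \<Longrightarrow> linear (M x y)"
    "x \<in> S \<Longrightarrow> y \<in> S \<Longrightarrow> \<phi> x - \<phi> y = M x y (x - y)"
    "x \<in> S \<Longrightarrow> y \<in> S \<Longrightarrow> norm (M x y v) \<le> D * norm v"
    "x1 \<in> S \<Longrightarrow> y1 \<in> S \<Longrightarrow> x2 \<in> S \<Longrightarrow> y2 \<in> S \<Longrightarrow>
       norm (M x1 y1 v - M x2 y2 v) \<le> D * (norm (x1 - x2) + norm (y1 - y2)) * norm v"
    "x1 \<in> S \<Longrightarrow> y1 \<in> S \<Longrightarrow> x2 \<in> S \<Longrightarrow> y2 \<in> S \<Longrightarrow> x3 \<in> S \<Longrightarrow> y3 \<in> S \<Longrightarrow> x4 \<in> S \<Longrightarrow> y4 \<in> S \<Longrightarrow>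
       norm (M x1 y1 v - M x2 y2 v - M x3 y3 v + M x4 y4 v) \<le>
          D * (norm (x1 - x2 - x3 + x4) + norm (y1 - y2 - y3 + y4)
             + (norm (x1 - x2) + norm (y1 - y2)) * (norm (x1 - x3) + norm (y1 - y3) + norm (x2 - x4) + norm (y2 - y4))) * norm v"
  using assms unfolding difference_quotient_def by blast+

lemma norm_integral_01_le:
  fixes g :: "real \<Rightarrow> 'b::banach"
  assumes "g integrable_on {0..1}" "\<And>t. t \<in> {0..1} \<Longrightarrow> norm (g t) \<le> C"
  shows "norm (integral {0..1} g) \<le> C"
  using integral_norm_bound_integral[OF assms(1) integrable_const_ivl[of C]] assms(2) by simp

text \<open>M x y v is the integral of the derivative in direction v along the segment from y to x.
  Three derivatives suffice, since the four point estimate for M needs two derivatives of the differential.\<close>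

lemma hadamard_difference_quotient:
  fixes \<phi> :: "'a::euclidean_space \<Rightarrow> 'b::banach"
  assumes \<phi>: "smooth_bound 3 S \<delta> \<phi>" and S: "convex S" and \<delta>: "0 \<le> \<delta>"
  obtains M where "difference_quotient S (real DIM('a) ^ 3 * \<delta>) \<phi> M"
proof -
  define d where "d = real DIM('a)"
  have d1: "1 \<le> d" using DIM_ge_Suc0[where 'a='a] by (simp add: d_def)
  define D where "D = d ^ 3 * \<delta>"
  have D: "\<delta> \<le> D" "d * \<delta> \<le> D" "d * (d * \<delta>) \<le> D" "D = d * (d * (d * \<delta>))" "0 \<le> D"
  proof -
    have le: "r \<le> d * r" if "0 \<le> r" for r using mult_right_mono[OF d1 that] by simp
    show "D = d * (d * (d * \<delta>))" by (simp add: D_def power3_eq_cube)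
    have n: "0 \<le> d * \<delta>" "0 \<le> d * (d * \<delta>)" using d1 \<delta> by simp_all
    show dd: "d * (d * \<delta>) \<le> D" using le[OF n(2)] \<open>D = d * (d * (d * \<delta>))\<close> by linarith
    show "d * \<delta> \<le> D" using le[OF n(1)] dd by linarith
    then show "\<delta> \<le> D" using le[OF \<delta>] by linarith
    then show "0 \<le> D" using \<delta> by linarith
  qed
  have \<phi>3: "smooth_bound (Suc (Suc (Suc 0))) S \<delta> \<phi>" using \<phi> by (simp add: numeral_3_eq_3)
  have \<phi>1: "smooth_bound (Suc 0) S \<delta> \<phi>" by (rule smooth_bound_mono[OF smooth_bound_mono[OF \<phi>3]])
  define F where "F = (\<lambda>x. frechet_derivative \<phi> (at x))"
  have dif: "\<phi> differentiable (at x)" if "x \<in> S" for x using \<phi>1 that by simp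
  have F_lip: "norm (F x v - F y v) \<le> D * norm (x - y) * norm v" if "x \<in> S" "y \<in> S" for x y v
  proof -
    have "norm (F x v - F y v) \<le> (d * (d * \<delta>)) * norm (x - y) * norm v"
      using smooth_bound_derivative_lipschitz[OF \<phi>3 S that, of v] by (simp add: F_def d_def mult_ac)
    also have "\<dots> \<le> D * norm (x - y) * norm v" by (intro mult_right_mono D(3) norm_ge_zero)
    finally show ?thesis .
  qed
  have F_le: "norm (F x v) \<le> D * norm v" if "x \<in> S" for x v
  proof -
    have "norm (F x v) \<le> d * \<delta> * norm v"
      using smooth_bound_derivative[OF \<phi>1 that, of v] by (simp add: F_def d_def)
    also have "\<dots> \<le> D * norm v" by (intro mult_right_mono D(2) norm_ge_zero)
    finally show ?thesis .
  qed
  have F_four: "norm (F x1 v - F x2 v - F x3 v + F x4 v) \<le>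
      D * (norm (x1 - x2 - x3 + x4) + norm (x1 - x2) * (norm (x1 - x3) + norm (x2 - x4))) * norm v"
    if x: "x1 \<in> S" "x2 \<in> S" "x3 \<in> S" "x4 \<in> S" for x1 x2 x3 x4 v
  proof -
    have "F x1 v - F x2 v - F x3 v + F x4 v = (\<Sum>b\<in>Basis. (v \<bullet> b) *\<^sub>R (F x1 b - F x2 b - F x3 b + F x4 b))"
      unfolding F_def frechet_derivative_basis_sum[OF dif[OF x(1)], of v] frechet_derivative_basis_sum[OF dif[OF x(2)], of v]
        frechet_derivative_basis_sum[OF dif[OF x(3)], of v] frechet_derivative_basis_sum[OF dif[OF x(4)], of v]
      by (simp add: scaleR_diff_right scaleR_add_right sum_subtractf sum.distrib)
    also have "norm \<dots> \<le> real DIM('a) * (real DIM('a) * (real DIM('a) * \<delta>) *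
      (norm (x1 - x2 - x3 + x4) + norm (x1 - x2) * (norm (x1 - x3) + norm (x2 - x4)))) * norm v"
    proof (rule norm_basis_sum_le)
      fix b :: 'a assume "b \<in> Basis"
      then have "smooth_bound (Suc (Suc 0)) S \<delta> (\<lambda>x. F x b)" using \<phi>3 by (simp add: F_def)
      from four_point_estimate[OF this S \<delta> x]
      show "norm (F x1 b - F x2 b - F x3 b + F x4 b) \<le> real DIM('a) * (real DIM('a) * \<delta>) *
        (norm (x1 - x2 - x3 + x4) + norm (x1 - x2) * (norm (x1 - x3) + norm (x2 - x4)))" .
    qed
    finally show ?thesis unfolding D(4) d_def by (simp only: mult_ac)
  qed
  define M where "M = (\<lambda>x y v. integral {0..1} (\<lambda>t. F (y + t *\<^sub>R (x - y)) v))"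
  have seg: "y + t *\<^sub>R (x - y) \<in> S" if "x \<in> S" "y \<in> S" "t \<in> {0..1}" for x y t
    using segment_in_convex[OF S that(1,2)] that(3) by simp
  have int: "(\<lambda>t. F (y + t *\<^sub>R (x - y)) v) integrable_on {0..1}" if xy: "x \<in> S" "y \<in> S" for x y v
  proof (rule integrable_continuous_real)
    have "(D * norm (x - y) * norm v)-lipschitz_on {0..1} (\<lambda>t. F (y + t *\<^sub>R (x - y)) v)"
    proof (rule lipschitz_onI)
      fix s t :: real assume st: "s \<in> {0..1}" "t \<in> {0..1}"
      have "(y + s *\<^sub>R (x - y)) - (y + t *\<^sub>R (x - y)) = (s - t) *\<^sub>R (x - y)" by (simp add: algebra_simps)
      then show "dist (F (y + s *\<^sub>R (x - y)) v) (F (y + t *\<^sub>R (x - y)) v) \<le> D * norm (x - y) * norm v * dist s t"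
        using F_lip[OF seg[OF xy st(1)] seg[OF xy st(2)], of v] by (simp add: dist_norm mult_ac)
    qed (use D(5) in auto)
    then show "continuous_on {0..1} (\<lambda>t. F (y + t *\<^sub>R (x - y)) v)" by (rule lipschitz_on_continuous_on)
  qed
  have lin: "linear (M x y)" if xy: "x \<in> S" "y \<in> S" for x y
  proof (rule linearI)
    have lF: "linear (F (y + t *\<^sub>R (x - y)))" if "t \<in> {0..1}" for t
      unfolding F_def by (rule linear_frechet_derivative) (rule dif[OF seg[OF xy that]])
    fix v w and r :: real
    have "M x y (v + w) = integral {0..1} (\<lambda>t. F (y + t *\<^sub>R (x - y)) v + F (y + t *\<^sub>R (x - y)) w)"
      unfolding M_def by (rule integral_cong) (rule linear_add[OF lF])
    then show "M x y (v + w) = M x y v + M x y w"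
      by (simp add: M_def integral_add[OF int[OF xy] int[OF xy]])
    have "M x y (r *\<^sub>R v) = integral {0..1} (\<lambda>t. r *\<^sub>R F (y + t *\<^sub>R (x - y)) v)"
      unfolding M_def by (rule integral_cong) (rule linear_scale[OF lF])
    then show "M x y (r *\<^sub>R v) = r *\<^sub>R M x y v" by (simp add: M_def)
  qed
  have ftc: "\<phi> x - \<phi> y = M x y (x - y)" if xy: "x \<in> S" "y \<in> S" for x y
  proof -
    have "((\<lambda>t. F (y + t *\<^sub>R (x - y)) (x - y)) has_integral \<phi> (y + 1 *\<^sub>R (x - y)) - \<phi> (y + 0 *\<^sub>R (x - y))) {0..1}"
    proof (rule fundamental_theorem_of_calculus)
      fix t :: real assume t: "t \<in> {0..1}"
      have "((\<lambda>t. y + t *\<^sub>R (x - y)) has_vector_derivative (x - y)) (at t)"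
        by (auto intro!: derivative_eq_intros)
      from diff_chain_at[OF this[unfolded has_vector_derivative_def] smooth_bound_has_derivative[OF \<phi>1 seg[OF xy t]]]
      have "((\<lambda>t. \<phi> (y + t *\<^sub>R (x - y))) has_vector_derivative F (y + t *\<^sub>R (x - y)) (x - y)) (at t)"
        using linear_frechet_derivative[OF dif[OF seg[OF xy t]]]
        by (simp add: has_vector_derivative_def o_def linear_scale F_def)
      then show "((\<lambda>t. \<phi> (y + t *\<^sub>R (x - y))) has_vector_derivative F (y + t *\<^sub>R (x - y)) (x - y)) (at t within {0..1})"
        by (rule has_vector_derivative_at_within)
    qed simp
    then show ?thesis by (simp add: M_def integral_unique)
  qed
  have bound: "norm (M x y v) \<le> D * norm v" if xy: "x \<in> S" "y \<in> S" for x y v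
    unfolding M_def by (rule norm_integral_01_le[OF int[OF xy] F_le[OF seg[OF xy]]])
  have lip: "norm (M x1 y1 v - M x2 y2 v) \<le> D * (norm (x1 - x2) + norm (y1 - y2)) * norm v"
    if x: "x1 \<in> S" "y1 \<in> S" and y: "x2 \<in> S" "y2 \<in> S" for x1 x2 y1 y2 v
    unfolding M_def integral_diff[OF int[OF x] int[OF y], symmetric]
  proof (rule norm_integral_01_le[OF integrable_diff[OF int[OF x] int[OF y]]])
    fix t :: real assume t: "t \<in> {0..1}"
    have "norm (F (y1 + t *\<^sub>R (x1 - y1)) v - F (y2 + t *\<^sub>R (x2 - y2)) v)
       \<le> D * norm ((y1 + t *\<^sub>R (x1 - y1)) - (y2 + t *\<^sub>R (x2 - y2))) * norm v"
      by (rule F_lip[OF seg[OF x t] seg[OF y t]])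
    also have "\<dots> \<le> D * (norm (x1 - x2) + norm (y1 - y2)) * norm v"
      using t D(5) by (intro mult_right_mono mult_left_mono norm_segment_diff_le) auto
    finally show "norm (F (y1 + t *\<^sub>R (x1 - y1)) v - F (y2 + t *\<^sub>R (x2 - y2)) v)
       \<le> D * (norm (x1 - x2) + norm (y1 - y2)) * norm v" .
  qed
  have four: "norm (M x1 y1 v - M x2 y2 v - M x3 y3 v + M x4 y4 v) \<le>
          D * (norm (x1 - x2 - x3 + x4) + norm (y1 - y2 - y3 + y4)
             + (norm (x1 - x2) + norm (y1 - y2)) * (norm (x1 - x3) + norm (y1 - y3) + norm (x2 - x4) + norm (y2 - y4))) * norm v"
    if x1: "x1 \<in> S" "y1 \<in> S" and x2: "x2 \<in> S" "y2 \<in> S" and x3: "x3 \<in> S" "y3 \<in> S" and x4: "x4 \<in> S" "y4 \<in> S"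
    for x1 x2 x3 x4 y1 y2 y3 y4 v
  proof -
    let ?s = "\<lambda>x y t. y + t *\<^sub>R (x - y)"
    note I = integrable_add[OF integrable_diff[OF integrable_diff[OF int[OF x1] int[OF x2]] int[OF x3]] int[OF x4]]
    have "M x1 y1 v - M x2 y2 v - M x3 y3 v + M x4 y4 v =
      integral {0..1} (\<lambda>t. F (?s x1 y1 t) v - F (?s x2 y2 t) v - F (?s x3 y3 t) v + F (?s x4 y4 t) v)"
      by (simp add: M_def integral_add integral_diff int x1 x2 x3 x4 integrable_diff)
    also have "norm \<dots> \<le> D * (norm (x1 - x2 - x3 + x4) + norm (y1 - y2 - y3 + y4)
             + (norm (x1 - x2) + norm (y1 - y2)) * (norm (x1 - x3) + norm (y1 - y3) + norm (x2 - x4) + norm (y2 - y4))) * norm v"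
    proof (rule norm_integral_01_le[OF I])
      fix t :: real assume t: "t \<in> {0..1}"
      then have t': "0 \<le> t" "t \<le> 1" by auto
      have "?s x1 y1 t - ?s x2 y2 t - ?s x3 y3 t + ?s x4 y4 t = t *\<^sub>R (x1 - x2 - x3 + x4) + (1 - t) *\<^sub>R (y1 - y2 - y3 + y4)"
        by (simp add: algebra_simps)
      also have "norm \<dots> \<le> norm (x1 - x2 - x3 + x4) + norm (y1 - y2 - y3 + y4)"
        using t' by (intro norm_triangle_mono) (auto simp: mult_left_le_one_le)
      finally have a: "norm (?s x1 y1 t - ?s x2 y2 t - ?s x3 y3 t + ?s x4 y4 t) \<le> norm (x1 - x2 - x3 + x4) + norm (y1 - y2 - y3 + y4)" .
      have "norm (F (?s x1 y1 t) v - F (?s x2 y2 t) v - F (?s x3 y3 t) v + F (?s x4 y4 t) v)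
        \<le> D * (norm (?s x1 y1 t - ?s x2 y2 t - ?s x3 y3 t + ?s x4 y4 t)
          + norm (?s x1 y1 t - ?s x2 y2 t) * (norm (?s x1 y1 t - ?s x3 y3 t) + norm (?s x2 y2 t - ?s x4 y4 t))) * norm v"
        by (rule F_four) (intro seg t x1 x2 x3 x4)+
      also have "\<dots> \<le> D * ((norm (x1 - x2 - x3 + x4) + norm (y1 - y2 - y3 + y4))
          + (norm (x1 - x2) + norm (y1 - y2)) * ((norm (x1 - x3) + norm (y1 - y3)) + (norm (x2 - x4) + norm (y2 - y4)))) * norm v"
        by (intro mult_right_mono mult_left_mono add_mono mult_mono a norm_segment_diff_le t' D(5) add_nonneg_nonneg norm_ge_zero)
      finally show "norm (F (?s x1 y1 t) v - F (?s x2 y2 t) v - F (?s x3 y3 t) v + F (?s x4 y4 t) v) \<le> 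
          D * (norm (x1 - x2 - x3 + x4) + norm (y1 - y2 - y3 + y4)
             + (norm (x1 - x2) + norm (y1 - y2)) * (norm (x1 - x3) + norm (y1 - y3) + norm (x2 - x4) + norm (y2 - y4))) * norm v"
        by (simp add: add.assoc)
    qed
    finally show ?thesis .
  qed
  have sup: "norm (\<phi> x) \<le> D" if "x \<in> S" for x using smooth_bound_norm[OF \<phi>1 that] D(1) by simp
  have "difference_quotient S D \<phi> M"
    unfolding difference_quotient_def by (intro conjI ballI allI D(5) sup lin ftc bound lip four; assumption)
  then show thesis using that by (simp add: D_def d_def)
qed

text \<open>Wirtinger derivatives are such combinations of two real partial derivatives.\<close>

lemma difference_quotient_combination:
  fixes \<phi> \<psi> :: "'a::real_normed_vector \<Rightarrow> real ^ 'd"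
  assumes \<phi>: "difference_quotient S D \<phi> M" and \<psi>: "difference_quotient S D \<psi> M'"
  shows "difference_quotient S D (\<lambda>x. (complex_of_real (\<phi> x $ k) - \<i> * of_real (\<psi> x $ k)) / 2)
    (\<lambda>x y v. (complex_of_real (M x y v $ k) - \<i> * of_real (M' x y v $ k)) / 2)"
proof -
  let ?c = "\<lambda>a b :: real ^ 'd. (complex_of_real (a $ k) - \<i> * of_real (b $ k)) / 2"
  have c: "cmod (?c a b) \<le> C" if "norm a \<le> C" "norm b \<le> C" for a b C
  proof -
    have "cmod (complex_of_real (a $ k) - \<i> * of_real (b $ k)) \<le> \<bar>a $ k\<bar> + \<bar>b $ k\<bar>"
      by (rule order_trans[OF norm_triangle_ineq4]) (simp add: norm_mult)
    also have "\<dots> \<le> C + C" using that component_le_norm_cart[of a k] component_le_norm_cart[of b k] by simp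
    finally show ?thesis by (simp add: norm_divide)
  qed
  have cd: "?c a b - ?c a' b' = ?c (a - a') (b - b')" for a a' b b' by (simp add: field_simps)
  have ca: "?c a b + ?c a' b' = ?c (a + a') (b + b')" for a a' b b' by (simp add: field_simps)
  note P = difference_quotientD[OF \<phi>] and Q = difference_quotientD[OF \<psi>]
  show ?thesis
    unfolding difference_quotient_def cd ca
  proof (intro conjI ballI allI)
    fix x y assume xy: "x \<in> S" "y \<in> S"
    show "linear (\<lambda>v. ?c (M x y v) (M' x y v))"
      using P(3)[OF xy] Q(3)[OF xy]
      by (intro linearI) (simp_all add: linear_add linear_scale complex_eq_iff field_simps)
    show "?c (\<phi> x - \<phi> y) (\<psi> x - \<psi> y) = ?c (M x y (x - y)) (M' x y (x - y))"
      by (simp only: P(4)[OF xy] Q(4)[OF xy])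
  qed ((rule P(1)), (rule c[OF P(2) Q(2)]; assumption), (rule c[OF P(5) Q(5)]; assumption),
      (rule c[OF P(6) Q(6)]; assumption), (rule c[OF P(7) Q(7)]; assumption))
qed

section \<open>Hoelder bounds for difference quotients\<close>

lemma holder_bound_compose:
  assumes M: "difference_quotient S D \<phi> M" and f: "holder_bound \<alpha> \<Gamma> B f" "\<And>z. z \<in> \<Gamma> \<Longrightarrow> f z \<in> S"
  shows "holder_bound \<alpha> \<Gamma> (D * (1 + B)) (\<lambda>z. \<phi> (f z))"
proof (rule holder_boundI)
  note D = difference_quotientD[OF M]
  fix z assume z: "z \<in> \<Gamma>"
  have B: "0 \<le> B" by (rule order_trans[OF norm_ge_zero holder_boundD(1)[OF f(1) z]])
  have "norm (\<phi> (f z)) \<le> D * 1" using D(2)[OF f(2)[OF z]] by simp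
  also have "\<dots> \<le> D * (1 + B)" using B D(1) by (intro mult_left_mono) auto
  finally show "norm (\<phi> (f z)) \<le> D * (1 + B)" .
  fix w assume w: "w \<in> \<Gamma>"
  have "norm (\<phi> (f z) - \<phi> (f w)) \<le> D * norm (f z - f w)"
    unfolding D(4)[OF f(2)[OF z] f(2)[OF w]] by (rule D(5)[OF f(2)[OF z] f(2)[OF w]])
  also have "\<dots> \<le> D * (B * cmod (z - w) powr \<alpha>)"
    by (intro mult_left_mono holder_boundD(2)[OF f(1) z w] D(1))
  also have "\<dots> \<le> D * ((1 + B) * cmod (z - w) powr \<alpha>)"
    by (intro mult_left_mono mult_right_mono D(1)) auto
  finally show "norm (\<phi> (f z) - \<phi> (f w)) \<le> D * (1 + B) * cmod (z - w) powr \<alpha>" by (simp add: mult.assoc)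
qed

lemma holder_bound_difference_quotient:
  assumes M: "difference_quotient S D \<phi> M"
    and f: "holder_bound \<alpha> \<Gamma> B f" "\<And>z. z \<in> \<Gamma> \<Longrightarrow> f z \<in> S"
    and g: "holder_bound \<alpha> \<Gamma> B g" "\<And>z. z \<in> \<Gamma> \<Longrightarrow> g z \<in> S"
    and u: "holder_bound \<alpha> \<Gamma> C u"
  shows "holder_bound \<alpha> \<Gamma> (D * C * (1 + 2 * B)) (\<lambda>z. M (f z) (g z) (u z))"
proof (rule holder_boundI)
  note D = difference_quotientD[OF M]
  fix z assume z: "z \<in> \<Gamma>"
  have B: "0 \<le> B" by (rule order_trans[OF norm_ge_zero holder_boundD(1)[OF f(1) z]])
  have C: "0 \<le> C" by (rule order_trans[OF norm_ge_zero holder_boundD(1)[OF u z]])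
  have "norm (M (f z) (g z) (u z)) \<le> D * norm (u z)" by (rule D(5)[OF f(2)[OF z] g(2)[OF z]])
  also have "\<dots> \<le> D * C" by (intro mult_left_mono holder_boundD(1)[OF u z] D(1))
  also have "\<dots> * 1 \<le> D * C * (1 + 2 * B)" using B C D(1) by (intro mult_left_mono) auto
  finally show "norm (M (f z) (g z) (u z)) \<le> D * C * (1 + 2 * B)" by simp
  fix w assume w: "w \<in> \<Gamma>"
  let ?p = "cmod (z - w) powr \<alpha>"
  have "M (f z) (g z) (u z) - M (f w) (g w) (u w) =
     M (f z) (g z) (u z - u w) + (M (f z) (g z) (u w) - M (f w) (g w) (u w))"
    using linear_diff[OF D(3)[OF f(2)[OF z] g(2)[OF z]]] by simp
  also have "norm \<dots> \<le> D * norm (u z - u w) + D * (norm (f z - f w) + norm (g z - g w)) * norm (u w)"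
    by (intro norm_triangle_mono D(5)[OF f(2)[OF z] g(2)[OF z]] D(6)[OF f(2)[OF z] g(2)[OF z] f(2)[OF w] g(2)[OF w]])
  also have "\<dots> \<le> D * (C * ?p) + D * (B * ?p + B * ?p) * C"
    by (intro add_mono mult_mono holder_boundD(2)[OF u z w] holder_boundD(2)[OF f(1) z w] holder_boundD(2)[OF g(1) z w]
        holder_boundD(1)[OF u w] D(1) mult_nonneg_nonneg add_nonneg_nonneg norm_ge_zero B C powr_ge_zero order_refl)
  finally show "norm (M (f z) (g z) (u z) - M (f w) (g w) (u w)) \<le> D * C * (1 + 2 * B) * ?p"
    by (simp add: algebra_simps)
qed

text \<open>The four point clause is used here, with the pairs of points taken at two points of the circle.\<close>

lemma holder_bound_difference_quotient_increment:
  assumes M: "difference_quotient S D \<phi> M"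
    and f: "holder_bound \<alpha> \<Gamma> B f" "\<And>z. z \<in> \<Gamma> \<Longrightarrow> f z \<in> S"
    and g: "holder_bound \<alpha> \<Gamma> B g" "\<And>z. z \<in> \<Gamma> \<Longrightarrow> g z \<in> S"
    and f': "holder_bound \<alpha> \<Gamma> B f'" "\<And>z. z \<in> \<Gamma> \<Longrightarrow> f' z \<in> S"
    and g': "holder_bound \<alpha> \<Gamma> B g'" "\<And>z. z \<in> \<Gamma> \<Longrightarrow> g' z \<in> S"
    and df: "holder_bound \<alpha> \<Gamma> E (\<lambda>z. f' z - f z)" and dg: "holder_bound \<alpha> \<Gamma> E (\<lambda>z. g' z - g z)"
    and u: "holder_bound \<alpha> \<Gamma> C u"
  shows "holder_bound \<alpha> \<Gamma> (D * C * E * (4 + 8 * B)) (\<lambda>z. M (f' z) (g' z) (u z) - M (f z) (g z) (u z))"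
proof (rule holder_boundI)
  note D = difference_quotientD[OF M]
  fix z assume z: "z \<in> \<Gamma>"
  note Sz = f'(2)[OF z] g'(2)[OF z] f(2)[OF z] g(2)[OF z]
  have B: "0 \<le> B" by (rule order_trans[OF norm_ge_zero holder_boundD(1)[OF f(1) z]])
  have C: "0 \<le> C" by (rule order_trans[OF norm_ge_zero holder_boundD(1)[OF u z]])
  have E: "0 \<le> E" by (rule order_trans[OF norm_ge_zero holder_boundD(1)[OF df z]])
  have n: "norm (M (f' z) (g' z) v - M (f z) (g z) v) \<le> D * (E + E) * norm v" for v
  proof -
    have "norm (M (f' z) (g' z) v - M (f z) (g z) v) \<le> D * (norm (f' z - f z) + norm (g' z - g z)) * norm v"
      by (rule D(6)[OF Sz])
    also have "\<dots> \<le> D * (E + E) * norm v"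
      by (intro mult_right_mono mult_left_mono add_mono holder_boundD(1)[OF df z] holder_boundD(1)[OF dg z] D(1) norm_ge_zero)
    finally show ?thesis .
  qed
  have "norm (M (f' z) (g' z) (u z) - M (f z) (g z) (u z)) \<le> D * (E + E) * norm (u z)" by (rule n)
  also have "\<dots> \<le> D * (E + E) * C"
    using D(1) E by (intro mult_left_mono holder_boundD(1)[OF u z]) auto
  also have "\<dots> = (D * C * E) * 2" by simp
  also have "\<dots> \<le> D * C * E * (4 + 8 * B)" using B C E D(1) by (intro mult_left_mono) auto
  finally show "norm (M (f' z) (g' z) (u z) - M (f z) (g z) (u z)) \<le> D * C * E * (4 + 8 * B)" .
  fix w assume w: "w \<in> \<Gamma>"
  note Sw = f'(2)[OF w] g'(2)[OF w] f(2)[OF w] g(2)[OF w]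
  let ?p = "cmod (z - w) powr \<alpha>"
  have reg: "f' z - f z - f' w + f w = (f' z - f z) - (f' w - f w)" "g' z - g z - g' w + g w = (g' z - g z) - (g' w - g w)"
    by simp_all
  have split: "(M (f' z) (g' z) (u z) - M (f z) (g z) (u z)) - (M (f' w) (g' w) (u w) - M (f w) (g w) (u w)) =
    (M (f' z) (g' z) (u z - u w) - M (f z) (g z) (u z - u w))
    + (M (f' z) (g' z) (u w) - M (f z) (g z) (u w) - M (f' w) (g' w) (u w) + M (f w) (g w) (u w))"
    using linear_diff[OF D(3)[OF Sz(1,2)]] linear_diff[OF D(3)[OF Sz(3,4)]] by simp
  have first: "norm (M (f' z) (g' z) (u z - u w) - M (f z) (g z) (u z - u w)) \<le> D * (E + E) * (C * ?p)"
    using D(1) E by (intro order_trans[OF n] mult_left_mono holder_boundD(2)[OF u z w]) auto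
  have inner: "norm (f' z - f z - f' w + f w) + norm (g' z - g z - g' w + g w)
      + (norm (f' z - f z) + norm (g' z - g z)) * (norm (f' z - f' w) + norm (g' z - g' w) + norm (f z - f w) + norm (g z - g w))
    \<le> E * ?p + E * ?p + (E + E) * (B * ?p + B * ?p + B * ?p + B * ?p)"
    unfolding reg using E
    by (intro add_mono mult_mono holder_boundD(2)[OF df z w] holder_boundD(2)[OF dg z w]
        holder_boundD(1)[OF df z] holder_boundD(1)[OF dg z] holder_boundD(2)[OF f(1) z w] holder_boundD(2)[OF g(1) z w]
        holder_boundD(2)[OF f'(1) z w] holder_boundD(2)[OF g'(1) z w]) auto
  have second: "norm (M (f' z) (g' z) (u w) - M (f z) (g z) (u w) - M (f' w) (g' w) (u w) + M (f w) (g w) (u w))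
    \<le> D * (E * ?p + E * ?p + (E + E) * (B * ?p + B * ?p + B * ?p + B * ?p)) * C"
    using D(1) E B
    by (intro order_trans[OF D(7)[OF Sz(1,2,3,4) Sw]] mult_mono holder_boundD(1)[OF u w] inner order_refl) auto
  have "norm ((M (f' z) (g' z) (u z) - M (f z) (g z) (u z)) - (M (f' w) (g' w) (u w) - M (f w) (g w) (u w)))
     \<le> D * (E + E) * (C * ?p) + D * (E * ?p + E * ?p + (E + E) * (B * ?p + B * ?p + B * ?p + B * ?p)) * C"
    unfolding split by (rule norm_triangle_mono[OF first second])
  moreover have "D * (E + E) * (C * ?p) + D * (E * ?p + E * ?p + (E + E) * (B * ?p + B * ?p + B * ?p + B * ?p)) * C
     = D * C * E * (4 + 8 * B) * ?p" by (simp add: algebra_simps)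
  ultimately show "norm ((M (f' z) (g' z) (u z) - M (f z) (g z) (u z)) - (M (f' w) (g' w) (u w) - M (f w) (g w) (u w)))
     \<le> D * C * E * (4 + 8 * B) * ?p" by (simp only:)
qed

text \<open>The multipliers solve a linear system that is a small perturbation of a multiple of the identity.
  Summing the absolute values over the indices absorbs the perturbation.\<close>

lemma holder_bound_implicit:
  fixes \<gamma> :: "'d::finite \<Rightarrow> complex \<Rightarrow> real" and s :: "'d \<Rightarrow> complex \<Rightarrow> complex"
    and w :: "'d \<Rightarrow> 'd \<Rightarrow> complex \<Rightarrow> complex"
  assumes eq: "\<And>j z. z \<in> \<Gamma> \<Longrightarrow> of_real (\<gamma> j z) / 2 = s j z - (\<Sum>k\<in>UNIV. of_real (\<gamma> k z) * w k j z)"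
    and s: "\<And>j. holder_bound \<alpha> \<Gamma> S (s j)" and w: "\<And>k j. holder_bound \<alpha> \<Gamma> \<delta> (w k j)"
    and \<delta>: "real CARD('d) * \<delta> \<le> 1 / 4"
  shows "holder_bound \<alpha> \<Gamma> (16 * real CARD('d) * S) (\<lambda>z. complex_of_real (\<gamma> j z))"
proof (rule holder_boundI)
  let ?d = "real CARD('d)"
  have main: "(\<Sum>j\<in>UNIV. \<bar>g j\<bar>) \<le> 4 * (?d * t)"
    if g: "\<And>j. of_real (g j) / 2 = (a j :: complex) - (\<Sum>k\<in>UNIV. of_real (g k) * b k j)"
      and a: "\<And>j. cmod (a j) \<le> t" and b: "\<And>k j. cmod (b k j) \<le> \<delta>" for g :: "'d \<Rightarrow> real" and a b t
  proof -
    define G where "G = (\<Sum>j\<in>UNIV. \<bar>g j\<bar>)"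
    have G: "0 \<le> G" by (simp add: G_def sum_nonneg)
    have "\<bar>g j\<bar> / 2 \<le> t + G * \<delta>" for j
    proof -
      have "\<bar>g j\<bar> / 2 = cmod (of_real (g j) / 2)" by (simp add: norm_divide)
      also have "\<dots> \<le> t + (\<Sum>k\<in>UNIV. \<bar>g k\<bar> * \<delta>)"
        unfolding g
        by (intro order_trans[OF norm_triangle_ineq4] add_mono a sum_norm_le order_trans[OF norm_mult_ineq])
           (auto intro: mult_left_mono b)
      finally show ?thesis by (simp add: G_def sum_distrib_right)
    qed
    then have "(\<Sum>j\<in>UNIV. \<bar>g j\<bar> / 2) \<le> (\<Sum>j\<in>(UNIV::'d set). t + G * \<delta>)" by (intro sum_mono)
    then have "G / 2 \<le> ?d * t + G * (?d * \<delta>)" by (simp add: G_def algebra_simps flip: sum_divide_distrib)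
    also have "G * (?d * \<delta>) \<le> G * (1 / 4)" using \<delta> G by (intro mult_left_mono)
    finally show ?thesis by (simp add: G_def)
  qed
  have comp: "\<bar>g j\<bar> \<le> (\<Sum>j\<in>UNIV. \<bar>g j\<bar>)" for g :: "'d \<Rightarrow> real" and j
    by (rule member_le_sum) auto
  fix z assume z: "z \<in> \<Gamma>"
  have S: "0 \<le> S" by (rule order_trans[OF norm_ge_zero holder_boundD(1)[OF s z]])
  have d1: "1 \<le> ?d" by (simp add: Suc_le_eq)
  have total: "(\<Sum>j\<in>UNIV. \<bar>\<gamma> j z\<bar>) \<le> 4 * (?d * S)" if "z \<in> \<Gamma>" for z
    using main[OF eq[OF that] holder_boundD(1)[OF s that] holder_boundD(1)[OF w that]] .
  have "\<bar>\<gamma> j z\<bar> \<le> 4 * (?d * S)" using comp[of "\<lambda>j. \<gamma> j z" j] total[OF z] by simp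
  also have "\<dots> \<le> 16 * ?d * S" using S by simp
  finally show "norm (complex_of_real (\<gamma> j z)) \<le> 16 * ?d * S" by simp
  fix v assume v: "v \<in> \<Gamma>"
  let ?p = "cmod (z - v) powr \<alpha>"
  define t where "t = S * ?p + 4 * (?d * S) * (\<delta> * ?p)"
  have "(\<Sum>j\<in>UNIV. \<bar>\<gamma> j z - \<gamma> j v\<bar>) \<le> 4 * (?d * t)"
  proof (rule main)
    fix j
    have "complex_of_real (\<gamma> j z - \<gamma> j v) / 2 = of_real (\<gamma> j z) / 2 - of_real (\<gamma> j v) / 2"
      by (simp add: diff_divide_distrib)
    also have "\<dots> = (s j z - (\<Sum>k\<in>UNIV. of_real (\<gamma> k z) * w k j z)) - (s j v - (\<Sum>k\<in>UNIV. of_real (\<gamma> k v) * w k j v))"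
      by (simp only: eq[OF z] eq[OF v])
    finally show "complex_of_real (\<gamma> j z - \<gamma> j v) / 2 = (s j z - s j v - (\<Sum>k\<in>UNIV. of_real (\<gamma> k v) * (w k j z - w k j v)))
       - (\<Sum>k\<in>UNIV. of_real (\<gamma> k z - \<gamma> k v) * w k j z)"
      by (simp add: algebra_simps sum_subtractf)
    have "cmod (\<Sum>k\<in>UNIV. of_real (\<gamma> k v) * (w k j z - w k j v)) \<le> (\<Sum>k\<in>UNIV. \<bar>\<gamma> k v\<bar> * (\<delta> * ?p))"
      by (intro sum_norm_le order_trans[OF norm_mult_ineq]) (auto intro: mult_left_mono holder_boundD(2)[OF w z v])
    also have "\<dots> = (\<Sum>k\<in>UNIV. \<bar>\<gamma> k v\<bar>) * (\<delta> * ?p)" by (simp add: sum_distrib_right)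
    also have "\<dots> \<le> 4 * (?d * S) * (\<delta> * ?p)"
    proof (rule mult_right_mono[OF total[OF v]])
      have "0 \<le> \<delta>" by (rule order_trans[OF norm_ge_zero holder_boundD(1)[OF w z]])
      then show "0 \<le> \<delta> * ?p" by simp
    qed
    finally show "cmod (s j z - s j v - (\<Sum>k\<in>UNIV. of_real (\<gamma> k v) * (w k j z - w k j v))) \<le> t"
      unfolding t_def by (intro order_trans[OF norm_triangle_ineq4] add_mono holder_boundD(2)[OF s z v])
    show "cmod (w k j z) \<le> \<delta>" for k by (rule holder_boundD(1)[OF w z])
  qed
  also have "t = (S + 4 * S * (?d * \<delta>)) * ?p" by (simp add: t_def algebra_simps)
  also have "4 * (?d * ((S + 4 * S * (?d * \<delta>)) * ?p)) \<le> 4 * (?d * ((S + 4 * S * (1 / 4)) * ?p))"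
    using S \<delta> by (intro mult_left_mono mult_right_mono add_left_mono) auto
  also have "\<dots> \<le> 16 * ?d * S * ?p"
  proof -
    have "0 \<le> ?d * S * ?p" using S by simp
    then show ?thesis by (simp add: algebra_simps)
  qed
  finally show "norm (complex_of_real (\<gamma> j z) - complex_of_real (\<gamma> j v)) \<le> 16 * ?d * S * ?p"
    using comp[of "\<lambda>j. \<gamma> j z - \<gamma> j v" j] by (simp flip: of_real_diff)
qed

section \<open>The equations of a lift and of a difference of lifts\<close>

text \<open>The equations of a lift at one point of the circle, where N is the perturbation of the quadric map, W k m is the
  Wirtinger derivative of the component k of N in the coordinate m, and cv are the conormal multipliers.\<close>

definition lift_at ::
  "('d::finite \<Rightarrow> complex ^ 'n::finite ^ 'n) \<Rightarrow> (complex ^ ('n + 'd) \<Rightarrow> real ^ 'd) \<Rightarrow>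
   ('d \<Rightarrow> 'n + 'd \<Rightarrow> complex ^ ('n + 'd) \<Rightarrow> complex) \<Rightarrow> complex ^ ('n + 'd) \<Rightarrow>
   ('n \<Rightarrow> complex) \<Rightarrow> ('d \<Rightarrow> complex) \<Rightarrow> ('d \<Rightarrow> real) \<Rightarrow> bool" where
  "lift_at A N W x p q cv \<longleftrightarrow>
     (\<forall>j. Re (x $ Inr j) = Re (herm_form (A j) (left_part x)) - N x $ j) \<and>
     (\<forall>j. q j = of_real (cv j) / 2 + (\<Sum>k\<in>UNIV. of_real (cv k) * W k (Inr j) x)) \<and>
     (\<forall>i. p i = - (\<Sum>k\<in>UNIV. of_real (cv k) * (\<Sum>l\<in>UNIV. cnj (x $ Inl l) * A k $ l $ i))
              + (\<Sum>k\<in>UNIV. of_real (cv k) * W k (Inl i) x))"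

text \<open>The three defects are the linear expressions in the increments (u of the base point, uq and up of the covector,
  \<open>\<gamma>\<close> of the multipliers) that vanish on a difference of two lifts. Keeping them as expressions, rather
  than as equations, lets them be evaluated also on differences of such increments.\<close>

definition defect_q where
  "defect_q W MW j x1 x2 cv uq u \<gamma> = uq - complex_of_real (\<gamma> j) / 2
     - (\<Sum>k\<in>UNIV. of_real (\<gamma> k) * W k (Inr j) x1) - (\<Sum>k\<in>UNIV. of_real (cv k) * MW k (Inr j) x1 x2 u)"

definition defect_p where
  "defect_p A W MW i x1 x2 cv up u \<gamma> = up
     + (\<Sum>k\<in>UNIV. complex_of_real (cv k) * (\<Sum>l\<in>UNIV. cnj (u $ Inl l) * A k $ l $ i))
     + (\<Sum>k\<in>UNIV. complex_of_real (\<gamma> k) * (\<Sum>l\<in>UNIV. cnj (x1 $ Inl l) * A k $ l $ i))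
     - (\<Sum>k\<in>UNIV. of_real (\<gamma> k) * W k (Inl i) x1) - (\<Sum>k\<in>UNIV. of_real (cv k) * MW k (Inl i) x1 x2 u)"

definition defect_w where
  "defect_w A MN j x1 x2 u = Re (u $ Inr j)
     - Re (\<Sum>l\<in>UNIV. \<Sum>m\<in>UNIV. cnj (u $ Inl l) * A j $ l $ m * x1 $ Inl m + cnj (x2 $ Inl l) * A j $ l $ m * u $ Inl m)
     + MN x1 x2 u $ j"

lemma herm_form_sum:
  "herm_form M z = (\<Sum>l\<in>UNIV. \<Sum>m\<in>UNIV. cnj (z $ l) * M $ l $ m * z $ m)"
proof -
  have "herm_form M z = (\<Sum>m\<in>UNIV. (\<Sum>l\<in>UNIV. cnj (z $ l) * M $ l $ m) * z $ m)"
    by (simp add: herm_form_def cnj_vec_def vector_matrix_mult_def)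
  also have "\<dots> = (\<Sum>m\<in>UNIV. \<Sum>l\<in>UNIV. cnj (z $ l) * M $ l $ m * z $ m)"
    by (intro sum.cong refl) (simp add: sum_distrib_right)
  also have "\<dots> = (\<Sum>l\<in>UNIV. \<Sum>m\<in>UNIV. cnj (z $ l) * M $ l $ m * z $ m)" by (rule sum.swap)
  finally show ?thesis .
qed

context
  fixes r :: real
begin

lemma scaled_difference_sums:
  fixes w X Y :: "'d \<Rightarrow> complex" and a b :: "'d \<Rightarrow> real" and s t :: complex and p q :: real
  shows "(\<Sum>k\<in>UNIV. of_real ((a k - b k) / r) * w k)
      = of_real (inverse r) * ((\<Sum>k\<in>UNIV. of_real (a k) * w k) - (\<Sum>k\<in>UNIV. of_real (b k) * w k))"
    and "(\<Sum>k\<in>UNIV. of_real (a k) * (of_real (inverse r) * (X k - Y k)))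
      = of_real (inverse r) * ((\<Sum>k\<in>UNIV. of_real (a k) * X k) - (\<Sum>k\<in>UNIV. of_real (a k) * Y k))"
    and "(\<Sum>k\<in>UNIV. of_real (a k) * (X k - Y k)) = (\<Sum>k\<in>UNIV. of_real (a k) * X k) - (\<Sum>k\<in>UNIV. of_real (a k) * Y k)"
    and "(\<Sum>k\<in>UNIV. of_real (a k - b k) * w k) = (\<Sum>k\<in>UNIV. of_real (a k) * w k) - (\<Sum>k\<in>UNIV. of_real (b k) * w k)"
    and "complex_of_real ((p - q) / r) / 2 = of_real (inverse r) * (of_real p / 2 - of_real q / 2)"
    and "(s - t) / of_real r = of_real (inverse r) * (s - t)"
proof -
  show "(\<Sum>k\<in>UNIV. of_real ((a k - b k) / r) * w k)
      = of_real (inverse r) * ((\<Sum>k\<in>UNIV. of_real (a k) * w k) - (\<Sum>k\<in>UNIV. of_real (b k) * w k))"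
    unfolding sum_subtractf[symmetric] sum_distrib_left
    by (intro sum.cong refl) (simp only: divide_inverse of_real_mult of_real_diff, algebra)
  show "(\<Sum>k\<in>UNIV. of_real (a k) * (of_real (inverse r) * (X k - Y k)))
      = of_real (inverse r) * ((\<Sum>k\<in>UNIV. of_real (a k) * X k) - (\<Sum>k\<in>UNIV. of_real (a k) * Y k))"
    unfolding sum_subtractf[symmetric] sum_distrib_left
    by (intro sum.cong refl) algebra
  show "(\<Sum>k\<in>UNIV. of_real (a k) * (X k - Y k)) = (\<Sum>k\<in>UNIV. of_real (a k) * X k) - (\<Sum>k\<in>UNIV. of_real (a k) * Y k)"
    unfolding sum_subtractf[symmetric] by (simp only: right_diff_distrib)
  show "(\<Sum>k\<in>UNIV. of_real (a k - b k) * w k) = (\<Sum>k\<in>UNIV. of_real (a k) * w k) - (\<Sum>k\<in>UNIV. of_real (b k) * w k)"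
    unfolding sum_subtractf[symmetric] by (simp only: left_diff_distrib of_real_diff)
  show "complex_of_real ((p - q) / r) / 2 = of_real (inverse r) * (of_real p / 2 - of_real q / 2)"
    by (simp only: divide_inverse of_real_mult of_real_diff) algebra
  show "(s - t) / of_real r = of_real (inverse r) * (s - t)" by (simp only: divide_inverse of_real_inverse mult.commute)
qed

end

lemma defect_w_pair:
  assumes N: "difference_quotient S D N MN" and x: "x1 \<in> S" "x2 \<in> S"
    and l: "lift_at A N W x1 p1 q1 c1" "lift_at A N W x2 p2 q2 c2"
  shows "defect_w A MN j x1 x2 ((x1 - x2) /\<^sub>R \<sigma>) = 0"
proof -
  have re: "Re (x1 $ Inr j) - Re (x2 $ Inr j)
    = Re (herm_form (A j) (left_part x1) - herm_form (A j) (left_part x2)) - (N x1 - N x2) $ j"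
    using l by (simp add: lift_at_def)
  have form: "herm_form (A j) (left_part x1) - herm_form (A j) (left_part x2)
    = (\<Sum>l\<in>UNIV. \<Sum>m\<in>UNIV. cnj ((x1 - x2) $ Inl l) * A j $ l $ m * x1 $ Inl m + cnj (x2 $ Inl l) * A j $ l $ m * (x1 - x2) $ Inl m)"
    unfolding herm_form_sum sum_subtractf[symmetric]
    by (intro sum.cong refl) (simp add: left_part_def algebra_simps)
  have "N x1 - N x2 = MN x1 x2 (x1 - x2)" by (rule difference_quotientD(4)[OF N x])
  then have "defect_w A MN j x1 x2 (x1 - x2) = 0"
    unfolding defect_w_def form[symmetric] using re by simp
  moreover have "defect_w A MN j x1 x2 (r *\<^sub>R u) = r * defect_w A MN j x1 x2 u" for r u
  proof -
    have "(\<Sum>l\<in>UNIV. \<Sum>m\<in>UNIV. cnj ((r *\<^sub>R u) $ Inl l) * A j $ l $ m * x1 $ Inl m + cnj (x2 $ Inl l) * A j $ l $ m * (r *\<^sub>R u) $ Inl m)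
      = r *\<^sub>R (\<Sum>l\<in>UNIV. \<Sum>m\<in>UNIV. cnj (u $ Inl l) * A j $ l $ m * x1 $ Inl m + cnj (x2 $ Inl l) * A j $ l $ m * u $ Inl m)"
      by (simp add: scaleR_sum_right scaleR_add_right)
    then show ?thesis
      unfolding defect_w_def using linear_scale[OF difference_quotientD(3)[OF N x]] by (simp add: algebra_simps)
  qed
  ultimately show ?thesis by simp
qed

text \<open>The difference of two lifts may be divided by any real number: multipliers stay real.\<close>

lemma defect_q_pair:
  assumes W: "\<And>k m. difference_quotient S D (W k m) (MW k m)" and x: "x1 \<in> S" "x2 \<in> S"
    and l: "lift_at A N W x1 p1 q1 c1" "lift_at A N W x2 p2 q2 c2"
  shows "defect_q W MW j x1 x2 c2 ((q1 j - q2 j) / of_real \<sigma>) ((x1 - x2) /\<^sub>R \<sigma>) (\<lambda>k. (c1 k - c2 k) / \<sigma>) = 0"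
proof -
  have M: "MW k m x1 x2 (x1 - x2) = W k m x1 - W k m x2" for k m
    by (rule difference_quotientD(4)[OF W x, symmetric])
  have s: "MW k m x1 x2 (r *\<^sub>R v) = of_real r * MW k m x1 x2 v" for k m r v
    using linear_scale[OF difference_quotientD(3)[OF W x]] by (simp add: scaleR_conv_of_real)
  have q: "q1 j - q2 j = of_real (c1 j - c2 j) / 2 + (\<Sum>k\<in>UNIV. of_real (c1 k - c2 k) * W k (Inr j) x1)
      + (\<Sum>k\<in>UNIV. of_real (c2 k) * (W k (Inr j) x1 - W k (Inr j) x2))"
  proof -
    have "q1 j = of_real (c1 j) / 2 + (\<Sum>k\<in>UNIV. of_real (c1 k) * W k (Inr j) x1)"
      "q2 j = of_real (c2 j) / 2 + (\<Sum>k\<in>UNIV. of_real (c2 k) * W k (Inr j) x2)"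
      using l unfolding lift_at_def by blast+
    then show ?thesis
      unfolding scaled_difference_sums(3,4) by (simp add: diff_divide_distrib)
  qed
  show ?thesis
    unfolding defect_q_def scaled_difference_sums(5,6) unfolding q s M scaled_difference_sums(1-4)
    by (simp add: right_diff_distrib distrib_left diff_divide_distrib)
qed

lemma defect_p_pair:
  assumes W: "\<And>k m. difference_quotient S D (W k m) (MW k m)" and x: "x1 \<in> S" "x2 \<in> S"
    and l: "lift_at A N W x1 p1 q1 c1" "lift_at A N W x2 p2 q2 c2"
  shows "defect_p A W MW i x1 x2 c2 ((p1 i - p2 i) / of_real \<sigma>) ((x1 - x2) /\<^sub>R \<sigma>) (\<lambda>k. (c1 k - c2 k) / \<sigma>) = 0"
proof -
  have M: "MW k m x1 x2 (x1 - x2) = W k m x1 - W k m x2" for k m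
    by (rule difference_quotientD(4)[OF W x, symmetric])
  have s: "MW k m x1 x2 (r *\<^sub>R v) = of_real r * MW k m x1 x2 v" for k m r v
    using linear_scale[OF difference_quotientD(3)[OF W x]] by (simp add: scaleR_conv_of_real)
  let ?Z = "\<lambda>x k. \<Sum>l\<in>UNIV. cnj (x $ Inl l) * A k $ l $ i"
  have Zs: "?Z (r *\<^sub>R (x1 - x2)) k = of_real r * (?Z x1 k - ?Z x2 k)" for r k
    by (simp add: sum_distrib_left scaleR_conv_of_real[where 'a = complex] algebra_simps sum_subtractf)
  have p: "p1 i - p2 i = - (\<Sum>k\<in>UNIV. of_real (c1 k - c2 k) * ?Z x1 k) - (\<Sum>k\<in>UNIV. of_real (c2 k) * (?Z x1 k - ?Z x2 k))
      + (\<Sum>k\<in>UNIV. of_real (c1 k - c2 k) * W k (Inl i) x1)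
      + (\<Sum>k\<in>UNIV. of_real (c2 k) * (W k (Inl i) x1 - W k (Inl i) x2))"
  proof -
    have "p1 i = - (\<Sum>k\<in>UNIV. of_real (c1 k) * ?Z x1 k) + (\<Sum>k\<in>UNIV. of_real (c1 k) * W k (Inl i) x1)"
      "p2 i = - (\<Sum>k\<in>UNIV. of_real (c2 k) * ?Z x2 k) + (\<Sum>k\<in>UNIV. of_real (c2 k) * W k (Inl i) x2)"
      using l unfolding lift_at_def by blast+
    then show ?thesis
      unfolding scaled_difference_sums(3,4) by simp
  qed
  define X1 where "X1 = ?Z x1"
  define X2 where "X2 = ?Z x2"
  show ?thesis
    unfolding defect_p_def scaled_difference_sums(6) unfolding p s M Zs unfolding X1_def[symmetric] X2_def[symmetric] scaled_difference_sums(1-4)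
    by algebra
qed

text \<open>Subtracting the equations of two increments gives the same linear expression for their difference, up to
  terms in which only the coefficients have been subtracted.\<close>

lemma defect_q_step:
  assumes W: "\<And>k m. difference_quotient S D (W k m) (MW k m)" and x: "x1 \<in> S" "x2 \<in> S"
    and 0: "defect_q W MW j x1 x2 cv uq u \<gamma> = 0" "defect_q W MW j x1' x2' cv' uq' u' \<gamma>' = 0"
  shows "defect_q W MW j x1 x2 cv ((uq' - uq) / of_real \<kappa>) ((u' - u) /\<^sub>R \<kappa>) (\<lambda>k. (\<gamma>' k - \<gamma> k) / \<kappa>)
    = of_real (inverse \<kappa>) * ((\<Sum>k\<in>UNIV. of_real (\<gamma>' k) * (W k (Inr j) x1' - W k (Inr j) x1))
       + (\<Sum>k\<in>UNIV. of_real (cv' k - cv k) * MW k (Inr j) x1' x2' u')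
       + (\<Sum>k\<in>UNIV. of_real (cv k) * (MW k (Inr j) x1' x2' u' - MW k (Inr j) x1 x2 u')))"
proof -
  have s: "MW k m x1 x2 ((v - v') /\<^sub>R \<kappa>) = of_real (inverse \<kappa>) * (MW k m x1 x2 v - MW k m x1 x2 v')" for k m v v'
    using linear_scale[OF difference_quotientD(3)[OF W x]] linear_diff[OF difference_quotientD(3)[OF W x]]
    by (simp add: scaleR_conv_of_real)
  have solve: "p = a + b + c'" if "p - a - b - c' = 0" for p a b c' :: complex
    using that by algebra
  have u: "uq = complex_of_real (\<gamma> j) / 2 + (\<Sum>k\<in>UNIV. of_real (\<gamma> k) * W k (Inr j) x1) + (\<Sum>k\<in>UNIV. of_real (cv k) * MW k (Inr j) x1 x2 u)"
    "uq' = complex_of_real (\<gamma>' j) / 2 + (\<Sum>k\<in>UNIV. of_real (\<gamma>' k) * W k (Inr j) x1') + (\<Sum>k\<in>UNIV. of_real (cv' k) * MW k (Inr j) x1' x2' u')"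
    by (rule solve[OF 0(1)[unfolded defect_q_def]] solve[OF 0(2)[unfolded defect_q_def]])+
  show ?thesis
    unfolding defect_q_def s scaled_difference_sums unfolding u
    by (simp add: right_diff_distrib distrib_left)
qed

lemma defect_p_step:
  assumes W: "\<And>k m. difference_quotient S D (W k m) (MW k m)" and x: "x1 \<in> S" "x2 \<in> S"
    and 0: "defect_p A W MW i x1 x2 cv up u \<gamma> = 0" "defect_p A W MW i x1' x2' cv' up' u' \<gamma>' = 0"
  shows "defect_p A W MW i x1 x2 cv ((up' - up) / of_real \<kappa>) ((u' - u) /\<^sub>R \<kappa>) (\<lambda>k. (\<gamma>' k - \<gamma> k) / \<kappa>)
    = of_real (inverse \<kappa>) * ((\<Sum>k\<in>UNIV. of_real (\<gamma>' k) * (W k (Inl i) x1' - W k (Inl i) x1))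
       + (\<Sum>k\<in>UNIV. of_real (cv' k - cv k) * MW k (Inl i) x1' x2' u')
       + (\<Sum>k\<in>UNIV. of_real (cv k) * (MW k (Inl i) x1' x2' u' - MW k (Inl i) x1 x2 u'))
       - (\<Sum>k\<in>UNIV. of_real (cv' k - cv k) * (\<Sum>l\<in>UNIV. cnj (u' $ Inl l) * A k $ l $ i))
       - (\<Sum>k\<in>UNIV. of_real (\<gamma>' k) * (\<Sum>l\<in>UNIV. cnj ((x1' - x1) $ Inl l) * A k $ l $ i)))"
proof -
  have s: "MW k m x1 x2 ((v - v') /\<^sub>R \<kappa>) = of_real (inverse \<kappa>) * (MW k m x1 x2 v - MW k m x1 x2 v')" for k m v v'
    using linear_scale[OF difference_quotientD(3)[OF W x]] linear_diff[OF difference_quotientD(3)[OF W x]]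
    by (simp add: scaleR_conv_of_real)
  let ?Z = "\<lambda>x k. \<Sum>l\<in>UNIV. cnj (x $ Inl l) * A k $ l $ i"
  have Zs: "?Z ((v - v') /\<^sub>R \<kappa>) k = of_real (inverse \<kappa>) * (?Z v k - ?Z v' k)" "?Z (v - v') k = ?Z v k - ?Z v' k" for v v' k
    by (simp_all add: sum_distrib_left scaleR_conv_of_real[where 'a = complex] algebra_simps sum_subtractf)
  have solve: "p = - a - b + c' + d" if "p + a + b - c' - d = 0" for p a b c' d :: complex
    using that by algebra
  have u: "up = - (\<Sum>k\<in>UNIV. of_real (cv k) * ?Z u k) - (\<Sum>k\<in>UNIV. of_real (\<gamma> k) * ?Z x1 k)
      + (\<Sum>k\<in>UNIV. of_real (\<gamma> k) * W k (Inl i) x1) + (\<Sum>k\<in>UNIV. of_real (cv k) * MW k (Inl i) x1 x2 u)"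
    "up' = - (\<Sum>k\<in>UNIV. of_real (cv' k) * ?Z u' k) - (\<Sum>k\<in>UNIV. of_real (\<gamma>' k) * ?Z x1' k)
      + (\<Sum>k\<in>UNIV. of_real (\<gamma>' k) * W k (Inl i) x1') + (\<Sum>k\<in>UNIV. of_real (cv' k) * MW k (Inl i) x1' x2' u')"
    by (rule solve[OF 0(1)[unfolded defect_p_def]] solve[OF 0(2)[unfolded defect_p_def]])+
  define Z where "Z = ?Z"
  show ?thesis
    unfolding defect_p_def s Zs unfolding Z_def[symmetric] scaled_difference_sums unfolding u Z_def[symmetric]
    by algebra
qed

lemma defect_w_step:
  fixes x1 x2 x1' x2' u u' :: "complex ^ ('n::finite + 'd::finite)"
  assumes N: "difference_quotient S D N MN" and x: "x1 \<in> S" "x2 \<in> S"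
    and 0: "defect_w A MN j x1 x2 u = 0" "defect_w A MN j x1' x2' u' = 0"
  shows "defect_w A MN j x1 x2 ((u' - u) /\<^sub>R \<kappa>) = inverse \<kappa> *
    (Re (\<Sum>l\<in>UNIV. \<Sum>m\<in>UNIV. A j $ l $ m * (cnj (u' $ Inl l) * (x1' - x1) $ Inl m)
        + A j $ l $ m * (cnj ((x2' - x2) $ Inl l) * u' $ Inl m))
     - (MN x1' x2' u' - MN x1 x2 u') $ j)"
proof -
  let ?H = "\<lambda>(x1 :: complex ^ ('n + 'd)) (x2 :: complex ^ ('n + 'd)) (u :: complex ^ ('n + 'd)).
     \<Sum>l\<in>UNIV. \<Sum>m\<in>UNIV. cnj (u $ Inl l) * A j $ l $ m * x1 $ Inl m + cnj (x2 $ Inl l) * A j $ l $ m * u $ Inl m"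
  have Hs: "?H x1 x2 (r *\<^sub>R v) = r *\<^sub>R ?H x1 x2 v" for r v
    by (simp add: scaleR_sum_right scaleR_add_right)
  have Hd: "?H x1 x2 (v - v') = ?H x1 x2 v - ?H x1 x2 v'" for v v'
    unfolding sum_subtractf[symmetric] by (intro sum.cong refl) (simp add: algebra_simps)
  have He: "?H x1' x2' u' - ?H x1 x2 u' = (\<Sum>l\<in>UNIV. \<Sum>m\<in>UNIV. A j $ l $ m * (cnj (u' $ Inl l) * (x1' - x1) $ Inl m)
        + A j $ l $ m * (cnj ((x2' - x2) $ Inl l) * u' $ Inl m))"
    unfolding sum_subtractf[symmetric] by (intro sum.cong refl) (simp add: algebra_simps)
  define H where "H = ?H"
  have Hs': "H x1 x2 (r *\<^sub>R v) = r *\<^sub>R H x1 x2 v" for r v unfolding H_def by (rule Hs)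
  have Hd': "H x1 x2 (v - v') = H x1 x2 v - H x1 x2 v'" for v v' unfolding H_def by (rule Hd)
  have He': "H x1' x2' u' - H x1 x2 u' = (\<Sum>l\<in>UNIV. \<Sum>m\<in>UNIV. A j $ l $ m * (cnj (u' $ Inl l) * (x1' - x1) $ Inl m)
        + A j $ l $ m * (cnj ((x2' - x2) $ Inl l) * u' $ Inl m))" unfolding H_def by (rule He)
  have D: "defect_w A MN j y1 y2 v = Re (v $ Inr j) - Re (H y1 y2 v) + MN y1 y2 v $ j" for y1 y2 v
    by (simp only: defect_w_def H_def)
  have M: "MN x1 x2 ((v - v') /\<^sub>R \<kappa>) = (MN x1 x2 v - MN x1 x2 v') /\<^sub>R \<kappa>" for v v'
    using linear_scale[OF difference_quotientD(3)[OF N x]] linear_diff[OF difference_quotientD(3)[OF N x]] by simp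
  have h: "Re (u $ Inr j) = Re (H x1 x2 u) - MN x1 x2 u $ j" "Re (u' $ Inr j) = Re (H x1' x2' u') - MN x1' x2' u' $ j"
    using 0 unfolding D by linarith+
  show ?thesis
    unfolding He'[symmetric] D M Hs' Hd'
    by (simp add: h algebra_simps)
qed

section \<open>The a priori estimate for small perturbations\<close>

text \<open>The constants K and \<open>\<epsilon>\<close> depend on \<open>\<alpha>\<close>, the bound L for the base discs, and the quadric with its multiplier.
  The bound S0 of the increments does not enter the conclusion; its finiteness is what makes absorption possible.\<close>

locale perturbation_estimate =
  fixes \<alpha> L K \<epsilon> :: real and A :: "'d::finite \<Rightarrow> complex ^ 'n::finite ^ 'n" and c :: "real ^ 'd"
  assumes exponent: "0 < \<alpha>" "\<alpha> < 1" and constants: "0 \<le> L" "0 \<le> K" "0 < \<epsilon>" "\<epsilon> \<le> 1"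
    and invertible_step: "real CARD('d) * (\<epsilon> * (1 + L)) \<le> 1 / 4"
    and estimate:
    "\<And>\<Gamma> S (N :: complex ^ ('n + 'd) \<Rightarrow> real ^ 'd) MN W MW E J f1 f2 cv u \<gamma> x y a b ep eq S0.
      \<lbrakk>sphere 0 1 - {1} \<subseteq> \<Gamma>; \<Gamma> \<subseteq> sphere 0 1; 0 \<le> E; 0 \<le> J;
       difference_quotient S \<epsilon> N MN; \<And>k m. difference_quotient S \<epsilon> (W k m) (MW k m);
       \<And>\<zeta>. \<zeta> \<in> \<Gamma> \<Longrightarrow> f1 \<zeta> \<in> S; \<And>\<zeta>. \<zeta> \<in> \<Gamma> \<Longrightarrow> f2 \<zeta> \<in> S;
       holder_bound \<alpha> \<Gamma> L f1; holder_bound \<alpha> \<Gamma> L f2;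
       \<And>k. holder_bound \<alpha> \<Gamma> \<epsilon> (\<lambda>\<zeta>. complex_of_real (cv \<zeta> k - c $ k));
       \<And>i. x i \<in> disc_algebra; \<And>i. y i \<in> disc_algebra;
       \<And>j. a j \<in> disc_algebra; \<And>j. b j \<in> disc_algebra;
       \<And>\<zeta> i. \<zeta> \<in> \<Gamma> \<Longrightarrow> u \<zeta> $ Inl i = x i \<zeta>; \<And>\<zeta> j. \<zeta> \<in> \<Gamma> \<Longrightarrow> u \<zeta> $ Inr j = a j \<zeta>;
       \<And>j. holder_bound \<alpha> \<Gamma> E (\<lambda>\<zeta>. defect_q W MW j (f1 \<zeta>) (f2 \<zeta>) (cv \<zeta>) (b j \<zeta> + eq j \<zeta>) (u \<zeta>) (\<gamma> \<zeta>));
       \<And>i. holder_bound \<alpha> \<Gamma> E (\<lambda>\<zeta>. defect_p A W MW i (f1 \<zeta>) (f2 \<zeta>) (cv \<zeta>) (y i \<zeta> + ep i \<zeta>) (u \<zeta>) (\<gamma> \<zeta>));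
       \<And>j. holder_bound \<alpha> \<Gamma> E (\<lambda>\<zeta>. defect_w A MN j (f1 \<zeta>) (f2 \<zeta>) (u \<zeta>));
       \<And>i. holder_bound \<alpha> \<Gamma> J (ep i); \<And>j. holder_bound \<alpha> \<Gamma> J (eq j);
       \<And>j. cmod (a j 0) \<le> J; \<And>i. cmod (x i 0) \<le> J; \<And>j. \<exists>p\<in>cball 0 1. cmod (b j p) \<le> J;
       0 \<le> S0; holder_bound \<alpha> \<Gamma> S0 u; \<And>k. holder_bound \<alpha> \<Gamma> S0 (\<lambda>\<zeta>. complex_of_real (\<gamma> \<zeta> k))\<rbrakk>
     \<Longrightarrow> (\<forall>i. holder_bound \<alpha> \<Gamma> (K * (E + J)) (x i)) \<and> (\<forall>i. holder_bound \<alpha> \<Gamma> (K * (E + J)) (y i))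
       \<and> (\<forall>j. holder_bound \<alpha> \<Gamma> (K * (E + J)) (a j)) \<and> (\<forall>j. holder_bound \<alpha> \<Gamma> (K * (E + J)) (b j))"

text \<open>Replacing the coefficients by those of the quadric with constant multiplier changes the defects by
  \<open>\<epsilon>\<close> times the current bound of the increments. For small \<open>\<epsilon>\<close> this is absorbed in \<open>linear_estimate\<close>.\<close>

lemma small_perturbation_estimate:
  fixes A :: "'d::finite \<Rightarrow> complex ^ 'n::finite ^ 'n" and c :: "real ^ 'd"
  assumes \<alpha>: "0 < \<alpha>" "\<alpha> < 1"
    and herm: "\<And>j. hermitian (A j)"
    and inv: "invertible (\<Sum>j\<in>UNIV. c $ j *\<^sub>R A j)"
    and L: "0 \<le> L"
  obtains K \<epsilon> where "perturbation_estimate \<alpha> L K \<epsilon> A c"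
proof (rule linear_estimate[OF \<alpha> herm inv L], goal_cases)
  case (1 KL)
  note KL = 1(2) and LE = 1(3)
  define M where "M = (\<Sum>j\<in>UNIV. \<Sum>l\<in>UNIV. norm (A j $ l)) + norm c"
  have MA: "cmod (A j $ l $ m) \<le> M" for j l m
  proof -
    have "cmod (A j $ l $ m) \<le> norm (A j $ l)" by (rule Finite_Cartesian_Product.norm_nth_le)
    also have "\<dots> \<le> (\<Sum>l\<in>UNIV. norm (A j $ l))" by (rule member_le_sum) auto
    also have "\<dots> \<le> (\<Sum>j\<in>UNIV. \<Sum>l\<in>UNIV. norm (A j $ l))"
      by (rule member_le_sum[where f = "\<lambda>j. \<Sum>l\<in>UNIV. norm (A j $ l)"]) (auto intro!: sum_nonneg)
    finally show ?thesis unfolding M_def using norm_ge_zero[of c] by linarith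
  qed
  have M: "0 \<le> M" by (rule order_trans[OF norm_ge_zero MA])
  have Mc: "\<bar>c $ k\<bar> \<le> M" for k
  proof -
    have "0 \<le> (\<Sum>j\<in>UNIV. \<Sum>l\<in>UNIV. norm (A j $ l))" by (intro sum_nonneg norm_ge_zero)
    then show ?thesis unfolding M_def using component_le_norm_cart[of c k] by linarith
  qed
  let ?n = "real CARD('n)" and ?d = "real CARD('d)" and ?m = "real CARD('n + 'd)"
  define CQ where "CQ = ?d * (2 * (1 + L)) + ?d * (2 * (1 + M) * (1 + 2 * L))"
  define C where "C = CQ + ?d * (2 * (?n * M)) + (1 + 2 * L)"
  have C: "0 \<le> CQ" "CQ + ?d * (2 * (?n * M)) \<le> C" "1 + 2 * L \<le> C" "CQ \<le> C" "0 \<le> C"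
    using L M by (auto simp: C_def CQ_def)
  define \<epsilon> where "\<epsilon> = 1 / (1 + 2 * (?m * KL * C) + 4 * (?d * (1 + L)))"
  have dL: "0 \<le> ?d * (1 + L)" using L by simp
  have den: "0 \<le> ?m * KL * C" using KL C by simp
  have \<epsilon>: "0 < \<epsilon>" "\<epsilon> \<le> 1" using den dL by (auto simp: \<epsilon>_def simp del: of_nat_mult)
  define \<theta> where "\<theta> = ?m * KL * C * \<epsilon>"
  have \<theta>: "0 \<le> \<theta>" "\<theta> \<le> 1 / 2"
  proof -
    have frac: "0 \<le> X * (1 / (1 + 2 * X + 4 * Y)) \<and> X * (1 / (1 + 2 * X + 4 * Y)) \<le> 1 / 2" if "0 \<le> X" "0 \<le> Y" for X Y :: real
      using that by (simp add: divide_simps)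
    show "0 \<le> \<theta>" "\<theta> \<le> 1 / 2" using frac[OF den dL] by (simp_all only: \<theta>_def \<epsilon>_def)
  qed
  show thesis
  proof (rule that[of "2 * KL" \<epsilon>], unfold_locales)
    show "0 < \<alpha>" "\<alpha> < 1" "0 \<le> L" "0 \<le> 2 * KL" "0 < \<epsilon>" "\<epsilon> \<le> 1" using \<alpha> L KL \<epsilon> by auto
    show "?d * (\<epsilon> * (1 + L)) \<le> 1 / 4"
    proof -
      have frac: "Y * (1 / (1 + 2 * X + 4 * Y)) \<le> 1 / 4" if "0 \<le> X" "0 \<le> Y" for X Y :: real
        using that by (simp add: divide_simps)
      have "?d * (\<epsilon> * (1 + L)) = (?d * (1 + L)) * \<epsilon>" by (simp only: mult_ac)
      then show ?thesis using frac[OF den dL] by (simp only: \<epsilon>_def)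
    qed
    fix \<Gamma> S and N :: "complex ^ ('n + 'd) \<Rightarrow> real ^ 'd" and MN W MW E J f1 f2 cv u \<gamma> x y a b ep eq S0
    assume \<Gamma>: "sphere 0 1 - {1} \<subseteq> \<Gamma>" "\<Gamma> \<subseteq> sphere 0 1" and E: "0 \<le> E" and J: "0 \<le> J"
      and N: "difference_quotient S \<epsilon> N MN" and W: "\<And>k m. difference_quotient S \<epsilon> (W k m) (MW k m)"
      and f: "\<And>\<zeta>. \<zeta> \<in> \<Gamma> \<Longrightarrow> f1 \<zeta> \<in> S" "\<And>\<zeta>. \<zeta> \<in> \<Gamma> \<Longrightarrow> f2 \<zeta> \<in> S"
      and fL: "holder_bound \<alpha> \<Gamma> L f1" "holder_bound \<alpha> \<Gamma> L f2"
      and cv: "\<And>k. holder_bound \<alpha> \<Gamma> \<epsilon> (\<lambda>\<zeta>. complex_of_real (cv \<zeta> k - c $ k))"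
      and DA: "\<And>i. x i \<in> disc_algebra" "\<And>i. y i \<in> disc_algebra" "\<And>j. a j \<in> disc_algebra" "\<And>j. b j \<in> disc_algebra"
      and ux: "\<And>\<zeta> i. \<zeta> \<in> \<Gamma> \<Longrightarrow> u \<zeta> $ Inl i = x i \<zeta>" and ua: "\<And>\<zeta> j. \<zeta> \<in> \<Gamma> \<Longrightarrow> u \<zeta> $ Inr j = a j \<zeta>"
      and eQ: "\<And>j. holder_bound \<alpha> \<Gamma> E (\<lambda>\<zeta>. defect_q W MW j (f1 \<zeta>) (f2 \<zeta>) (cv \<zeta>) (b j \<zeta> + eq j \<zeta>) (u \<zeta>) (\<gamma> \<zeta>))"
      and eP: "\<And>i. holder_bound \<alpha> \<Gamma> E (\<lambda>\<zeta>. defect_p A W MW i (f1 \<zeta>) (f2 \<zeta>) (cv \<zeta>) (y i \<zeta> + ep i \<zeta>) (u \<zeta>) (\<gamma> \<zeta>))"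
      and eW: "\<And>j. holder_bound \<alpha> \<Gamma> E (\<lambda>\<zeta>. defect_w A MN j (f1 \<zeta>) (f2 \<zeta>) (u \<zeta>))"
      and ep: "\<And>i. holder_bound \<alpha> \<Gamma> J (ep i)" and eq: "\<And>j. holder_bound \<alpha> \<Gamma> J (eq j)"
      and a0: "\<And>j. cmod (a j 0) \<le> J" and x0: "\<And>i. cmod (x i 0) \<le> J" and b0: "\<And>j. \<exists>p\<in>cball 0 1. cmod (b j p) \<le> J"
      and S0: "0 \<le> S0" "holder_bound \<alpha> \<Gamma> S0 u" "\<And>k. holder_bound \<alpha> \<Gamma> S0 (\<lambda>\<zeta>. complex_of_real (\<gamma> \<zeta> k))"
    have cvM: "holder_bound \<alpha> \<Gamma> (1 + M) (\<lambda>\<zeta>. complex_of_real (cv \<zeta> k))" for k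
    proof -
      have "holder_bound \<alpha> \<Gamma> (\<epsilon> + M) (\<lambda>\<zeta>. complex_of_real (cv \<zeta> k - c $ k) + of_real (c $ k))"
        by (intro holder_bound_add cv holder_bound_const) (simp add: Mc)
      then show ?thesis by (auto intro: holder_bound_mono simp: \<epsilon>)
    qed
    have core: "(\<forall>i. holder_bound \<alpha> \<Gamma> (KL * (E + \<epsilon> * C * S1 + J)) (x i)) \<and> (\<forall>i. holder_bound \<alpha> \<Gamma> (KL * (E + \<epsilon> * C * S1 + J)) (y i))
       \<and> (\<forall>j. holder_bound \<alpha> \<Gamma> (KL * (E + \<epsilon> * C * S1 + J)) (a j)) \<and> (\<forall>j. holder_bound \<alpha> \<Gamma> (KL * (E + \<epsilon> * C * S1 + J)) (b j))
       \<and> (\<forall>j. holder_bound \<alpha> \<Gamma> (KL * (E + \<epsilon> * C * S1 + J)) (\<lambda>\<zeta>. complex_of_real (\<gamma> \<zeta> j)))"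
      if S1: "0 \<le> S1" and u: "holder_bound \<alpha> \<Gamma> S1 u" and \<gamma>: "\<And>k. holder_bound \<alpha> \<Gamma> S1 (\<lambda>\<zeta>. complex_of_real (\<gamma> \<zeta> k))" for S1
    proof -
      let ?Wt = "\<lambda>m \<zeta>. (\<Sum>k\<in>UNIV. of_real (\<gamma> \<zeta> k) * W k m (f1 \<zeta>)) + (\<Sum>k\<in>UNIV. of_real (cv \<zeta> k) * MW k m (f1 \<zeta>) (f2 \<zeta>) (u \<zeta>))"
      have Wt: "holder_bound \<alpha> \<Gamma> (\<epsilon> * CQ * S1) (?Wt m)" for m
      proof -
        have "holder_bound \<alpha> \<Gamma> (?d * (2 * S1 * (\<epsilon> * (1 + L))) + ?d * (2 * (1 + M) * (\<epsilon> * S1 * (1 + 2 * L)))) (?Wt m)"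
          by (intro holder_bound_add holder_bound_sum holder_bound_mult \<gamma> cvM
              holder_bound_compose[OF W fL(1) f(1)] holder_bound_difference_quotient[OF W fL(1) f(1) fL(2) f(2) u])
        then show ?thesis by (rule holder_bound_mono) (simp add: CQ_def algebra_simps)
      qed
      have \<epsilon>S: "0 \<le> \<epsilon> * S1" using \<epsilon> S1 by simp
      have CS: "\<epsilon> * X * S1 \<le> \<epsilon> * C * S1" if "X \<le> C" for X
        using mult_right_mono[OF that \<epsilon>S] by (simp add: mult_ac)
      show ?thesis
      proof (rule LE[where ?z1.0 = "\<lambda>i \<zeta>. f1 \<zeta> $ Inl i" and ?z2.0 = "\<lambda>i \<zeta>. f2 \<zeta> $ Inl i" and \<gamma> = "\<lambda>j \<zeta>. \<gamma> \<zeta> j", OF \<Gamma>])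
        show "0 \<le> E + \<epsilon> * C * S1" using E \<epsilon> C S1 by simp
        show "holder_bound \<alpha> \<Gamma> L (\<lambda>\<zeta>. f1 \<zeta> $ Inl i)" "holder_bound \<alpha> \<Gamma> L (\<lambda>\<zeta>. f2 \<zeta> $ Inl i)" for i
          by (intro holder_bound_component fL)+
        show "holder_bound \<alpha> \<Gamma> (E + \<epsilon> * C * S1) (\<lambda>\<zeta>. b j \<zeta> + eq j \<zeta> - complex_of_real (\<gamma> \<zeta> j) / 2)" for j
        proof -
          have "holder_bound \<alpha> \<Gamma> (E + \<epsilon> * CQ * S1) (\<lambda>\<zeta>. b j \<zeta> + eq j \<zeta> - complex_of_real (\<gamma> \<zeta> j) / 2)"
            by (rule holder_bound_cong[OF holder_bound_add[OF eQ[of j] Wt[of "Inr j"]]]) (simp add: defect_q_def)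
          then show ?thesis by (rule holder_bound_mono) (use CS[OF C(4)] in linarith)
        qed
        show "holder_bound \<alpha> \<Gamma> (E + \<epsilon> * C * S1) (\<lambda>\<zeta>. y i \<zeta> + ep i \<zeta>
          + (\<Sum>k\<in>UNIV. of_real (c $ k) * (\<Sum>l\<in>UNIV. cnj (x l \<zeta>) * A k $ l $ i))
          + (\<Sum>k\<in>UNIV. of_real (\<gamma> \<zeta> k) * (\<Sum>l\<in>UNIV. cnj (f1 \<zeta> $ Inl l) * A k $ l $ i)))" for i
        proof -
          have "holder_bound \<alpha> \<Gamma> (E + \<epsilon> * CQ * S1 + ?d * (2 * \<epsilon> * (?n * (M * S1))))
            (\<lambda>\<zeta>. defect_p A W MW i (f1 \<zeta>) (f2 \<zeta>) (cv \<zeta>) (y i \<zeta> + ep i \<zeta>) (u \<zeta>) (\<gamma> \<zeta>) + ?Wt (Inl i) \<zeta>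
              - (\<Sum>k\<in>UNIV. of_real (cv \<zeta> k - c $ k) * (\<Sum>l\<in>UNIV. A k $ l $ i * cnj (u \<zeta> $ Inl l))))"
            by (intro holder_bound_diff holder_bound_add eP Wt holder_bound_sum holder_bound_mult cv
                holder_bound_cmult holder_bound_cnj holder_bound_component u MA)
          then have "holder_bound \<alpha> \<Gamma> (E + \<epsilon> * CQ * S1 + ?d * (2 * \<epsilon> * (?n * (M * S1)))) (\<lambda>\<zeta>. y i \<zeta> + ep i \<zeta>
          + (\<Sum>k\<in>UNIV. of_real (c $ k) * (\<Sum>l\<in>UNIV. cnj (x l \<zeta>) * A k $ l $ i))
          + (\<Sum>k\<in>UNIV. of_real (\<gamma> \<zeta> k) * (\<Sum>l\<in>UNIV. cnj (f1 \<zeta> $ Inl l) * A k $ l $ i)))"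
          proof (rule holder_bound_cong)
            fix \<zeta> assume \<zeta>: "\<zeta> \<in> \<Gamma>"
            have comm: "(\<Sum>l\<in>UNIV. A k $ l $ i * cnj (x l \<zeta>)) = (\<Sum>l\<in>UNIV. cnj (x l \<zeta>) * A k $ l $ i)" for k
              by (simp add: mult.commute)
            show "y i \<zeta> + ep i \<zeta>
              + (\<Sum>k\<in>UNIV. of_real (c $ k) * (\<Sum>l\<in>UNIV. cnj (x l \<zeta>) * A k $ l $ i))
              + (\<Sum>k\<in>UNIV. of_real (\<gamma> \<zeta> k) * (\<Sum>l\<in>UNIV. cnj (f1 \<zeta> $ Inl l) * A k $ l $ i))
              = defect_p A W MW i (f1 \<zeta>) (f2 \<zeta>) (cv \<zeta>) (y i \<zeta> + ep i \<zeta>) (u \<zeta>) (\<gamma> \<zeta>) + ?Wt (Inl i) \<zeta>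
              - (\<Sum>k\<in>UNIV. of_real (cv \<zeta> k - c $ k) * (\<Sum>l\<in>UNIV. A k $ l $ i * cnj (u \<zeta> $ Inl l)))"
              unfolding defect_p_def ux[OF \<zeta>] comm scaled_difference_sums(4) by simp
          qed
          then show ?thesis
          proof (rule holder_bound_mono)
            have "\<epsilon> * (CQ + ?d * (2 * (?n * M))) * S1 \<le> \<epsilon> * C * S1" by (rule CS[OF C(2)])
            then show "E + \<epsilon> * CQ * S1 + ?d * (2 * \<epsilon> * (?n * (M * S1))) \<le> E + \<epsilon> * C * S1"
              by (simp add: algebra_simps)
          qed
        qed
        show "holder_bound \<alpha> \<Gamma> (E + \<epsilon> * C * S1) (\<lambda>\<zeta>. Re (a j \<zeta>)
          - Re (\<Sum>l\<in>UNIV. \<Sum>m\<in>UNIV. cnj (x l \<zeta>) * A j $ l $ m * f1 \<zeta> $ Inl m + cnj (f2 \<zeta> $ Inl l) * A j $ l $ m * x m \<zeta>))" for j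
        proof -
          have "holder_bound \<alpha> \<Gamma> (E + \<epsilon> * S1 * (1 + 2 * L)) (\<lambda>\<zeta>. defect_w A MN j (f1 \<zeta>) (f2 \<zeta>) (u \<zeta>) - MN (f1 \<zeta>) (f2 \<zeta>) (u \<zeta>) $ j)"
            by (intro holder_bound_diff eW holder_bound_component[OF holder_bound_difference_quotient[OF N fL(1) f(1) fL(2) f(2) u]])
          then have "holder_bound \<alpha> \<Gamma> (E + \<epsilon> * S1 * (1 + 2 * L)) (\<lambda>\<zeta>. Re (a j \<zeta>)
            - Re (\<Sum>l\<in>UNIV. \<Sum>m\<in>UNIV. cnj (x l \<zeta>) * A j $ l $ m * f1 \<zeta> $ Inl m + cnj (f2 \<zeta> $ Inl l) * A j $ l $ m * x m \<zeta>))"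
            by (rule holder_bound_cong) (simp add: defect_w_def ux ua)
          then show ?thesis
            by (rule holder_bound_mono) (use CS[OF C(3)] in \<open>simp add: mult_ac\<close>)
        qed
      qed (rule DA J ep eq a0 x0 b0)+
    qed
    define E' where "E' = ?m * KL * (E + J)"
    have E': "0 \<le> E'" using KL E J by (simp add: E'_def)
    have "holder_bound \<alpha> \<Gamma> (E' / (1 - \<theta>)) u \<and> (\<forall>k. holder_bound \<alpha> \<Gamma> (E' / (1 - \<theta>)) (\<lambda>\<zeta>. complex_of_real (\<gamma> \<zeta> k)))"
    proof (rule absorb_small_multiple[where P = "\<lambda>S. holder_bound \<alpha> \<Gamma> S u \<and> (\<forall>k. holder_bound \<alpha> \<Gamma> S (\<lambda>\<zeta>. complex_of_real (\<gamma> \<zeta> k)))"])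
      show "holder_bound \<alpha> \<Gamma> s u \<and> (\<forall>k. holder_bound \<alpha> \<Gamma> s (\<lambda>\<zeta>. complex_of_real (\<gamma> \<zeta> k)))"
        if "\<And>n. holder_bound \<alpha> \<Gamma> (S n) u \<and> (\<forall>k. holder_bound \<alpha> \<Gamma> (S n) (\<lambda>\<zeta>. complex_of_real (\<gamma> \<zeta> k)))" "S \<longlonglongrightarrow> s" for S s
        using holder_bound_closed[OF _ that(2), of \<alpha> \<Gamma> u] holder_bound_closed[OF _ that(2), of \<alpha> \<Gamma>] that(1) by blast
      show "holder_bound \<alpha> \<Gamma> (\<theta> * S1 + E') u \<and> (\<forall>k. holder_bound \<alpha> \<Gamma> (\<theta> * S1 + E') (\<lambda>\<zeta>. complex_of_real (\<gamma> \<zeta> k)))"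
        if S1: "0 \<le> S1" and P: "holder_bound \<alpha> \<Gamma> S1 u \<and> (\<forall>k. holder_bound \<alpha> \<Gamma> S1 (\<lambda>\<zeta>. complex_of_real (\<gamma> \<zeta> k)))" for S1
      proof -
        let ?B = "KL * (E + \<epsilon> * C * S1 + J)"
        note co = core[OF S1 conjunct1[OF P] spec[OF conjunct2[OF P]]]
        have Beq: "?m * ?B = \<theta> * S1 + E'" by (simp add: \<theta>_def E'_def algebra_simps)
        have "holder_bound \<alpha> \<Gamma> ?B (\<lambda>\<zeta>. u \<zeta> $ s)" for s
        proof (cases s)
          case (Inl i)
          have "holder_bound \<alpha> \<Gamma> ?B (x i)" using co by blast
          then show ?thesis by (rule holder_bound_cong) (simp add: Inl ux)
        next
          case (Inr j)
          have "holder_bound \<alpha> \<Gamma> ?B (a j)" using co by blast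
          then show ?thesis by (rule holder_bound_cong) (simp add: Inr ua)
        qed
        then have "holder_bound \<alpha> \<Gamma> (?m * ?B) u" by (rule holder_bound_vec)
        moreover have "?B \<le> ?m * ?B"
        proof -
          have "0 \<le> ?B" using KL E J \<epsilon> C S1 by simp
          moreover have "1 \<le> ?m"
          proof -
            have "Suc 0 \<le> CARD('n + 'd)" by (rule Suc_leI[OF zero_less_card_finite])
            then have "real (Suc 0) \<le> ?m" by (rule of_nat_mono)
            then show ?thesis by (simp only: of_nat_1 One_nat_def[symmetric])
          qed
          ultimately show ?thesis using mult_right_mono[of 1 ?m ?B] by simp
        qed
        then have "holder_bound \<alpha> \<Gamma> (?m * ?B) (\<lambda>\<zeta>. complex_of_real (\<gamma> \<zeta> k))" for k
          using co holder_bound_mono by blast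
        ultimately show ?thesis unfolding Beq by blast
      qed
    qed (use S0 \<theta> E' in auto)
    then have fin: "holder_bound \<alpha> \<Gamma> (2 * E') u" "\<And>k. holder_bound \<alpha> \<Gamma> (2 * E') (\<lambda>\<zeta>. complex_of_real (\<gamma> \<zeta> k))"
    proof -
      have "E' / (1 - \<theta>) \<le> E' / (1 / 2)" using \<theta> E' by (intro divide_left_mono) auto
      then have le: "E' / (1 - \<theta>) \<le> 2 * E'" by simp
      assume "holder_bound \<alpha> \<Gamma> (E' / (1 - \<theta>)) u \<and> (\<forall>k. holder_bound \<alpha> \<Gamma> (E' / (1 - \<theta>)) (\<lambda>\<zeta>. complex_of_real (\<gamma> \<zeta> k)))"
      then show "holder_bound \<alpha> \<Gamma> (2 * E') u" "\<And>k. holder_bound \<alpha> \<Gamma> (2 * E') (\<lambda>\<zeta>. complex_of_real (\<gamma> \<zeta> k))"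
        using holder_bound_mono[OF _ le] by blast+
    qed
    have "0 \<le> 2 * E'" using E' by simp
    note co = core[OF this fin]
    have le: "KL * (E + \<epsilon> * C * (2 * E') + J) \<le> 2 * KL * (E + J)"
    proof -
      have "\<epsilon> * C * (2 * E') = 2 * \<theta> * (E + J)" by (simp add: \<theta>_def E'_def)
      also have "\<dots> \<le> 1 * (E + J)" using \<theta> E J by (intro mult_right_mono) auto
      finally have "E + \<epsilon> * C * (2 * E') + J \<le> 2 * (E + J)" by simp
      from mult_left_mono[OF this KL] show ?thesis by (simp only: mult.assoc mult.left_commute)
    qed
    show "(\<forall>i. holder_bound \<alpha> \<Gamma> (2 * KL * (E + J)) (x i)) \<and> (\<forall>i. holder_bound \<alpha> \<Gamma> (2 * KL * (E + J)) (y i))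
       \<and> (\<forall>j. holder_bound \<alpha> \<Gamma> (2 * KL * (E + J)) (a j)) \<and> (\<forall>j. holder_bound \<alpha> \<Gamma> (2 * KL * (E + J)) (b j))"
      using co holder_bound_mono[OF _ le] by blast
  qed
qed

section \<open>Rotation quotients of lifts\<close>

definition C2_holder_disc :: "real \<Rightarrow> (complex \<Rightarrow> complex) \<Rightarrow> bool" where
  "C2_holder_disc \<alpha> g \<longleftrightarrow> (\<exists>g1 g2 C. 0 \<le> C \<and>
     (\<forall>z\<in>cball 0 1. (g has_field_derivative g1 z) (at z within cball 0 1)) \<and>
     (\<forall>z\<in>cball 0 1. (g1 has_field_derivative g2 z) (at z within cball 0 1)) \<and>
     (\<forall>z\<in>cball 0 1. \<forall>w\<in>cball 0 1. cmod (g2 z - g2 w) \<le> C * cmod (z - w) powr \<alpha>))"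

lemma lipschitz_imp_holder:
  assumes "0 < \<alpha>" "\<alpha> < 1" "0 \<le> M" "z \<in> cball (0::complex) 1" "w \<in> cball 0 1"
  shows "M * cmod (z - w) \<le> 2 * M * cmod (z - w) powr \<alpha>"
proof (cases "z = w")
  case False
  have "cmod (z - w) \<le> 2" using norm_triangle_ineq4[of z w] assms(4,5) by simp
  then have "cmod (z - w) powr (1 - \<alpha>) \<le> 2 powr (1 - \<alpha>)" using assms by (intro powr_mono2) auto
  also have "\<dots> \<le> 2 powr 1" using assms by (intro powr_mono) auto
  finally have "cmod (z - w) powr (1 - \<alpha>) * cmod (z - w) powr \<alpha> \<le> 2 * cmod (z - w) powr \<alpha>"
    by (intro mult_right_mono) auto
  then have "cmod (z - w) \<le> 2 * cmod (z - w) powr \<alpha>" using False by (simp flip: powr_add)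
  from mult_left_mono[OF this assms(3)] show ?thesis by simp
qed (use assms in simp)

text \<open>The covector components enter the equations multiplied by \<open>cnj \<zeta>\<close>. Writing g z = a + z * v z replaces them by the
  holomorphic v, up to the explicit term \<open>a * cnj \<zeta>\<close>, and regularity is transferred back here.\<close>

lemma C2_holder_disc_shift:
  assumes \<alpha>: "0 < \<alpha>" "\<alpha> < 1" and v: "C2_holder_disc \<alpha> v"
    and g: "\<And>z. z \<in> cball 0 1 \<Longrightarrow> g z = a + z * v z"
  shows "C2_holder_disc \<alpha> g"
proof -
  obtain v1 v2 C where C: "0 \<le> C"
    and v1: "\<And>z. z \<in> cball 0 1 \<Longrightarrow> (v has_field_derivative v1 z) (at z within cball 0 1)"
    and v2: "\<And>z. z \<in> cball 0 1 \<Longrightarrow> (v1 has_field_derivative v2 z) (at z within cball 0 1)"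
    and hol: "\<And>z w. z \<in> cball 0 1 \<Longrightarrow> w \<in> cball 0 1 \<Longrightarrow> cmod (v2 z - v2 w) \<le> C * cmod (z - w) powr \<alpha>"
    using v unfolding C2_holder_disc_def by blast
  define M where "M = cmod (v2 0) + C"
  have M: "0 \<le> M" using C by (simp add: M_def)
  have v2M: "cmod (v2 z) \<le> M" if z: "z \<in> cball 0 1" for z
  proof -
    have "cmod (v2 z - v2 0) \<le> C * cmod (z - 0) powr \<alpha>" using z by (intro hol) auto
    also have "\<dots> \<le> C * 1" using z \<alpha> C by (intro mult_left_mono powr_le1) auto
    finally show ?thesis using norm_triangle_ineq2[of "v2 z" "v2 0"] by (simp add: M_def)
  qed
  show ?thesis
    unfolding C2_holder_disc_def
  proof (intro exI conjI ballI)
    show "0 \<le> 6 * M + C" using M C by simp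
    fix z :: complex assume z: "z \<in> cball 0 1"
    have "((\<lambda>z. a + z * v z) has_field_derivative v z + z * v1 z) (at z within cball 0 1)"
      using v1[OF z] by (auto intro!: derivative_eq_intros)
    then show "(g has_field_derivative v z + z * v1 z) (at z within cball 0 1)"
      by (rule has_field_derivative_transform_within[OF _ zero_less_one z]) (use g in auto)
    show "((\<lambda>z. v z + z * v1 z) has_field_derivative 2 * v1 z + z * v2 z) (at z within cball 0 1)"
      using v1[OF z] v2[OF z] by (auto intro!: derivative_eq_intros)
    fix w :: complex assume w: "w \<in> cball 0 1"
    let ?p = "cmod (z - w) powr \<alpha>"
    have "cmod (v1 z - v1 w) \<le> M * cmod (z - w)"
      by (rule field_differentiable_bound[OF convex_cball v2 v2M z w])
    then have a: "cmod (v1 z - v1 w) \<le> 2 * M * ?p" using lipschitz_imp_holder[OF \<alpha> M z w] by linarith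
    have b: "cmod (z - w) \<le> 2 * ?p" using lipschitz_imp_holder[OF \<alpha> _ z w, of 1] by simp
    have "(2 * v1 z + z * v2 z) - (2 * v1 w + w * v2 w) = 2 * (v1 z - v1 w) + (z * (v2 z - v2 w) + (z - w) * v2 w)"
      by (simp add: algebra_simps)
    moreover have "cmod (2 * (v1 z - v1 w)) \<le> 4 * M * ?p"
      unfolding norm_mult norm_numeral using a by linarith
    moreover have "cmod (z * (v2 z - v2 w)) \<le> 1 * (C * ?p)"
      unfolding norm_mult using z by (intro mult_mono hol[OF z w]) auto
    moreover have "cmod ((z - w) * v2 w) \<le> (2 * ?p) * M"
      unfolding norm_mult using b v2M[OF w] by (intro mult_mono) auto
    ultimately have "cmod ((2 * v1 z + z * v2 z) - (2 * v1 w + w * v2 w)) \<le> 4 * M * ?p + (1 * (C * ?p) + (2 * ?p) * M)"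
      by (simp only:) (intro norm_triangle_mono)
    then show "cmod ((2 * v1 z + z * v2 z) - (2 * v1 w + w * v2 w)) \<le> (6 * M + C) * ?p"
      by (simp add: algebra_simps)
  qed
qed

lemma disc_algebra_divide_id:
  assumes P: "P \<in> disc_algebra"
  obtains v where "v \<in> disc_algebra" "\<And>z. z \<in> cball 0 1 \<Longrightarrow> P z = P 0 + z * v z"
proof
  have c: "continuous_on (cball 0 1) P" and h: "P holomorphic_on ball 0 1"
    using P by (auto simp: disc_algebra_def)
  define v where "v = (\<lambda>z. if z = 0 then deriv P 0 else (P z - P 0) / (z - 0))"
  have vh: "v holomorphic_on ball 0 1" unfolding v_def by (rule pole_lemma_open[OF h]) simp
  have "continuous_on (cball 0 (1/2) \<union> (cball 0 1 - ball 0 (1/2))) v"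
  proof (rule continuous_on_closed_Un)
    show "continuous_on (cball 0 (1/2)) v"
      by (rule continuous_on_subset[OF holomorphic_on_imp_continuous_on[OF vh]]) auto
    have "continuous_on (cball 0 1 - ball 0 (1/2)) (\<lambda>z. (P z - P 0) / (z - 0))"
      by (intro continuous_intros continuous_on_subset[OF c]) auto
    then show "continuous_on (cball 0 1 - ball 0 (1/2)) v"
      by (rule continuous_on_eq) (auto simp: v_def)
  qed auto
  moreover have "cball 0 (1/2) \<union> (cball 0 1 - ball 0 (1/2)) = cball (0::complex) 1" by auto
  ultimately show "v \<in> disc_algebra" using vh by (simp add: disc_algebra_def)
  show "P z = P 0 + z * v z" if "z \<in> cball 0 1" for z by (simp add: v_def)
qed

lemma disc_algebra_rotate: "f \<in> disc_algebra \<Longrightarrow> (\<lambda>z. f (cis t * z)) \<in> disc_algebra"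
proof -
  assume f: "f \<in> disc_algebra"
  have fc: "continuous_on (cball 0 1) f" and fh: "f holomorphic_on ball 0 1"
    using f by (auto simp: disc_algebra_def)
  have "continuous_on (cball 0 1) (\<lambda>z. f (cis t * z))"
    by (rule continuous_on_compose2[OF fc _ image_subsetI[OF cis_mult_cball]]) (intro continuous_intros)
  moreover have "(f \<circ> (\<lambda>z. cis t * z)) holomorphic_on ball 0 1"
    by (rule holomorphic_on_compose_gen[OF _ fh image_subsetI[OF cis_mult_ball]]) (intro holomorphic_intros)
  ultimately show ?thesis by (simp add: disc_algebra_def o_def)
qed

lemma disc_algebra_diff: "f \<in> disc_algebra \<Longrightarrow> g \<in> disc_algebra \<Longrightarrow> (\<lambda>z. f z - g z) \<in> disc_algebra"
  by (auto simp: disc_algebra_def intro: continuous_on_diff holomorphic_on_diff)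

lemma disc_algebra_cdiv: "f \<in> disc_algebra \<Longrightarrow> (\<lambda>z. f z / c) \<in> disc_algebra"
  unfolding disc_algebra_def divide_inverse mem_Collect_eq
  by (intro conjI continuous_on_mult_right holomorphic_on_mult holomorphic_on_const) auto

text \<open>Rotations preserve both the circle and the disc algebra, so this quotient replaces the derivative with
  respect to the angle without assuming that it exists.\<close>

definition rotation_quotient :: "real \<Rightarrow> (complex \<Rightarrow> 'b::real_vector) \<Rightarrow> complex \<Rightarrow> 'b" where
  "rotation_quotient h u = (\<lambda>z. (u (cis h * z) - u z) /\<^sub>R h)"

lemma rotation_quotient_complex: "rotation_quotient h u z = (u (cis h * z) - u z) / complex_of_real h"
  by (simp add: rotation_quotient_def scaleR_conv_of_real divide_inverse mult.commute)

lemma disc_algebra_rotation_quotient: "f \<in> disc_algebra \<Longrightarrow> rotation_quotient h f \<in> disc_algebra"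
proof -
  assume "f \<in> disc_algebra"
  then have "(\<lambda>z. (f (cis h * z) - f z) / of_real h) \<in> disc_algebra"
    by (intro disc_algebra_cdiv disc_algebra_diff disc_algebra_rotate)
  then show ?thesis by (simp add: rotation_quotient_complex[abs_def])
qed

lemma C2_holder_disc_from_rotation_quotients:
  assumes \<alpha>: "0 < \<alpha>" "\<alpha> < 1" and g: "g \<in> disc_algebra" and K: "0 \<le> K"
    and hb: "\<And>h k. 0 < h \<Longrightarrow> h < 1 \<Longrightarrow> 0 < k \<Longrightarrow> k < 1 \<Longrightarrow>
      holder_bound \<alpha> (sphere 0 1) K (rotation_quotient k (rotation_quotient h g))"
  shows "C2_holder_disc \<alpha> g"
proof -
  let ?D = "\<lambda>h k z. g (cis (h + k) * z) - g (cis h * z) - g (cis k * z) + g z"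
  have D: "?D h k z = of_real (h * k) * rotation_quotient k (rotation_quotient h g) z" if "0 < h" "0 < k" for h k z
    using that by (simp add: rotation_quotient_complex cis_mult[symmetric] mult.assoc divide_simps)
  have "cmod (?D h k z - ?D h k w) \<le> K * h * k * cmod (z - w) powr \<alpha>"
    if hk: "0 < h" "h < 1" "0 < k" "k < 1" and zw: "z \<in> sphere 0 1" "w \<in> sphere 0 1" for h k z w
  proof -
    let ?q = "rotation_quotient k (rotation_quotient h g)"
    have "?D h k z - ?D h k w = of_real (h * k) * (?q z - ?q w)"
      unfolding D[OF hk(1,3)] by (simp only: right_diff_distrib)
    then have "cmod (?D h k z - ?D h k w) = h * k * cmod (?q z - ?q w)"
      using hk by (simp only: norm_mult norm_of_real) simp
    also have "\<dots> \<le> h * k * (K * cmod (z - w) powr \<alpha>)"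
      using holder_boundD(2)[OF hb[OF hk] zw] hk by (intro mult_left_mono) auto
    finally show ?thesis by (simp only: mult_ac)
  qed
  then obtain g1 g2 C where "0 \<le> C"
    "\<And>z. z \<in> cball 0 1 \<Longrightarrow> (g has_field_derivative g1 z) (at z within cball 0 1)"
    "\<And>z. z \<in> cball 0 1 \<Longrightarrow> (g1 has_field_derivative g2 z) (at z within cball 0 1)"
    "\<And>z w. z \<in> cball 0 1 \<Longrightarrow> w \<in> cball 0 1 \<Longrightarrow> cmod (g2 z - g2 w) \<le> C * cmod (z - w) powr \<alpha>"
    using second_rotation_difference_regularity[OF \<alpha> g K] by metis
  then show ?thesis unfolding C2_holder_disc_def by blast
qed

lemma holder_bound_cnj_rotation_quotients:
  assumes \<alpha>: "0 < \<alpha>" "\<alpha> < 1" and hk: "0 < h" "0 < k"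
  shows "holder_bound \<alpha> (sphere 0 1) (2 * cmod a) (rotation_quotient k (rotation_quotient h (\<lambda>z. cnj z * a)))"
proof -
  have cis1: "cmod (cis t - 1) \<le> \<bar>t\<bar>" for t
  proof -
    have "cmod (cis t - 1) = 2 * \<bar>sin (t / 2)\<bar>"
      using dist_exp_i_1[of t] by (simp add: cis_conv_exp dist_norm)
    also have "\<dots> \<le> 2 * \<bar>t / 2\<bar>" by (intro mult_left_mono abs_sin_x_le_abs_x) auto
    finally show ?thesis by simp
  qed
  define \<kappa> where "\<kappa> = (cis (- k) - 1) / of_real k * ((cis (- h) - 1) / of_real h)"
  have "cmod \<kappa> \<le> 1 * 1"
    unfolding \<kappa>_def norm_mult norm_divide using cis1[of "- h"] cis1[of "- k"] hk
    by (intro mult_mono) (auto simp: divide_le_eq)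
  then have "cmod (a * \<kappa>) \<le> cmod a" unfolding norm_mult using mult_left_mono[of "cmod \<kappa>" 1 "cmod a"] by simp
  moreover have "holder_bound \<alpha> (sphere 0 1) 2 (\<lambda>z. cnj z)"
  proof (rule holder_boundI)
    fix z w :: complex assume zw: "z \<in> sphere 0 1" "w \<in> sphere 0 1"
    have "cmod (cnj z - cnj w) = cmod (z - w)" by (simp flip: complex_cnj_diff)
    then show "cmod (cnj z - cnj w) \<le> 2 * cmod (z - w) powr \<alpha>"
      using lipschitz_imp_holder[OF \<alpha>, of 1 z w] zw by simp
  qed simp
  ultimately have "holder_bound \<alpha> (sphere 0 1) (cmod a * 2) (\<lambda>z. (a * \<kappa>) * cnj z)"
    by (intro holder_bound_cmult)
  then have "holder_bound \<alpha> (sphere 0 1) (cmod a * 2) (rotation_quotient k (rotation_quotient h (\<lambda>z. cnj z * a)))"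
    by (rule holder_bound_cong)
       (use hk in \<open>simp add: rotation_quotient_complex \<kappa>_def cis_cnj field_simps\<close>)
  then show ?thesis by (simp add: mult.commute)
qed

lemma rotation_quotient_bound:
  assumes "holder_bound \<alpha> (sphere 0 1) C u" "0 < h"
  shows "holder_bound \<alpha> (sphere 0 1) (2 * C / h) (rotation_quotient h u)"
proof -
  have "holder_bound \<alpha> (sphere 0 1) (\<bar>inverse h\<bar> * (C + C)) (rotation_quotient h u)"
    unfolding rotation_quotient_def
    by (intro holder_bound_scaleR holder_bound_diff holder_bound_rotate assms)
  moreover have "\<bar>inverse h\<bar> * (C + C) = 2 * C / h" using assms(2) by (simp add: divide_inverse)
  ultimately show ?thesis by (simp only:)
qed

context perturbation_estimate
begin

lemma multiplier_bound:
  assumes cv: "\<And>k. holder_bound \<alpha> \<Gamma> \<epsilon> (\<lambda>\<zeta>. complex_of_real (cv \<zeta> k - c $ k))"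
  shows "holder_bound \<alpha> \<Gamma> (1 + norm c) (\<lambda>\<zeta>. complex_of_real (cv \<zeta> k))"
proof -
  have "holder_bound \<alpha> \<Gamma> (\<epsilon> + norm c) (\<lambda>\<zeta>. complex_of_real (cv \<zeta> k - c $ k) + of_real (c $ k))"
    by (intro holder_bound_add cv holder_bound_const) (simp add: component_le_norm_cart)
  then show ?thesis by (auto intro: holder_bound_mono simp: constants)
qed

text \<open>Only the equation for q is needed: it determines the increments of the multipliers from the other increments.\<close>

lemma multiplier_difference_bound:
  assumes W: "\<And>k m. difference_quotient S \<epsilon> (W k m) (MW k m)"
    and f: "holder_bound \<alpha> \<Gamma> L f1" "\<And>z. z \<in> \<Gamma> \<Longrightarrow> f1 z \<in> S"
      "holder_bound \<alpha> \<Gamma> L f2" "\<And>z. z \<in> \<Gamma> \<Longrightarrow> f2 z \<in> S"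
    and cv: "\<And>k. holder_bound \<alpha> \<Gamma> \<epsilon> (\<lambda>\<zeta>. complex_of_real (cv \<zeta> k - c $ k))"
    and uq: "\<And>j. holder_bound \<alpha> \<Gamma> B (uq j)" and u: "holder_bound \<alpha> \<Gamma> B u"
    and 0: "\<And>j \<zeta>. \<zeta> \<in> \<Gamma> \<Longrightarrow> defect_q W MW j (f1 \<zeta>) (f2 \<zeta>) (cv \<zeta>) (uq j \<zeta>) (u \<zeta>) (\<gamma> \<zeta>) = 0"
  shows "holder_bound \<alpha> \<Gamma> (16 * real CARD('d) * (B + real CARD('d) * (2 * (1 + norm c) * (\<epsilon> * B * (1 + 2 * L)))))
     (\<lambda>\<zeta>. complex_of_real (\<gamma> \<zeta> j))"
proof (rule holder_bound_implicit[where \<gamma> = "\<lambda>j \<zeta>. \<gamma> \<zeta> j" and w = "\<lambda>k j \<zeta>. W k (Inr j) (f1 \<zeta>)"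
    and s = "\<lambda>j \<zeta>. uq j \<zeta> - (\<Sum>k\<in>UNIV. of_real (cv \<zeta> k) * MW k (Inr j) (f1 \<zeta>) (f2 \<zeta>) (u \<zeta>))"])
  have solve: "g = p - b - a" if "p - g - a - b = 0" for p a b g :: complex using that by algebra
  show "complex_of_real (\<gamma> z j) / 2 = uq j z - (\<Sum>k\<in>UNIV. of_real (cv z k) * MW k (Inr j) (f1 z) (f2 z) (u z))
      - (\<Sum>k\<in>UNIV. of_real (\<gamma> z k) * W k (Inr j) (f1 z))" if "z \<in> \<Gamma>" for j z
    using 0[OF that, of j] unfolding defect_q_def by (rule solve)
  show "holder_bound \<alpha> \<Gamma> (B + real CARD('d) * (2 * (1 + norm c) * (\<epsilon> * B * (1 + 2 * L))))
    (\<lambda>\<zeta>. uq j \<zeta> - (\<Sum>k\<in>UNIV. of_real (cv \<zeta> k) * MW k (Inr j) (f1 \<zeta>) (f2 \<zeta>) (u \<zeta>)))" for j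
    by (intro holder_bound_diff uq holder_bound_sum holder_bound_mult multiplier_bound[OF cv]
        holder_bound_difference_quotient[OF W f u])
  show "holder_bound \<alpha> \<Gamma> (\<epsilon> * (1 + L)) (\<lambda>\<zeta>. W k (Inr j) (f1 \<zeta>))" for k j
    by (rule holder_bound_compose[OF W f(1,2)])
  show "real CARD('d) * (\<epsilon> * (1 + L)) \<le> 1 / 4" by (rule invertible_step)
qed

text \<open>The estimate is applied to increments of increments. The pair formed by a lift and its rotation satisfies the linear system
  exactly; comparing this system with its own rotation leaves defects that involve only first quotients, which are
  bounded by assumption. The resulting bound does not depend on h and k.\<close>

lemma lift_second_rotation_quotients:
  fixes N :: "complex ^ ('n + 'd) \<Rightarrow> real ^ 'd" and f :: "complex \<Rightarrow> complex ^ ('n + 'd)"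
    and P v :: "'n \<Rightarrow> complex \<Rightarrow> complex" and Q t :: "'d \<Rightarrow> complex \<Rightarrow> complex" and cv :: "complex \<Rightarrow> 'd \<Rightarrow> real"
  assumes N: "difference_quotient S \<epsilon> N MN" and W: "\<And>k m. difference_quotient S \<epsilon> (W k m) (MW k m)"
    and fS: "\<And>\<zeta>. \<zeta> \<in> sphere 0 1 \<Longrightarrow> f \<zeta> \<in> S"
    and lift: "\<And>\<zeta>. \<zeta> \<in> sphere 0 1 \<Longrightarrow> lift_at A N W (f \<zeta>) (\<lambda>i. cnj \<zeta> * P i \<zeta>) (\<lambda>j. cnj \<zeta> * Q j \<zeta>) (cv \<zeta>)"
    and fL: "holder_bound \<alpha> (sphere 0 1) L f"
    and cv: "\<And>k. holder_bound \<alpha> (sphere 0 1) \<epsilon> (\<lambda>\<zeta>. complex_of_real (cv \<zeta> k - c $ k))"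
    and f_DA: "\<And>s. (\<lambda>\<zeta>. f \<zeta> $ s) \<in> disc_algebra"
    and v: "\<And>i. v i \<in> disc_algebra" "\<And>i z. z \<in> cball 0 1 \<Longrightarrow> P i z = P i 0 + z * v i z"
    and t: "\<And>j. t j \<in> disc_algebra" "\<And>j z. z \<in> cball 0 1 \<Longrightarrow> Q j z = Q j 0 + z * t j z"
    and B: "0 \<le> B"
    and df: "\<And>h. 0 < h \<Longrightarrow> h < 1 \<Longrightarrow> holder_bound \<alpha> (sphere 0 1) B (rotation_quotient h f)"
    and dQ: "\<And>h j. 0 < h \<Longrightarrow> h < 1 \<Longrightarrow> holder_bound \<alpha> (sphere 0 1) B (rotation_quotient h (\<lambda>\<zeta>. cnj \<zeta> * Q j \<zeta>))"
  obtains C where "0 \<le> C" "\<And>h k g. 0 < h \<Longrightarrow> h < 1 \<Longrightarrow> 0 < k \<Longrightarrow> k < 1 \<Longrightarrow>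
    g \<in> range v \<union> range t \<union> range (\<lambda>s \<zeta>. f \<zeta> $ s) \<Longrightarrow>
      holder_bound \<alpha> (sphere 0 1) C (rotation_quotient k (rotation_quotient h g))"
proof -
  let ?\<Gamma> = "sphere (0::complex) 1" and ?d = "real CARD('d)" and ?n = "real CARD('n)"
  define M where "M = (\<Sum>j\<in>UNIV. \<Sum>l\<in>UNIV. norm (A j $ l))"
  have MA: "cmod (A j $ l $ m) \<le> M" for j l m
  proof -
    have "cmod (A j $ l $ m) \<le> norm (A j $ l)" by (rule Finite_Cartesian_Product.norm_nth_le)
    also have "\<dots> \<le> (\<Sum>l\<in>UNIV. norm (A j $ l))" by (rule member_le_sum) auto
    also have "\<dots> \<le> M" unfolding M_def
      by (rule member_le_sum[where f = "\<lambda>j. \<Sum>l\<in>UNIV. norm (A j $ l)"]) (auto intro!: sum_nonneg)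
    finally show ?thesis .
  qed
  have M: "0 \<le> M" by (rule order_trans[OF norm_ge_zero MA])
  have \<epsilon>: "0 \<le> \<epsilon>" and L: "0 \<le> L" and \<alpha>: "0 < \<alpha>" "\<alpha> < 1" and K: "0 \<le> K" using constants exponent by auto
  define G where "G = 16 * ?d * (B + ?d * (2 * (1 + norm c) * (\<epsilon> * B * (1 + 2 * L))))"
  have G: "0 \<le> G" using B \<epsilon> L by (simp add: G_def)
  define X where "X = \<epsilon> * B * (1 + 2 * L)"
  define Y where "Y = \<epsilon> * B * B * (4 + 8 * L)"
  have XY: "0 \<le> X" "0 \<le> Y" using B \<epsilon> L by (auto simp: X_def Y_def)
  define E1 where "E1 = ?d * (2 * G * X) + ?d * (2 * G * X) + ?d * (2 * (1 + norm c) * Y)"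
  define E2 where "E2 = E1 + ?d * (2 * G * (?n * (M * B))) + ?d * (2 * G * (?n * (M * B)))"
  define E3 where "E3 = ?n * (?n * (M * (2 * B * B) + M * (2 * B * B))) + Y"
  define E where "E = E2 + E3"
  have E: "0 \<le> E1" "E1 \<le> E" "E2 \<le> E" "E3 \<le> E" "0 \<le> E"
    using G XY M B by (auto simp: E1_def E2_def E3_def E_def)
  define J where "J = (\<Sum>i\<in>UNIV. 2 * cmod (P i 0)) + (\<Sum>j\<in>UNIV. 2 * cmod (Q j 0))"
  have JP: "2 * cmod (P i 0) \<le> J" for i
  proof -
    have "2 * cmod (P i 0) \<le> (\<Sum>i\<in>UNIV. 2 * cmod (P i 0))" by (rule member_le_sum) auto
    moreover have "0 \<le> (\<Sum>j\<in>UNIV. 2 * cmod (Q j 0))" by (intro sum_nonneg) auto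
    ultimately show ?thesis by (simp add: J_def)
  qed
  have JQ: "2 * cmod (Q j 0) \<le> J" for j
  proof -
    have "2 * cmod (Q j 0) \<le> (\<Sum>j\<in>UNIV. 2 * cmod (Q j 0))" by (rule member_le_sum) auto
    moreover have "0 \<le> (\<Sum>i\<in>UNIV. 2 * cmod (P i 0))" by (intro sum_nonneg) auto
    ultimately show ?thesis by (simp add: J_def)
  qed
  have J: "0 \<le> J" using order_trans[OF _ JQ] by simp
  have sq: "cnj z * (w + z * v) = cnj z * w + v" if "z \<in> ?\<Gamma>" for z w v :: complex
  proof -
    have "cnj z * z = 1" using that complex_norm_square[of z] by (simp add: mult.commute)
    then show ?thesis by (simp add: distrib_left flip: mult.assoc)
  qed
  have cvM: "holder_bound \<alpha> ?\<Gamma> (1 + norm c) (\<lambda>\<zeta>. complex_of_real (cv \<zeta> k))" for k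
    by (rule multiplier_bound[OF cv])
  show thesis
  proof (rule that[of "K * (E + J)"])
    show "0 \<le> K * (E + J)" using K E J by simp
    fix h k :: real and g assume hk: "0 < h" "h < 1" "0 < k" "k < 1"
      and g: "g \<in> range v \<union> range t \<union> range (\<lambda>s \<zeta>. f \<zeta> $ s)"
    define f1 where "f1 = (\<lambda>\<zeta>. f (cis h * \<zeta>))"
    define u where "u = rotation_quotient h f"
    define \<gamma> where "\<gamma> = (\<lambda>\<zeta> j. (cv (cis h * \<zeta>) j - cv \<zeta> j) / h)"
    define uq where "uq = (\<lambda>j. rotation_quotient h (\<lambda>\<zeta>. cnj \<zeta> * Q j \<zeta>))"
    define up where "up = (\<lambda>i. rotation_quotient h (\<lambda>\<zeta>. cnj \<zeta> * P i \<zeta>))"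
    let ?r = "\<lambda>\<zeta>. cis k * \<zeta>"
    have rS: "?r \<zeta> \<in> ?\<Gamma>" "cis h * \<zeta> \<in> ?\<Gamma>" if "\<zeta> \<in> ?\<Gamma>" for \<zeta> using that by (auto simp: norm_mult)
    have f1S: "f1 \<zeta> \<in> S" if "\<zeta> \<in> ?\<Gamma>" for \<zeta> unfolding f1_def by (rule fS[OF rS(2)[OF that]])
    have f1L: "holder_bound \<alpha> ?\<Gamma> L f1" unfolding f1_def by (rule holder_bound_rotate[OF fL])
    have u_def': "u \<zeta> = (f1 \<zeta> - f \<zeta>) /\<^sub>R h" for \<zeta> by (simp add: u_def f1_def rotation_quotient_def)
    have z_q: "defect_q W MW j (f1 \<zeta>) (f \<zeta>) (cv \<zeta>) (uq j \<zeta>) (u \<zeta>) (\<gamma> \<zeta>) = 0" if "\<zeta> \<in> ?\<Gamma>" for j \<zeta>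
      unfolding u_def f1_def uq_def \<gamma>_def rotation_quotient_complex rotation_quotient_def[of h f]
      by (rule defect_q_pair[OF W fS[OF rS(2)[OF that]] fS[OF that] lift[OF rS(2)[OF that]] lift[OF that]])
    have z_p: "defect_p A W MW i (f1 \<zeta>) (f \<zeta>) (cv \<zeta>) (up i \<zeta>) (u \<zeta>) (\<gamma> \<zeta>) = 0" if "\<zeta> \<in> ?\<Gamma>" for i \<zeta>
      unfolding u_def f1_def up_def \<gamma>_def rotation_quotient_complex rotation_quotient_def[of h f]
      by (rule defect_p_pair[OF W fS[OF rS(2)[OF that]] fS[OF that] lift[OF rS(2)[OF that]] lift[OF that]])
    have z_w: "defect_w A MN j (f1 \<zeta>) (f \<zeta>) (u \<zeta>) = 0" if "\<zeta> \<in> ?\<Gamma>" for j \<zeta>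
      unfolding u_def f1_def rotation_quotient_def
      by (rule defect_w_pair[OF N fS[OF rS(2)[OF that]] fS[OF that] lift[OF rS(2)[OF that]] lift[OF that]])
    have hu: "holder_bound \<alpha> ?\<Gamma> B u" unfolding u_def by (rule df[OF hk(1,2)])
    have h\<gamma>: "holder_bound \<alpha> ?\<Gamma> G (\<lambda>\<zeta>. complex_of_real (\<gamma> \<zeta> j))" for j
      unfolding G_def
      by (rule multiplier_difference_bound[OF W f1L f1S fL fS cv _ hu z_q]) (assumption | (unfold uq_def, rule dQ[OF hk(1,2)]))+
    define \<gamma>k where "\<gamma>k = (\<lambda>\<zeta> j. (cv (?r \<zeta>) j - cv \<zeta> j) / k)"
    have h\<gamma>k: "holder_bound \<alpha> ?\<Gamma> G (\<lambda>\<zeta>. complex_of_real (\<gamma>k \<zeta> j))" for j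
      unfolding G_def
    proof (rule multiplier_difference_bound[OF W holder_bound_rotate[OF fL] fS[OF rS(1)] fL fS cv dQ[OF hk(3,4)] df[OF hk(3,4)]])
      fix j \<zeta> assume \<zeta>: "\<zeta> \<in> ?\<Gamma>"
      show "defect_q W MW j (f (?r \<zeta>)) (f \<zeta>) (cv \<zeta>) (rotation_quotient k (\<lambda>\<zeta>. cnj \<zeta> * Q j \<zeta>) \<zeta>) (rotation_quotient k f \<zeta>) (\<gamma>k \<zeta>) = 0"
        unfolding rotation_quotient_complex rotation_quotient_def[of k f] \<gamma>k_def
        by (rule defect_q_pair[OF W fS[OF rS(1)[OF \<zeta>]] fS[OF \<zeta>] lift[OF rS(1)[OF \<zeta>]] lift[OF \<zeta>]])
    qed
    define f1k where "f1k = (\<lambda>\<zeta>. f1 (?r \<zeta>))"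
    define fk where "fk = (\<lambda>\<zeta>. f (?r \<zeta>))"
    define uk where "uk = (\<lambda>\<zeta>. u (?r \<zeta>))"
    have f1kS: "f1k \<zeta> \<in> S" and fkS: "fk \<zeta> \<in> S" if "\<zeta> \<in> ?\<Gamma>" for \<zeta>
      unfolding f1k_def fk_def by (rule f1S[OF rS(1)[OF that]], rule fS[OF rS(1)[OF that]])
    have f1kL: "holder_bound \<alpha> ?\<Gamma> L f1k" and fkL: "holder_bound \<alpha> ?\<Gamma> L fk" and huk: "holder_bound \<alpha> ?\<Gamma> B uk"
      unfolding f1k_def fk_def uk_def by (rule holder_bound_rotate f1L fL hu)+
    have h\<gamma>r: "holder_bound \<alpha> ?\<Gamma> G (\<lambda>\<zeta>. complex_of_real (\<gamma> (?r \<zeta>) j))" for j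
      by (rule holder_bound_rotate[OF h\<gamma>])
    have dfk: "holder_bound \<alpha> ?\<Gamma> B (\<lambda>\<zeta>. (fk \<zeta> - f \<zeta>) /\<^sub>R k)"
      using df[OF hk(3,4)] unfolding rotation_quotient_def fk_def .
    have df1k: "holder_bound \<alpha> ?\<Gamma> B (\<lambda>\<zeta>. (f1k \<zeta> - f1 \<zeta>) /\<^sub>R k)"
      using holder_bound_rotate[OF df[OF hk(3,4)], of h]
      unfolding rotation_quotient_def f1k_def f1_def by (simp only: mult.left_commute)
    have unscale: "holder_bound \<alpha> ?\<Gamma> (B * k) p" if "holder_bound \<alpha> ?\<Gamma> B (\<lambda>\<zeta>. p \<zeta> /\<^sub>R k)" for p :: "complex \<Rightarrow> complex ^ ('n + 'd)"
    proof -
      have "holder_bound \<alpha> ?\<Gamma> (\<bar>k\<bar> * B) p"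
        by (rule holder_bound_cong[OF holder_bound_scaleR[OF that, of k]]) (use hk in simp)
      then show ?thesis using hk by (simp add: mult.commute)
    qed
    have inc: "holder_bound \<alpha> ?\<Gamma> Y (\<lambda>\<zeta>. (MQ (f1k \<zeta>) (fk \<zeta>) (uk \<zeta>) - MQ (f1 \<zeta>) (f \<zeta>) (uk \<zeta>)) /\<^sub>R k)"
      if "difference_quotient S \<epsilon> \<phi> MQ" for \<phi> and MQ :: "_ \<Rightarrow> _ \<Rightarrow> _ \<Rightarrow> 'z::real_normed_vector"
    proof -
      have "holder_bound \<alpha> ?\<Gamma> (\<bar>inverse k\<bar> * (\<epsilon> * B * (B * k) * (4 + 8 * L))) (\<lambda>\<zeta>. (MQ (f1k \<zeta>) (fk \<zeta>) (uk \<zeta>) - MQ (f1 \<zeta>) (f \<zeta>) (uk \<zeta>)) /\<^sub>R k)"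
        by (intro holder_bound_scaleR holder_bound_difference_quotient_increment[OF that f1L f1S fL fS f1kL f1kS fkL fkS
              unscale[OF df1k] unscale[OF dfk] huk])
      moreover have "\<bar>inverse k\<bar> * (\<epsilon> * B * (B * k) * (4 + 8 * L)) = Y" using hk by (simp add: Y_def)
      ultimately show ?thesis by (simp only:)
    qed
    have Winc: "holder_bound \<alpha> ?\<Gamma> X (\<lambda>\<zeta>. (W k' m (f1k \<zeta>) - W k' m (f1 \<zeta>)) /\<^sub>R k)" for k' m
      unfolding X_def
    proof (rule holder_bound_cong[OF holder_bound_difference_quotient[OF W f1kL f1kS f1L f1S df1k]])
      fix \<zeta> assume \<zeta>: "\<zeta> \<in> ?\<Gamma>"
      show "(W k' m (f1k \<zeta>) - W k' m (f1 \<zeta>)) /\<^sub>R k = MW k' m (f1k \<zeta>) (f1 \<zeta>) ((f1k \<zeta> - f1 \<zeta>) /\<^sub>R k)"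
        using difference_quotientD(4)[OF W f1kS[OF \<zeta>] f1S[OF \<zeta>]] linear_scale[OF difference_quotientD(3)[OF W f1kS[OF \<zeta>] f1S[OF \<zeta>]]]
        by simp
    qed
    have Mk: "holder_bound \<alpha> ?\<Gamma> X (\<lambda>\<zeta>. MW k' m (f1k \<zeta>) (fk \<zeta>) (uk \<zeta>))" for k' m
      unfolding X_def by (rule holder_bound_difference_quotient[OF W f1kL f1kS fkL fkS huk])
    let ?T = "\<lambda>m \<zeta>. (\<Sum>k'\<in>UNIV. of_real (\<gamma> (?r \<zeta>) k') * ((W k' m (f1k \<zeta>) - W k' m (f1 \<zeta>)) /\<^sub>R k))
       + (\<Sum>k'\<in>UNIV. of_real (\<gamma>k \<zeta> k') * MW k' m (f1k \<zeta>) (fk \<zeta>) (uk \<zeta>))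
       + (\<Sum>k'\<in>UNIV. of_real (cv \<zeta> k') * ((MW k' m (f1k \<zeta>) (fk \<zeta>) (uk \<zeta>) - MW k' m (f1 \<zeta>) (f \<zeta>) (uk \<zeta>)) /\<^sub>R k))"
    have hT: "holder_bound \<alpha> ?\<Gamma> E1 (?T m)" for m
      unfolding E1_def by (intro holder_bound_add holder_bound_sum holder_bound_mult h\<gamma>r h\<gamma>k cvM Winc Mk inc[OF W])
    define u2 where "u2 = rotation_quotient k u"
    define \<gamma>2 where "\<gamma>2 = (\<lambda>\<zeta> j. (\<gamma> (?r \<zeta>) j - \<gamma> \<zeta> j) / k)"
    have pull: "of_real (inverse k) * (\<Sum>k'\<in>UNIV. of_real (a k') * Z k') = (\<Sum>k'\<in>UNIV. of_real (a k') * (Z k' /\<^sub>R k))"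
      "of_real (inverse k) * (\<Sum>k'\<in>UNIV. of_real (a k' - b k') * Z k') = (\<Sum>k'\<in>UNIV. of_real ((a k' - b k') / k) * Z k')"
      for a b :: "'d \<Rightarrow> real" and Z :: "'d \<Rightarrow> complex"
      by (simp_all only: sum_distrib_left scaleR_conv_of_real divide_inverse of_real_mult mult_ac)
    have s_q: "defect_q W MW j (f1 \<zeta>) (f \<zeta>) (cv \<zeta>) (rotation_quotient k (uq j) \<zeta>) (u2 \<zeta>) (\<gamma>2 \<zeta>) = ?T (Inr j) \<zeta>"
      if \<zeta>: "\<zeta> \<in> ?\<Gamma>" for j \<zeta>
      using defect_q_step[OF W f1S[OF \<zeta>] fS[OF \<zeta>] z_q[OF \<zeta>] z_q[OF rS(1)[OF \<zeta>]], of j k]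
      unfolding distrib_left unfolding pull(2) unfolding pull(1) u2_def \<gamma>2_def \<gamma>k_def rotation_quotient_def[of k u] rotation_quotient_complex[of k "uq j"] f1k_def fk_def uk_def .
    have s_p: "defect_p A W MW i (f1 \<zeta>) (f \<zeta>) (cv \<zeta>) (rotation_quotient k (up i) \<zeta>) (u2 \<zeta>) (\<gamma>2 \<zeta>) = ?T (Inl i) \<zeta>
        - (\<Sum>k'\<in>UNIV. of_real (\<gamma>k \<zeta> k') * (\<Sum>l\<in>UNIV. cnj (uk \<zeta> $ Inl l) * A k' $ l $ i))
        - (\<Sum>k'\<in>UNIV. of_real (\<gamma> (?r \<zeta>) k') * ((\<Sum>l\<in>UNIV. cnj ((f1k \<zeta> - f1 \<zeta>) $ Inl l) * A k' $ l $ i) /\<^sub>R k))"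
      if \<zeta>: "\<zeta> \<in> ?\<Gamma>" for i \<zeta>
      using defect_p_step[OF W f1S[OF \<zeta>] fS[OF \<zeta>] z_p[OF \<zeta>] z_p[OF rS(1)[OF \<zeta>]], of i k]
      unfolding distrib_left right_diff_distrib[of "complex_of_real (inverse k)"] unfolding pull(2) unfolding pull(1) u2_def \<gamma>2_def \<gamma>k_def rotation_quotient_def[of k u] rotation_quotient_complex[of k "up i"] f1k_def fk_def uk_def .
    have s_w: "defect_w A MN j (f1 \<zeta>) (f \<zeta>) (u2 \<zeta>) =
        Re (\<Sum>l\<in>UNIV. \<Sum>m\<in>UNIV. A j $ l $ m * (cnj (uk \<zeta> $ Inl l) * ((f1k \<zeta> - f1 \<zeta>) /\<^sub>R k) $ Inl m)
          + A j $ l $ m * (cnj (((fk \<zeta> - f \<zeta>) /\<^sub>R k) $ Inl l) * uk \<zeta> $ Inl m))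
        - ((MN (f1k \<zeta>) (fk \<zeta>) (uk \<zeta>) - MN (f1 \<zeta>) (f \<zeta>) (uk \<zeta>)) /\<^sub>R k) $ j"
      if \<zeta>: "\<zeta> \<in> ?\<Gamma>" for j \<zeta>
    proof -
      have re: "Re (s /\<^sub>R k) = inverse k * Re s" for s by simp
      have comp: "(w /\<^sub>R k) $ j = inverse k * (w $ j)" for w :: "real ^ 'd" by simp
      have scaled: "(\<Sum>l\<in>UNIV. \<Sum>m\<in>UNIV. A j $ l $ m * (cnj (uk \<zeta> $ Inl l) * ((f1k \<zeta> - f1 \<zeta>) /\<^sub>R k) $ Inl m)
          + A j $ l $ m * (cnj (((fk \<zeta> - f \<zeta>) /\<^sub>R k) $ Inl l) * uk \<zeta> $ Inl m))
        = (\<Sum>l\<in>UNIV. \<Sum>m\<in>UNIV. A j $ l $ m * (cnj (uk \<zeta> $ Inl l) * (f1k \<zeta> - f1 \<zeta>) $ Inl m)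
          + A j $ l $ m * (cnj ((fk \<zeta> - f \<zeta>) $ Inl l) * uk \<zeta> $ Inl m)) /\<^sub>R k"
        unfolding scaleR_sum_right
        by (intro sum.cong refl) (simp add: scaleR_conv_of_real[where 'a = complex] algebra_simps)
      show ?thesis
        unfolding scaled re comp right_diff_distrib[symmetric]
        unfolding u2_def rotation_quotient_def[of k u] f1k_def fk_def uk_def
        by (rule defect_w_step[OF N f1S[OF \<zeta>] fS[OF \<zeta>] z_w[OF \<zeta>] z_w[OF rS(1)[OF \<zeta>]]])
    qed
    have est: "(\<forall>i. holder_bound \<alpha> ?\<Gamma> (K * (E + J)) (rotation_quotient k (rotation_quotient h (\<lambda>\<zeta>. f \<zeta> $ Inl i))))
      \<and> (\<forall>i. holder_bound \<alpha> ?\<Gamma> (K * (E + J)) (rotation_quotient k (rotation_quotient h (v i))))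
      \<and> (\<forall>j. holder_bound \<alpha> ?\<Gamma> (K * (E + J)) (rotation_quotient k (rotation_quotient h (\<lambda>\<zeta>. f \<zeta> $ Inr j))))
      \<and> (\<forall>j. holder_bound \<alpha> ?\<Gamma> (K * (E + J)) (rotation_quotient k (rotation_quotient h (t j))))"
    proof (rule estimate[where ?f1.0 = f1 and ?f2.0 = f and cv = cv and u = u2 and \<gamma> = \<gamma>2 and ?S0.0 = "2 * B / k + 2 * G / k"
          and ep = "\<lambda>i. rotation_quotient k (rotation_quotient h (\<lambda>z. cnj z * P i 0))"
          and eq = "\<lambda>j. rotation_quotient k (rotation_quotient h (\<lambda>z. cnj z * Q j 0))", OF _ _ E(5) J N W f1S fS f1L fL cv])
      show "sphere 0 1 - {1} \<subseteq> ?\<Gamma>" "?\<Gamma> \<subseteq> sphere 0 1" by auto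
      show "rotation_quotient k (rotation_quotient h (\<lambda>\<zeta>. f \<zeta> $ Inl i)) \<in> disc_algebra"
        "rotation_quotient k (rotation_quotient h (v i)) \<in> disc_algebra"
        "rotation_quotient k (rotation_quotient h (\<lambda>\<zeta>. f \<zeta> $ Inr j)) \<in> disc_algebra"
        "rotation_quotient k (rotation_quotient h (t j)) \<in> disc_algebra" for i j
        by (intro disc_algebra_rotation_quotient f_DA v t)+
      show "u2 \<zeta> $ Inl i = rotation_quotient k (rotation_quotient h (\<lambda>\<zeta>. f \<zeta> $ Inl i)) \<zeta>"
        "u2 \<zeta> $ Inr j = rotation_quotient k (rotation_quotient h (\<lambda>\<zeta>. f \<zeta> $ Inr j)) \<zeta>" for \<zeta> i j
        by (simp_all add: u2_def u_def rotation_quotient_def)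
      show "holder_bound \<alpha> ?\<Gamma> E (\<lambda>\<zeta>. defect_q W MW j (f1 \<zeta>) (f \<zeta>) (cv \<zeta>)
          (rotation_quotient k (rotation_quotient h (t j)) \<zeta> + rotation_quotient k (rotation_quotient h (\<lambda>z. cnj z * Q j 0)) \<zeta>) (u2 \<zeta>) (\<gamma>2 \<zeta>))" for j
      proof (rule holder_bound_cong[OF holder_bound_mono[OF hT[of "Inr j"] E(2)]])
        fix \<zeta> assume \<zeta>: "\<zeta> \<in> ?\<Gamma>"
        have qq: "cnj \<xi> * Q j \<xi> = cnj \<xi> * Q j 0 + t j \<xi>" if "\<xi> \<in> ?\<Gamma>" for \<xi>
          using sq[OF that, of "Q j 0" "t j \<xi>"] t(2)[of \<xi> j] that by simp
        have "rotation_quotient k (rotation_quotient h (t j)) \<zeta> + rotation_quotient k (rotation_quotient h (\<lambda>z. cnj z * Q j 0)) \<zeta>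
            = rotation_quotient k (uq j) \<zeta>"
          unfolding uq_def rotation_quotient_def qq[OF rS(2)[OF rS(1)[OF \<zeta>]]] qq[OF rS(1)[OF \<zeta>]] qq[OF rS(2)[OF \<zeta>]] qq[OF \<zeta>]
          by (simp only: scaleR_add_right scaleR_diff_right) simp
        then show "defect_q W MW j (f1 \<zeta>) (f \<zeta>) (cv \<zeta>)
          (rotation_quotient k (rotation_quotient h (t j)) \<zeta> + rotation_quotient k (rotation_quotient h (\<lambda>z. cnj z * Q j 0)) \<zeta>) (u2 \<zeta>) (\<gamma>2 \<zeta>) = ?T (Inr j) \<zeta>"
          using s_q[OF \<zeta>] by (simp only:)
      qed
      show "holder_bound \<alpha> ?\<Gamma> E (\<lambda>\<zeta>. defect_p A W MW i (f1 \<zeta>) (f \<zeta>) (cv \<zeta>)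
          (rotation_quotient k (rotation_quotient h (v i)) \<zeta> + rotation_quotient k (rotation_quotient h (\<lambda>z. cnj z * P i 0)) \<zeta>) (u2 \<zeta>) (\<gamma>2 \<zeta>))" for i
      proof -
        have "holder_bound \<alpha> ?\<Gamma> E2 (\<lambda>\<zeta>. ?T (Inl i) \<zeta>
          - (\<Sum>k'\<in>UNIV. of_real (\<gamma>k \<zeta> k') * (\<Sum>l\<in>UNIV. A k' $ l $ i * cnj (uk \<zeta> $ Inl l)))
          - (\<Sum>k'\<in>UNIV. of_real (\<gamma> (?r \<zeta>) k') * (\<Sum>l\<in>UNIV. A k' $ l $ i * cnj (((f1k \<zeta> - f1 \<zeta>) /\<^sub>R k) $ Inl l))))"
          unfolding E2_def
          by (intro holder_bound_diff hT holder_bound_sum holder_bound_mult h\<gamma>k h\<gamma>r holder_bound_cmult holder_bound_cnj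
              holder_bound_component huk df1k MA)
        then show ?thesis
        proof (rule holder_bound_cong[OF holder_bound_mono[OF _ E(3)]])
          fix \<zeta> assume \<zeta>: "\<zeta> \<in> ?\<Gamma>"
          have pp: "cnj \<xi> * P i \<xi> = cnj \<xi> * P i 0 + v i \<xi>" if "\<xi> \<in> ?\<Gamma>" for \<xi>
            using sq[OF that, of "P i 0" "v i \<xi>"] v(2)[of \<xi> i] that by simp
          have e: "rotation_quotient k (rotation_quotient h (v i)) \<zeta> + rotation_quotient k (rotation_quotient h (\<lambda>z. cnj z * P i 0)) \<zeta>
            = rotation_quotient k (up i) \<zeta>"
            unfolding up_def rotation_quotient_def pp[OF rS(2)[OF rS(1)[OF \<zeta>]]] pp[OF rS(1)[OF \<zeta>]] pp[OF rS(2)[OF \<zeta>]] pp[OF \<zeta>]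
            by (simp only: scaleR_add_right scaleR_diff_right) simp
          have c1: "(\<Sum>l\<in>UNIV. A k' $ l $ i * cnj (uk \<zeta> $ Inl l)) = (\<Sum>l\<in>UNIV. cnj (uk \<zeta> $ Inl l) * A k' $ l $ i)" for k'
            by (simp only: mult.commute)
          have c2: "(\<Sum>l\<in>UNIV. A k' $ l $ i * cnj (((f1k \<zeta> - f1 \<zeta>) /\<^sub>R k) $ Inl l))
            = (\<Sum>l\<in>UNIV. cnj ((f1k \<zeta> - f1 \<zeta>) $ Inl l) * A k' $ l $ i) /\<^sub>R k" for k'
            unfolding scaleR_sum_right by (intro sum.cong refl) (simp add: scaleR_conv_of_real[where 'a = complex] mult_ac)
          show "defect_p A W MW i (f1 \<zeta>) (f \<zeta>) (cv \<zeta>)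
            (rotation_quotient k (rotation_quotient h (v i)) \<zeta> + rotation_quotient k (rotation_quotient h (\<lambda>z. cnj z * P i 0)) \<zeta>) (u2 \<zeta>) (\<gamma>2 \<zeta>)
            = ?T (Inl i) \<zeta> - (\<Sum>k'\<in>UNIV. of_real (\<gamma>k \<zeta> k') * (\<Sum>l\<in>UNIV. A k' $ l $ i * cnj (uk \<zeta> $ Inl l)))
          - (\<Sum>k'\<in>UNIV. of_real (\<gamma> (?r \<zeta>) k') * (\<Sum>l\<in>UNIV. A k' $ l $ i * cnj (((f1k \<zeta> - f1 \<zeta>) /\<^sub>R k) $ Inl l)))"
            unfolding e c1 c2 by (rule s_p[OF \<zeta>])
        qed
      qed
      show "holder_bound \<alpha> ?\<Gamma> E (\<lambda>\<zeta>. defect_w A MN j (f1 \<zeta>) (f \<zeta>) (u2 \<zeta>))" for j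
      proof -
        have "holder_bound \<alpha> ?\<Gamma> E3 (\<lambda>\<zeta>.
          Re (\<Sum>l\<in>UNIV. \<Sum>m\<in>UNIV. A j $ l $ m * (cnj (uk \<zeta> $ Inl l) * ((f1k \<zeta> - f1 \<zeta>) /\<^sub>R k) $ Inl m)
            + A j $ l $ m * (cnj (((fk \<zeta> - f \<zeta>) /\<^sub>R k) $ Inl l) * uk \<zeta> $ Inl m))
          - ((MN (f1k \<zeta>) (fk \<zeta>) (uk \<zeta>) - MN (f1 \<zeta>) (f \<zeta>) (uk \<zeta>)) /\<^sub>R k) $ j)"
          unfolding E3_def
          by (intro holder_bound_diff holder_bound_Re holder_bound_sum holder_bound_add holder_bound_cmult holder_bound_mult
              holder_bound_cnj holder_bound_component[OF df1k] holder_bound_component[OF dfk] holder_bound_component[OF huk]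
              holder_bound_component[OF inc[OF N]] MA)
        then show ?thesis by (rule holder_bound_cong[OF holder_bound_mono[OF _ E(4)]]) (rule s_w)
      qed
      show "holder_bound \<alpha> ?\<Gamma> J (rotation_quotient k (rotation_quotient h (\<lambda>z. cnj z * P i 0)))" for i
        by (rule holder_bound_mono[OF holder_bound_cnj_rotation_quotients[OF \<alpha> hk(1,3)] JP])
      show "holder_bound \<alpha> ?\<Gamma> J (rotation_quotient k (rotation_quotient h (\<lambda>z. cnj z * Q j 0)))" for j
        by (rule holder_bound_mono[OF holder_bound_cnj_rotation_quotients[OF \<alpha> hk(1,3)] JQ])
      show "cmod (rotation_quotient k (rotation_quotient h (\<lambda>\<zeta>. f \<zeta> $ Inr j)) 0) \<le> J"
        "cmod (rotation_quotient k (rotation_quotient h (\<lambda>\<zeta>. f \<zeta> $ Inl i)) 0) \<le> J" for i j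
        using J by (simp_all add: rotation_quotient_def)
      show "\<exists>p\<in>cball 0 1. cmod (rotation_quotient k (rotation_quotient h (t j)) p) \<le> J" for j
        using J by (intro bexI[of _ 0]) (simp_all add: rotation_quotient_def)
      show "0 \<le> 2 * B / k + 2 * G / k" using B G hk by simp
      show "holder_bound \<alpha> ?\<Gamma> (2 * B / k + 2 * G / k) u2"
        unfolding u2_def by (rule holder_bound_mono[OF rotation_quotient_bound[OF hu hk(3)]]) (use G hk in simp)
      show "holder_bound \<alpha> ?\<Gamma> (2 * B / k + 2 * G / k) (\<lambda>\<zeta>. complex_of_real (\<gamma>2 \<zeta> j))" for j
      proof -
        have "holder_bound \<alpha> ?\<Gamma> (2 * G / k) (\<lambda>\<zeta>. complex_of_real (\<gamma>2 \<zeta> j))"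
          by (rule holder_bound_cong[OF rotation_quotient_bound[OF h\<gamma>[of j] hk(3)]])
             (simp add: \<gamma>2_def rotation_quotient_complex)
        then show ?thesis by (rule holder_bound_mono) (use B hk in simp)
      qed
    qed
    have est_f: "holder_bound \<alpha> ?\<Gamma> (K * (E + J)) (rotation_quotient k (rotation_quotient h (\<lambda>\<zeta>. f \<zeta> $ s)))" for s
      using est by (cases s) simp_all
    from g show "holder_bound \<alpha> ?\<Gamma> (K * (E + J)) (rotation_quotient k (rotation_quotient h g))"
    proof (elim UnE rangeE)
      show ?thesis if "g = v i" for i unfolding that using est by blast
      show ?thesis if "g = t j" for j unfolding that using est by blast
      show ?thesis if "g = (\<lambda>\<zeta>. f \<zeta> $ s)" for s unfolding that by (rule est_f)
    qed
  qed
qed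

end

section \<open>Boundary regularity and uniqueness of lifts\<close>

text \<open>Integrating the Hoelder bound of the second derivative twice along the segment to 1 shows that g and its
  derivative are of order \<open>2 + \<alpha>\<close> and \<open>1 + \<alpha>\<close> at 1. The derivative of the quotient is therefore of
  order \<open>\<alpha> - 1\<close>, and the Hardy-Littlewood theorem applies because \<open>\<bar>1 - z\<bar>\<close> is at least \<open>1 - \<bar>z\<bar>\<close>.\<close>

lemma double_zero_quotient:
  assumes \<alpha>: "0 < \<alpha>" "\<alpha> < 1" and g: "g \<in> disc_algebra" and C: "0 \<le> C"
    and g1: "\<And>z. z \<in> cball 0 1 \<Longrightarrow> (g has_field_derivative g1 z) (at z within cball 0 1)"
    and g2: "\<And>z. z \<in> cball 0 1 \<Longrightarrow> (g1 has_field_derivative g2 z) (at z within cball 0 1)"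
    and hol: "\<And>z w. z \<in> cball 0 1 \<Longrightarrow> w \<in> cball 0 1 \<Longrightarrow> cmod (g2 z - g2 w) \<le> C * cmod (z - w) powr \<alpha>"
    and jet: "g 1 = 0" "g1 1 = 0" "g2 1 = 0"
  obtains H B where "H \<in> disc_algebra" "H 1 = 0" "0 \<le> B" "\<And>z. z \<in> cball 0 1 \<Longrightarrow> g z = (1 - z)\<^sup>2 * H z"
    "\<And>z w. z \<in> cball 0 1 \<Longrightarrow> w \<in> cball 0 1 \<Longrightarrow> cmod (H z - H w) \<le> B * cmod (z - w) powr \<alpha>"
proof -
  have seg: "closed_segment 1 z \<subseteq> cball 0 1" if "z \<in> cball 0 1" for z :: complex
    using that by (intro closed_segment_subset) auto
  have seg_le: "cmod (w - 1) \<le> cmod (z - 1)" if w: "w \<in> closed_segment 1 z" for w z :: complex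
  proof -
    obtain t where t: "0 \<le> t" "t \<le> 1" "w = (1 - t) *\<^sub>R 1 + t *\<^sub>R z"
      using w unfolding closed_segment_def by blast
    then have "w - 1 = t *\<^sub>R (z - 1)" by (simp add: algebra_simps)
    then show ?thesis using t by (simp add: mult_left_le_one_le)
  qed
  have b2: "cmod (g2 w) \<le> C * cmod (z - 1) powr \<alpha>" if z: "z \<in> cball 0 1" and w: "w \<in> closed_segment 1 z" for z w
  proof -
    have "cmod (g2 w - g2 1) \<le> C * cmod (w - 1) powr \<alpha>" using seg[OF z] w by (intro hol) auto
    also have "\<dots> \<le> C * cmod (z - 1) powr \<alpha>"
      using seg_le[OF w] C \<alpha> by (intro mult_left_mono powr_mono2) auto
    finally show ?thesis by (simp add: jet)
  qed
  have b1: "cmod (g1 w) \<le> C * cmod (z - 1) powr \<alpha> * cmod (z - 1)" if z: "z \<in> cball 0 1" and w: "w \<in> closed_segment 1 z" for z w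
  proof -
    have "cmod (g1 w - g1 1) \<le> C * cmod (z - 1) powr \<alpha> * cmod (w - 1)"
    proof (rule field_differentiable_bound[of "closed_segment 1 z"])
      show "(g1 has_field_derivative g2 x) (at x within closed_segment 1 z)" if "x \<in> closed_segment 1 z" for x
        by (rule DERIV_subset[OF g2 seg[OF z]]) (use seg[OF z] that in blast)
      show "cmod (g2 x) \<le> C * cmod (z - 1) powr \<alpha>" if "x \<in> closed_segment 1 z" for x by (rule b2[OF z that])
    qed (use w in auto)
    also have "\<dots> \<le> C * cmod (z - 1) powr \<alpha> * cmod (z - 1)" using C by (intro mult_left_mono seg_le[OF w]) auto
    finally show ?thesis by (simp add: jet)
  qed
  have b0: "cmod (g z) \<le> C * cmod (z - 1) powr \<alpha> * cmod (z - 1) * cmod (z - 1)" if z: "z \<in> cball 0 1" for z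
  proof -
    have "cmod (g z - g 1) \<le> C * cmod (z - 1) powr \<alpha> * cmod (z - 1) * cmod (z - 1)"
    proof (rule field_differentiable_bound[of "closed_segment 1 z"])
      show "(g has_field_derivative g1 x) (at x within closed_segment 1 z)" if "x \<in> closed_segment 1 z" for x
        by (rule DERIV_subset[OF g1 seg[OF z]]) (use seg[OF z] that in blast)
      show "cmod (g1 x) \<le> C * cmod (z - 1) powr \<alpha> * cmod (z - 1)" if "x \<in> closed_segment 1 z" for x by (rule b1[OF z that])
    qed auto
    then show ?thesis by (simp add: jet)
  qed
  have gc: "continuous_on (cball 0 1) g" and gh: "g holomorphic_on ball 0 1" using g by (auto simp: disc_algebra_def)
  define H where "H = (\<lambda>z. g z / (1 - z)\<^sup>2)"
  have H1: "H 1 = 0" by (simp add: H_def)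
  have Hb: "cmod (H z) \<le> C * cmod (z - 1) powr \<alpha>" if z: "z \<in> cball 0 1" for z
  proof (cases "z = 1")
    case False
    have "cmod (H z) = cmod (g z) / (cmod (z - 1) * cmod (z - 1))"
      by (simp add: H_def norm_divide norm_power norm_mult power2_eq_square norm_minus_commute)
    also have "\<dots> \<le> C * cmod (z - 1) powr \<alpha>" using b0[OF z] False by (simp add: divide_le_eq mult.assoc)
    finally show ?thesis .
  qed (simp add: H1)
  have Hh: "H holomorphic_on ball 0 1" unfolding H_def by (intro holomorphic_intros gh) auto
  have "continuous_on (cball 0 1) H"
    unfolding continuous_on_eq_continuous_within
  proof
    fix z :: complex assume z: "z \<in> cball 0 1"
    show "continuous (at z within cball 0 1) H"
    proof (cases "z = 1")
      case True
      have "(H \<longlongrightarrow> 0) (at 1 within cball 0 1)"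
      proof (rule Lim_null_comparison)
        show "\<forall>\<^sub>F z in at 1 within cball 0 1. cmod (H z) \<le> C * cmod (z - 1) powr \<alpha>"
          using Hb by (auto simp: eventually_at_filter)
        have "((\<lambda>z::complex. C * cmod (z - 1) powr \<alpha>) \<longlongrightarrow> C * cmod (1 - 1) powr \<alpha>) (at 1 within cball 0 1)"
          using \<alpha> by (intro tendsto_intros tendsto_powr') auto
        then show "((\<lambda>z::complex. C * cmod (z - 1) powr \<alpha>) \<longlongrightarrow> 0) (at 1 within cball 0 1)" by simp
      qed
      then show ?thesis using True by (simp add: continuous_within H1)
    next
      case False
      then show ?thesis unfolding H_def
      proof (intro continuous_at_within_divide continuous_power continuous_diff continuous_const continuous_ident)
        show "continuous (at z within cball 0 1) g" using gc z by (simp only: continuous_on_eq_continuous_within)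
        show "(1 - z)\<^sup>2 \<noteq> 0" using False by simp
      qed
    qed
  qed
  then have H: "H \<in> disc_algebra" using Hh by (simp add: disc_algebra_def)
  have dH: "cmod (deriv H z) \<le> (3 * C) * (1 - cmod z) powr (\<alpha> - 1)" if z: "z \<in> ball 0 1" for z
  proof -
    have zc: "z \<in> cball 0 1" and z1: "z \<noteq> 1" using z by auto
    define r where "r = cmod (z - 1)"
    have r: "0 < r" using z1 by (simp add: r_def)
    have "(g has_field_derivative g1 z) (at z)"
    proof -
      have "at z within cball 0 1 = at z" by (rule at_within_interior) (use z in \<open>simp only: interior_cball\<close>)
      then show ?thesis using g1[OF zc] by simp
    qed
    moreover have "((\<lambda>z. (1 - z)\<^sup>2) has_field_derivative 2 * (1 - z) * (-1)) (at z)"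
      by (auto intro!: derivative_eq_intros)
    moreover have X: "1 - z \<noteq> 0" using z1 by simp
    ultimately have "(H has_field_derivative (g1 z * (1 - z)\<^sup>2 - g z * (2 * (1 - z) * (-1))) / ((1 - z)\<^sup>2 * (1 - z)\<^sup>2)) (at z)"
      unfolding H_def by (intro DERIV_divide) simp_all
    then have "deriv H z = (g1 z * (1 - z)\<^sup>2 - g z * (2 * (1 - z) * (-1))) / ((1 - z)\<^sup>2 * (1 - z)\<^sup>2)"
      by (rule DERIV_imp_deriv)
    also have "\<dots> = g1 z / (1 - z)\<^sup>2 + 2 * g z / (1 - z) ^ 3"
    proof -
      have "(a * x\<^sup>2 - b * (2 * x * (-1))) / (x\<^sup>2 * x\<^sup>2) = a / x\<^sup>2 + 2 * b / x ^ 3" if "x \<noteq> 0" for a b x :: complex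
        using that by (simp add: field_simps power2_eq_square power3_eq_cube)
      from this[OF X] show ?thesis .
    qed
    finally have "cmod (deriv H z) \<le> cmod (g1 z / (1 - z)\<^sup>2) + cmod (2 * g z / (1 - z) ^ 3)"
      by (simp only: norm_triangle_ineq)
    also have "cmod (g1 z / (1 - z)\<^sup>2) + cmod (2 * g z / (1 - z) ^ 3) = cmod (g1 z) / r\<^sup>2 + 2 * cmod (g z) / r ^ 3"
      by (simp add: norm_divide norm_mult norm_power r_def norm_minus_commute)
    also have "\<dots> \<le> (C * r powr \<alpha> * r) / r\<^sup>2 + 2 * (C * r powr \<alpha> * r * r) / r ^ 3"
      using b1[OF zc, of z] b0[OF zc] r by (intro add_mono divide_right_mono mult_left_mono) (auto simp: r_def)
    also have "\<dots> = 3 * C * r powr (\<alpha> - 1)"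
    proof -
      have "C * r powr \<alpha> * r / r\<^sup>2 = C * (r powr \<alpha> / r)" using r by (simp add: power2_eq_square)
      moreover have "2 * (C * r powr \<alpha> * r * r) / r ^ 3 = 2 * (C * (r powr \<alpha> / r))" using r by (simp add: power3_eq_cube)
      ultimately show ?thesis using r by (simp add: powr_diff)
    qed
    also have "\<dots> \<le> 3 * C * (1 - cmod z) powr (\<alpha> - 1)"
    proof (intro mult_left_mono powr_mono2')
      show "1 - cmod z \<le> r" using norm_triangle_ineq2[of 1 z] by (simp add: r_def norm_minus_commute)
    qed (use C \<alpha> z in auto)
    finally show ?thesis .
  qed
  show thesis
  proof (rule that[OF H H1])
    show "0 \<le> 3 * C * (2 / \<alpha> + 1)" using C \<alpha> by simp
    show "g z = (1 - z)\<^sup>2 * H z" if "z \<in> cball 0 1" for z using jet by (cases "z = 1") (auto simp: H_def)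
    show "cmod (H z - H w) \<le> 3 * C * (2 / \<alpha> + 1) * cmod (z - w) powr \<alpha>" if "z \<in> cball 0 1" "w \<in> cball 0 1" for z w
      using C by (intro hardy_littlewood_aux[OF \<alpha> H _ dH that]) auto
  qed
qed

lemma holder_bound_identity:
  assumes "0 < \<alpha>" "\<alpha> < 1" "\<Gamma> \<subseteq> sphere 0 1"
  shows "holder_bound \<alpha> \<Gamma> 2 (\<lambda>z. z)"
proof (rule holder_boundI)
  show "cmod z \<le> 2" if "z \<in> \<Gamma>" for z using that assms(3) by auto
  show "cmod (z - w) \<le> 2 * cmod (z - w) powr \<alpha>" if "z \<in> \<Gamma>" "w \<in> \<Gamma>" for z w
  proof -
    have "z \<in> cball 0 1" "w \<in> cball 0 1" using that assms(3) by auto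
    then show ?thesis using lipschitz_imp_holder[OF assms(1,2), of 1 z w] by simp
  qed
qed

context perturbation_estimate
begin

text \<open>First rotation quotients of a disc with Hoelder continuous first derivative are uniformly bounded, and
  this is all that is needed to bound the second ones and hence to gain one derivative.\<close>

lemma lift_C2_holder:
  fixes N :: "complex ^ ('n + 'd) \<Rightarrow> real ^ 'd" and f :: "complex \<Rightarrow> complex ^ ('n + 'd)"
    and P :: "'n \<Rightarrow> complex \<Rightarrow> complex" and Q :: "'d \<Rightarrow> complex \<Rightarrow> complex" and cv :: "complex \<Rightarrow> 'd \<Rightarrow> real"
  assumes N: "difference_quotient S \<epsilon> N MN" and W: "\<And>k m. difference_quotient S \<epsilon> (W k m) (MW k m)"
    and fS: "\<And>\<zeta>. \<zeta> \<in> sphere 0 1 \<Longrightarrow> f \<zeta> \<in> S"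
    and lift: "\<And>\<zeta>. \<zeta> \<in> sphere 0 1 \<Longrightarrow> lift_at A N W (f \<zeta>) (\<lambda>i. cnj \<zeta> * P i \<zeta>) (\<lambda>j. cnj \<zeta> * Q j \<zeta>) (cv \<zeta>)"
    and fL: "holder_bound \<alpha> (sphere 0 1) L f"
    and cv: "\<And>k. holder_bound \<alpha> (sphere 0 1) \<epsilon> (\<lambda>\<zeta>. complex_of_real (cv \<zeta> k - c $ k))"
    and DA: "\<And>s. (\<lambda>\<zeta>. f \<zeta> $ s) \<in> disc_algebra" "\<And>i. P i \<in> disc_algebra" "\<And>j. Q j \<in> disc_algebra"
    and B: "0 \<le> B"
    and df: "\<And>h. 0 < h \<Longrightarrow> h < 1 \<Longrightarrow> holder_bound \<alpha> (sphere 0 1) B (rotation_quotient h f)"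
    and dQ: "\<And>h j. 0 < h \<Longrightarrow> h < 1 \<Longrightarrow> holder_bound \<alpha> (sphere 0 1) B (rotation_quotient h (\<lambda>\<zeta>. cnj \<zeta> * Q j \<zeta>))"
  shows "C2_holder_disc \<alpha> (\<lambda>\<zeta>. f \<zeta> $ s)" "C2_holder_disc \<alpha> (P i)" "C2_holder_disc \<alpha> (Q j)"
proof -
  \<comment> \<open>The quotient (g z - g 0) / z, extended holomorphically over the origin.\<close>
  define dv where "dv = (\<lambda>g. SOME v. v \<in> disc_algebra \<and> (\<forall>z\<in>cball 0 1. g z = g 0 + z * v z))"
  have dv_ex: "dv g \<in> disc_algebra \<and> (\<forall>z\<in>cball 0 1. g z = g 0 + z * dv g z)" if g: "g \<in> disc_algebra" for g
    unfolding dv_def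
  proof (rule someI_ex[where P = "\<lambda>v. v \<in> disc_algebra \<and> (\<forall>z\<in>cball 0 1. g z = g 0 + z * v z)"])
    show "\<exists>v. v \<in> disc_algebra \<and> (\<forall>z\<in>cball 0 1. g z = g 0 + z * v z)"
    proof (rule disc_algebra_divide_id[OF g])
      fix v assume "v \<in> disc_algebra" "\<And>z. z \<in> cball 0 1 \<Longrightarrow> g z = g 0 + z * v z"
      then show "\<exists>v. v \<in> disc_algebra \<and> (\<forall>z\<in>cball 0 1. g z = g 0 + z * v z)" by blast
    qed
  qed
  have dv: "dv g \<in> disc_algebra" "z \<in> cball 0 1 \<Longrightarrow> g z = g 0 + z * dv g z" if "g \<in> disc_algebra" for g z
    using dv_ex[OF that] by blast+
  let ?R = "range (\<lambda>i. dv (P i)) \<union> range (\<lambda>j. dv (Q j)) \<union> range (\<lambda>s \<zeta>. f \<zeta> $ s)"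
  have "\<exists>C\<ge>0. \<forall>h k g. 0 < h \<longrightarrow> h < 1 \<longrightarrow> 0 < k \<longrightarrow> k < 1 \<longrightarrow> g \<in> ?R \<longrightarrow>
      holder_bound \<alpha> (sphere 0 1) C (rotation_quotient k (rotation_quotient h g))"
  proof (rule lift_second_rotation_quotients[where v = "\<lambda>i. dv (P i)" and t = "\<lambda>j. dv (Q j)",
        OF N W fS lift fL cv DA(1) dv(1)[OF DA(2)] dv(2)[OF DA(2)] dv(1)[OF DA(3)] dv(2)[OF DA(3)] B df dQ])
    fix C assume C: "0 \<le> C" and hb: "\<And>h k g. 0 < h \<Longrightarrow> h < 1 \<Longrightarrow> 0 < k \<Longrightarrow> k < 1 \<Longrightarrow> g \<in> ?R \<Longrightarrow>
        holder_bound \<alpha> (sphere 0 1) C (rotation_quotient k (rotation_quotient h g))"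
    show "\<exists>C\<ge>0. \<forall>h k g. 0 < h \<longrightarrow> h < 1 \<longrightarrow> 0 < k \<longrightarrow> k < 1 \<longrightarrow> g \<in> ?R \<longrightarrow>
      holder_bound \<alpha> (sphere 0 1) C (rotation_quotient k (rotation_quotient h g))"
      by (intro exI[of _ C] conjI allI impI C hb)
  qed
  then obtain C where C: "0 \<le> C" and hb': "\<forall>h k g. 0 < h \<longrightarrow> h < 1 \<longrightarrow> 0 < k \<longrightarrow> k < 1 \<longrightarrow> g \<in> ?R \<longrightarrow>
      holder_bound \<alpha> (sphere 0 1) C (rotation_quotient k (rotation_quotient h g))"
    by (elim exE conjE) (rule that)
  have hb: "holder_bound \<alpha> (sphere 0 1) C (rotation_quotient k (rotation_quotient h g))"
    if "0 < h" "h < 1" "0 < k" "k < 1" "g \<in> ?R" for h k g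
    using hb'[rule_format, OF that] .
  have C2: "C2_holder_disc \<alpha> g" if "g \<in> disc_algebra" "g \<in> ?R" for g
    by (rule C2_holder_disc_from_rotation_quotients[OF exponent that(1) C hb]) (use that in auto)
  show "C2_holder_disc \<alpha> (\<lambda>\<zeta>. f \<zeta> $ s)" by (rule C2[OF DA(1)]) auto
  show "C2_holder_disc \<alpha> (P i)" by (rule C2_holder_disc_shift[OF exponent C2[OF dv(1)[OF DA(2)]] dv(2)[OF DA(2)]]) auto
  show "C2_holder_disc \<alpha> (Q j)" by (rule C2_holder_disc_shift[OF exponent C2[OF dv(1)[OF DA(3)]] dv(2)[OF DA(3)]]) auto
qed

text \<open>After division by \<open>\<bar>1 - \<zeta>\<bar>\<^sup>2\<close> the difference of the lifts solves the linear system with no defect.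
  Its components \<open>- \<zeta> * H s\<close> vanish at the origin and the components \<open>- HQ j\<close> vanish at 1, so the
  estimate bounds the solution by 0.\<close>

lemma lifts_determined:
  fixes N :: "complex ^ ('n + 'd) \<Rightarrow> real ^ 'd" and f f' :: "complex \<Rightarrow> complex ^ ('n + 'd)"
    and P P' :: "'n \<Rightarrow> complex \<Rightarrow> complex" and Q Q' :: "'d \<Rightarrow> complex \<Rightarrow> complex" and cv cv' :: "complex \<Rightarrow> 'd \<Rightarrow> real"
  assumes N: "difference_quotient S \<epsilon> N MN" and W: "\<And>k m. difference_quotient S \<epsilon> (W k m) (MW k m)"
    and fS: "\<And>\<zeta>. \<zeta> \<in> sphere 0 1 \<Longrightarrow> f \<zeta> \<in> S" "\<And>\<zeta>. \<zeta> \<in> sphere 0 1 \<Longrightarrow> f' \<zeta> \<in> S"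
    and lift: "\<And>\<zeta>. \<zeta> \<in> sphere 0 1 \<Longrightarrow> lift_at A N W (f \<zeta>) (\<lambda>i. cnj \<zeta> * P i \<zeta>) (\<lambda>j. cnj \<zeta> * Q j \<zeta>) (cv \<zeta>)"
      "\<And>\<zeta>. \<zeta> \<in> sphere 0 1 \<Longrightarrow> lift_at A N W (f' \<zeta>) (\<lambda>i. cnj \<zeta> * P' i \<zeta>) (\<lambda>j. cnj \<zeta> * Q' j \<zeta>) (cv' \<zeta>)"
    and fL: "holder_bound \<alpha> (sphere 0 1) L f" "holder_bound \<alpha> (sphere 0 1) L f'"
    and cv: "\<And>k. holder_bound \<alpha> (sphere 0 1) \<epsilon> (\<lambda>\<zeta>. complex_of_real (cv' \<zeta> k - c $ k))"
    and H: "\<And>s. H s \<in> disc_algebra" "\<And>s. H s 1 = 0" "\<And>s \<zeta>. \<zeta> \<in> cball 0 1 \<Longrightarrow> f \<zeta> $ s - f' \<zeta> $ s = (1 - \<zeta>)\<^sup>2 * H s \<zeta>"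
    and HP: "\<And>i. HP i \<in> disc_algebra" "\<And>i \<zeta>. \<zeta> \<in> cball 0 1 \<Longrightarrow> P i \<zeta> - P' i \<zeta> = (1 - \<zeta>)\<^sup>2 * HP i \<zeta>"
    and HQ: "\<And>j. HQ j \<in> disc_algebra" "\<And>j. HQ j 1 = 0" "\<And>j \<zeta>. \<zeta> \<in> cball 0 1 \<Longrightarrow> Q j \<zeta> - Q' j \<zeta> = (1 - \<zeta>)\<^sup>2 * HQ j \<zeta>"
    and B: "0 \<le> B"
      "\<And>s z w. z \<in> cball 0 1 \<Longrightarrow> w \<in> cball 0 1 \<Longrightarrow> cmod (H s z - H s w) \<le> B * cmod (z - w) powr \<alpha>"
      "\<And>j z w. z \<in> cball 0 1 \<Longrightarrow> w \<in> cball 0 1 \<Longrightarrow> cmod (HQ j z - HQ j w) \<le> B * cmod (z - w) powr \<alpha>"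
    and \<zeta>: "\<zeta> \<in> sphere 0 1 - {1}"
  shows "H s \<zeta> = 0" "HP i \<zeta> = 0" "HQ j \<zeta> = 0"
proof -
  let ?\<Gamma> = "sphere (0::complex) 1 - {1}" and ?m = "real CARD('n + 'd)"
  have \<Gamma>: "?\<Gamma> \<subseteq> sphere 0 1" by auto
  \<comment> \<open>This factor is real, so the divided multipliers are real, and it differs from \<open>(1 - \<zeta>)\<^sup>2\<close> by the unimodular factor \<open>- \<zeta>\<close>.\<close>
  define \<tau> where "\<tau> = (\<lambda>\<zeta>. (cmod (1 - \<zeta>))\<^sup>2)"
  have \<tau>: "\<tau> \<zeta> \<noteq> 0" "(1 - \<zeta>)\<^sup>2 = of_real (\<tau> \<zeta>) * (- \<zeta>)" "cnj \<zeta> * \<zeta> = 1" if "\<zeta> \<in> ?\<Gamma>" for \<zeta>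
  proof -
    show "\<tau> \<zeta> \<noteq> 0" using that by (auto simp: \<tau>_def)
    show 1: "cnj \<zeta> * \<zeta> = 1" using that complex_norm_square[of \<zeta>] by (simp add: mult.commute)
    have t: "of_real (\<tau> \<zeta>) = (1 - \<zeta>) * (1 - cnj \<zeta>)" unfolding \<tau>_def complex_norm_square by simp
    have "of_real (\<tau> \<zeta>) * (- \<zeta>) = (1 - \<zeta>) * (cnj \<zeta> * \<zeta> - \<zeta>)" unfolding t by (simp add: algebra_simps)
    then show "(1 - \<zeta>)\<^sup>2 = of_real (\<tau> \<zeta>) * (- \<zeta>)" unfolding 1 by (simp only: power2_eq_square)
  qed
  define u where "u = (\<lambda>\<zeta>. (f \<zeta> - f' \<zeta>) /\<^sub>R \<tau> \<zeta>)"
  define \<gamma> where "\<gamma> = (\<lambda>\<zeta> k. (cv \<zeta> k - cv' \<zeta> k) / \<tau> \<zeta>)"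
  have u_comp: "u \<zeta> $ s = - \<zeta> * H s \<zeta>" if "\<zeta> \<in> ?\<Gamma>" for \<zeta> s
  proof -
    have "u \<zeta> $ s = (f \<zeta> $ s - f' \<zeta> $ s) /\<^sub>R \<tau> \<zeta>" by (simp add: u_def)
    also have "f \<zeta> $ s - f' \<zeta> $ s = of_real (\<tau> \<zeta>) * (- \<zeta> * H s \<zeta>)"
      using H(3)[of \<zeta> s] that unfolding \<tau>(2)[OF that] by (simp add: mult.assoc)
    also have "(of_real (\<tau> \<zeta>) * (- \<zeta> * H s \<zeta>)) /\<^sub>R \<tau> \<zeta> = - \<zeta> * H s \<zeta>"
      using \<tau>(1)[OF that] by (simp add: scaleR_conv_of_real[where 'a = complex])
    finally show ?thesis .
  qed
  have cov: "(cnj \<zeta> * a - cnj \<zeta> * b) / of_real (\<tau> \<zeta>) = - h" if z: "\<zeta> \<in> ?\<Gamma>" and e: "a - b = (1 - \<zeta>)\<^sup>2 * h" for \<zeta> a b h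
  proof -
    have "cnj \<zeta> * a - cnj \<zeta> * b = cnj \<zeta> * (a - b)" by (simp only: right_diff_distrib)
    also have "\<dots> = (cnj \<zeta> * \<zeta>) * (- of_real (\<tau> \<zeta>) * h)" unfolding e \<tau>(2)[OF z] by (simp only: mult_ac mult_minus_left mult_minus_right)
    also have "\<dots> = - of_real (\<tau> \<zeta>) * h" unfolding \<tau>(3)[OF z] by simp
    finally show ?thesis using \<tau>(1)[OF z] by simp
  qed
  have z_q: "defect_q W MW j (f \<zeta>) (f' \<zeta>) (cv' \<zeta>) (- HQ j \<zeta>) (u \<zeta>) (\<gamma> \<zeta>) = 0" if z: "\<zeta> \<in> ?\<Gamma>" for j \<zeta>
  proof -
    have e: "(cnj \<zeta> * Q j \<zeta> - cnj \<zeta> * Q' j \<zeta>) / of_real (\<tau> \<zeta>) = - HQ j \<zeta>"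
      by (rule cov[OF z HQ(3)]) (use z in auto)
    show ?thesis
      unfolding u_def \<gamma>_def e[symmetric]
      by (rule defect_q_pair[OF W fS(1) fS(2) lift(1) lift(2)]) (use z in auto)
  qed
  have z_p: "defect_p A W MW i (f \<zeta>) (f' \<zeta>) (cv' \<zeta>) (- HP i \<zeta>) (u \<zeta>) (\<gamma> \<zeta>) = 0" if z: "\<zeta> \<in> ?\<Gamma>" for i \<zeta>
  proof -
    have e: "(cnj \<zeta> * P i \<zeta> - cnj \<zeta> * P' i \<zeta>) / of_real (\<tau> \<zeta>) = - HP i \<zeta>"
      by (rule cov[OF z HP(2)]) (use z in auto)
    show ?thesis
      unfolding u_def \<gamma>_def e[symmetric]
      by (rule defect_p_pair[OF W fS(1) fS(2) lift(1) lift(2)]) (use z in auto)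
  qed
  have z_w: "defect_w A MN j (f \<zeta>) (f' \<zeta>) (u \<zeta>) = 0" if z: "\<zeta> \<in> ?\<Gamma>" for j \<zeta>
    unfolding u_def by (rule defect_w_pair[OF N fS(1) fS(2) lift(1) lift(2)]) (use z in auto)
  have fS': "f \<zeta> \<in> S" "f' \<zeta> \<in> S" if "\<zeta> \<in> ?\<Gamma>" for \<zeta>
    using that by (auto intro!: fS)
  note fL' = holder_bound_subset[OF fL(1) \<Gamma>] holder_bound_subset[OF fL(2) \<Gamma>]
  note cv_\<Gamma> = holder_bound_subset[OF cv \<Gamma>]
  have hH: "holder_bound \<alpha> ?\<Gamma> (2 * B) (H s)" for s
    using holder_bound_from_increments[OF exponent \<Gamma> B(1) B(2)[of _ _ s], where p = 1 and J = 0] H(2)[of s] by simp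
  have hHQ: "holder_bound \<alpha> ?\<Gamma> (2 * B) (\<lambda>\<zeta>. - HQ j \<zeta>)" for j
    using holder_bound_uminus[OF holder_bound_from_increments[OF exponent \<Gamma> B(1) B(3)[of _ _ j], where p = 1 and J = 0]] HQ(2)[of j] by simp
  define B' where "B' = ?m * (2 * 2 * (2 * B)) + 2 * B"
  have B': "0 \<le> B'" using B by (simp add: B'_def)
  have hu: "holder_bound \<alpha> ?\<Gamma> B' u"
  proof -
    have comp: "holder_bound \<alpha> ?\<Gamma> (2 * 2 * (2 * B)) (\<lambda>\<zeta>. u \<zeta> $ s)" for s
      by (rule holder_bound_cong[OF holder_bound_mult[OF holder_bound_uminus[OF holder_bound_identity[OF exponent \<Gamma>]] hH[of s]] u_comp])
    show ?thesis
      by (rule holder_bound_mono[OF holder_bound_vec[OF comp]]) (use B(1) in \<open>simp add: B'_def\<close>)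
  qed
  have hq: "holder_bound \<alpha> ?\<Gamma> B' (\<lambda>\<zeta>. - HQ j \<zeta>)" for j
    by (rule holder_bound_mono[OF hHQ]) (use B(1) in \<open>simp add: B'_def\<close>)
  define G where "G = 16 * real CARD('d) * (B' + real CARD('d) * (2 * (1 + norm c) * (\<epsilon> * B' * (1 + 2 * L))))"
  have G: "0 \<le> G" using B' constants by (simp add: G_def)
  have h\<gamma>: "holder_bound \<alpha> ?\<Gamma> G (\<lambda>\<zeta>. complex_of_real (\<gamma> \<zeta> k))" for k
    unfolding G_def
    by (rule multiplier_difference_bound[OF W fL'(1) fS'(1) fL'(2) fS'(2) cv_\<Gamma> hq hu z_q]) assumption+
  have zero: "holder_bound \<alpha> ?\<Gamma> 0 p" if "\<And>\<zeta>. \<zeta> \<in> ?\<Gamma> \<Longrightarrow> p \<zeta> = 0" for p :: "complex \<Rightarrow> 'z::real_normed_vector"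
  proof (rule holder_boundI)
    fix z w assume z: "z \<in> ?\<Gamma>"
    show "norm (p z) \<le> 0" unfolding that[OF z] by simp
    assume w: "w \<in> ?\<Gamma>"
    show "norm (p z - p w) \<le> 0 * cmod (z - w) powr \<alpha>" unfolding that[OF z] that[OF w] by simp
  qed
  have concl: "(\<forall>i. holder_bound \<alpha> ?\<Gamma> (K * (0 + 0)) (\<lambda>\<zeta>. - \<zeta> * H (Inl i) \<zeta>)) \<and> (\<forall>i. holder_bound \<alpha> ?\<Gamma> (K * (0 + 0)) (\<lambda>\<zeta>. - HP i \<zeta>))
       \<and> (\<forall>j. holder_bound \<alpha> ?\<Gamma> (K * (0 + 0)) (\<lambda>\<zeta>. - \<zeta> * H (Inr j) \<zeta>)) \<and> (\<forall>j. holder_bound \<alpha> ?\<Gamma> (K * (0 + 0)) (\<lambda>\<zeta>. - HQ j \<zeta>))"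
  proof (rule estimate[where ?f1.0 = f and ?f2.0 = f' and cv = cv' and u = u and \<gamma> = \<gamma> and ?S0.0 = "B' + G"
        and ep = "\<lambda>_ _. 0" and eq = "\<lambda>_ _. 0", OF order_refl \<Gamma> order_refl order_refl N W fS' fL' cv_\<Gamma>])
    have m: "(\<lambda>z. - z * g z) \<in> disc_algebra" and n: "(\<lambda>z. - g z) \<in> disc_algebra" if "g \<in> disc_algebra" for g
    proof -
      have g: "continuous_on (cball 0 1) g" "g holomorphic_on ball 0 1" using that by (simp_all add: disc_algebra_def)
      have "continuous_on (cball 0 1) (\<lambda>z. - z * g z)" by (intro continuous_on_mult continuous_on_minus continuous_on_id g(1))
      moreover have "(\<lambda>z. - z * g z) holomorphic_on ball 0 1" by (intro holomorphic_on_mult holomorphic_on_minus holomorphic_on_ident g(2))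
      ultimately show "(\<lambda>z. - z * g z) \<in> disc_algebra" by (simp only: disc_algebra_def mem_Collect_eq)
      have "continuous_on (cball 0 1) (\<lambda>z. - g z)" by (rule continuous_on_minus[OF g(1)])
      moreover have "(\<lambda>z. - g z) holomorphic_on ball 0 1" by (rule holomorphic_on_minus[OF g(2)])
      ultimately show "(\<lambda>z. - g z) \<in> disc_algebra" by (simp only: disc_algebra_def mem_Collect_eq)
    qed
    show "(\<lambda>\<zeta>. - \<zeta> * H (Inl i) \<zeta>) \<in> disc_algebra" for i by (rule m[OF H(1)])
    show "(\<lambda>\<zeta>. - HP i \<zeta>) \<in> disc_algebra" for i by (rule n[OF HP(1)])
    show "(\<lambda>\<zeta>. - \<zeta> * H (Inr j) \<zeta>) \<in> disc_algebra" for j by (rule m[OF H(1)])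
    show "(\<lambda>\<zeta>. - HQ j \<zeta>) \<in> disc_algebra" for j by (rule n[OF HQ(1)])
    show "holder_bound \<alpha> ?\<Gamma> 0 (\<lambda>\<zeta>. defect_q W MW j (f \<zeta>) (f' \<zeta>) (cv' \<zeta>) (- HQ j \<zeta> + 0) (u \<zeta>) (\<gamma> \<zeta>))" for j
      by (rule zero) (simp only: z_q add_0_right)
    show "holder_bound \<alpha> ?\<Gamma> 0 (\<lambda>\<zeta>. defect_p A W MW i (f \<zeta>) (f' \<zeta>) (cv' \<zeta>) (- HP i \<zeta> + 0) (u \<zeta>) (\<gamma> \<zeta>))" for i
      by (rule zero) (simp only: z_p add_0_right)
    show "holder_bound \<alpha> ?\<Gamma> 0 (\<lambda>\<zeta>. defect_w A MN j (f \<zeta>) (f' \<zeta>) (u \<zeta>))" for j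
      by (rule zero) (simp only: z_w)
    show "holder_bound \<alpha> ?\<Gamma> 0 (\<lambda>_. 0 :: complex)" "holder_bound \<alpha> ?\<Gamma> 0 (\<lambda>_. 0 :: complex)" by (rule zero, simp)+
    show "\<exists>p\<in>cball 0 1. cmod (- HQ j p) \<le> 0" for j using HQ(2) by (intro bexI[of _ 1]) auto
    show "holder_bound \<alpha> ?\<Gamma> (B' + G) u" by (rule holder_bound_mono[OF hu]) (use G in simp)
    show "holder_bound \<alpha> ?\<Gamma> (B' + G) (\<lambda>\<zeta>. complex_of_real (\<gamma> \<zeta> k))" for k by (rule holder_bound_mono[OF h\<gamma>]) (use B' in simp)
  qed ((rule u_comp, assumption) | use B' G in simp)+
  have c: "p \<zeta> = 0" if "holder_bound \<alpha> ?\<Gamma> (K * (0 + 0)) p" for p :: "complex \<Rightarrow> complex"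
    using holder_boundD(1)[OF that \<zeta>] by simp
  note c1 = conjunct1[OF concl, THEN spec] and c2 = conjunct1[OF conjunct2[OF concl], THEN spec]
    and c3 = conjunct1[OF conjunct2[OF conjunct2[OF concl]], THEN spec]
    and c4 = conjunct2[OF conjunct2[OF conjunct2[OF concl]], THEN spec]
  have "- \<zeta> * H s \<zeta> = 0"
    by (cases s) (use c[OF c1] c[OF c3] in simp_all)
  then show "H s \<zeta> = 0" using \<zeta> by auto
  show "HP i \<zeta> = 0" using c[OF c2[of i]] by simp
  show "HQ j \<zeta> = 0" using c[OF c4[of j]] by simp
qed

end

section \<open>Circle derivatives and small neighborhoods in the space of differentiable maps\<close>

text \<open>On the circle the angle is at most twice the chord.\<close>

lemma sphere_param:
  assumes "z \<in> sphere (0::complex) 1" "w \<in> sphere 0 1"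
  obtains t where "z = w * cis t" "\<bar>t\<bar> \<le> 2 * cmod (z - w)" "\<bar>t\<bar> \<le> pi"
proof -
  have w: "cmod w = 1" "w \<noteq> 0" and z: "cmod z = 1" "z \<noteq> 0" using assms by auto
  define t where "t = Arg (z / w)"
  have "cis t = z / w"
    using cis_Arg[of "z / w"] w z by (auto simp: t_def sgn_eq norm_divide)
  then have zw: "z = w * cis t" using w by simp
  have t: "\<bar>t\<bar> \<le> pi" using Arg_bounded[of "z / w"] by (auto simp: t_def abs_le_iff)
  have "z - w = w * (cis t - 1)" unfolding zw by (simp add: algebra_simps)
  then have "cmod (z - w) = cmod (cis t - 1)" by (simp add: norm_mult w)
  then show thesis using that[OF zw _ t] chord_ge_half_angle[OF t] by simp
qed

lemma mult_cis_sphere: "z \<in> sphere 0 1 \<Longrightarrow> z * cis t \<in> sphere 0 1"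
  by (simp add: norm_mult)

lemma circle_deriv_path:
  assumes G: "G \<in> C1_holder \<alpha>" and z: "z \<in> sphere 0 1"
  shows "((\<lambda>t. G (z * cis t)) has_vector_derivative circle_deriv G (z * cis t)) (at t)"
proof -
  have "(\<lambda>s. G (z * cis t * cis s)) differentiable (at 0)"
    using G mult_cis_sphere[OF z, of t] by (simp add: C1_holder_def del: mem_sphere)
  then have "((\<lambda>s. G (z * cis t * cis s)) has_vector_derivative circle_deriv G (z * cis t)) (at (t - t))"
    by (simp add: circle_deriv_def vector_derivative_works)
  moreover have "((\<lambda>s. s - t) has_vector_derivative 1) (at t)"
    unfolding has_real_derivative_iff_has_vector_derivative[symmetric] by (auto intro!: derivative_eq_intros)
  ultimately have "((\<lambda>s. G (z * cis t * cis s)) \<circ> (\<lambda>s. s - t) has_vector_derivative 1 *\<^sub>R circle_deriv G (z * cis t)) (at t)"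
    by (rule vector_diff_chain_at[rotated])
  moreover have "(\<lambda>s. G (z * cis t * cis s)) \<circ> (\<lambda>s. s - t) = (\<lambda>s. G (z * cis s))"
    by (simp add: fun_eq_iff mult.assoc cis_mult)
  ultimately show ?thesis by simp
qed

lemma C1_holder_bounds:
  assumes \<alpha>: "0 < \<alpha>" "\<alpha> < 1" and G: "G \<in> C1_holder \<alpha>"
  obtains M where "0 \<le> M" "\<And>z. z \<in> sphere 0 1 \<Longrightarrow> norm (circle_deriv G z) \<le> M"
    "\<And>z w. z \<in> sphere 0 1 \<Longrightarrow> w \<in> sphere 0 1 \<Longrightarrow> norm (circle_deriv G z - circle_deriv G w) \<le> M * cmod (z - w) powr \<alpha>"
proof -
  obtain C where C: "\<And>z w. z \<in> sphere 0 1 \<Longrightarrow> w \<in> sphere 0 1 \<Longrightarrow>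
      norm (circle_deriv G z - circle_deriv G w) \<le> C * cmod (z - w) powr \<alpha>"
    using G unfolding C1_holder_def mem_Collect_eq by metis
  define M where "M = norm (circle_deriv G 1) + \<bar>C\<bar> * 2"
  have CM: "\<bar>C\<bar> \<le> M" by (simp add: M_def)
  show thesis
  proof (rule that[of M])
    show "0 \<le> M" using CM by linarith
    fix z :: complex assume z: "z \<in> sphere 0 1"
    have one: "(1::complex) \<in> sphere 0 1" by simp
    have "cmod (z - 1) \<le> 2" using norm_triangle_ineq4[of z 1] z by simp
    then have "cmod (z - 1) powr \<alpha> \<le> 2 powr 1"
      using \<alpha> powr_mono2[of \<alpha> "cmod (z - 1)" 2] powr_mono[of \<alpha> 1 "2::real"] by simp
    then have "\<bar>C\<bar> * cmod (z - 1) powr \<alpha> \<le> \<bar>C\<bar> * 2" by (intro mult_left_mono) auto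
    moreover have "C * cmod (z - 1) powr \<alpha> \<le> \<bar>C\<bar> * cmod (z - 1) powr \<alpha>" by (intro mult_right_mono) auto
    ultimately have "norm (circle_deriv G z - circle_deriv G 1) \<le> \<bar>C\<bar> * 2" using C[OF z one] by linarith
    then show "norm (circle_deriv G z) \<le> M"
      using norm_triangle_ineq2[of "circle_deriv G z" "circle_deriv G 1"] by (simp add: M_def)
    fix w :: complex assume w: "w \<in> sphere 0 1"
    have "C * cmod (z - w) powr \<alpha> \<le> M * cmod (z - w) powr \<alpha>" using CM by (intro mult_right_mono) auto
    then show "norm (circle_deriv G z - circle_deriv G w) \<le> M * cmod (z - w) powr \<alpha>" using C[OF z w] by linarith
  qed
qed

lemma path_increment_bound:
  fixes p :: "real \<Rightarrow> 'b::real_normed_vector"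
  assumes "\<And>t. (p has_vector_derivative p' t) (at t)" "\<And>t. norm (p' t) \<le> B"
  shows "norm (p t - p 0) \<le> B * \<bar>t\<bar>"
proof -
  have "norm (p t - p 0) \<le> B * norm (t - 0)"
  proof (rule differentiable_bound[where S = UNIV and f' = "\<lambda>t h. h *\<^sub>R p' t"])
    show "(p has_derivative (\<lambda>h. h *\<^sub>R p' x)) (at x within UNIV)" for x
      using assms(1)[of x] by (simp add: has_vector_derivative_def)
    show "onorm (\<lambda>h. h *\<^sub>R p' x) \<le> B" for x
    proof (rule onorm_le)
      fix h :: real
      show "norm (h *\<^sub>R p' x) \<le> B * norm h"
        using mult_left_mono[OF assms(2)[of x], of "\<bar>h\<bar>"] by (simp add: mult.commute)
    qed
  qed auto
  then show ?thesis by simp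
qed

text \<open>The rotation quotient is an average of the angular derivative, so it inherits the bounds of the latter, uniformly in h.\<close>

lemma C1_holder_rotation_quotient:
  assumes \<alpha>: "0 < \<alpha>" "\<alpha> < 1" and G: "G \<in> C1_holder \<alpha>"
  obtains B where "0 \<le> B" "\<And>h. 0 < h \<Longrightarrow> holder_bound \<alpha> (sphere 0 1) B (rotation_quotient h G)"
proof (rule C1_holder_bounds[OF \<alpha> G])
  fix M assume M: "0 \<le> M" "\<And>z. z \<in> sphere 0 1 \<Longrightarrow> norm (circle_deriv G z) \<le> M"
    "\<And>z w. z \<in> sphere 0 1 \<Longrightarrow> w \<in> sphere 0 1 \<Longrightarrow> norm (circle_deriv G z - circle_deriv G w) \<le> M * cmod (z - w) powr \<alpha>"
  show thesis
  proof (rule that[OF M(1)])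
    fix h :: real assume h: "0 < h"
    show "holder_bound \<alpha> (sphere 0 1) M (rotation_quotient h G)"
    proof (rule holder_boundI)
      fix z :: complex assume z: "z \<in> sphere 0 1"
      have "norm (G (z * cis h) - G (z * cis 0)) \<le> M * \<bar>h\<bar>"
        by (rule path_increment_bound[OF circle_deriv_path[OF G z] M(2)[OF mult_cis_sphere[OF z]]])
      then show "norm (rotation_quotient h G z) \<le> M"
        using h by (simp add: rotation_quotient_def mult.commute divide_simps)
      fix w :: complex assume w: "w \<in> sphere 0 1"
      have "norm ((G (z * cis h) - G (w * cis h)) - (G (z * cis 0) - G (w * cis 0))) \<le> M * cmod (z - w) powr \<alpha> * \<bar>h\<bar>"
      proof (rule path_increment_bound[OF has_vector_derivative_diff[OF circle_deriv_path[OF G z] circle_deriv_path[OF G w]]])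
        fix t
        have "norm (circle_deriv G (z * cis t) - circle_deriv G (w * cis t)) \<le> M * cmod (z * cis t - w * cis t) powr \<alpha>"
          by (rule M(3)[OF mult_cis_sphere[OF z] mult_cis_sphere[OF w]])
        also have "cmod (z * cis t - w * cis t) = cmod (z - w)"
          using norm_mult[of "z - w" "cis t"] by (simp add: left_diff_distrib)
        finally show "norm (circle_deriv G (z * cis t) - circle_deriv G (w * cis t)) \<le> M * cmod (z - w) powr \<alpha>" .
      qed
      then have a: "norm ((G (z * cis h) - G (w * cis h)) - (G z - G w)) \<le> h * (M * cmod (z - w) powr \<alpha>)"
        using h by (simp add: mult.commute)
      have "rotation_quotient h G z - rotation_quotient h G w = ((G (z * cis h) - G (w * cis h)) - (G z - G w)) /\<^sub>R h"
        by (simp add: rotation_quotient_def mult.commute algebra_simps)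
      then have "norm (rotation_quotient h G z - rotation_quotient h G w) = norm ((G (z * cis h) - G (w * cis h)) - (G z - G w)) / h"
        using h by (simp add: divide_inverse mult.commute)
      also have "\<dots> \<le> M * cmod (z - w) powr \<alpha>" using a h by (simp add: divide_le_eq mult.commute)
      finally show "norm (rotation_quotient h G z - rotation_quotient h G w) \<le> M * cmod (z - w) powr \<alpha>" .
    qed
  qed
qed

text \<open>The angle is at most twice the chord, and a chord is at most twice its power \<open>\<alpha>\<close>; this produces the factor 4.\<close>

lemma C1_holder_norm_bound:
  assumes \<alpha>: "0 < \<alpha>" "\<alpha> < 1" and G: "G \<in> C1_holder \<alpha>" and less: "C1_holder_norm \<alpha> G < \<delta>"
  shows "holder_bound \<alpha> (sphere 0 1) (4 * \<delta>) G"
proof (rule C1_holder_bounds[OF \<alpha> G])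
  fix M assume M: "0 \<le> M" "\<And>z. z \<in> sphere 0 1 \<Longrightarrow> norm (circle_deriv G z) \<le> M"
    "\<And>z w. z \<in> sphere 0 1 \<Longrightarrow> w \<in> sphere 0 1 \<Longrightarrow> norm (circle_deriv G z - circle_deriv G w) \<le> M * cmod (z - w) powr \<alpha>"
  let ?S = "sphere (0::complex) 1"
  have inc: "norm (G z - G w) \<le> B * \<bar>t\<bar>" if "w \<in> ?S" "z = w * cis t" "\<And>z. z \<in> ?S \<Longrightarrow> norm (circle_deriv G z) \<le> B" for z w t B
    using path_increment_bound[OF circle_deriv_path[OF G that(1)] that(3)[OF mult_cis_sphere[OF that(1)]], of t] by (simp add: that(2))
  have bG: "norm (G z) \<le> norm (G 1) + M * pi" if z: "z \<in> ?S" for z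
  proof -
    obtain t where t: "z = 1 * cis t" "\<bar>t\<bar> \<le> pi" using sphere_param[OF z, of 1] by auto
    have "norm (G z - G 1) \<le> M * \<bar>t\<bar>" by (rule inc[OF _ t(1) M(2)]) auto
    also have "\<dots> \<le> M * pi" using M(1) t(2) by (intro mult_left_mono)
    finally show ?thesis using norm_triangle_ineq2[of "G z" "G 1"] by linarith
  qed
  define s1 where "s1 = (SUP \<zeta>\<in>?S. norm (G \<zeta>))"
  define s2 where "s2 = (SUP \<zeta>\<in>?S. norm (circle_deriv G \<zeta>))"
  let ?T = "{(\<zeta>, \<eta>). \<zeta> \<in> ?S \<and> \<eta> \<in> ?S \<and> \<zeta> \<noteq> \<eta>}"
  let ?q = "\<lambda>(\<zeta>, \<eta>). norm (circle_deriv G \<zeta> - circle_deriv G \<eta>) / cmod (\<zeta> - \<eta>) powr \<alpha>"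
  define s3 where "s3 = (SUP p\<in>?T. ?q p)"
  have s1: "norm (G z) \<le> s1" if "z \<in> ?S" for z
    unfolding s1_def by (rule cSUP_upper[OF that]) (use bG in \<open>auto intro!: bdd_aboveI2\<close>)
  have s2: "norm (circle_deriv G z) \<le> s2" if "z \<in> ?S" for z
    unfolding s2_def by (rule cSUP_upper[OF that]) (use M(2) in \<open>auto intro!: bdd_aboveI2\<close>)
  have "?q (1, -1) \<le> s3"
    unfolding s3_def
  proof (rule cSUP_upper)
    show "(1, -1) \<in> ?T" by auto
    show "bdd_above (?q ` ?T)"
    proof (rule bdd_aboveI2)
      fix p assume p: "p \<in> ?T"
      obtain a b where ab: "p = (a, b)" by (cases p)
      have "a \<in> ?S" "b \<in> ?S" "a \<noteq> b" using p ab by auto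
      then show "?q p \<le> M" using M(3)[of a b] by (simp add: ab divide_le_eq)
    qed
  qed
  moreover have "0 \<le> ?q (1, -1)" by simp
  ultimately have s3: "0 \<le> s3" by linarith
  have "C1_holder_norm \<alpha> G = s1 + s2 + s3" by (simp only: C1_holder_norm_def s1_def s2_def s3_def)
  moreover have "0 \<le> s1" "0 \<le> s2" using order_trans[OF norm_ge_zero s1[of 1]] order_trans[OF norm_ge_zero s2[of 1]] by auto
  ultimately have le: "s1 \<le> \<delta>" "s2 \<le> \<delta>" "0 \<le> \<delta>" using less s3 by linarith+
  show ?thesis
  proof (rule holder_boundI)
    fix z assume z: "z \<in> ?S"
    show "norm (G z) \<le> 4 * \<delta>" using s1[OF z] le by linarith
    fix w assume w: "w \<in> ?S"
    obtain t where t: "z = w * cis t" "\<bar>t\<bar> \<le> 2 * cmod (z - w)" by (rule sphere_param[OF z w])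
    have "norm (G z - G w) \<le> \<delta> * \<bar>t\<bar>" by (rule inc[OF w t(1)]) (use s2 le in force)
    also have "\<dots> \<le> \<delta> * (2 * cmod (z - w))" using le t(2) by (intro mult_left_mono) auto
    also have "\<dots> = (2 * \<delta>) * cmod (z - w)" by simp
    also have "\<dots> \<le> 2 * (2 * \<delta>) * cmod (z - w) powr \<alpha>"
      by (rule lipschitz_imp_holder[OF \<alpha>]) (use le z w in auto)
    finally show "norm (G z - G w) \<le> 4 * \<delta> * cmod (z - w) powr \<alpha>" by simp
  qed
qed

lemma C1_holder_diff:
  assumes "F \<in> C1_holder \<alpha>" "G \<in> C1_holder \<alpha>"
  shows "(\<lambda>z. F z - G z) \<in> C1_holder \<alpha>"
proof -
  have d: "circle_deriv (\<lambda>z. F z - G z) z = circle_deriv F z - circle_deriv G z" if z: "z \<in> sphere 0 1" for z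
    unfolding circle_deriv_def
    using has_vector_derivative_diff[OF circle_deriv_path[OF assms(1) z, of 0] circle_deriv_path[OF assms(2) z, of 0]]
    by (simp add: vector_derivative_at circle_deriv_def)
  obtain C where C: "\<And>z w. z \<in> sphere 0 1 \<Longrightarrow> w \<in> sphere 0 1 \<Longrightarrow> norm (circle_deriv F z - circle_deriv F w) \<le> C * cmod (z - w) powr \<alpha>"
    using assms(1) unfolding C1_holder_def mem_Collect_eq by metis
  obtain D where D: "\<And>z w. z \<in> sphere 0 1 \<Longrightarrow> w \<in> sphere 0 1 \<Longrightarrow> norm (circle_deriv G z - circle_deriv G w) \<le> D * cmod (z - w) powr \<alpha>"
    using assms(2) unfolding C1_holder_def mem_Collect_eq by metis
  have "norm (circle_deriv (\<lambda>z. F z - G z) z - circle_deriv (\<lambda>z. F z - G z) w) \<le> (C + D) * cmod (z - w) powr \<alpha>"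
    if z: "z \<in> sphere 0 1" and w: "w \<in> sphere 0 1" for z w
  proof -
    have "circle_deriv (\<lambda>z. F z - G z) z - circle_deriv (\<lambda>z. F z - G z) w
      = (circle_deriv F z - circle_deriv F w) - (circle_deriv G z - circle_deriv G w)"
      unfolding d[OF z] d[OF w] by simp
    then show ?thesis
      using norm_triangle_ineq4[of "circle_deriv F z - circle_deriv F w" "circle_deriv G z - circle_deriv G w"]
        C[OF z w] D[OF z w] by (simp add: distrib_right)
  qed
  moreover have "(\<lambda>t. F (z * cis t) - G (z * cis t)) differentiable (at 0)" if "z \<in> sphere 0 1" for z
    using assms that unfolding C1_holder_def by (intro differentiable_diff) auto
  ultimately show ?thesis unfolding C1_holder_def by blast
qed

lemma affine_C1_holder:
  assumes G: "\<And>z. z \<in> sphere 0 1 \<Longrightarrow> G z = a + z *s b" and \<alpha>: "0 < \<alpha>" "\<alpha> < 1"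
  shows "(G :: complex \<Rightarrow> complex ^ 'm) \<in> C1_holder \<alpha>"
proof -
  have bl: "bounded_linear (\<lambda>z. z *s b)"
    unfolding linear_conv_bounded_linear[symmetric] by (rule linearI) (simp_all add: vec_eq_iff algebra_simps)
  have d: "((\<lambda>t. G (z * cis t)) has_vector_derivative (z * \<i>) *s b) (at 0)" if z: "z \<in> sphere 0 1" for z
  proof -
    have "((\<lambda>t. z * cis t) has_vector_derivative z * (cis 0 * \<i>)) (at 0)"
      by (intro has_vector_derivative_mult_right cis_has_vector_derivative)
    from has_vector_derivative_add[OF has_vector_derivative_const[of a] bounded_linear.has_vector_derivative[OF bl this]]
    have "((\<lambda>t. a + (z * cis t) *s b) has_vector_derivative (z * \<i>) *s b) (at 0)" by simp
    moreover have "(\<lambda>t. G (z * cis t)) = (\<lambda>t. a + (z * cis t) *s b)"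
      using G[OF mult_cis_sphere[OF z]] by (intro ext)
    ultimately show ?thesis by simp
  qed
  have cd: "circle_deriv G z = (z * \<i>) *s b" if "z \<in> sphere 0 1" for z
    unfolding circle_deriv_def by (rule vector_derivative_at[OF d[OF that]])
  obtain K where K: "0 \<le> K" "\<And>z. norm (z *s b) \<le> norm z * K" using bounded_linear.nonneg_bounded[OF bl] by blast
  have "norm (circle_deriv G z - circle_deriv G w) \<le> (2 * K) * cmod (z - w) powr \<alpha>"
    if z: "z \<in> sphere 0 1" and w: "w \<in> sphere 0 1" for z w
  proof -
    have "circle_deriv G z - circle_deriv G w = ((z - w) * \<i>) *s b"
      unfolding cd[OF z] cd[OF w] by (simp add: vec_eq_iff algebra_simps)
    then have "norm (circle_deriv G z - circle_deriv G w) \<le> K * cmod (z - w)"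
      using K(2)[of "(z - w) * \<i>"] by (simp add: norm_mult mult.commute)
    also have "\<dots> \<le> 2 * K * cmod (z - w) powr \<alpha>"
      by (rule lipschitz_imp_holder[OF \<alpha> K(1)]) (use z w in auto)
    finally show ?thesis .
  qed
  moreover have "(\<lambda>t. G (z * cis t)) differentiable (at 0)" if "z \<in> sphere 0 1" for z
    using d[OF that] by (rule differentiableI_vector)
  ultimately show ?thesis unfolding C1_holder_def by blast
qed

lemma initial_disc_affine:
  assumes "\<zeta> \<in> cball 0 1"
  shows "initial_disc A c V \<zeta> = initial_disc A c V 0 + \<zeta> *s (initial_disc A c V 1 - initial_disc A c V 0)"
  using assms unfolding vec_eq_iff initial_disc_def join_def
  by (auto simp: algebra_simps split: sum.splits)

text \<open>Linearity of iterated partial derivatives. It holds only where the lower order derivatives are differentiable,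
  which is why membership in the space is required and why openness of the domain matters.\<close>

lemma iter_partial_diff:
  assumes S: "open S" and g: "g \<in> Ck k S" and h: "h \<in> Ck k S"
    and vs: "set vs \<subseteq> Basis" "length vs \<le> k" and x: "x \<in> S"
  shows "iter_partial vs (\<lambda>x. g x - h x) x = iter_partial vs g x - iter_partial vs h x"
    "length vs < k \<Longrightarrow> iter_partial vs (\<lambda>x. g x - h x) differentiable (at x)"
proof -
  have dif: "iter_partial vs g differentiable (at x)" if "g \<in> Ck k S" "set vs \<subseteq> Basis" "length vs < k" "x \<in> S" for g :: "'a \<Rightarrow> 'b" and vs x
  proof -
    have "vs \<in> partials k" using that by (simp add: partials_def)
    then have "iter_partial vs g differentiable_on S" using that(1,3) unfolding Ck_def by blast
    then show ?thesis using that(4) at_within_open[OF that(4) S] by (simp only: differentiable_on_def) (metis)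
  qed
  have main: "\<forall>x\<in>S. iter_partial vs (\<lambda>x. g x - h x) x = iter_partial vs g x - iter_partial vs h x"
    if "set vs \<subseteq> Basis" "length vs \<le> k" for vs
    using that
  proof (induction vs)
    case (Cons v vs)
    then have IH: "\<And>y. y \<in> S \<Longrightarrow> iter_partial vs (\<lambda>x. g x - h x) y = iter_partial vs g y - iter_partial vs h y" by auto
    show ?case
    proof
      fix y assume y: "y \<in> S"
      have d: "iter_partial vs g differentiable (at y)" "iter_partial vs h differentiable (at y)"
        using Cons.prems y by (auto intro!: dif g h)
      have "((\<lambda>y. iter_partial vs g y - iter_partial vs h y) has_derivative
          (\<lambda>v. frechet_derivative (iter_partial vs g) (at y) v - frechet_derivative (iter_partial vs h) (at y) v)) (at y)"
        by (intro has_derivative_diff frechet_derivative_works[THEN iffD1] d)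
      then have "(iter_partial vs (\<lambda>x. g x - h x) has_derivative
          (\<lambda>v. frechet_derivative (iter_partial vs g) (at y) v - frechet_derivative (iter_partial vs h) (at y) v)) (at y)"
        by (rule has_derivative_transform_within_open[OF _ S y]) (simp add: IH)
      from fun_cong[OF frechet_derivative_at[OF this], of v]
      show "iter_partial (v # vs) (\<lambda>x. g x - h x) y = iter_partial (v # vs) g y - iter_partial (v # vs) h y"
        by simp
    qed
  qed simp
  show "iter_partial vs (\<lambda>x. g x - h x) x = iter_partial vs g x - iter_partial vs h x" using main[OF vs] x by blast
  assume l: "length vs < k"
  have "(\<lambda>y. iter_partial vs g y - iter_partial vs h y) differentiable (at x)"
    using dif[OF g vs(1) l x] dif[OF h vs(1) l x] by (rule differentiable_diff)
  then obtain D where "((\<lambda>y. iter_partial vs g y - iter_partial vs h y) has_derivative D) (at x)"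
    unfolding differentiable_def by blast
  then have "(iter_partial vs (\<lambda>x. g x - h x) has_derivative D) (at x)"
    by (rule has_derivative_transform_within_open[OF _ S x]) (use main[OF vs] in auto)
  then show "iter_partial vs (\<lambda>x. g x - h x) differentiable (at x)" unfolding differentiable_def by blast
qed

lemma finite_partials: "finite (partials k)"
  unfolding partials_def using finite_lists_length_le[OF finite_Basis, of k] by simp

lemma Ck_norm_upper:
  assumes S: "open S" and g: "g \<in> Ck k S" and h: "h \<in> Ck k S" and vs: "vs \<in> partials k" and x: "x \<in> S"
  shows "norm (iter_partial vs (\<lambda>x. g x - h x) x) \<le> (SUP x\<in>S. norm (iter_partial vs (\<lambda>x. g x - h x) x))"
proof (rule cSUP_upper[OF x])
  have vs': "set vs \<subseteq> Basis" "length vs \<le> k" using vs by (auto simp: partials_def)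
  obtain a where a: "\<And>x. x \<in> S \<Longrightarrow> norm (iter_partial vs g x) \<le> a"
    using g vs unfolding Ck_def bounded_iff by blast
  obtain b where b: "\<And>x. x \<in> S \<Longrightarrow> norm (iter_partial vs h x) \<le> b"
    using h vs unfolding Ck_def bounded_iff by blast
  show "bdd_above ((\<lambda>x. norm (iter_partial vs (\<lambda>x. g x - h x) x)) ` S)"
  proof (rule bdd_aboveI2)
    fix y assume y: "y \<in> S"
    show "norm (iter_partial vs (\<lambda>x. g x - h x) y) \<le> a + b"
      unfolding iter_partial_diff(1)[OF S g h vs' y] by (rule order_trans[OF norm_triangle_ineq4 add_mono[OF a[OF y] b[OF y]]])
  qed
qed

lemma Ck_norm_triangle:
  assumes S: "open S" "S \<noteq> {}" and r: "r \<in> Ck k S" and g: "g \<in> Ck k S" and h: "h \<in> Ck k S"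
  shows "Ck_norm k S (\<lambda>x. r x - h x) \<le> Ck_norm k S (\<lambda>x. r x - g x) + Ck_norm k S (\<lambda>x. g x - h x)"
  unfolding Ck_norm_def sum.distrib[symmetric]
proof (intro sum_mono cSUP_least[OF S(2)])
  fix vs :: "'a list" and x assume vs: "vs \<in> partials k" and x: "x \<in> S"
  have vs': "set vs \<subseteq> Basis" "length vs \<le> k" using vs by (auto simp: partials_def)
  have "iter_partial vs (\<lambda>x. r x - h x) x = iter_partial vs (\<lambda>x. r x - g x) x + iter_partial vs (\<lambda>x. g x - h x) x"
    unfolding iter_partial_diff(1)[OF S(1) r h vs' x] iter_partial_diff(1)[OF S(1) r g vs' x] iter_partial_diff(1)[OF S(1) g h vs' x]
    by simp
  then show "norm (iter_partial vs (\<lambda>x. r x - h x) x) \<le> (SUP x\<in>S. norm (iter_partial vs (\<lambda>x. r x - g x) x))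
      + (SUP x\<in>S. norm (iter_partial vs (\<lambda>x. g x - h x) x))"
    using norm_triangle_mono[OF Ck_norm_upper[OF S(1) r g vs x] Ck_norm_upper[OF S(1) g h vs x]] by simp
qed

lemma openin_Ck_ball:
  assumes S: "open S" "S \<noteq> {}" and g: "g \<in> Ck k S"
  shows "openin (Ck_topology k S) {r \<in> Ck k S. Ck_norm k S (\<lambda>x. r x - g x) < \<delta>}"
  unfolding openin_Ck_topology
proof (intro conjI ballI)
  fix r assume r: "r \<in> {r \<in> Ck k S. Ck_norm k S (\<lambda>x. r x - g x) < \<delta>}"
  show "\<exists>\<eta>>0. \<forall>h\<in>Ck k S. Ck_norm k S (\<lambda>x. h x - r x) < \<eta> \<longrightarrow> h \<in> {r \<in> Ck k S. Ck_norm k S (\<lambda>x. r x - g x) < \<delta>}"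
  proof (intro exI[of _ "\<delta> - Ck_norm k S (\<lambda>x. r x - g x)"] conjI ballI impI)
    fix h assume h: "h \<in> Ck k S" "Ck_norm k S (\<lambda>x. h x - r x) < \<delta> - Ck_norm k S (\<lambda>x. r x - g x)"
    then show "h \<in> {r \<in> Ck k S. Ck_norm k S (\<lambda>x. r x - g x) < \<delta>}"
      using Ck_norm_triangle[OF S h(1) _ g, of r] r by simp
  qed (use r in simp)
qed blast

lemma Ck_norm_diff_self:
  assumes S: "open S" "S \<noteq> {}" and g: "g \<in> Ck k S"
  shows "Ck_norm k S (\<lambda>x. g x - g x) = 0"
  unfolding Ck_norm_def
proof (rule sum.neutral, rule ballI)
  fix vs :: "'a list" assume "vs \<in> partials k"
  then have vs: "set vs \<subseteq> Basis" "length vs \<le> k" by (auto simp: partials_def)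
  have "(SUP x\<in>S. norm (iter_partial vs (\<lambda>x. g x - g x) x)) = (SUP x\<in>S. 0::real)"
    by (rule SUP_cong[OF refl]) (subst iter_partial_diff(1)[OF S(1) g g vs], auto)
  then show "(SUP x\<in>S. norm (iter_partial vs (\<lambda>x. g x - g x) x)) = 0" using S(2) by simp
qed

text \<open>Every iterated partial derivative is one of the summands of the norm, hence bounded by it.\<close>

lemma Ck_small_smooth_bound:
  assumes S: "open S" "S \<noteq> {}" and g: "g \<in> Ck k S" and h: "h \<in> Ck k S" and less: "Ck_norm k S (\<lambda>x. g x - h x) < \<delta>"
  shows "smooth_bound k S \<delta> (\<lambda>x. g x - h x)"
proof -
  let ?N = "\<lambda>x. g x - h x"
  have b: "norm (iter_partial vs ?N x) \<le> \<delta>" if vs: "vs \<in> partials k" and x: "x \<in> S" for vs x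
  proof -
    have "(SUP x\<in>S. norm (iter_partial vs ?N x)) \<le> Ck_norm k S ?N"
      unfolding Ck_norm_def
    proof (rule member_le_sum[OF vs _ finite_partials])
      fix ws :: "'a list" assume "ws \<in> partials k - {vs}"
      then have ws: "ws \<in> partials k" by blast
      show "0 \<le> (SUP x\<in>S. norm (iter_partial ws ?N x))"
        by (rule order_trans[OF norm_ge_zero Ck_norm_upper[OF S(1) g h ws x]])
    qed
    then show ?thesis using Ck_norm_upper[OF S(1) g h vs x] less by linarith
  qed
  have "smooth_bound m S \<delta> (iter_partial vs ?N)" if "set vs \<subseteq> Basis" "length vs + m \<le> k" for m vs
    using that
  proof (induction m arbitrary: vs)
    case 0
    then show ?case using b[of vs] by (simp add: partials_def)
  next
    case (Suc m)
    have v: "vs \<in> partials k" "length vs \<le> k" "length vs < k" using Suc.prems by (auto simp: partials_def)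
    have "smooth_bound m S \<delta> (iter_partial (c # vs) ?N)" if "c \<in> Basis" for c
      by (rule Suc.IH) (use Suc.prems that in auto)
    then show ?case
      using b[OF v(1)] iter_partial_diff(2)[OF S(1) g h Suc.prems(1) v(2) _ v(3)] by simp
  qed
  from this[of "[]" k] show ?thesis by simp
qed

text \<open>A partial derivative of an inhomogeneous quadratic map is again such a map, so membership follows by
  induction for all orders at once.\<close>

lemma quadratic_Ck:
  fixes b :: "'a::euclidean_space \<Rightarrow> 'a \<Rightarrow> 'b::euclidean_space"
  assumes b: "bounded_bilinear b" and l: "bounded_linear l" and S: "bounded S"
  shows "(\<lambda>x. a + l x + b x x) \<in> Ck k S"
proof -
  have form: "\<exists>b' l' a'. bounded_bilinear b' \<and> bounded_linear l' \<and> iter_partial vs (\<lambda>x. a + l x + b x x) = (\<lambda>x. a' + l' x + b' x x)"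
    for vs
  proof (induction vs)
    case Nil
    show ?case by (intro exI[of _ b] exI[of _ l] exI[of _ a]) (simp add: b l)
  next
    case (Cons v vs)
    then obtain b' l' a' where h: "bounded_bilinear b'" "bounded_linear l'"
      and e: "iter_partial vs (\<lambda>x. a + l x + b x x) = (\<lambda>x. a' + l' x + b' x x)" by blast
    have "frechet_derivative (\<lambda>x. a' + l' x + b' x x) (at x) v = l' v + (b' x v + b' v x)" for x
    proof -
      have "((\<lambda>x. a' + l' x + b' x x) has_derivative (\<lambda>v. 0 + l' v + (b' x v + b' v x))) (at x)"
        by (intro has_derivative_add has_derivative_const bounded_linear_imp_has_derivative h(2)
            bounded_bilinear.FDERIV[OF h(1)] has_derivative_ident)
      from fun_cong[OF frechet_derivative_at[OF this], of v] show ?thesis by simp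
    qed
    moreover have "bounded_bilinear (\<lambda>x y. 0 :: 'b)" by (rule bounded_bilinear.intro) (auto intro: exI[of _ 0])
    moreover have "bounded_linear (\<lambda>x. b' x v + b' v x)"
      by (intro bounded_linear_add bounded_bilinear.bounded_linear_left[OF h(1)] bounded_bilinear.bounded_linear_right[OF h(1)])
    ultimately show ?case
      by (intro exI[of _ "\<lambda>x y. 0"] exI[of _ "\<lambda>x. b' x v + b' v x"] exI[of _ "l' v"]) (simp add: e)
  qed
  show ?thesis
    unfolding Ck_def mem_Collect_eq
  proof (intro ballI)
    fix vs :: "'a list"
    obtain b' l' a' where h: "bounded_bilinear b'" "bounded_linear l'"
      and e: "iter_partial vs (\<lambda>x. a + l x + b x x) = (\<lambda>x. a' + l' x + b' x x)" using form by blast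
    have d: "(\<lambda>x. a' + l' x + b' x x) differentiable_on T" for T
    proof (rule differentiable_at_imp_differentiable_on)
      fix x
      have "((\<lambda>x. a' + l' x + b' x x) has_derivative (\<lambda>v. 0 + l' v + (b' x v + b' v x))) (at x)"
        by (intro has_derivative_add has_derivative_const bounded_linear_imp_has_derivative h(2)
            bounded_bilinear.FDERIV[OF h(1)] has_derivative_ident)
      then show "(\<lambda>x. a' + l' x + b' x x) differentiable (at x)" by (rule differentiableI)
    qed
    have "compact (closure S)" using S by (simp add: compact_closure)
    then have "bounded ((\<lambda>x. a' + l' x + b' x x) ` closure S)"
      by (intro compact_imp_bounded compact_continuous_image differentiable_imp_continuous_on d)
    then have "bounded ((\<lambda>x. a' + l' x + b' x x) ` S)" by (rule bounded_subset) (auto simp: closure_def)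
    then show "continuous_on S (iter_partial vs (\<lambda>x. a + l x + b x x)) \<and> bounded (iter_partial vs (\<lambda>x. a + l x + b x x) ` S)
        \<and> (length vs < k \<longrightarrow> iter_partial vs (\<lambda>x. a + l x + b x x) differentiable_on S)"
      unfolding e using d differentiable_imp_continuous_on[OF d] by blast
  qed
qed

section \<open>Lifts close to the initial disc\<close>

lemma difference_quotient_weaken:
  fixes \<phi> :: "'a::real_normed_vector \<Rightarrow> 'b::real_normed_vector"
  assumes M: "difference_quotient S D \<phi> M" and le: "D \<le> D'"
  shows "difference_quotient S D' \<phi> M"
proof -
  note D = difference_quotientD[OF M]
  have m: "norm x \<le> D' * t" if "norm x \<le> D * t" "0 \<le> t" for x :: 'b and t
    using that(1) mult_right_mono[OF le that(2)] by linarith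
  have m2: "norm x \<le> D' * s * t" if "norm x \<le> D * s * t" "0 \<le> s" "0 \<le> t" for x :: 'b and s t
    using m[of x "s * t"] that by (simp add: mult.assoc)
  show ?thesis unfolding difference_quotient_def
  proof (intro conjI ballI allI)
    show "0 \<le> D'" using D(1) le by simp
    show "norm (\<phi> x) \<le> D'" if "x \<in> S" for x using D(2)[OF that] le by simp
    show "linear (M x y)" if "x \<in> S" "y \<in> S" for x y by (rule D(3)[OF that])
    show "\<phi> x - \<phi> y = M x y (x - y)" if "x \<in> S" "y \<in> S" for x y by (rule D(4)[OF that])
    show "norm (M x y v) \<le> D' * norm v" if "x \<in> S" "y \<in> S" for x y v by (rule m[OF D(5)[OF that] norm_ge_zero])
  qed ((rule m2[OF D(6)] | rule m2[OF D(7)]), (assumption | intro add_nonneg_nonneg mult_nonneg_nonneg norm_ge_zero)+)+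
qed

text \<open>The coefficients are indexed by the generators and not by their values, because different components of
  the defining map may have the same differential.\<close>

lemma span_indexed:
  fixes f :: "'d::finite \<Rightarrow> 'v::real_vector"
  assumes "x \<in> span {f j | j. True}"
  obtains u where "x = (\<Sum>j\<in>UNIV. u j *\<^sub>R f j)"
proof -
  define g where "g = (\<lambda>u. \<Sum>j\<in>UNIV. u j *\<^sub>R f j)"
  have "subspace (range g)"
  proof (rule subspaceI)
    have "g (\<lambda>_. 0) = 0" by (simp add: g_def)
    then show "0 \<in> range g" by (metis rangeI)
    fix a b assume "a \<in> range g" "b \<in> range g"
    then obtain u v where e: "a = g u" "b = g v" by blast
    have "g (\<lambda>j. u j + v j) = a + b" by (simp add: e g_def scaleR_add_left sum.distrib)
    then show "a + b \<in> range g" by (metis rangeI)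
  next
    fix k :: real and a assume "a \<in> range g"
    then obtain u where e: "a = g u" by blast
    have "g (\<lambda>j. k * u j) = k *\<^sub>R a" by (simp add: e g_def scaleR_sum_right)
    then show "k *\<^sub>R a \<in> range g" by (metis rangeI)
  qed
  moreover have "{f j | j. True} \<subseteq> range g"
  proof
    fix y assume "y \<in> {f j | j. True}"
    then obtain i where y: "y = f i" by blast
    have "(if j = i then 1 else 0::real) *\<^sub>R f j = (if j = i then f j else 0)" for j by simp
    then have "g (\<lambda>j. if j = i then 1 else 0) = y" by (simp add: g_def y)
    then show "y \<in> range g" by (metis rangeI)
  qed
  ultimately have "x \<in> range g" using span_minimal[of "{f j | j. True}" "range g"] assms by blast
  then show thesis using that unfolding g_def by blast
qed

text \<open>The quadratic part of the quadric map, polarized, so that the map is a linear map plus the diagonal of a bilinear one.\<close>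

definition quadric_form ::
  "('d::finite \<Rightarrow> complex ^ 'n::finite ^ 'n) \<Rightarrow> complex ^ ('n + 'd) \<Rightarrow> complex ^ ('n + 'd) \<Rightarrow> real ^ 'd" where
  "quadric_form A x y = (\<chi> k. - Re (\<Sum>l\<in>UNIV. \<Sum>m\<in>UNIV. cnj (x $ Inl l) * A k $ l $ m * y $ Inl m))"

lemma quadric_map_eq: "quadric_map A x = 0 + (\<chi> k. Re (x $ Inr k)) + quadric_form A x x"
  by (simp add: vec_eq_iff quadric_map_def quadric_form_def right_part_def left_part_def herm_form_sum)

lemma bounded_bilinear_quadric_form:
  fixes A :: "'d::finite \<Rightarrow> complex ^ 'n::finite ^ 'n"
  shows "bounded_bilinear (quadric_form A)"
  unfolding bilinear_conv_bounded_bilinear[symmetric] bilinear_def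
proof (intro conjI allI linearI)
  fix x y z :: "complex ^ ('n + 'd)" and k :: real
  show "quadric_form A x (y + z) = quadric_form A x y + quadric_form A x z"
    by (simp add: vec_eq_iff quadric_form_def distrib_left sum.distrib)
  show "quadric_form A (x + y) z = quadric_form A x z + quadric_form A y z"
    by (simp add: vec_eq_iff quadric_form_def distrib_right sum.distrib)
  show "quadric_form A x (k *\<^sub>R y) = k *\<^sub>R quadric_form A x y"
    by (simp add: vec_eq_iff quadric_form_def sum_distrib_left algebra_simps)
  show "quadric_form A (k *\<^sub>R x) y = k *\<^sub>R quadric_form A x y"
    by (simp add: vec_eq_iff quadric_form_def sum_distrib_left algebra_simps)
qed

lemma bounded_linear_Re_part: "bounded_linear (\<lambda>x :: complex ^ ('n::finite + 'd::finite). (\<chi> k. Re (x $ Inr k)) :: real ^ 'd)"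
  unfolding linear_conv_bounded_linear[symmetric] by (rule linearI) (simp_all add: vec_eq_iff)

lemma quadric_map_Ck: "quadric_map A \<in> Ck k (ball 0 1)"
proof -
  have "quadric_map A = (\<lambda>x. 0 + (\<chi> k. Re (x $ Inr k)) + quadric_form A x x)"
    by (rule ext) (rule quadric_map_eq)
  moreover have "(\<lambda>x. 0 + (\<chi> k. Re (x $ Inr k)) + quadric_form A x x) \<in> Ck k (ball 0 1)"
    by (rule quadratic_Ck[OF bounded_bilinear_quadric_form bounded_linear_Re_part bounded_ball])
  ultimately show ?thesis by (simp only:)
qed

definition quadric_differential where
  "quadric_differential A x v = (\<chi> k. Re (v $ Inr k)) + (quadric_form A x v + quadric_form A v x)"

lemma quadric_map_has_derivative: "(quadric_map A has_derivative quadric_differential A x) (at x)"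
proof -
  have "((\<lambda>x. 0 + (\<chi> k. Re (x $ Inr k)) + quadric_form A x x) has_derivative
      (\<lambda>v. 0 + (\<chi> k. Re (v $ Inr k)) + (quadric_form A x v + quadric_form A v x))) (at x)"
    by (intro has_derivative_add has_derivative_const bounded_linear_imp_has_derivative bounded_linear_Re_part
        bounded_bilinear.FDERIV[OF bounded_bilinear_quadric_form] has_derivative_ident)
  moreover have "quadric_map A = (\<lambda>x. 0 + (\<chi> k. Re (x $ Inr k)) + quadric_form A x x)"
    by (rule ext) (rule quadric_map_eq)
  moreover have "quadric_differential A x = (\<lambda>v. 0 + (\<chi> k. Re (v $ Inr k)) + (quadric_form A x v + quadric_form A v x))"
    by (rule ext) (simp add: quadric_differential_def)
  ultimately show ?thesis by simp
qed

lemma quadric_differential_Inr: "quadric_differential A x (axis (Inr j) a) $ k = (if j = k then Re a else 0)"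
  by (cases "j = k") (simp_all add: quadric_differential_def quadric_form_def axis_def)

text \<open>Both slots of the form are differentiated; for a Hermitian matrix the two contributions are complex conjugates of
  each other, so their real parts coincide.\<close>

lemma quadric_differential_Inl:
  fixes A :: "'d::finite \<Rightarrow> complex ^ 'n::finite ^ 'n" and x :: "complex ^ ('n + 'd)"
  assumes "hermitian (A k)"
  shows "quadric_differential A x (axis (Inl i) a) $ k = - 2 * Re ((\<Sum>l\<in>UNIV. cnj (x $ Inl l) * A k $ l $ i) * a)"
proof -
  let ?T = "\<Sum>l\<in>UNIV. cnj (x $ Inl l) * A k $ l $ i" and ?v = "axis (Inl i) a :: complex ^ ('n + 'd)"
  have 0: "?v $ Inr k = 0" by (simp add: axis_def)
  have v: "?v $ Inl m = (if m = i then a else 0)" for m by (simp add: axis_def)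
  have 1: "(\<Sum>l\<in>UNIV. \<Sum>m\<in>UNIV. cnj (x $ Inl l) * A k $ l $ m * ?v $ Inl m) = ?T * a"
  proof -
    have "cnj (x $ Inl l) * A k $ l $ m * ?v $ Inl m = (if m = i then cnj (x $ Inl l) * A k $ l $ i * a else 0)" for l m
      by (simp add: v)
    then show ?thesis by (simp add: sum_distrib_right)
  qed
  have h: "A k $ i $ m = cnj (A k $ m $ i)" for m using assms unfolding hermitian_def by blast
  have 2: "(\<Sum>l\<in>UNIV. \<Sum>m\<in>UNIV. cnj (?v $ Inl l) * A k $ l $ m * x $ Inl m) = cnj (?T * a)"
  proof -
    have "cnj (?v $ Inl l) * A k $ l $ m * x $ Inl m = (if l = i then cnj a * A k $ i $ m * x $ Inl m else 0)" for l m
      by (simp add: v)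
    then have "(\<Sum>l\<in>UNIV. \<Sum>m\<in>UNIV. cnj (?v $ Inl l) * A k $ l $ m * x $ Inl m)
       = (\<Sum>l\<in>UNIV. \<Sum>m\<in>UNIV. if l = i then cnj a * A k $ i $ m * x $ Inl m else 0)" by (simp only:)
    also have "\<dots> = (\<Sum>m\<in>UNIV. \<Sum>l\<in>UNIV. if l = i then cnj a * A k $ i $ m * x $ Inl m else 0)" by (rule sum.swap)
    also have "\<dots> = (\<Sum>m\<in>UNIV. cnj a * A k $ i $ m * x $ Inl m)" by simp
    also have "\<dots> = cnj (?T * a)" unfolding h by (simp add: sum_distrib_left sum_distrib_right mult_ac)
    finally show ?thesis .
  qed
  have "quadric_differential A x ?v $ k = Re 0 + (- Re (?T * a) + - Re (cnj (?T * a)))"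
    unfolding quadric_differential_def quadric_form_def vector_add_component vec_lambda_beta 0 1 2 ..
  also have "\<dots> = - 2 * Re (?T * a)"
  proof -
    have "Re 0 + (- Re w + - Re (cnj w)) = - 2 * Re w" for w by simp
    then show ?thesis .
  qed
  finally show ?thesis .
qed

definition wirtinger_map ::
  "(complex ^ 'm \<Rightarrow> real ^ 'd) \<Rightarrow> 'd \<Rightarrow> 'm \<Rightarrow> complex ^ 'm \<Rightarrow> complex" where
  "wirtinger_map N k m x = (complex_of_real (frechet_derivative N (at x) (axis m 1) $ k)
      - \<i> * of_real (frechet_derivative N (at x) (axis m \<i>) $ k)) / 2"

lemma wirtinger_component:
  assumes "r differentiable (at q)"
  shows "wirtinger (\<lambda>p. r p $ k) q $ m = wirtinger_map r k m q"
proof -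
  have "((\<lambda>p. r p $ k) has_derivative (\<lambda>v. frechet_derivative r (at q) v $ k)) (at q)"
    by (rule bounded_linear.has_derivative[OF bounded_linear_vec_nth]) (use assms frechet_derivative_works in blast)
  from frechet_derivative_at[OF this, symmetric] show ?thesis by (simp add: wirtinger_def wirtinger_map_def)
qed

lemma wirtinger_map_split:
  assumes "r differentiable (at q)" "g differentiable (at q)"
  shows "wirtinger_map r k m q = wirtinger_map g k m q + wirtinger_map (\<lambda>x. r x - g x) k m q"
proof -
  have "((\<lambda>x. r x - g x) has_derivative (\<lambda>v. frechet_derivative r (at q) v - frechet_derivative g (at q) v)) (at q)"
    by (rule has_derivative_diff) (use assms frechet_derivative_works in blast)+
  from frechet_derivative_at[OF this, symmetric] show ?thesis by (simp add: wirtinger_map_def field_simps)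
qed

lemma wirtinger_quadric:
  assumes "hermitian (A k)"
  shows "wirtinger_map (quadric_map A) k (Inr j) q = (if j = k then 1 / 2 else 0)"
    "wirtinger_map (quadric_map A) k (Inl i) q = - (\<Sum>l\<in>UNIV. cnj (q $ Inl l) * A k $ l $ i)"
proof -
  have e: "frechet_derivative (quadric_map A) (at q) = quadric_differential A q"
    by (rule frechet_derivative_at[OF quadric_map_has_derivative, symmetric])
  show "wirtinger_map (quadric_map A) k (Inr j) q = (if j = k then 1 / 2 else 0)"
    unfolding wirtinger_map_def e quadric_differential_Inr by simp
  have g: "(complex_of_real (- 2 * Re (T * 1)) - \<i> * of_real (- 2 * Re (T * \<i>))) / 2 = - T" for T
    by (simp add: complex_eq_iff)
  show "wirtinger_map (quadric_map A) k (Inl i) q = - (\<Sum>l\<in>UNIV. cnj (q $ Inl l) * A k $ l $ i)"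
    unfolding wirtinger_map_def e quadric_differential_Inl[where A = A and k = k, OF assms] by (rule g)
qed

text \<open>The conormal condition provides the real multipliers. Multiplication by \<open>cnj \<zeta>\<close> cancels the factor \<open>\<zeta>\<close>, and the
  differential of r splits into that of the quadric and that of the perturbation.\<close>

lemma stationary_lift_at:
  fixes A :: "'d::finite \<Rightarrow> complex ^ 'n::finite ^ 'n" and F :: "complex \<Rightarrow> complex ^ (('n + 'd) + ('n + 'd))"
  assumes herm: "\<And>j. hermitian (A j)" and r: "\<And>q. q \<in> S \<Longrightarrow> r differentiable (at q)"
    and F: "F \<in> stationary_lifts S r" and \<zeta>: "\<zeta> \<in> sphere 0 1"
  shows "\<exists>cv. lift_at A (\<lambda>x. r x - quadric_map A x) (wirtinger_map (\<lambda>x. r x - quadric_map A x)) (left_part (F \<zeta>))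
      (\<lambda>i. cnj \<zeta> * F \<zeta> $ Inr (Inl i)) (\<lambda>j. cnj \<zeta> * F \<zeta> $ Inr (Inr j)) cv"
proof -
  let ?q = "left_part (F \<zeta>)" and ?N = "\<lambda>x. r x - quadric_map A x"
  have q: "?q \<in> S" "r ?q = 0" and "right_part (F \<zeta>) \<in> (\<lambda>\<xi>. \<zeta> *s \<xi>) ` conormal_fiber r ?q"
    using F \<zeta> unfolding stationary_lifts_def by blast+
  then obtain \<xi> where \<xi>: "right_part (F \<zeta>) = \<zeta> *s \<xi>" "\<xi> \<in> span {wirtinger (\<lambda>p. r p $ k) ?q | k. True}"
    unfolding conormal_fiber_def by blast
  obtain u where u: "\<xi> = (\<Sum>k\<in>UNIV. u k *\<^sub>R wirtinger (\<lambda>p. r p $ k) ?q)" by (rule span_indexed[OF \<xi>(2)])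
  have quad: "quadric_map A differentiable (at ?q)" by (rule differentiableI[OF quadric_map_has_derivative])
  have comp: "cnj \<zeta> * F \<zeta> $ Inr m
      = (\<Sum>k\<in>UNIV. of_real (u k) * (wirtinger_map (quadric_map A) k m ?q + wirtinger_map ?N k m ?q))" for m
  proof -
    have a: "F \<zeta> $ Inr m = \<zeta> * \<xi> $ m" using arg_cong[OF \<xi>(1), of "\<lambda>v. v $ m"] by (simp add: right_part_def)
    have b: "cnj \<zeta> * \<zeta> = 1" using \<zeta> complex_norm_square[of \<zeta>] by (simp add: mult.commute)
    have "cnj \<zeta> * F \<zeta> $ Inr m = \<xi> $ m" unfolding a mult.assoc[symmetric] b by simp
    also have "\<dots> = (\<Sum>k\<in>UNIV. of_real (u k) * wirtinger (\<lambda>p. r p $ k) ?q $ m)"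
      unfolding u sum_component vector_scaleR_component scaleR_conv_of_real[where 'a = complex] ..
    finally show ?thesis
      unfolding wirtinger_component[OF r[OF q(1)]] wirtinger_map_split[OF r[OF q(1)] quad] .
  qed
  show ?thesis
    unfolding lift_at_def
  proof (intro exI[of _ u] conjI allI)
    fix j
    show "Re (?q $ Inr j) = Re (herm_form (A j) (left_part ?q)) - (r ?q - quadric_map A ?q) $ j"
      unfolding q(2) by (simp add: quadric_map_def right_part_def)
    have e: "of_real (u k) * (if j = k then 1 / 2 else 0) = (if j = k then of_real (u k) / 2 else 0 :: complex)" for k by simp
    have "(\<Sum>k\<in>UNIV. of_real (u k) * (if j = k then 1 / 2 else 0)) = complex_of_real (u j) / 2"
      unfolding e by simp
    then show "cnj \<zeta> * F \<zeta> $ Inr (Inr j) = of_real (u j) / 2 + (\<Sum>k\<in>UNIV. of_real (u k) * wirtinger_map ?N k (Inr j) ?q)"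
      by (simp only: comp wirtinger_quadric(1)[where A = A, OF herm] distrib_left sum.distrib)
  next
    fix i
    show "cnj \<zeta> * F \<zeta> $ Inr (Inl i) = - (\<Sum>k\<in>UNIV. of_real (u k) * (\<Sum>l\<in>UNIV. cnj (?q $ Inl l) * A k $ l $ i))
        + (\<Sum>k\<in>UNIV. of_real (u k) * wirtinger_map ?N k (Inl i) ?q)"
      by (simp only: comp wirtinger_quadric(2)[where A = A, OF herm] distrib_left sum.distrib mult_minus_right sum_negf)
  qed
qed

lemma Ck_differentiable:
  assumes "open S" "g \<in> Ck k S" "0 < k" "x \<in> S"
  shows "g differentiable (at x)"
proof -
  have "[] \<in> partials k" by (simp add: partials_def)
  then have "iter_partial [] g differentiable_on S" using assms(2,3) unfolding Ck_def by fastforce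
  then have "g differentiable (at x within S)" using assms(4) by (simp add: differentiable_on_def)
  then show ?thesis unfolding at_within_open[OF assms(4,1)] .
qed

lemma perturbation_difference_quotients:
  fixes N :: "complex ^ 'm \<Rightarrow> real ^ 'd"
  assumes N: "smooth_bound 4 S \<delta> N" and S: "convex S" and \<delta>: "0 \<le> \<delta>" and E: "real DIM(complex ^ 'm) ^ 3 * \<delta> \<le> E"
  obtains MN MW where "difference_quotient S E N MN" "\<And>k m. difference_quotient S E (wirtinger_map N k m) (MW k m)"
proof -
  have four: "(4::nat) = Suc 3" by simp
  have N': "smooth_bound (Suc 3) S \<delta> N" using N by (simp only: four)
  have dq: "\<exists>M. difference_quotient S E \<phi> M" if "smooth_bound 3 S \<delta> \<phi>" for \<phi> :: "complex ^ 'm \<Rightarrow> real ^ 'd"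
  proof (rule hadamard_difference_quotient[OF that S \<delta>])
    fix M assume "difference_quotient S (real DIM(complex ^ 'm) ^ 3 * \<delta>) \<phi> M"
    from difference_quotient_weaken[OF this E] show "\<exists>M. difference_quotient S E \<phi> M" by blast
  qed
  have part: "\<exists>M. difference_quotient S E (\<lambda>x. frechet_derivative N (at x) b) M" if "b \<in> Basis" for b
    by (rule dq) (use N' that in \<open>unfold smooth_bound.simps(2), blast\<close>)
  have B: "axis m (1::complex) \<in> Basis" "axis m \<i> \<in> Basis" for m :: 'm
    by (simp_all add: axis_in_Basis_iff Basis_complex_def)
  have W: "\<exists>M. difference_quotient S E (wirtinger_map N k m) M" for k m
  proof -
    obtain M1 where M1: "difference_quotient S E (\<lambda>x. frechet_derivative N (at x) (axis m 1)) M1" using part[OF B(1)] by blast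
    obtain M2 where M2: "difference_quotient S E (\<lambda>x. frechet_derivative N (at x) (axis m \<i>)) M2" using part[OF B(2)] by blast
    have "wirtinger_map N k m = (\<lambda>x. (complex_of_real (frechet_derivative N (at x) (axis m 1) $ k)
      - \<i> * of_real (frechet_derivative N (at x) (axis m \<i>) $ k)) / 2)" by (rule ext) (rule wirtinger_map_def)
    then show ?thesis using difference_quotient_combination[OF M1 M2, of k] by (simp only:) blast
  qed
  obtain MN where MN: "difference_quotient S E N MN" using dq[OF smooth_bound_mono[OF N']] by blast
  define MW where "MW = (\<lambda>k m. SOME M. difference_quotient S E (wirtinger_map N k m) M)"
  have "difference_quotient S E (wirtinger_map N k m) (MW k m)" for k m
    unfolding MW_def by (rule someI_ex[OF W])
  from that[OF MN this] show thesis .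
qed

text \<open>The product rule for rotation quotients; the quotient of \<open>cnj \<zeta>\<close> is bounded by 1 because a chord is shorter than its arc.\<close>

lemma rotation_quotient_cnj_mult:
  fixes Q :: "complex \<Rightarrow> complex"
  assumes \<alpha>: "0 < \<alpha>" "\<alpha> < 1" and Q: "holder_bound \<alpha> (sphere 0 1) C Q"
    and dq: "holder_bound \<alpha> (sphere 0 1) B (rotation_quotient h Q)" and h: "0 < h"
  shows "holder_bound \<alpha> (sphere 0 1) (2 * 2 * B + 1 * (2 * 2 * C)) (rotation_quotient h (\<lambda>\<zeta>. cnj \<zeta> * Q \<zeta>))"
proof -
  have "cmod (cis h - cis 0) \<le> 1 * \<bar>h\<bar>"
    by (rule path_increment_bound[where p' = "\<lambda>t. cis t * \<i>"]) (simp_all add: cis_has_vector_derivative norm_mult)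
  then have "cmod (cnj (cis h - 1)) \<le> h" using h by (simp only: complex_mod_cnj cis_zero)
  then have k: "cmod (cnj (cis h - 1) / of_real h) \<le> 1" using h by (simp add: norm_divide)
  have id: "holder_bound \<alpha> (sphere 0 1) 2 (\<lambda>z. z)" by (rule holder_bound_identity[OF \<alpha> order_refl])
  show ?thesis
  proof (rule holder_bound_cong[OF holder_bound_add[OF
        holder_bound_mult[OF holder_bound_cnj[OF holder_bound_rotate[OF id, of h]] dq]
        holder_bound_cmult[OF holder_bound_mult[OF holder_bound_cnj[OF id] Q] k]]])
    fix z :: complex
    have "(a' * b' - a * b) / t = a' * ((b' - b) / t) + (a' - a) / t * b" for a a' b b' t :: complex
      by (simp add: diff_divide_distrib algebra_simps)
    from this[of "cnj (cis h * z)" "Q (cis h * z)" "cnj z" "Q z" "of_real h"]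
    show "rotation_quotient h (\<lambda>\<zeta>. cnj \<zeta> * Q \<zeta>) z
        = cnj (cis h * z) * rotation_quotient h Q z + cnj (cis h - 1) / of_real h * (cnj z * Q z)"
      unfolding rotation_quotient_complex by (simp add: left_diff_distrib diff_divide_distrib)
  qed
qed

text \<open>Every point of the closed disc is a limit point of it, so derivatives within the disc are unique also on the circle.\<close>

lemma within_disc_derivative_unique:
  assumes "(g has_field_derivative a) (at z within cball (0::complex) 1)" "(g has_field_derivative b) (at z within cball 0 1)"
    and z: "z \<in> cball 0 1"
  shows "a = b"
proof -
  have "z islimpt ball 0 1" using z by (simp only: islimpt_ball) simp
  then have "z islimpt cball 0 1" by (rule islimpt_subset) (rule ball_subset_cball)
  then have "at z within cball 0 1 \<noteq> bot" using trivial_limit_within by blast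
  then show ?thesis using assms(1,2) unfolding has_field_derivative_iff by (rule tendsto_unique)
qed

lemma disc_deriv_component:
  assumes "((\<lambda>\<eta>. F \<eta> $ s) has_field_derivative D) (at z within cball 0 1)" "z \<in> cball 0 1"
  shows "disc_deriv F z $ s = D"
proof -
  have "(SOME D. ((\<lambda>\<eta>. F \<eta> $ s) has_field_derivative D) (at z within cball 0 1)) = D"
  proof (rule some_equality[where P = "\<lambda>D. ((\<lambda>\<eta>. F \<eta> $ s) has_field_derivative D) (at z within cball 0 1)"])
    show "((\<lambda>\<eta>. F \<eta> $ s) has_field_derivative D) (at z within cball 0 1)" by (rule assms(1))
    show "E = D" if "((\<lambda>\<eta>. F \<eta> $ s) has_field_derivative E) (at z within cball 0 1)" for E
      by (rule within_disc_derivative_unique[OF that assms])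
  qed
  then show ?thesis by (simp only: disc_deriv_def vec_lambda_beta)
qed

lemma disc_deriv2_component:
  assumes "\<And>z. z \<in> cball 0 1 \<Longrightarrow> ((\<lambda>\<eta>. F \<eta> $ s) has_field_derivative g1 z) (at z within cball 0 1)"
    and "(g1 has_field_derivative D) (at z within cball 0 1)" and z: "z \<in> cball 0 1"
  shows "disc_deriv (disc_deriv F) z $ s = D"
proof (rule disc_deriv_component[OF _ z])
  show "((\<lambda>\<eta>. disc_deriv F \<eta> $ s) has_field_derivative D) (at z within cball 0 1)"
    by (rule has_field_derivative_transform_within[OF assms(2) zero_less_one z])
       (simp only: disc_deriv_component[OF assms(1)])
qed

text \<open>Componentwise this is \<open>double_zero_quotient\<close>; the sum of the constants serves all components.\<close>

lemma equal_jets_double_zero: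
  fixes F F' :: "complex \<Rightarrow> complex ^ 'm"
  assumes \<alpha>: "0 < \<alpha>" "\<alpha> < 1" and C2: "\<And>s. C2_holder_disc \<alpha> (\<lambda>\<zeta>. F \<zeta> $ s)" "\<And>s. C2_holder_disc \<alpha> (\<lambda>\<zeta>. F' \<zeta> $ s)"
    and DA: "\<And>s. (\<lambda>\<zeta>. F \<zeta> $ s) \<in> disc_algebra" "\<And>s. (\<lambda>\<zeta>. F' \<zeta> $ s) \<in> disc_algebra" and jet: "jet2 F = jet2 F'"
  obtains H B where "\<And>s. H s \<in> disc_algebra" "\<And>s. H s 1 = 0" "0 \<le> B"
    "\<And>s \<zeta>. \<zeta> \<in> cball 0 1 \<Longrightarrow> F \<zeta> $ s - F' \<zeta> $ s = (1 - \<zeta>)\<^sup>2 * H s \<zeta>"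
    "\<And>s z w. z \<in> cball 0 1 \<Longrightarrow> w \<in> cball 0 1 \<Longrightarrow> cmod (H s z - H s w) \<le> B * cmod (z - w) powr \<alpha>"
proof -
  have j: "F 1 = F' 1" "disc_deriv F 1 = disc_deriv F' 1" "disc_deriv (disc_deriv F) 1 = disc_deriv (disc_deriv F') 1"
    using jet by (simp_all add: jet2_def)
  have one: "(1::complex) \<in> cball 0 1" by simp
  define P where "P = (\<lambda>s H B. H \<in> disc_algebra \<and> H 1 = 0 \<and> 0 \<le> B \<and> (\<forall>\<zeta>\<in>cball 0 1. F \<zeta> $ s - F' \<zeta> $ s = (1 - \<zeta>)\<^sup>2 * H \<zeta>)
     \<and> (\<forall>z\<in>cball 0 1. \<forall>w\<in>cball 0 1. cmod (H z - H w) \<le> B * cmod (z - w) powr \<alpha>))"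
  have single: "\<exists>H B. P s H B" for s
  proof -
    obtain g1 g2 C where g: "0 \<le> C" "\<And>z. z \<in> cball 0 1 \<Longrightarrow> ((\<lambda>\<zeta>. F \<zeta> $ s) has_field_derivative g1 z) (at z within cball 0 1)"
      "\<And>z. z \<in> cball 0 1 \<Longrightarrow> (g1 has_field_derivative g2 z) (at z within cball 0 1)"
      "\<And>z w. z \<in> cball 0 1 \<Longrightarrow> w \<in> cball 0 1 \<Longrightarrow> cmod (g2 z - g2 w) \<le> C * cmod (z - w) powr \<alpha>"
      using C2(1)[of s] unfolding C2_holder_disc_def by blast
    obtain k1 k2 D where k: "0 \<le> D" "\<And>z. z \<in> cball 0 1 \<Longrightarrow> ((\<lambda>\<zeta>. F' \<zeta> $ s) has_field_derivative k1 z) (at z within cball 0 1)"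
      "\<And>z. z \<in> cball 0 1 \<Longrightarrow> (k1 has_field_derivative k2 z) (at z within cball 0 1)"
      "\<And>z w. z \<in> cball 0 1 \<Longrightarrow> w \<in> cball 0 1 \<Longrightarrow> cmod (k2 z - k2 w) \<le> D * cmod (z - w) powr \<alpha>"
      using C2(2)[of s] unfolding C2_holder_disc_def by blast
    have e1: "g1 1 - k1 1 = 0"
      using disc_deriv_component[OF g(2)[OF one] one] disc_deriv_component[OF k(2)[OF one] one] j(2) by simp
    have e2: "g2 1 - k2 1 = 0"
      using disc_deriv2_component[OF g(2) g(3)[OF one] one] disc_deriv2_component[OF k(2) k(3)[OF one] one] j(3) by simp
    have da: "(\<lambda>\<zeta>. F \<zeta> $ s - F' \<zeta> $ s) \<in> disc_algebra"
      using DA[of s] by (auto simp: disc_algebra_def intro!: continuous_on_diff holomorphic_on_diff)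
    have e0: "F 1 $ s - F' 1 $ s = 0" using j(1) by simp
    have hol: "cmod ((g2 z - k2 z) - (g2 w - k2 w)) \<le> (C + D) * cmod (z - w) powr \<alpha>" if "z \<in> cball 0 1" "w \<in> cball 0 1" for z w
    proof -
      have "cmod ((g2 z - k2 z) - (g2 w - k2 w)) = cmod ((g2 z - g2 w) - (k2 z - k2 w))" by (simp add: algebra_simps)
      also have "\<dots> \<le> C * cmod (z - w) powr \<alpha> + D * cmod (z - w) powr \<alpha>"
        by (rule order_trans[OF norm_triangle_ineq4 add_mono[OF g(4)[OF that] k(4)[OF that]]])
      also have "\<dots> = (C + D) * cmod (z - w) powr \<alpha>" by (simp only: distrib_right)
      finally show ?thesis .
    qed
    have CD: "0 \<le> C + D" using g(1) k(1) by simp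
    have d1: "((\<lambda>\<zeta>. F \<zeta> $ s - F' \<zeta> $ s) has_field_derivative g1 z - k1 z) (at z within cball 0 1)" if "z \<in> cball 0 1" for z
      by (rule DERIV_diff[OF g(2)[OF that] k(2)[OF that]])
    have d2: "((\<lambda>\<zeta>. g1 \<zeta> - k1 \<zeta>) has_field_derivative g2 z - k2 z) (at z within cball 0 1)" if "z \<in> cball 0 1" for z
      by (rule DERIV_diff[OF g(3)[OF that] k(3)[OF that]])
    show "\<exists>H B. P s H B"
    proof (rule double_zero_quotient[where g = "\<lambda>\<zeta>. F \<zeta> $ s - F' \<zeta> $ s" and ?g1.0 = "\<lambda>z. g1 z - k1 z"
          and ?g2.0 = "\<lambda>z. g2 z - k2 z", OF \<alpha> da CD d1 d2 hol e0 e1 e2])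
      fix H B assume "H \<in> disc_algebra" "H 1 = 0" "0 \<le> B" "\<And>z. z \<in> cball 0 1 \<Longrightarrow> F z $ s - F' z $ s = (1 - z)\<^sup>2 * H z"
        "\<And>z w. z \<in> cball 0 1 \<Longrightarrow> w \<in> cball 0 1 \<Longrightarrow> cmod (H z - H w) \<le> B * cmod (z - w) powr \<alpha>"
      then have "P s H B" unfolding P_def by blast
      then show "\<exists>H B. P s H B" by blast
    qed
  qed
  then obtain H B where HB: "\<And>s. P s (H s) (B s)" by metis
  show thesis
  proof (rule that[of H "\<Sum>s\<in>UNIV. B s"])
    have B: "0 \<le> B s" for s using HB[of s] by (simp add: P_def)
    then show "0 \<le> (\<Sum>s\<in>UNIV. B s)" by (intro sum_nonneg)
    show "H s \<in> disc_algebra" "H s 1 = 0" for s using HB[of s] by (simp_all add: P_def)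
    show "F \<zeta> $ s - F' \<zeta> $ s = (1 - \<zeta>)\<^sup>2 * H s \<zeta>" if "\<zeta> \<in> cball 0 1" for s \<zeta> using HB[of s] that unfolding P_def by blast
    show "cmod (H s z - H s w) \<le> (\<Sum>s\<in>UNIV. B s) * cmod (z - w) powr \<alpha>" if "z \<in> cball 0 1" "w \<in> cball 0 1" for s z w
    proof -
      have "cmod (H s z - H s w) \<le> B s * cmod (z - w) powr \<alpha>" using HB[of s] that unfolding P_def by blast
      also have "\<dots> \<le> (\<Sum>s\<in>UNIV. B s) * cmod (z - w) powr \<alpha>"
        by (intro mult_right_mono member_le_sum B) auto
      finally show ?thesis .
    qed
  qed
qed

lemma analytic_disc_component: "analytic_disc F \<Longrightarrow> (\<lambda>\<zeta>. F \<zeta> $ s) \<in> disc_algebra"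
proof -
  assume F: "analytic_disc F"
  have "continuous_on (cball 0 1) (\<lambda>\<zeta>. F \<zeta> $ s)"
    by (rule bounded_linear.continuous_on[OF bounded_linear_vec_nth]) (use F in \<open>simp add: analytic_disc_def\<close>)
  then show ?thesis using F by (simp add: disc_algebra_def analytic_disc_def)
qed

lemma initial_disc_C1_holder: "0 < \<alpha> \<Longrightarrow> \<alpha> < 1 \<Longrightarrow> initial_disc A c V \<in> C1_holder \<alpha>"
  by (rule affine_C1_holder[OF initial_disc_affine]) auto

lemma initial_disc_covector: "\<zeta> \<in> cball 0 1 \<Longrightarrow> initial_disc A c V \<zeta> $ Inr (Inr j) = \<zeta> * (of_real (c $ j) / 2)"
  by (simp add: initial_disc_def join_def)

context perturbation_estimate
begin

text \<open>A disc close to the initial one has multipliers close to c: the covector component q of the initial disc equals c / 2 after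
  multiplication by \<open>cnj \<zeta>\<close>, and the equation for q determines the multipliers from q. All hypotheses of the regularity
  and uniqueness statements are collected here.\<close>

lemma nearby_lift:
  fixes F :: "complex \<Rightarrow> complex ^ (('n + 'd) + ('n + 'd))" and r :: "complex ^ ('n + 'd) \<Rightarrow> real ^ 'd"
  assumes herm: "\<And>j. hermitian (A j)" and r: "\<And>q. q \<in> S \<Longrightarrow> r differentiable (at q)"
    and Nd: "difference_quotient S E (\<lambda>x. r x - quadric_map A x) MN"
    and Wd: "\<And>k m. difference_quotient S E (wirtinger_map (\<lambda>x. r x - quadric_map A x) k m) (MW k m)"
    and F: "F \<in> stationary_lifts S r" "F \<in> C1_holder \<alpha>"
    and F0: "holder_bound \<alpha> (sphere 0 1) L0 (initial_disc A c V)"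
    and near: "holder_bound \<alpha> (sphere 0 1) \<delta> (\<lambda>\<zeta>. F \<zeta> - initial_disc A c V \<zeta>)"
    and L: "real CARD('n + 'd) * (\<delta> + L0) \<le> L" and E: "E \<le> \<epsilon>"
    and small: "16 * real CARD('d) * (2 * 2 * \<delta> + real CARD('d) * (norm c * (E * (1 + L)))) \<le> \<epsilon>"
  obtains cv where "\<And>\<zeta>. \<zeta> \<in> sphere 0 1 \<Longrightarrow> left_part (F \<zeta>) \<in> S"
    "\<And>\<zeta>. \<zeta> \<in> sphere 0 1 \<Longrightarrow> lift_at A (\<lambda>x. r x - quadric_map A x) (wirtinger_map (\<lambda>x. r x - quadric_map A x)) (left_part (F \<zeta>))
      (\<lambda>i. cnj \<zeta> * F \<zeta> $ Inr (Inl i)) (\<lambda>j. cnj \<zeta> * F \<zeta> $ Inr (Inr j)) (cv \<zeta>)"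
    "holder_bound \<alpha> (sphere 0 1) L (\<lambda>\<zeta>. left_part (F \<zeta>))"
    "\<And>k. holder_bound \<alpha> (sphere 0 1) \<epsilon> (\<lambda>\<zeta>. complex_of_real (cv \<zeta> k - c $ k))"
    "\<And>s. C2_holder_disc \<alpha> (\<lambda>\<zeta>. F \<zeta> $ s)"
proof -
  let ?S = "sphere (0::complex) 1" and ?N = "\<lambda>x. r x - quadric_map A x" and ?I = "initial_disc A c V"
  let ?W = "wirtinger_map ?N"
  have fS: "left_part (F \<zeta>) \<in> S" if "\<zeta> \<in> ?S" for \<zeta> using F(1) that unfolding stationary_lifts_def by blast
  have "\<forall>\<zeta>\<in>?S. \<exists>cv. lift_at A ?N ?W (left_part (F \<zeta>)) (\<lambda>i. cnj \<zeta> * F \<zeta> $ Inr (Inl i)) (\<lambda>j. cnj \<zeta> * F \<zeta> $ Inr (Inr j)) cv"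
  proof
    fix \<zeta> assume z: "\<zeta> \<in> ?S"
    show "\<exists>cv. lift_at A ?N ?W (left_part (F \<zeta>)) (\<lambda>i. cnj \<zeta> * F \<zeta> $ Inr (Inl i)) (\<lambda>j. cnj \<zeta> * F \<zeta> $ Inr (Inr j)) cv"
      by (rule stationary_lift_at[OF herm r F(1) z])
  qed
  from bchoice[OF this] obtain cv where "\<forall>\<zeta>\<in>?S. lift_at A ?N ?W (left_part (F \<zeta>)) (\<lambda>i. cnj \<zeta> * F \<zeta> $ Inr (Inl i)) (\<lambda>j. cnj \<zeta> * F \<zeta> $ Inr (Inr j)) (cv \<zeta>)" by blast
  then have lift: "lift_at A ?N ?W (left_part (F \<zeta>)) (\<lambda>i. cnj \<zeta> * F \<zeta> $ Inr (Inl i)) (\<lambda>j. cnj \<zeta> * F \<zeta> $ Inr (Inr j)) (cv \<zeta>)" if "\<zeta> \<in> ?S" for \<zeta>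
    using that by blast
  have hF: "holder_bound \<alpha> ?S (\<delta> + L0) F"
    by (rule holder_bound_cong[OF holder_bound_add[OF near F0]]) simp
  have fL: "holder_bound \<alpha> ?S L (\<lambda>\<zeta>. left_part (F \<zeta>))"
  proof (rule holder_bound_mono[OF holder_bound_vec L])
    show "holder_bound \<alpha> ?S (\<delta> + L0) (\<lambda>\<zeta>. left_part (F \<zeta>) $ m)" for m
      using holder_bound_component[OF hF, of "Inl m"] by (simp only: left_part_def vec_lambda_beta)
  qed
  have cv: "holder_bound \<alpha> ?S \<epsilon> (\<lambda>\<zeta>. complex_of_real (cv \<zeta> k - c $ k))" for k
  proof -
    have W: "holder_bound \<alpha> ?S (E * (1 + L)) (\<lambda>\<zeta>. ?W k m (left_part (F \<zeta>)))" for k m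
      by (rule holder_bound_compose[OF Wd fL fS])
    have s: "holder_bound \<alpha> ?S (2 * 2 * \<delta> + real CARD('d) * (norm c * (E * (1 + L))))
       (\<lambda>\<zeta>. cnj \<zeta> * (F \<zeta> - ?I \<zeta>) $ Inr (Inr j) - (\<Sum>k\<in>UNIV. complex_of_real (c $ k) * ?W k (Inr j) (left_part (F \<zeta>))))" for j
    proof (rule holder_bound_diff[OF holder_bound_mult[OF holder_bound_cnj[OF holder_bound_identity[OF exponent order_refl]] holder_bound_component[OF near]]
        holder_bound_sum[OF holder_bound_cmult[OF W]]])
      show "cmod (complex_of_real (c $ k)) \<le> norm c" for k using component_le_norm_cart[of c k] by simp
    qed
    have inv: "real CARD('d) * (E * (1 + L)) \<le> 1 / 4"
    proof -
      have "real CARD('d) * (E * (1 + L)) \<le> real CARD('d) * (\<epsilon> * (1 + L))"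
        using E constants by (intro mult_left_mono mult_right_mono) auto
      then show ?thesis using invertible_step by linarith
    qed
    have "holder_bound \<alpha> ?S (16 * real CARD('d) * (2 * 2 * \<delta> + real CARD('d) * (norm c * (E * (1 + L)))))
      (\<lambda>\<zeta>. complex_of_real (cv \<zeta> k - c $ k))"
    proof (rule holder_bound_implicit[where \<gamma> = "\<lambda>j \<zeta>. cv \<zeta> j - c $ j" and j = k and w = "\<lambda>k j \<zeta>. ?W k (Inr j) (left_part (F \<zeta>))"
          and s = "\<lambda>j \<zeta>. cnj \<zeta> * (F \<zeta> - ?I \<zeta>) $ Inr (Inr j) - (\<Sum>k\<in>UNIV. complex_of_real (c $ k) * ?W k (Inr j) (left_part (F \<zeta>)))",
          OF _ s W inv])
      fix j \<zeta> assume \<zeta>: "\<zeta> \<in> ?S"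
      have b: "cnj \<zeta> * \<zeta> = 1" using \<zeta> complex_norm_square[of \<zeta>] by (simp add: mult.commute)
      have "cnj \<zeta> * ?I \<zeta> $ Inr (Inr j) = (cnj \<zeta> * \<zeta>) * (of_real (c $ j) / 2)"
        using \<zeta> by (subst initial_disc_covector) (auto simp: mult.assoc)
      then have I: "cnj \<zeta> * ?I \<zeta> $ Inr (Inr j) = of_real (c $ j) / 2" unfolding b by simp
      have Fq: "cnj \<zeta> * F \<zeta> $ Inr (Inr j) = of_real (cv \<zeta> j) / 2 + (\<Sum>k\<in>UNIV. of_real (cv \<zeta> k) * ?W k (Inr j) (left_part (F \<zeta>)))"
        using lift[OF \<zeta>] unfolding lift_at_def by blast
      have d: "cnj \<zeta> * (F \<zeta> - ?I \<zeta>) $ Inr (Inr j) = cnj \<zeta> * F \<zeta> $ Inr (Inr j) - cnj \<zeta> * ?I \<zeta> $ Inr (Inr j)"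
        by (simp only: vector_minus_component right_diff_distrib)
      show "of_real (cv \<zeta> j - c $ j) / 2 = cnj \<zeta> * (F \<zeta> - ?I \<zeta>) $ Inr (Inr j)
          - (\<Sum>k\<in>UNIV. complex_of_real (c $ k) * ?W k (Inr j) (left_part (F \<zeta>)))
          - (\<Sum>k\<in>UNIV. of_real (cv \<zeta> k - c $ k) * ?W k (Inr j) (left_part (F \<zeta>)))"
        unfolding d I Fq by (simp add: left_diff_distrib sum_subtractf diff_divide_distrib)
    qed
    then show ?thesis using small by (rule holder_bound_mono)
  qed
  have an: "analytic_disc F" using F(1) by (simp add: stationary_lifts_def)
  note DA = analytic_disc_component[OF an]
  obtain B where B: "0 \<le> B" "\<And>h. 0 < h \<Longrightarrow> holder_bound \<alpha> ?S B (rotation_quotient h F)"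
  proof (rule C1_holder_rotation_quotient[OF exponent F(2)], goal_cases)
    case (1 B)
    show ?case by (rule 1(1)[of B, OF 1(2-)])
  qed
  define B' where "B' = real CARD('n + 'd) * B + (2 * 2 * B + 1 * (2 * 2 * (\<delta> + L0)))"
  have pos: "0 \<le> \<delta> + L0" by (rule order_trans[OF norm_ge_zero holder_boundD(1)[OF hF, of 1]]) simp
  have B': "0 \<le> B'" using B(1) pos by (simp add: B'_def)
  have df: "holder_bound \<alpha> ?S B' (rotation_quotient h (\<lambda>\<zeta>. left_part (F \<zeta>)))" if "0 < h" "h < 1" for h
  proof (rule holder_bound_mono[OF holder_bound_vec])
    show "holder_bound \<alpha> ?S B (\<lambda>z. rotation_quotient h (\<lambda>\<zeta>. left_part (F \<zeta>)) z $ m)" for m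
      by (rule holder_bound_cong[OF holder_bound_component[OF B(2)[OF that(1)], of "Inl m"]])
         (simp add: rotation_quotient_def left_part_def)
    show "real CARD('n + 'd) * B \<le> B'" using B(1) pos by (simp add: B'_def)
  qed
  have dQ: "holder_bound \<alpha> ?S B' (rotation_quotient h (\<lambda>\<zeta>. cnj \<zeta> * F \<zeta> $ Inr (Inr j)))" if "0 < h" "h < 1" for h j
  proof (rule holder_bound_mono[OF rotation_quotient_cnj_mult[OF exponent holder_bound_component[OF hF] _ that(1)]])
    show "holder_bound \<alpha> ?S B (rotation_quotient h (\<lambda>\<zeta>. F \<zeta> $ Inr (Inr j)))"
      by (rule holder_bound_cong[OF holder_bound_component[OF B(2)[OF that(1)], of "Inr (Inr j)"]])
         (simp add: rotation_quotient_def)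
    show "2 * 2 * B + 1 * (2 * 2 * (\<delta> + L0)) \<le> B'" using B(1) by (simp add: B'_def)
  qed
  have DAl: "(\<lambda>\<zeta>. left_part (F \<zeta>) $ m) \<in> disc_algebra" for m
    using DA[of "Inl m"] by (simp only: left_part_def vec_lambda_beta)
  note C2 = lift_C2_holder[where f = "\<lambda>\<zeta>. left_part (F \<zeta>)" and P = "\<lambda>i \<zeta>. F \<zeta> $ Inr (Inl i)" and Q = "\<lambda>j \<zeta>. F \<zeta> $ Inr (Inr j)",
      OF difference_quotient_weaken[OF Nd E] difference_quotient_weaken[OF Wd E] fS lift fL cv DAl DA DA B' df dQ]
  have C2l: "C2_holder_disc \<alpha> (\<lambda>\<zeta>. left_part (F \<zeta>) $ m)" for m by (rule C2(1))
  have C2p: "C2_holder_disc \<alpha> (\<lambda>\<zeta>. F \<zeta> $ Inr (Inl i))" for i by (rule C2(2))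
  have C2q: "C2_holder_disc \<alpha> (\<lambda>\<zeta>. F \<zeta> $ Inr (Inr j))" for j by (rule C2(3))
  have C2': "C2_holder_disc \<alpha> (\<lambda>\<zeta>. F \<zeta> $ s)" for s
  proof (cases s)
    case (Inl m)
    then show ?thesis using C2l[of m] by (simp only: left_part_def vec_lambda_beta)
  next
    case (Inr t)
    show ?thesis by (cases t) (simp_all only: Inr C2p C2q)
  qed
  show thesis by (rule that[OF fS lift fL cv C2'])
qed

end

theorem proposition3p8:
  fixes A :: "'d::finite \<Rightarrow> complex ^ 'n ^ 'n"
    and c :: "real ^ 'd"
    and V :: "complex ^ 'n"
    and \<alpha> :: real
  assumes "0 < \<alpha>" and "\<alpha> < 1"
    and "\<And>j. hermitian (A j)"
    and "invertible (\<Sum>j\<in>UNIV. c $ j *\<^sub>R A j)"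
    and "initial_disc A c V \<in> stationary_lifts0 \<alpha> c UNIV (quadric_map A)"
  shows "\<exists>U. openin (Ck_topology 4 (ball 0 1)) U \<and> quadric_map A \<in> U \<and>
           (\<exists>\<epsilon>>0. \<forall>r\<in>U.
              inj_on jet2 {F \<in> stationary_lifts (ball 0 1) r.
                F \<in> A1_holder \<alpha> \<and>
                C1_holder_norm \<alpha> (\<lambda>\<zeta>. F \<zeta> - initial_disc A c V \<zeta>) < \<epsilon>})"
proof -
  note \<alpha> = assms(1,2) and herm = assms(3) and inv = assms(4)
  let ?I = "initial_disc A c V" and ?S = "sphere (0::complex) 1" and ?D = "ball (0 :: complex ^ ('n + 'd)) 1"
  let ?m = "real CARD('n + 'd)" and ?d = "real CARD('d)"
  have I: "?I \<in> C1_holder \<alpha>" by (rule initial_disc_C1_holder[OF \<alpha>])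
  define L0 where "L0 = 4 * (C1_holder_norm \<alpha> ?I + 1)"
  have hI: "holder_bound \<alpha> ?S L0 ?I" unfolding L0_def by (rule C1_holder_norm_bound[OF \<alpha> I]) simp
  have L0: "0 \<le> L0" by (rule order_trans[OF norm_ge_zero holder_boundD(1)[OF hI, of 1]]) simp
  define L where "L = ?m * (1 + L0)"
  have L: "0 \<le> L" using L0 by (simp add: L_def)
  obtain K \<epsilon> where PE: "perturbation_estimate \<alpha> L K \<epsilon> A c"
    by (rule small_perturbation_estimate[OF \<alpha> herm inv L])
  interpret perturbation_estimate \<alpha> L K \<epsilon> A c by (rule PE)
  have \<epsilon>: "0 < \<epsilon>" "\<epsilon> \<le> 1" using constants by auto
  have d1: "1 \<le> ?d" by (simp add: Suc_le_eq)
  \<comment> \<open>Closeness of the discs and smallness of the perturbation each contribute at most half of \<open>\<epsilon>\<close> to the deviation of the multipliers from c.\<close>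
  define \<delta> where "\<delta> = \<epsilon> / (128 * ?d)"
  define E where "E = \<epsilon> / (32 * ?d * ?d * (1 + norm c) * (1 + L))"
  have \<delta>: "0 < \<delta>" "\<delta> \<le> 1"
  proof -
    show "0 < \<delta>" unfolding \<delta>_def using \<epsilon> d1 by (intro divide_pos_pos) linarith+
    show "\<delta> \<le> 1" unfolding \<delta>_def using \<epsilon> d1 by (subst divide_le_eq_1_pos) linarith+
  qed
  have den: "1 \<le> 32 * ?d * ?d * (1 + norm c) * (1 + L)"
  proof -
    have "1 * 1 \<le> (32 * ?d * ?d) * ((1 + norm c) * (1 + L))"
    proof (rule mult_mono)
      have "1 * 1 \<le> ?d * ?d" by (rule mult_mono) (use d1 in auto)
      then show "1 \<le> 32 * ?d * ?d" by simp
      have "1 * 1 \<le> (1 + norm c) * (1 + L)" by (rule mult_mono) (use L in auto)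
      then show "1 \<le> (1 + norm c) * (1 + L)" by simp
    qed auto
    then show ?thesis by (simp add: mult.assoc)
  qed
  have E: "0 < E" "E \<le> \<epsilon>"
  proof -
    show "0 < E" unfolding E_def using den \<epsilon> by (intro divide_pos_pos) linarith+
    have "\<epsilon> * 1 \<le> \<epsilon> * (32 * ?d * ?d * (1 + norm c) * (1 + L))" using den \<epsilon> by (intro mult_left_mono) auto
    then show "E \<le> \<epsilon>" unfolding E_def using den by (subst pos_divide_le_eq) linarith+
  qed
  have small: "16 * ?d * (2 * 2 * \<delta> + ?d * (norm c * (E * (1 + L)))) \<le> \<epsilon>"
  proof -
    have "16 * ?d * (2 * 2 * \<delta>) = \<epsilon> / 2" using d1 by (simp add: \<delta>_def)
    moreover have "16 * ?d * (?d * (norm c * (E * (1 + L)))) = \<epsilon> / 2 * (norm c / (1 + norm c))"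
    proof -
      have "16 * t * (t * (n * (e / (32 * t * t * k * l) * l))) = e / 2 * (n / k)" if "t \<noteq> 0" "k \<noteq> 0" "l \<noteq> 0" for t n e k l :: real
        using that by (simp add: field_simps)
      note alg = this
      have nz: "?d \<noteq> 0" "1 + norm c \<noteq> 0" "1 + L \<noteq> 0" using d1 L norm_ge_zero[of c] by linarith+
      show ?thesis unfolding E_def by (rule alg[OF nz])
    qed
    moreover have "\<epsilon> / 2 * (norm c / (1 + norm c)) \<le> \<epsilon> / 2 * 1"
      using \<epsilon> norm_ge_zero[of c] by (intro mult_left_mono) (auto simp: divide_le_eq add_pos_nonneg)
    ultimately show ?thesis by (simp only: distrib_left)
  qed
  \<comment> \<open>Hadamard's lemma loses the cube of the real dimension.\<close>
  define \<eta> where "\<eta> = E / real DIM(complex ^ ('n + 'd)) ^ 3"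
  have \<eta>: "0 < \<eta>" "real DIM(complex ^ ('n + 'd)) ^ 3 * \<eta> \<le> E"
  proof -
    have "0 < real DIM(complex ^ ('n + 'd))" by (simp only: of_nat_0_less_iff DIM_positive)
    then show "0 < \<eta>" unfolding \<eta>_def using E(1) by (intro divide_pos_pos zero_less_power)
    show "real DIM(complex ^ ('n + 'd)) ^ 3 * \<eta> \<le> E" using E by (simp add: \<eta>_def)
  qed
  have D: "open ?D" "?D \<noteq> {}" "convex ?D" by auto
  define U where "U = {r \<in> Ck 4 ?D. Ck_norm 4 ?D (\<lambda>x. r x - quadric_map A x) < \<eta>}"
  have U1: "openin (Ck_topology 4 ?D) U" unfolding U_def by (rule openin_Ck_ball[OF D(1,2) quadric_map_Ck])
  have U2: "quadric_map A \<in> U"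
    unfolding U_def mem_Collect_eq Ck_norm_diff_self[OF D(1,2) quadric_map_Ck] using quadric_map_Ck \<eta>(1) by blast
  have U3: "inj_on jet2 {F \<in> stationary_lifts ?D r. F \<in> A1_holder \<alpha> \<and> C1_holder_norm \<alpha> (\<lambda>\<zeta>. F \<zeta> - ?I \<zeta>) < \<delta> / 4}"
    if r: "r \<in> U" for r
  proof (rule inj_onI)
    have rC: "r \<in> Ck 4 ?D" and rs: "Ck_norm 4 ?D (\<lambda>x. r x - quadric_map A x) < \<eta>" using r by (simp_all add: U_def)
    have rd: "r differentiable (at q)" if "q \<in> ?D" for q by (rule Ck_differentiable[OF D(1) rC _ that]) simp
    have sb: "smooth_bound 4 ?D \<eta> (\<lambda>x. r x - quadric_map A x)"
      by (rule Ck_small_smooth_bound[OF D(1,2) rC quadric_map_Ck rs])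
    obtain MN MW where Nd: "difference_quotient ?D E (\<lambda>x. r x - quadric_map A x) MN"
      and Wd: "\<And>k m. difference_quotient ?D E (wirtinger_map (\<lambda>x. r x - quadric_map A x) k m) (MW k m)"
    proof (rule perturbation_difference_quotients[OF sb D(3) less_imp_le[OF \<eta>(1)] \<eta>(2)], goal_cases)
      case (1 MN MW)
      show ?case by (rule 1(1)[of MN MW, OF 1(2-)])
    qed
    fix F F' assume mem: "F \<in> {F \<in> stationary_lifts ?D r. F \<in> A1_holder \<alpha> \<and> C1_holder_norm \<alpha> (\<lambda>\<zeta>. F \<zeta> - ?I \<zeta>) < \<delta> / 4}"
      "F' \<in> {F \<in> stationary_lifts ?D r. F \<in> A1_holder \<alpha> \<and> C1_holder_norm \<alpha> (\<lambda>\<zeta>. F \<zeta> - ?I \<zeta>) < \<delta> / 4}"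
      and jet: "jet2 F = jet2 F'"
    have F: "G \<in> stationary_lifts ?D r" "G \<in> C1_holder \<alpha>" "holder_bound \<alpha> ?S \<delta> (\<lambda>\<zeta>. G \<zeta> - ?I \<zeta>)"
      if "G \<in> {F \<in> stationary_lifts ?D r. F \<in> A1_holder \<alpha> \<and> C1_holder_norm \<alpha> (\<lambda>\<zeta>. F \<zeta> - ?I \<zeta>) < \<delta> / 4}" for G
    proof -
      show 1: "G \<in> stationary_lifts ?D r" "G \<in> C1_holder \<alpha>" using that by (simp_all add: A1_holder_def)
      have "C1_holder_norm \<alpha> (\<lambda>\<zeta>. G \<zeta> - ?I \<zeta>) < \<delta> / 4" using that by simp
      from C1_holder_norm_bound[OF \<alpha> C1_holder_diff[OF 1(2) I] this] show "holder_bound \<alpha> ?S \<delta> (\<lambda>\<zeta>. G \<zeta> - ?I \<zeta>)" by simp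
    qed
    have LL: "?m * (\<delta> + L0) \<le> L" unfolding L_def using \<delta> by (intro mult_left_mono) auto
    note Fm = F[OF mem(1)] and Fm' = F[OF mem(2)]
    obtain cv where l: "\<And>\<zeta>. \<zeta> \<in> ?S \<Longrightarrow> left_part (F \<zeta>) \<in> ?D"
      "\<And>\<zeta>. \<zeta> \<in> ?S \<Longrightarrow> lift_at A (\<lambda>x. r x - quadric_map A x) (wirtinger_map (\<lambda>x. r x - quadric_map A x)) (left_part (F \<zeta>))
        (\<lambda>i. cnj \<zeta> * F \<zeta> $ Inr (Inl i)) (\<lambda>j. cnj \<zeta> * F \<zeta> $ Inr (Inr j)) (cv \<zeta>)"
      "holder_bound \<alpha> ?S L (\<lambda>\<zeta>. left_part (F \<zeta>))"
      "\<And>k. holder_bound \<alpha> ?S \<epsilon> (\<lambda>\<zeta>. complex_of_real (cv \<zeta> k - c $ k))"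
      "\<And>s. C2_holder_disc \<alpha> (\<lambda>\<zeta>. F \<zeta> $ s)"
    proof (rule nearby_lift[OF herm rd Nd Wd Fm(1,2) hI Fm(3) LL E(2) small], assumption?, goal_cases)
      case (1 cv)
      show ?case by (rule 1(1)[of cv, OF 1(2-)])
    qed
    obtain cv' where l': "\<And>\<zeta>. \<zeta> \<in> ?S \<Longrightarrow> left_part (F' \<zeta>) \<in> ?D"
      "\<And>\<zeta>. \<zeta> \<in> ?S \<Longrightarrow> lift_at A (\<lambda>x. r x - quadric_map A x) (wirtinger_map (\<lambda>x. r x - quadric_map A x)) (left_part (F' \<zeta>))
        (\<lambda>i. cnj \<zeta> * F' \<zeta> $ Inr (Inl i)) (\<lambda>j. cnj \<zeta> * F' \<zeta> $ Inr (Inr j)) (cv' \<zeta>)"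
      "holder_bound \<alpha> ?S L (\<lambda>\<zeta>. left_part (F' \<zeta>))"
      "\<And>k. holder_bound \<alpha> ?S \<epsilon> (\<lambda>\<zeta>. complex_of_real (cv' \<zeta> k - c $ k))"
      "\<And>s. C2_holder_disc \<alpha> (\<lambda>\<zeta>. F' \<zeta> $ s)"
    proof (rule nearby_lift[OF herm rd Nd Wd Fm'(1,2) hI Fm'(3) LL E(2) small], assumption?, goal_cases)
      case (1 cv)
      show ?case by (rule 1(1)[of cv, OF 1(2-)])
    qed
    have ext: "F \<in> extensional (cball 0 1)" "F' \<in> extensional (cball 0 1)" and an: "analytic_disc F" "analytic_disc F'"
      using F(1)[OF mem(1)] F(1)[OF mem(2)] by (simp_all add: stationary_lifts_def)
    note DA = analytic_disc_component[OF an(1)] analytic_disc_component[OF an(2)]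
    obtain H B where H: "\<And>s. H s \<in> disc_algebra" "\<And>s. H s 1 = 0" "0 \<le> B"
      "\<And>s \<zeta>. \<zeta> \<in> cball 0 1 \<Longrightarrow> F \<zeta> $ s - F' \<zeta> $ s = (1 - \<zeta>)\<^sup>2 * H s \<zeta>"
      "\<And>s z w. z \<in> cball 0 1 \<Longrightarrow> w \<in> cball 0 1 \<Longrightarrow> cmod (H s z - H s w) \<le> B * cmod (z - w) powr \<alpha>"
    proof (rule equal_jets_double_zero[OF \<alpha> l(5) l'(5) DA jet], goal_cases)
      case (1 H B)
      show ?case by (rule 1(1)[of H B, OF 1(2-)])
    qed
    have Hl: "left_part (F \<zeta>) $ m - left_part (F' \<zeta>) $ m = (1 - \<zeta>)\<^sup>2 * H (Inl m) \<zeta>" if "\<zeta> \<in> cball 0 1" for m \<zeta>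
      using H(4)[OF that] by (simp only: left_part_def vec_lambda_beta)
    note zero = lifts_determined[where f = "\<lambda>\<zeta>. left_part (F \<zeta>)" and f' = "\<lambda>\<zeta>. left_part (F' \<zeta>)"
        and P = "\<lambda>i \<zeta>. F \<zeta> $ Inr (Inl i)" and P' = "\<lambda>i \<zeta>. F' \<zeta> $ Inr (Inl i)"
        and Q = "\<lambda>j \<zeta>. F \<zeta> $ Inr (Inr j)" and Q' = "\<lambda>j \<zeta>. F' \<zeta> $ Inr (Inr j)"
        and H = "\<lambda>m. H (Inl m)" and HP = "\<lambda>i. H (Inr (Inl i))" and HQ = "\<lambda>j. H (Inr (Inr j))",
        OF difference_quotient_weaken[OF Nd E(2)] difference_quotient_weaken[OF Wd E(2)] l(1) l'(1) l(2) l'(2) l(3) l'(3) l'(4)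
          H(1) H(2) Hl H(1) H(4) H(1) H(2) H(4) H(3) H(5) H(5)]
    have Z1: "H (Inl m) \<zeta> = 0" if "\<zeta> \<in> ?S - {1}" for m \<zeta> by (rule zero(1)) (assumption | rule that)+
    have Z2: "H (Inr (Inl i)) \<zeta> = 0" if "\<zeta> \<in> ?S - {1}" for i \<zeta> by (rule zero(2)) (assumption | rule that)+
    have Z3: "H (Inr (Inr j)) \<zeta> = 0" if "\<zeta> \<in> ?S - {1}" for j \<zeta> by (rule zero(3)) (assumption | rule that)+
    have H0: "H s \<zeta> = 0" if \<zeta>: "\<zeta> \<in> ?S - {1}" for s \<zeta>
    proof (cases s)
      case (Inl m)
      then show ?thesis using Z1[OF \<zeta>] by (simp only:)
    next
      case (Inr t)
      show ?thesis by (cases t) (simp_all only: Inr Z2[OF \<zeta>] Z3[OF \<zeta>])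
    qed
    have bd: "F \<zeta> $ s - F' \<zeta> $ s = 0" if "\<zeta> \<in> ?S" for s \<zeta>
    proof (cases "\<zeta> = 1")
      case True
      then show ?thesis using jet by (simp add: jet2_def)
    next
      case False
      then show ?thesis using H(4)[of \<zeta> s] H0[of \<zeta> s] that by simp
    qed
    have inside: "F \<zeta> $ s - F' \<zeta> $ s = 0" if "\<zeta> \<in> cball 0 1" for s \<zeta>
    proof -
      have da: "continuous_on (cball 0 1) (\<lambda>\<zeta>. F \<zeta> $ s - F' \<zeta> $ s)" "(\<lambda>\<zeta>. F \<zeta> $ s - F' \<zeta> $ s) holomorphic_on ball 0 1"
        using DA[of s] by (auto simp: disc_algebra_def intro!: continuous_on_diff holomorphic_on_diff)
      have "cmod (F \<zeta> $ s - F' \<zeta> $ s) \<le> 0"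
      proof (rule maximum_modulus_frontier[where f = "\<lambda>\<zeta>. F \<zeta> $ s - F' \<zeta> $ s" and S = "cball 0 1"])
        show "cmod (F z $ s - F' z $ s) \<le> 0" if "z \<in> frontier (cball 0 1)" for z
        proof -
          have "z \<in> ?S" using that by simp
          then show ?thesis by (simp only: bd norm_zero order_refl)
        qed
      qed (use da that in auto)
      then show ?thesis by simp
    qed
    show "F = F'"
    proof (rule extensionalityI[OF ext])
      show "F \<zeta> = F' \<zeta>" if "\<zeta> \<in> cball 0 1" for \<zeta> using inside[OF that] by (simp add: vec_eq_iff)
    qed
  qed
  show ?thesis
  proof (intro exI[of _ U] conjI exI[of _ "\<delta> / 4"] ballI U1 U2)
    show "0 < \<delta> / 4" using \<delta>(1) by simp
  qed (rule U3)
qed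

end
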